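(* Let $f_1,\ldots,f_d$ be non-zero multiplicative functions and let $L(s,f_j)=\sum_{n=1}^\infty f_j(n)n^{-s}$ be the associated $L$-functions. Suppose that for some $0<\theta<1/2$ and for all integers $r\ge 1$, each $f_j$ satisfies the estimates $$f_{j,1/r}(n)\ll_{f_j,r}n^\theta\quad\text{and}\quad\sum_p\sum_{m=2}^\infty\frac{|f_{j,1/r}(p^m)|^2}{p^m}<\infty,$$ where $f_{j,1/r}(n)$ are formally defined by $L(s,f_j)^{1/r}=\sum_{n=1}^\infty f_{j,1/r}(n)n^{-s}$. Assume furthermore that for each $j$ there is some $N_j>0$ such that, as $x\to\infty$, $$\sum_{p\le x}\frac{|f_j(p)|^2}{p}=N_j\log\log x+O(1),$$ and that there exists a constant $B>0$ such that for all $i\ne j$, all real $t$ and all $x\ge 2$, $$\Re\left(\sum_{p\le x}\frac{f_i(p)\overline{f_j(p)}}{p^{1+it}}\right)\le B\log(2+|t|).$$ Suppose that each $L(s,f_j)$ admits a meromorphic continuation to the half-plane $\sigma\ge 1/2$ with its only possible pole at $s=1$, and that $L(s,f_j)=O(|t|^A)$ as $|t|\to\infty$ for some $A>0$, uniformly in the half-plane $\sigma\ge 1/2$. Let $N=\max\{N_1,\ldots,N_d\}$. If $b_1,\ldots,b_d$ are non-zero complex numbers, then for all real $k\ge 0$ and all sufficiently large $T>0$, $$\int_T^{2T}\left|\sum_{j=1}^d b_jL(1/2+it,f_j)\right|^{2k}dt\gg_{(f_j),k,(b_j)}T(\log T)^{Nk^2}.$$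
   Context: Here $s=\sigma+it$ with $\sigma,t$ real, and $p$ always denotes a prime. Multiplicative functions are complex-valued functions on the positive integers; $f_{j,1/r}$ denotes the coefficients of the formal Dirichlet series $r$-th root of $L(s,f_j)$ with $f_{j,1/r}(1)=1$. The implied constant in the conclusion is positive and depends only on the $f_j$, $k$ and the $b_j$. *)

theory Defs
  imports "HOL-Complex_Analysis.Complex_Analysis" "HOL-Library.Landau_Symbols"
    "HOL-Computational_Algebra.Primes"
begin

(* Arithmetic functions are functions on nat of which only the values at positive arguments matter. *)

definition multiplicative :: "(nat \<Rightarrow> complex) \<Rightarrow> bool" where
  "multiplicative f \<longleftrightarrow> (\<forall>m\<ge>1. \<forall>n\<ge>1. coprime m n \<longrightarrow> f (m * n) = f m * f n)"

definition dirichlet_conv :: "(nat \<Rightarrow> complex) \<Rightarrow> (nat \<Rightarrow> complex) \<Rightarrow> nat \<Rightarrow> complex" where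
  "dirichlet_conv f g n = (\<Sum>d | d dvd n. f d * g (n div d))"

fun dirichlet_power :: "nat \<Rightarrow> (nat \<Rightarrow> complex) \<Rightarrow> nat \<Rightarrow> complex" where
  "dirichlet_power 0 g = (\<lambda>n. if n = 1 then 1 else 0)"
| "dirichlet_power (Suc r) g = dirichlet_conv g (dirichlet_power r g)"

(* The coefficients of the formal r-th root of a Dirichlet series with f 1 = 1. The condition
   g 0 = 0 only serves to make g unique as a function on nat; existence and uniqueness are
   lemma dirichlet_root_ex1 below. *)
definition is_dirichlet_root :: "nat \<Rightarrow> (nat \<Rightarrow> complex) \<Rightarrow> (nat \<Rightarrow> complex) \<Rightarrow> bool" where
  "is_dirichlet_root r f g \<longleftrightarrow> g 0 = 0 \<and> g 1 = 1 \<and> (\<forall>n\<ge>1. dirichlet_power r g n = f n)"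

definition dirichlet_root :: "nat \<Rightarrow> (nat \<Rightarrow> complex) \<Rightarrow> nat \<Rightarrow> complex" where
  "dirichlet_root r f = (THE g. is_dirichlet_root r f g)"

(* L is the sum of the Dirichlet series of f in some right half-plane and is meromorphic on
   (a neighbourhood of) the closed half-plane Re s >= 1/2, with no pole except possibly at 1.
   The value of L at 1 is irrelevant. *)
definition is_L_continuation :: "(nat \<Rightarrow> complex) \<Rightarrow> (complex \<Rightarrow> complex) \<Rightarrow> bool" where
  "is_L_continuation f L \<longleftrightarrow>
     (\<exists>\<sigma>. \<forall>s. Re s > \<sigma> \<longrightarrow> ((\<lambda>n. f n / of_nat n powr s) has_sum L s) {1..}) \<and>
     L meromorphic_on {s. Re s \<ge> 1/2} \<and>
     L analytic_on {s. Re s \<ge> 1/2} - {1}"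

(* |z|^a with the convention 0^0 = 1, whereas 0 powr 0 = 0. *)
definition abs_power :: "complex \<Rightarrow> real \<Rightarrow> real" where
  "abs_power z a = (if a = 0 then 1 else norm z powr a)"

lemma dirichlet_power_1: "g 1 = 1 \<Longrightarrow> dirichlet_power r g 1 = 1"
  by (induction r) (auto simp: dirichlet_conv_def)

lemma dirichlet_power_cong:
  assumes "n \<ge> 1" "\<And>m. 1 \<le> m \<Longrightarrow> m \<le> n \<Longrightarrow> g m = h m"
  shows "dirichlet_power r g n = dirichlet_power r h n"
  using assms
proof (induction r arbitrary: n)
  case (Suc r)
  have "g d * dirichlet_power r g (n div d) = h d * dirichlet_power r h (n div d)"
    if "d dvd n" for d
  proof -
    have d: "d \<ge> 1" "d \<le> n" "n div d \<ge> 1" "n div d \<le> n"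
      using that Suc.prems(1) by (auto elim!: dvdE)
    have "dirichlet_power r g (n div d) = dirichlet_power r h (n div d)"
    proof (rule Suc.IH)
      show "g m = h m" if "1 \<le> m" "m \<le> n div d" for m
        using that d(4) by (intro Suc.prems(2)) linarith+
    qed (rule d(3))
    then show ?thesis using Suc.prems(2)[OF d(1,2)] by simp
  qed
  then show ?case by (auto simp: dirichlet_conv_def intro!: sum.cong)
qed simp

lemma dirichlet_power_diff:
  assumes "n > 1" "g 1 = 1" "h 1 = 1" "\<And>m. 1 \<le> m \<Longrightarrow> m < n \<Longrightarrow> g m = h m"
  shows "dirichlet_power r g n - dirichlet_power r h n = of_nat r * (g n - h n)"
proof (induction r)
  case (Suc r)
  have fin: "finite {d. d dvd n}" using assms(1) by simp
  have split: "{d. d dvd n} = insert 1 (insert n ({d. d dvd n} - {1, n}))" by auto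
  have *: "dirichlet_conv k q n = k 1 * q n + (k n * q 1 +
      (\<Sum>d\<in>{d. d dvd n} - {1, n}. k d * q (n div d)))" for k q
    unfolding dirichlet_conv_def using fin assms(1) by (subst split) simp
  have "g d * dirichlet_power r g (n div d) = h d * dirichlet_power r h (n div d)"
    if "d \<in> {d. d dvd n} - {1, n}" for d
  proof -
    have d: "d > 1" "d < n" "n div d \<ge> 1" "n div d < n"
      using that assms(1) by (auto elim!: dvdE simp: nat_neq_iff)
    have "dirichlet_power r g (n div d) = dirichlet_power r h (n div d)"
    proof (rule dirichlet_power_cong)
      show "g m = h m" if "1 \<le> m" "m \<le> n div d" for m
        using that d(4) by (intro assms(4)) linarith+
    qed (rule d(3))
    then show ?thesis using d assms(4) by simp
  qed
  then have "(\<Sum>d\<in>{d. d dvd n} - {1, n}. g d * dirichlet_power r g (n div d)) =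
      (\<Sum>d\<in>{d. d dvd n} - {1, n}. h d * dirichlet_power r h (n div d))"
    by (rule sum.cong[OF refl])
  then show ?case
    using Suc.IH assms(1-3) dirichlet_power_1[of g r] dirichlet_power_1[of h r]
    by (simp add: * algebra_simps)
qed (use assms in simp)

function dirichlet_root_aux :: "nat \<Rightarrow> (nat \<Rightarrow> complex) \<Rightarrow> nat \<Rightarrow> complex" where
  "dirichlet_root_aux r f n = (if n \<le> 1 then of_nat n else
     (f n - dirichlet_power r (\<lambda>m. if m < n then dirichlet_root_aux r f m else 0) n) / of_nat r)"
  by auto
termination by (relation "Wellfounded.measure (\<lambda>(r, f, n). n)") auto

declare dirichlet_root_aux.simps [simp del]

lemma dirichlet_root_ex1:
  assumes "r \<ge> 1" "f 1 = 1"
  shows "\<exists>!g. is_dirichlet_root r f g"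
proof (rule ex_ex1I)
  let ?g = "dirichlet_root_aux r f"
  have g: "?g 0 = 0" "?g 1 = 1" by (simp_all add: dirichlet_root_aux.simps)
  have "dirichlet_power r ?g n = f n" if n: "n \<ge> 1" for n
  proof (cases "n = 1")
    case True
    then show ?thesis using g assms dirichlet_power_1[of ?g r] by simp
  next
    case False
    let ?h = "\<lambda>m. if m < n then ?g m else 0"
    have "dirichlet_power r ?g n - dirichlet_power r ?h n = of_nat r * (?g n - ?h n)"
      using n False g by (intro dirichlet_power_diff) auto
    moreover have "of_nat r * ?g n = f n - dirichlet_power r ?h n"
      using n False assms by (subst dirichlet_root_aux.simps) simp
    ultimately show ?thesis by simp
  qed
  with g show "\<exists>g. is_dirichlet_root r f g" by (auto simp: is_dirichlet_root_def)
next
  fix g h assume gh: "is_dirichlet_root r f g" "is_dirichlet_root r f h"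
  have "g n = h n" for n
  proof (induction n rule: less_induct)
    case (less n)
    show ?case
    proof (cases "n \<le> 1")
      case True
      then have "n = 0 \<or> n = 1" by auto
      then show ?thesis using gh by (auto simp: is_dirichlet_root_def)
    next
      case False
      have "dirichlet_power r g n - dirichlet_power r h n = of_nat r * (g n - h n)"
        using False gh less by (intro dirichlet_power_diff) (auto simp: is_dirichlet_root_def)
      then show ?thesis using gh False assms by (simp add: is_dirichlet_root_def)
    qed
  qed
  then show "g = h" by auto
qed

lemma is_dirichlet_root_dirichlet_root:
  "r \<ge> 1 \<Longrightarrow> f 1 = 1 \<Longrightarrow> is_dirichlet_root r f (dirichlet_root r f)"
  unfolding dirichlet_root_def by (rule theI'[OF dirichlet_root_ex1])

end

theory Submission
  imports Defs "HOL-Probability.Probability"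
begin

text \<open>Let \<open>N = N\<^sub>1\<close> be maximal and let \<open>a(s)\<close> be a product over blocks of primes \<open>p \<le> X\<close> of truncated exponentials
  of \<open>\<beta> * (\<Sum>p. f\<^sub>1(p) * p powr - s)\<close>, where \<open>\<beta> = k - 1/m\<close> for an integer \<open>m > 1/k\<close>; it imitates \<open>L(s, f\<^sub>1) powr \<beta>\<close>.
  To the right of the critical strip \<open>(\<Sum>j. b\<^sub>j * L(s, f\<^sub>j)) * a(s)^m\<close> is within a power of \<open>1/X\<close> of
  \<open>\<Sum>j. b\<^sub>j * V\<^sub>j(s)^m\<close>, where \<open>V\<^sub>j\<close> is the partial sum of length \<open>X\<close> of the Dirichlet series of \<open>L(s, f\<^sub>j) powr (1/m) * a(s)\<close>.
  The Gaussian mean square of \<open>V\<^sub>1\<close> has the order of \<open>(log X) powr (N * k^2)\<close>, both at 1/2 and at distance \<open>C / log X\<close>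
  from 1/2; for the other \<open>j\<close> a power of \<open>log X\<close> is saved, because \<open>f\<^sub>j\<close> and \<open>f\<^sub>1\<close> do not correlate (only \<open>t = 0\<close> matters)
  and \<open>N\<^sub>j \<le> N\<close>. Mean values of \<open>2/m\<close>-th powers of moduli of holomorphic functions are essentially log-convex in the
  abscissa, which carries the lower bound from \<open>V\<^sub>1\<close> to the mean value of \<open>\<bar>(\<Sum>j. b\<^sub>j * L(s, f\<^sub>j)) * a(s)^m\<bar> powr (2/m)\<close> on the
  critical line; to the right of it the difference is smaller than the main term once \<open>C\<close> is large.
  The factor \<open>a\<close> is removed by Young's inequality and the upper bound
  for the mean value of \<open>\<bar>a\<bar> powr (2 * k / \<beta>)\<close>. Finally \<open>X\<close> is a small power of \<open>T\<close>, the width of the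
  Gaussian is the square root of \<open>T\<close>, and its centre is averaged over the middle of \<open>[T, 2T]\<close>.\<close>

subsection \<open>Convexity of mean values of holomorphic functions\<close>

text \<open>The exponent \<open>2 / m\<close> makes everything computable. The
  \<open>2 / m\<close>-th power of the modulus of \<open>V^m\<close> is a square, so its mean value
  is a diagonal sum; and since \<open>2 / m <= 1\<close>, that power is subadditive, so the summands
  over \<open>j\<close> separate although nothing is known about their joint behaviour. The value of
  \<open>\<beta>\<close> is forced: at a prime the coefficient of \<open>V_1\<close> is
  \<open>(1 / m + \<beta>) * f_1(p) = k * f_1(p)\<close>, whose squares produce the exponent
  \<open>N * k^2\<close>. For another \<open>j\<close> the coefficient is
  \<open>f_j(p) / m + \<beta> * f_1(p)\<close>, and the missing cross term costs
  \<open>2 * \<beta> * N / m\<close> in the exponent. The transfer is a race between two losses at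
  distance \<open>C / log X\<close>: convexity damps the unwanted mean value at 1/2 by
  \<open>exp (- 2 * \<rho> * C)\<close>, whereas the main term keeps a proportion
  \<open>exp (- \<rho> * C)\<close>, because its lower bound uses only integers up to a small power
  of \<open>X\<close>. The exponentials must be truncated for \<open>a\<close> to be a short
  Dirichlet polynomial. This destroys multiplicativity inside a block, which is why Euler products
  are replaced by inequalities block by block and by Rankin's trick.\<close>

lemma ball_expand_open:
  fixes z0 :: complex
  assumes "open A" "cball z0 r \<subseteq> A" "0 < r"
  obtains \<rho> where "r < \<rho>" "ball z0 \<rho> \<subseteq> A"
proof -
  obtain e where e: "e > 0" "(\<Union>x\<in>cball z0 r. ball x e) \<subseteq> A"
    using compact_subset_open_imp_ball_epsilon_subset[OF compact_cball assms(1,2)] by blast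
  have "ball z0 (r + e) \<subseteq> A"
  proof
    fix x assume x: "x \<in> ball z0 (r + e)"
    show "x \<in> A"
    proof (cases "x \<in> cball z0 r")
      case False
      \<comment> \<open>The radial projection of \<open>x\<close> to the sphere; its distance from
        \<open>x\<close> is \<open>norm (x - z0) - r < e\<close>.\<close>
      define y where "y = z0 + of_real (r / norm (x - z0)) * (x - z0)"
      have n: "norm (x - z0) > r" using False by (simp add: dist_norm norm_minus_commute)
      have nz: "norm (x - z0) > 0" using n assms(3) by linarith
      then have "norm (y - z0) = r" using assms(3) by (simp add: y_def norm_mult norm_divide)
      then have y: "y \<in> cball z0 r" by (simp add: dist_norm norm_minus_commute)
      have "x - y = of_real (1 - r / norm (x - z0)) * (x - z0)"
        by (simp add: y_def algebra_simps)
      then have "norm (x - y) = \<bar>1 - r / norm (x - z0)\<bar> * norm (x - z0)"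
        by (simp only: norm_mult norm_of_real)
      also have "\<dots> = norm (x - z0) - r" using n nz assms(3) by (simp add: abs_if field_simps)
      also have "\<dots> < e" using x by (simp add: dist_norm norm_minus_commute)
      finally have "x \<in> ball y e" by (simp add: dist_norm norm_minus_commute)
      then show ?thesis using y e by blast
    qed (use assms in auto)
  qed
  then show ?thesis using that[of "r + e"] e by auto
qed

lemma mean_value_circle:
  fixes h :: "complex \<Rightarrow> complex"
  assumes "h holomorphic_on ball z0 \<rho>" "0 < r" "r < \<rho>"
  shows "integral {0..2*pi} (\<lambda>t. h (z0 + of_real r * cis t)) = 2 * pi * h z0"
proof -
  have "((\<lambda>u. h u / (u - z0)) has_contour_integral (2 * of_real pi * \<i> * h z0)) (circlepath z0 r)"
    using assms by (intro Cauchy_integral_circlepath_simple holomorphic_on_subset[OF assms(1)]) auto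
  then have "contour_integral (part_circlepath z0 r 0 (2*pi)) (\<lambda>u. h u / (u - z0)) =
      2 * of_real pi * \<i> * h z0"
    unfolding circlepath_def by (rule contour_integral_unique)
  then have "integral {0..2*pi} (\<lambda>t. h (z0 + r * cis t) / (z0 + r * cis t - z0) * r * \<i> * cis t) =
      2 * of_real pi * \<i> * h z0"
    by (subst (asm) contour_integral_part_circlepath_eq) auto
  moreover have "(\<lambda>t. h (z0 + r * cis t) / (z0 + r * cis t - z0) * r * \<i> * cis t) =
      (\<lambda>t. \<i> * h (z0 + r * cis t))"
    using assms by (auto simp: fun_eq_iff)
  ultimately have "\<i> * integral {0..2*pi} (\<lambda>t. h (z0 + r * cis t)) = 2 * of_real pi * \<i> * h z0"
    by simp
  then have "\<i> * integral {0..2*pi} (\<lambda>t. h (z0 + r * cis t)) = \<i> * (2 * of_real pi * h z0)"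
    by (simp add: algebra_simps)
  then show ?thesis by simp
qed

lemma continuous_on_circle:
  fixes h :: "complex \<Rightarrow> 'a::topological_space"
  assumes "continuous_on (sphere z0 r) h" "0 < r"
  shows "continuous_on X (\<lambda>t. h (z0 + of_real r * cis t))"
proof -
  have "continuous_on X (\<lambda>t. z0 + of_real r * cis t)" by (intro continuous_intros)
  moreover have "(\<lambda>t. z0 + of_real r * cis t) ` X \<subseteq> sphere z0 r"
    using assms(2) by (auto simp: dist_norm norm_mult)
  ultimately show ?thesis
    using continuous_on_compose2[OF assms(1)] by blast
qed

text \<open>Without zeros \<open>f\<close> has a holomorphic logarithm \<open>g\<close> on a
  slightly larger disc, and \<open>exp (p * g)\<close> is a holomorphic function of modulus
  \<open>norm (f z) powr p\<close> to which the mean value property applies.\<close>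

lemma submean_nonzero:
  assumes "f holomorphic_on ball z0 R" "0 < r" "r < R" "\<And>z. z \<in> cball z0 r \<Longrightarrow> f z \<noteq> 0"
  shows "2 * pi * norm (f z0) powr p \<le> integral {0..2*pi} (\<lambda>t. norm (f (z0 + of_real r * cis t)) powr p)"
proof -
  have "open (ball z0 R \<inter> f -` (-{0}))"
    using assms(1) by (intro continuous_open_preimage holomorphic_on_imp_continuous_on) auto
  moreover have "cball z0 r \<subseteq> ball z0 R \<inter> f -` (-{0})" using assms by auto
  ultimately obtain \<rho> where \<rho>: "r < \<rho>" "ball z0 \<rho> \<subseteq> ball z0 R \<inter> f -` (-{0})"
    using ball_expand_open[OF _ _ assms(2)] by metis
  have hf: "f holomorphic_on ball z0 \<rho>" using \<rho> assms(1) by (meson Int_subset_iff holomorphic_on_subset)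
  have "contractible (ball z0 \<rho>)" by (simp add: convex_imp_contractible)
  then obtain g where g: "g holomorphic_on ball z0 \<rho>" "\<And>z. z \<in> ball z0 \<rho> \<Longrightarrow> f z = exp (g z)"
    using contractible_imp_holomorphic_log[OF hf] \<rho>(2) by blast
  define h where "h = (\<lambda>z. exp (of_real p * g z))"
  have hh: "h holomorphic_on ball z0 \<rho>" unfolding h_def by (intro holomorphic_intros g)
  have nh: "norm (h z) = norm (f z) powr p" if "z \<in> ball z0 \<rho>" for z
    using g(2)[OF that] by (simp add: h_def powr_def)
  have sub: "sphere z0 r \<subseteq> ball z0 \<rho>" using \<rho> by auto
  have cont: "continuous_on (sphere z0 r) h"
    using hh sub holomorphic_on_imp_continuous_on continuous_on_subset by blast
  have in_ball: "z0 + of_real r * cis t \<in> ball z0 \<rho>" for t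
    using \<rho> assms(2) by (simp add: dist_norm norm_mult)
  have "2 * pi * norm (f z0) powr p = norm (2 * pi * h z0)"
    using \<rho> assms(2) by (simp add: norm_mult nh)
  also have "\<dots> = norm (integral {0..2*pi} (\<lambda>t. h (z0 + of_real r * cis t)))"
    using mean_value_circle[OF hh assms(2) \<rho>(1)] by simp
  also have "\<dots> \<le> integral {0..2*pi} (\<lambda>t. norm (h (z0 + of_real r * cis t)))"
    by (intro integral_norm_bound_integral integrable_continuous_interval continuous_on_circle
        continuous_on_norm cont assms order_refl)
  finally show ?thesis using in_ball by (simp add: nh)
qed

text \<open>The local factorization at \<open>\<xi>\<close> extends to all of \<open>S\<close>: the
  quotient \<open>f w / (w - \<xi>) ^ n\<close> is holomorphic off \<open>\<xi>\<close> and has the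
  limit \<open>g \<xi>\<close> there, so the singularity is removable.\<close>

lemma factor_out_zero:
  assumes "f holomorphic_on S" "open S" "connected S" "\<not> f constant_on S" "\<xi> \<in> S" "f \<xi> = 0"
  obtains g n where "g holomorphic_on S" "0 < n" "\<And>w. w \<in> S \<Longrightarrow> f w = (w - \<xi>) ^ n * g w" "g \<xi> \<noteq> 0"
proof -
  obtain g r n where g: "0 < n" "0 < r" "ball \<xi> r \<subseteq> S" "g holomorphic_on ball \<xi> r"
      "\<And>w. w \<in> ball \<xi> r \<Longrightarrow> f w = (w - \<xi>)^n * g w" "\<And>w. w \<in> ball \<xi> r \<Longrightarrow> g w \<noteq> 0"
    using holomorphic_factor_zero_nonconstant[OF assms(1-3,5,6,4)] by metis
  define q where "q = (\<lambda>w. f w / (w - \<xi>) ^ n)"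
  have q: "q holomorphic_on S - {\<xi>}" unfolding q_def
    by (intro holomorphic_intros holomorphic_on_subset[OF assms(1)]) auto
  have "g \<midarrow>\<xi>\<rightarrow> g \<xi>"
    using g(2,4) by (meson centre_in_ball holomorphic_on_imp_continuous_on continuous_on_interior
        interior_open open_ball continuous_at isCont_def continuous_on_eq_continuous_at)
  moreover have "eventually (\<lambda>w. g w = q w) (at \<xi>)"
  proof -
    have "eventually (\<lambda>w. w \<in> ball \<xi> r - {\<xi>}) (at \<xi>)"
      using g(2) by (intro eventually_at_in_open) auto
    then show ?thesis by eventually_elim (use g(5) in \<open>auto simp: q_def\<close>)
  qed
  ultimately have lim: "q \<midarrow>\<xi>\<rightarrow> g \<xi>" by (rule Lim_transform_eventually)
  show ?thesis
  proof
    show "(\<lambda>w. if w = \<xi> then g \<xi> else q w) holomorphic_on S"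
      by (rule removable_singularity[OF q assms(2) lim])
    show "f w = (w - \<xi>) ^ n * (if w = \<xi> then g \<xi> else q w)" if "w \<in> S" for w
      using assms(6) g(1) by (auto simp: q_def)
  qed (use g in auto)
qed

text \<open>Each zero is replaced by its mirror image in the circle, which does not change the modulus on
  the circle and increases it at the centre.\<close>

lemma submean_no_zero_on_circle:
  assumes "f holomorphic_on ball z0 R" "0 < r" "r < R" "\<And>z. z \<in> sphere z0 r \<Longrightarrow> f z \<noteq> 0" "p > 0"
  shows "2 * pi * norm (f z0) powr p \<le> integral {0..2*pi} (\<lambda>t. norm (f (z0 + of_real r * cis t)) powr p)"
proof -
  have "finite {z \<in> cball z0 r. f z = 0} \<or> (\<forall>z\<in>ball z0 R. f z = 0)"
  proof (cases "f constant_on ball z0 R")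
    case True
    moreover have "z0 + of_real r \<in> sphere z0 r" using assms by (simp add: dist_norm)
    moreover have "z0 + of_real r \<in> ball z0 R" using assms by (simp add: dist_norm)
    ultimately have "\<And>z. z \<in> ball z0 R \<Longrightarrow> f z \<noteq> 0" using assms(4) unfolding constant_on_def by metis
    then have "{z \<in> cball z0 r. f z = 0} = {}" using assms by auto
    then show ?thesis by (metis finite.emptyI)
  next
    case False
    then show ?thesis
      using assms by (intro disjI1 holomorphic_compact_finite_zeros[OF assms(1)]) auto
  qed
  moreover have ?thesis if "\<forall>z\<in>ball z0 R. f z = 0"
    using that assms by (auto simp: dist_norm norm_mult)
  moreover have ?thesis if "finite {z \<in> cball z0 r. f z = 0}"
    using that assms(1,4)
  \<comment> \<open>The induction counts distinct zeros; one step removes a zero together with its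
    full multiplicity \<open>n\<close>.\<close>
  proof (induction "card {z \<in> cball z0 r. f z = 0}" arbitrary: f)
    case 0
    then have "\<And>z. z \<in> cball z0 r \<Longrightarrow> f z \<noteq> 0" by auto
    then show ?case using submean_nonzero[OF 0(3) assms(2,3)] by blast
  next
    case (Suc N)
    then obtain \<xi> where \<xi>: "\<xi> \<in> cball z0 r" "f \<xi> = 0"
      by (metis (mono_tags, lifting) card.empty empty_Collect_eq nat.distinct(1))
    have xr: "norm (\<xi> - z0) < r" using \<xi> Suc.prems(3)
      by (metis dist_commute dist_norm mem_cball mem_sphere order_le_less)
    have nc: "\<not> f constant_on ball z0 R"
    proof
      assume "f constant_on ball z0 R"
      moreover have "z0 + of_real r \<in> sphere z0 r" "z0 + of_real r \<in> ball z0 R" "\<xi> \<in> ball z0 R"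
        using assms \<xi> by (auto simp: dist_norm)
      ultimately show False using Suc.prems(3) \<xi>(2) unfolding constant_on_def by metis
    qed
    obtain g n where g: "g holomorphic_on ball z0 R" "0 < n" "g \<xi> \<noteq> 0"
        "\<And>w. w \<in> ball z0 R \<Longrightarrow> f w = (w - \<xi>) ^ n * g w"
      using factor_out_zero[OF Suc.prems(2) _ _ nc _ \<xi>(2)] \<xi>(1) assms
      by (metis connected_ball open_ball mem_ball mem_cball order_le_less_trans)
    \<comment> \<open>\<open>(w - \<xi>) / bl w\<close> is the Blaschke factor of the disc with zero
      \<open>\<xi>\<close>, so \<open>f1\<close> is \<open>f\<close> divided by its
      \<open>n\<close>-th power. \<open>bl\<close> has no zero in the closed disc, equals
      \<open>r\<close> at the centre, and has the modulus of \<open>w - \<xi>\<close> on the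
      circle.\<close>
    define bl where "bl = (\<lambda>w. of_real r - cnj (\<xi> - z0) * (w - z0) / of_real r)"
    define f1 where "f1 = (\<lambda>w. bl w ^ n * g w)"
    have bl0: "bl w \<noteq> 0" if "w \<in> cball z0 r" for w
    proof
      assume "bl w = 0"
      then have "norm (of_real r :: complex) = norm (cnj (\<xi> - z0) * (w - z0) / of_real r)"
        by (simp add: bl_def)
      also have "\<dots> = norm (\<xi> - z0) * norm (w - z0) / r" using assms
        by (simp add: norm_mult norm_divide del: complex_cnj_diff)
      also have "\<dots> \<le> norm (\<xi> - z0) * r / r" using assms that
        by (intro divide_right_mono mult_left_mono) (auto simp: dist_norm norm_minus_commute)
      also have "\<dots> < r" using xr assms by simp
      finally show False using assms by simp
    qed
    have blc: "norm (bl w) = norm (w - \<xi>)" if "w \<in> sphere z0 r" for w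
    proof -
      have n: "norm (w - z0) = r" using that by (simp add: dist_norm norm_minus_commute)
      have *: "(w - z0) * cnj (w - z0) = of_real (r\<^sup>2)"
        by (metis n complex_norm_square of_real_power)
      have "cnj (w - \<xi>) * (w - z0) = of_real (r\<^sup>2) - cnj (\<xi> - z0) * (w - z0)"
        using * by (simp add: algebra_simps)
      also have "\<dots> = of_real r * bl w"
        using assms by (simp add: bl_def field_simps power2_eq_square)
      finally have "norm (w - \<xi>) * r = r * norm (bl w)"
        by (metis n norm_mult complex_mod_cnj norm_of_real abs_of_pos assms(2))
      then show ?thesis using assms by simp
    qed
    have hf1: "f1 holomorphic_on ball z0 R" unfolding f1_def bl_def
      by (intro holomorphic_intros g) (use assms in auto)
    have f1c: "norm (f1 w) = norm (f w)" if "w \<in> sphere z0 r" for w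
      using that assms g(4)[of w] blc[OF that] by (simp add: f1_def norm_mult norm_power)
    have zeros: "{z \<in> cball z0 r. f1 z = 0} = {z \<in> cball z0 r. f z = 0} - {\<xi>}"
    proof -
      have "f1 z = 0 \<longleftrightarrow> f z = 0 \<and> z \<noteq> \<xi>" if "z \<in> cball z0 r" for z
      proof -
        have "z \<in> ball z0 R" using that assms by auto
        then have "f z = 0 \<longleftrightarrow> z = \<xi> \<or> g z = 0" using g(2,4) by auto
        moreover have "f1 z = 0 \<longleftrightarrow> g z = 0" using bl0[OF that] by (simp add: f1_def)
        ultimately show ?thesis using g(3) by auto
      qed
      then show ?thesis by auto
    qed
    have "2 * pi * norm (f z0) powr p \<le> 2 * pi * norm (f1 z0) powr p"
    proof -
      have "norm (f z0) = norm (z0 - \<xi>) ^ n * norm (g z0)"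
        using g(4)[of z0] assms by (simp add: norm_mult norm_power)
      also have "\<dots> \<le> r ^ n * norm (g z0)"
        using xr by (intro mult_right_mono power_mono) (auto simp: norm_minus_commute)
      also have "\<dots> = norm (f1 z0)" using assms by (simp add: f1_def bl_def norm_mult norm_power)
      finally show ?thesis using assms by (intro mult_left_mono powr_mono2) auto
    qed
    also have "\<dots> \<le> integral {0..2*pi} (\<lambda>t. norm (f1 (z0 + of_real r * cis t)) powr p)"
    proof (rule Suc.hyps(1))
      show "N = card {z \<in> cball z0 r. f1 z = 0}"
        unfolding zeros using Suc.hyps(2) Suc.prems(1) \<xi> by (subst card_Diff_singleton) auto
      show "finite {z \<in> cball z0 r. f1 z = 0}" unfolding zeros using Suc.prems(1) by auto
      show "f1 z \<noteq> 0" if "z \<in> sphere z0 r" for z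
        using f1c[OF that] Suc.prems(3)[OF that] by auto
    qed (rule hf1)
    also have "\<dots> = integral {0..2*pi} (\<lambda>t. norm (f (z0 + of_real r * cis t)) powr p)"
    proof -
      have "z0 + of_real r * cis t \<in> sphere z0 r" for t
        using assms by (simp add: dist_norm norm_mult)
      then show ?thesis using f1c by simp
    qed
    finally show ?case .
  qed
  ultimately show ?thesis by blast
qed

text \<open>A non-constant \<open>f\<close> has finitely many zeros in the closed disc, so all radii
  slightly below \<open>r\<close> give circles free of zeros; the inequality passes to
  \<open>r\<close> because the circle mean is continuous in the radius.\<close>

lemma submean_value:
  assumes "f holomorphic_on ball z0 R" "0 < r" "r < R" "p > 0"
  shows "2 * pi * norm (f z0) powr p \<le> integral {0..2*pi} (\<lambda>t. norm (f (z0 + of_real r * cis t)) powr p)"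
proof (cases "f constant_on ball z0 R")
  case True
  moreover have "z0 + of_real r * cis t \<in> ball z0 R" "z0 \<in> ball z0 R" for t
    using assms by (auto simp: dist_norm norm_mult)
  ultimately have *: "f (z0 + of_real r * cis t) = f z0" for t unfolding constant_on_def by metis
  show ?thesis by (simp add: *)
next
  case False
  have contf: "continuous_on (ball z0 R) f" using assms(1) by (rule holomorphic_on_imp_continuous_on)
  define I where "I = (\<lambda>\<rho>. integral {0..2*pi} (\<lambda>t. norm (f (z0 + of_real \<rho> * cis t)) powr p))"
  have "continuous_on {r/2..r} (\<lambda>\<rho>. integral (cbox 0 (2*pi)) (\<lambda>t. norm (f (z0 + of_real \<rho> * cis t)) powr p))"
  proof (rule integral_continuous_on_param, unfold case_prod_unfold)
    have "(\<lambda>x. z0 + complex_of_real (fst x) * cis (snd x)) ` ({r/2..r} \<times> cbox 0 (2*pi)) \<subseteq> ball z0 R"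
      using assms by (auto simp: dist_norm norm_mult)
    then have "continuous_on ({r/2..r} \<times> cbox 0 (2*pi)) (\<lambda>x. f (z0 + complex_of_real (fst x) * cis (snd x)))"
      by (intro continuous_on_compose2[OF contf] continuous_intros) auto
    then show "continuous_on ({r/2..r} \<times> cbox 0 (2*pi))
        (\<lambda>x. norm (f (z0 + complex_of_real (fst x) * cis (snd x))) powr p)"
      using assms by (intro continuous_on_powr' continuous_on_norm continuous_on_const) auto
  qed
  then have cI: "continuous_on {r/2..r} I" by (simp add: I_def)
  have fin: "finite {z \<in> cball z0 r. f z = 0}"
    using False assms by (intro holomorphic_compact_finite_zeros[OF assms(1)]) auto
  \<comment> \<open>The radii of the circles that carry a zero, a finite set.\<close>
  define bad where "bad = (\<lambda>z. norm (z - z0)) ` {z \<in> cball z0 r. f z = 0}"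
  have finbad: "finite bad" using fin by (simp add: bad_def)
  have lim: "(I \<longlongrightarrow> I r) (at r within {r/2..r})"
    using cI assms by (simp add: continuous_on_def)
  have ne: "at r within {r/2..r} \<noteq> bot"
    using assms by (simp add: at_within_Icc_at_left)
  have ev: "\<forall>\<^sub>F \<rho> in at r within {r/2..r}. 2 * pi * norm (f z0) powr p \<le> I \<rho>"
  proof -
    have "\<forall>\<^sub>F \<rho> in at r. \<rho> \<notin> bad - {r}"
    proof -
      have "closed (bad - {r})" using finbad by (intro finite_imp_closed) auto
      then have "open (- (bad - {r}))" by (rule open_Compl)
      then have "\<forall>\<^sub>F \<rho> in nhds r. \<rho> \<in> - (bad - {r})" by (intro eventually_nhds_in_open) auto
      then show ?thesis by (simp add: eventually_at_filter) (auto elim: eventually_mono)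
    qed
    then have "\<forall>\<^sub>F \<rho> in at r within {r/2..r}. \<rho> \<notin> bad - {r}"
      by (rule filter_leD[OF at_le, rotated]) auto
    moreover have "\<forall>\<^sub>F \<rho> in at r within {r/2..r}. \<rho> \<in> {r/2..r} \<and> \<rho> \<noteq> r"
      by (simp add: eventually_at_filter)
    ultimately show ?thesis
    proof eventually_elim
      case (elim \<rho>)
      then have \<rho>: "0 < \<rho>" "\<rho> < r" "\<rho> \<notin> bad" using assms by auto
      have "f z \<noteq> 0" if "z \<in> sphere z0 \<rho>" for z
      proof
        assume "f z = 0"
        moreover have "norm (z - z0) = \<rho>" using that by (simp add: dist_norm norm_minus_commute)
        moreover have "z \<in> cball z0 r" using that \<rho> by auto
        ultimately show False using \<rho>(3) unfolding bad_def by auto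
      qed
      then show ?case unfolding I_def
        using \<rho> assms by (intro submean_no_zero_on_circle[OF assms(1)]) auto
    qed
  qed
  show ?thesis using tendsto_lowerbound[OF lim ev ne] by (simp add: I_def)
qed

text \<open>A maximum principle: after subtracting the chord, a positive maximum would lie in the
  interior, and the mean inequality around it would spread the maximum to the whole interval of
  averaging. The averages are weighted by the cosine because that is what remains of a circle mean
  after integration over the imaginary direction.\<close>

lemma cosine_submean_imp_below_chord:
  fixes M :: "real \<Rightarrow> real"
  assumes ab: "a < b" and cont: "continuous_on {a..b} M"
    and sub: "\<And>x r. 0 < r \<Longrightarrow> a \<le> x - r \<Longrightarrow> x + r \<le> b \<Longrightarrow>
      2 * pi * M x \<le> integral {0..2*pi} (\<lambda>t. M (x + r * cos t))"
    and x: "x \<in> {a..b}"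
  shows "M x \<le> ((b - x) * M a + (x - a) * M b) / (b - a)"
proof -
  define L where "L = (\<lambda>x. M a + (x - a) * ((M b - M a) / (b - a)))"
  define h where "h = (\<lambda>x. M x - L x)"
  have L_eq: "L x = ((b - x) * M a + (x - a) * M b) / (b - a)" for x
    using ab by (simp add: L_def field_simps)
  have conth: "continuous_on {a..b} h" unfolding h_def L_def using ab by (intro continuous_intros cont) auto
  obtain m where m: "m \<in> {a..b}" "\<And>y. y \<in> {a..b} \<Longrightarrow> h y \<le> h m"
    using continuous_attains_sup[OF compact_Icc _ conth] ab by auto
  have "h m \<le> 0"
  proof (rule ccontr)
    assume "\<not> h m \<le> 0"
    then have pos: "h m > 0" by simp
    \<comment> \<open>The leftmost maximum point is taken, so that reaching the maximum at
      \<open>s - r\<close> is a contradiction.\<close>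
    define S where "S = {a..b} \<inter> h -` {h m}"
    have "closed S" unfolding S_def using conth by (intro continuous_closed_preimage) auto
    moreover have "S \<noteq> {}" "bdd_below S" using m by (auto simp: S_def intro!: bdd_belowI[of _ a])
    ultimately have "Inf S \<in> S" by (intro closed_contains_Inf)
    define s where "s = Inf S"
    have s: "s \<in> {a..b}" "h s = h m" using \<open>Inf S \<in> S\<close> by (auto simp: S_def s_def)
    have smin: "s \<le> y" if "y \<in> {a..b}" "h y = h m" for y
      unfolding s_def by (rule cInf_lower) (use that \<open>bdd_below S\<close> in \<open>auto simp: S_def\<close>)
    have "h a = 0" "h b = 0" using ab by (auto simp: h_def L_eq)
    then have "s \<noteq> a" "s \<noteq> b" using s pos by auto
    then have sab: "a < s" "s < b" using s by auto
    define r where "r = min (s - a) (b - s)"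
    have r: "r > 0" "a \<le> s - r" "s + r \<le> b" using sab by (auto simp: r_def)
    have inab: "s + r * cos t \<in> {a..b}" for t
    proof -
      have "r * cos t \<le> r * 1" "r * (-1) \<le> r * cos t" using r by (intro mult_left_mono; simp)+
      moreover note r
      ultimately show ?thesis unfolding atLeastAtMost_iff by linarith
    qed
    have conthc: "continuous_on {0..2*pi} (\<lambda>t. h (s + r * cos t))"
      by (rule continuous_on_compose2[OF conth]) (use inab in \<open>auto intro!: continuous_intros\<close>)
    have contMc: "continuous_on {0..2*pi} (\<lambda>t. M (s + r * cos t))"
      by (rule continuous_on_compose2[OF cont]) (use inab in \<open>auto intro!: continuous_intros\<close>)
    \<comment> \<open>Affine functions satisfy the mean condition with equality because the cosine
      integrates to 0, hence subtracting the chord preserves the inequality.\<close>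
    define c where "c = (M b - M a) / (b - a)"
    have "((\<lambda>t. r * c * cos t) has_integral (r * c * sin (2*pi) - r * c * sin 0)) {0..2*pi}"
      by (rule fundamental_theorem_of_calculus)
         (auto intro!: derivative_eq_intros simp flip: has_real_derivative_iff_has_vector_derivative)
    then have cos0: "integral {0..2*pi} (\<lambda>t. r * c * cos t) = 0" by (auto dest: integral_unique)
    have hM: "h (s + r * cos t) = M (s + r * cos t) - (L s + r * c * cos t)" for t
      unfolding h_def L_def c_def[symmetric] by (simp add: algebra_simps)
    have "integral {0..2*pi} (\<lambda>t. h (s + r * cos t)) =
        integral {0..2*pi} (\<lambda>t. M (s + r * cos t)) - integral {0..2*pi} (\<lambda>t. L s + r * c * cos t)"
      unfolding hM by (intro integral_diff integrable_continuous_interval contMc continuous_intros)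
    also have "integral {0..2*pi} (\<lambda>t. L s + r * c * cos t) = 2 * pi * L s"
      by (subst integral_add) (auto intro!: integrable_continuous_interval continuous_intros simp: cos0)
    finally have ge: "integral {0..2*pi} (\<lambda>t. h (s + r * cos t)) \<ge> 2 * pi * h s"
      using sub[OF r] by (simp add: h_def algebra_simps)
    have "integral {0..2*pi} (\<lambda>t. h m - h (s + r * cos t)) =
        2 * pi * h m - integral {0..2*pi} (\<lambda>t. h (s + r * cos t))"
      by (subst integral_diff) (auto intro!: integrable_continuous_interval conthc)
    then have "integral {0..2*pi} (\<lambda>t. h m - h (s + r * cos t)) \<le> 0" using ge s by simp
    moreover have "integral {0..2*pi} (\<lambda>t. h m - h (s + r * cos t)) \<ge> 0"
      using m(2) inab by (intro integral_nonneg integrable_continuous_interval continuous_intros conthc) auto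
    ultimately have "integral {0..2*pi} (\<lambda>t. h m - h (s + r * cos t)) = 0" by simp
    then have "\<forall>t\<in>{0..2*pi}. h m - h (s + r * cos t) = 0"
      using m(2) inab by (subst (asm) integral_eq_0_iff) (auto intro!: continuous_intros conthc)
    then have "h m - h (s + r * cos pi) = 0" by (rule bspec) auto
    then have "h (s - r) = h m" by simp
    then have "s \<le> s - r" using r sab by (intro smin) auto
    then show False using r by simp
  qed
  then have "h x \<le> 0" using m(2)[OF x] by simp
  then show ?thesis by (simp add: h_def L_eq)
qed

lemma integrable_inverse_1_plus_sq: "integrable lborel (\<lambda>t::real. K / (1 + t\<^sup>2))"
proof -
  have "integrable lborel (\<lambda>t::real. inverse (1 + t\<^sup>2))"
    using integrable_inverse_1_plus_square by (simp add: set_integrable_def)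
  then have "integrable lborel (\<lambda>t::real. K * inverse (1 + t\<^sup>2))" by (rule integrable_mult_right)
  then show ?thesis by (simp add: divide_inverse)
qed

text \<open>The \<open>p\<close>-th power of the modulus is subharmonic. Integrating its circle
  inequality over the whole vertical line and exchanging the integrals leaves only the real part
  \<open>x + r * cos \<theta>\<close>, so that \<open>M\<close> satisfies the hypothesis of
  \<open>cosine_submean_imp_below_chord\<close>. The bound by
  \<open>K / (1 + (Im z)\<^sup>2)\<close> gives integrability on each line and, by dominated
  convergence, continuity of \<open>M\<close>.\<close>

lemma
  assumes ana: "\<Psi> analytic_on {z. a \<le> Re z \<and> Re z \<le> b}" and ab: "a < b" and p: "p > 0"
    and bound: "\<And>z. a \<le> Re z \<Longrightarrow> Re z \<le> b \<Longrightarrow> norm (\<Psi> z) powr p \<le> K / (1 + (Im z)\<^sup>2)"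
  defines "M \<equiv> \<lambda>x. LINT t|lborel. norm (\<Psi> (Complex x t)) powr p"
  shows strip_integrable: "x \<in> {a..b} \<Longrightarrow> integrable lborel (\<lambda>t. norm (\<Psi> (Complex x t)) powr p)"
    and hardy_convexity: "x \<in> {a..b} \<Longrightarrow> M x \<le> ((b - x) * M a + (x - a) * M b) / (b - a)"
proof -
  let ?S = "{z. a \<le> Re z \<and> Re z \<le> b}"
  have cS: "closed ?S" by (intro closed_Collect_conj closed_Collect_le continuous_intros)
  define u where "u = (\<lambda>z. norm (\<Psi> z) powr p)"
  have contu: "continuous_on ?S u"
    unfolding u_def using p
    by (intro continuous_on_powr' continuous_on_norm continuous_on_const analytic_imp_holomorphic
        holomorphic_on_imp_continuous_on ana) auto
  \<comment> \<open>Extension by 0 outside the strip, which makes the integrand measurable on the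
    whole plane as Tonelli's theorem requires.\<close>
  define U where "U = (\<lambda>z. if z \<in> ?S then u z else 0)"
  have U_meas: "U \<in> borel_measurable borel"
    unfolding U_def by (intro borel_measurable_continuous_on_if contu continuous_on_const borel_closed cS)
  have Complex_meas [measurable]: "(\<lambda>w. Complex (f w) (g w)) \<in> borel_measurable N"
    if "f \<in> borel_measurable N" "g \<in> borel_measurable N" for f g and N :: "'x measure"
    unfolding Complex_eq using that by measurable
  note U_meas' [measurable] = measurable_compose[OF _ U_meas]
  have meas: "(\<lambda>t. u (Complex x t)) \<in> borel_measurable lborel" if "x \<in> {a..b}" for x
  proof -
    have "(\<lambda>t. U (Complex x t)) \<in> borel_measurable lborel" by measurable
    then show ?thesis using that by (simp add: U_def)
  qed
  have int: "integrable lborel (\<lambda>t. u (Complex x t))" if "x \<in> {a..b}" for x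
  proof (rule Bochner_Integration.integrable_bound[OF integrable_inverse_1_plus_sq[of K] meas[OF that]])
    show "AE t in lborel. norm (u (Complex x t)) \<le> norm (K / (1 + t\<^sup>2))"
    proof (intro always_eventually allI)
      fix t
      have "u (Complex x t) \<le> K / (1 + t\<^sup>2)" using bound[of "Complex x t"] that by (simp add: u_def)
      moreover have "u (Complex x t) \<ge> 0" by (simp add: u_def)
      ultimately show "norm (u (Complex x t)) \<le> norm (K / (1 + t\<^sup>2))"
        unfolding real_norm_def by linarith
    qed
  qed
  then show "x \<in> {a..b} \<Longrightarrow> integrable lborel (\<lambda>t. norm (\<Psi> (Complex x t)) powr p)" by (simp add: u_def)
  have Mu: "M = (\<lambda>x. LINT t|lborel. u (Complex x t))" by (simp add: M_def u_def)
  have M0: "M x \<ge> 0" for x by (simp add: Mu u_def)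
  have nnM: "(\<integral>\<^sup>+t. ennreal (u (Complex x t)) \<partial>lborel) = ennreal (M x)" if "x \<in> {a..b}" for x
    unfolding Mu by (rule nn_integral_eq_integral[OF int[OF that]]) (simp add: u_def)
  have contM: "continuous_on {a..b} M"
  proof (rule continuous_on_sequentiallyI)
    fix y :: "nat \<Rightarrow> real" and l assume y: "\<forall>n. y n \<in> {a..b}" "l \<in> {a..b}" "y \<longlonglongrightarrow> l"
    show "(\<lambda>n. M (y n)) \<longlonglongrightarrow> M l" unfolding Mu
    proof (rule integral_dominated_convergence)
      show "integrable lborel (\<lambda>t. K / (1 + t\<^sup>2))" by (rule integrable_inverse_1_plus_sq)
      show "AE t in lborel. (\<lambda>n. u (Complex (y n) t)) \<longlonglongrightarrow> u (Complex l t)"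
      proof (intro always_eventually allI)
        fix t
        have "(\<lambda>n. Complex (y n) t) \<longlonglongrightarrow> Complex l t" unfolding Complex_eq using y(3) by (intro tendsto_intros)
        then show "(\<lambda>n. u (Complex (y n) t)) \<longlonglongrightarrow> u (Complex l t)"
          by (rule continuous_on_tendsto_compose[OF contu]) (use y in auto)
      qed
      show "AE t in lborel. norm (u (Complex (y n) t)) \<le> K / (1 + t\<^sup>2)" for n
        using bound[of "Complex (y n) _"] y by (intro always_eventually allI) (auto simp: u_def)
    qed (use y meas in auto)
  qed
  show "M x \<le> ((b - x) * M a + (x - a) * M b) / (b - a)" if "x \<in> {a..b}"
  proof (rule cosine_submean_imp_below_chord[OF ab contM _ that])
    fix x r :: real assume r: "0 < r" "a \<le> x - r" "x + r \<le> b"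
    have xab: "x \<in> {a..b}" using r by auto
    have inab: "x + r * cos \<theta> \<in> {a..b}" for \<theta>
    proof -
      have "r * cos \<theta> \<le> r * 1" "r * (-1) \<le> r * cos \<theta>" using r by (intro mult_left_mono; simp)+
      moreover note r
      ultimately show ?thesis unfolding atLeastAtMost_iff by linarith
    qed
    obtain W where W: "open W" "?S \<subseteq> W" "\<Psi> holomorphic_on W"
      using ana by (auto simp: analytic_on_holomorphic)
    have sub: "2 * pi * u (Complex x t) \<le>
        integral {0..2*pi} (\<lambda>\<theta>. u (Complex (x + r * cos \<theta>) (t + r * sin \<theta>)))" for t
    proof -
      have "cball (Complex x t) r \<subseteq> ?S"
      proof
        fix w assume "w \<in> cball (Complex x t) r"
        then have "norm (w - Complex x t) \<le> r" by (simp add: dist_norm norm_minus_commute)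
        then have "\<bar>Re w - x\<bar> \<le> r" using abs_Re_le_cmod[of "w - Complex x t"] by simp
        then show "w \<in> ?S" using r by auto
      qed
      then obtain \<rho> where "r < \<rho>" "ball (Complex x t) \<rho> \<subseteq> W"
        using ball_expand_open[OF W(1) _ r(1)] W(2) by (metis subset_trans)
      then have "2 * pi * norm (\<Psi> (Complex x t)) powr p \<le>
          integral {0..2*pi} (\<lambda>\<theta>. norm (\<Psi> (Complex x t + of_real r * cis \<theta>)) powr p)"
        using r p W(3) by (intro submean_value[where R = \<rho>]) (auto intro: holomorphic_on_subset)
      moreover have "Complex x t + of_real r * cis \<theta> = Complex (x + r * cos \<theta>) (t + r * sin \<theta>)" for \<theta>
        by (simp add: complex_eq_iff)
      ultimately show ?thesis by (simp add: u_def)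
    qed
    have "ennreal (2 * pi * M x) = ennreal (2 * pi) * (\<integral>\<^sup>+t. ennreal (u (Complex x t)) \<partial>lborel)"
      by (simp add: nnM[OF xab] ennreal_mult' M0)
    also have "\<dots> = (\<integral>\<^sup>+t. ennreal (2 * pi) * ennreal (u (Complex x t)) \<partial>lborel)"
      using meas[OF xab] by (intro nn_integral_cmult[symmetric]) auto
    also have "\<dots> \<le> (\<integral>\<^sup>+t. (\<integral>\<^sup>+\<theta>. ennreal (U (Complex (x + r * cos \<theta>) (t + r * sin \<theta>))) *
        indicator {0..2*pi} \<theta> \<partial>lborel) \<partial>lborel)"
    proof (rule nn_integral_mono)
      fix t :: real
      have cc: "continuous_on {0..2*pi} (\<lambda>\<theta>. u (Complex (x + r * cos \<theta>) (t + r * sin \<theta>)))"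
        by (rule continuous_on_compose2[OF contu])
           (use inab in \<open>auto simp: Complex_eq intro!: continuous_intros\<close>)
      have "(\<integral>\<^sup>+\<theta>. ennreal (u (Complex (x + r * cos \<theta>) (t + r * sin \<theta>))) * indicator {0..2*pi} \<theta> \<partial>lborel) =
          ennreal (integral {0..2*pi} (\<lambda>\<theta>. u (Complex (x + r * cos \<theta>) (t + r * sin \<theta>))))"
        by (intro nn_integral_has_integral_lebesgue' integrable_integral integrable_continuous_interval cc)
           (simp add: u_def)
      then show "ennreal (2 * pi) * ennreal (u (Complex x t)) \<le>
          (\<integral>\<^sup>+\<theta>. ennreal (U (Complex (x + r * cos \<theta>) (t + r * sin \<theta>))) * indicator {0..2*pi} \<theta> \<partial>lborel)"
        using sub[of t] inab by (simp add: U_def u_def ennreal_leI flip: ennreal_mult')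
    qed
    also have "\<dots> = (\<integral>\<^sup>+\<theta>. (\<integral>\<^sup>+t. ennreal (U (Complex (x + r * cos \<theta>) (t + r * sin \<theta>))) *
        indicator {0..2*pi} \<theta> \<partial>lborel) \<partial>lborel)"
      by (rule lborel_pair.Fubini') measurable
    also have "\<dots> = (\<integral>\<^sup>+\<theta>. ennreal (M (x + r * cos \<theta>)) * indicator {0..2*pi} \<theta> \<partial>lborel)"
    proof (rule nn_integral_cong)
      fix \<theta> :: real
      have "(\<integral>\<^sup>+t. ennreal (U (Complex (x + r * cos \<theta>) (t + r * sin \<theta>))) * indicator {0..2*pi} \<theta> \<partial>lborel) =
         (\<integral>\<^sup>+t. ennreal (U (Complex (x + r * cos \<theta>) (r * sin \<theta> + 1 * t))) \<partial>lborel) * indicator {0..2*pi} \<theta>"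
        by (subst nn_integral_multc) (auto simp: add.commute)
      also have "(\<integral>\<^sup>+t. ennreal (U (Complex (x + r * cos \<theta>) (r * sin \<theta> + 1 * t))) \<partial>lborel) =
          (\<integral>\<^sup>+t. ennreal (U (Complex (x + r * cos \<theta>) t)) \<partial>lborel)"
        by (subst nn_integral_real_affine[of _ 1 "r * sin \<theta>"]) auto
      also have "\<dots> = ennreal (M (x + r * cos \<theta>))"
        using nnM[OF inab[of \<theta>]] inab[of \<theta>] by (simp add: U_def)
      finally show "(\<integral>\<^sup>+t. ennreal (U (Complex (x + r * cos \<theta>) (t + r * sin \<theta>))) * indicator {0..2*pi} \<theta> \<partial>lborel) =
         ennreal (M (x + r * cos \<theta>)) * indicator {0..2*pi} \<theta>" .
    qed
    also have "\<dots> = ennreal (integral {0..2*pi} (\<lambda>\<theta>. M (x + r * cos \<theta>)))"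
      by (intro nn_integral_has_integral_lebesgue' integrable_integral integrable_continuous_interval
          continuous_on_compose2[OF contM] continuous_intros M0) (use inab in auto)
    finally show "2 * pi * M x \<le> integral {0..2*pi} (\<lambda>\<theta>. M (x + r * cos \<theta>))"
      by (rule ennreal_le_iff[THEN iffD1, rotated])
         (intro integral_nonneg integrable_continuous_interval continuous_on_compose2[OF contM]
           continuous_intros M0, use inab in auto)
  qed
qed

subsection \<open>Gaussian weights\<close>

text \<open>A Gaussian is chosen since it is the modulus, up to a factor bounded on vertical strips,
  of the entire function \<open>exp ((s - i * \<tau>)^2 / (2 * \<Delta>^2))\<close>, and because its
  Fourier transform decays so fast. It is not normalised: its mass
  \<open>sqrt (2 * pi) * \<Delta>\<close> appears in all mean values.\<close>

definition gw :: "real \<Rightarrow> real \<Rightarrow> real \<Rightarrow> real" where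
  "gw \<tau> \<Delta> t = exp (- (t - \<tau>)\<^sup>2 / (2 * \<Delta>\<^sup>2))"

lemma gw_pos: "gw \<tau> \<Delta> t > 0"
  by (simp add: gw_def)

lemma gw_measurable [measurable]: "gw \<tau> \<Delta> \<in> borel_measurable borel"
  unfolding gw_def by measurable

lemma gw_continuous [continuous_intros]:
  "continuous_on A f \<Longrightarrow> continuous_on A g \<Longrightarrow> continuous_on A (\<lambda>x. gw (f x) \<Delta> (g x))"
  unfolding gw_def by (cases "\<Delta> = 0") (auto intro!: continuous_intros)

lemma power_le_fact_exp:
  fixes y :: real
  assumes "y \<ge> 0"
  shows "y ^ n \<le> fact n * exp y"
proof -
  have "y ^ n / fact n \<le> (\<Sum>k. y ^ k / fact k)"
    using sum_le_suminf[of "\<lambda>k. y ^ k / fact k" "{n}"] summable_exp[of y] assms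
    by (simp add: field_simps)
  then show ?thesis by (simp add: exp_def field_simps)
qed

text \<open>The right-hand side has the shape of the majorant in \<open>hardy_convexity\<close>. The
  constant may depend on \<open>\<tau>\<close> and \<open>\<Delta>\<close>, as it serves
  integrability only.\<close>

lemma poly_gw_decay:
  assumes "\<Delta> > 0"
  obtains C where "\<And>t. (1 + \<bar>t\<bar>) ^ n * gw \<tau> \<Delta> t \<le> C / (1 + t\<^sup>2)"
proof
  fix t :: real
  define y where "y = \<bar>t - \<tau>\<bar>"
  define m where "m = n + 2"
  have "(1 + \<bar>t\<bar>) ^ n * gw \<tau> \<Delta> t * (1 + t\<^sup>2) \<le> (1 + \<bar>t\<bar>) ^ n * gw \<tau> \<Delta> t * (1 + \<bar>t\<bar>)\<^sup>2"
    using gw_pos[of \<tau> \<Delta> t] by (intro mult_left_mono) (auto simp: power2_eq_square algebra_simps)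
  also have "\<dots> = (1 + \<bar>t\<bar>) ^ m * gw \<tau> \<Delta> t" by (simp add: m_def power_add power2_eq_square)
  also have "\<dots> \<le> ((1 + \<bar>\<tau>\<bar>) * (1 + y)) ^ m * gw \<tau> \<Delta> t"
  proof -
    have "\<bar>t\<bar> \<le> \<bar>\<tau>\<bar> + y" by (simp add: y_def)
    also have "\<dots> \<le> \<bar>\<tau>\<bar> + y + \<bar>\<tau>\<bar> * y" by (simp add: y_def)
    finally have "1 + \<bar>t\<bar> \<le> (1 + \<bar>\<tau>\<bar>) * (1 + y)" by (simp add: algebra_simps)
    then show ?thesis using gw_pos[of \<tau> \<Delta> t] by (intro mult_right_mono power_mono) auto
  qed
  also have "\<dots> = (1 + \<bar>\<tau>\<bar>) ^ m * ((1 + y) ^ m * exp (- y\<^sup>2 / (2 * \<Delta>\<^sup>2)))"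
    by (simp add: gw_def y_def power_mult_distrib)
  also have "(1 + y) ^ m * exp (- y\<^sup>2 / (2 * \<Delta>\<^sup>2)) \<le> fact m * exp (1 + y) * exp (- y\<^sup>2 / (2 * \<Delta>\<^sup>2))"
    by (intro mult_right_mono power_le_fact_exp) (auto simp: y_def)
  also have "\<dots> = fact m * exp (1 + y - y\<^sup>2 / (2 * \<Delta>\<^sup>2))" by (simp flip: exp_add)
  also have "exp (1 + y - y\<^sup>2 / (2 * \<Delta>\<^sup>2)) \<le> exp (1 + \<Delta>\<^sup>2 / 2)"
  proof -
    have "0 \<le> (y / \<Delta> - \<Delta>)\<^sup>2" by simp
    also have "\<dots> = y\<^sup>2 / \<Delta>\<^sup>2 + \<Delta>\<^sup>2 - 2 * y" using assms by (simp add: power2_diff power_divide)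
    finally show ?thesis by simp
  qed
  finally have "(1 + \<bar>t\<bar>) ^ n * gw \<tau> \<Delta> t * (1 + t\<^sup>2) \<le> (1 + \<bar>\<tau>\<bar>) ^ m * (fact m * exp (1 + \<Delta>\<^sup>2 / 2))"
    by (simp add: mult_left_mono)
  moreover have "1 + t\<^sup>2 > 0" by (simp add: add_pos_nonneg)
  ultimately show "(1 + \<bar>t\<bar>) ^ n * gw \<tau> \<Delta> t \<le> (1 + \<bar>\<tau>\<bar>) ^ m * (fact m * exp (1 + \<Delta>\<^sup>2 / 2)) / (1 + t\<^sup>2)"
    by (simp add: pos_le_divide_eq)
qed

text \<open>Convexity is applied to \<open>\<Phi>\<close> times an entire factor whose
  \<open>p\<close>-th power has modulus \<open>gw \<tau> \<Delta> (Im z)\<close> times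
  \<open>exp ((Re z)^2 / (2 * \<Delta>^2))\<close>; the latter lies between 1 and
  \<open>exp (b^2 / 2)\<close> on the strip. A further factor \<open>exp (\<kappa> * z)\<close>
  tilts the chord. Leaving \<open>\<kappa>\<close> free does the work of log-convexity, since the
  best choice of \<open>\<kappa>\<close> would turn the sum into a geometric mean.\<close>

lemma
  fixes \<tau> :: real
  assumes ana: "\<Phi> analytic_on {z. a \<le> Re z \<and> Re z \<le> b}" and ab: "0 \<le> a" "a < b" and p: "p > 0"
    and growth: "\<And>z. a \<le> Re z \<Longrightarrow> Re z \<le> b \<Longrightarrow> norm (\<Phi> z) \<le> K * (1 + \<bar>Im z\<bar>) ^ N"
    and \<Delta>: "\<Delta> \<ge> 1"
  defines "I \<equiv> \<lambda>x. LINT t|lborel. norm (\<Phi> (Complex x t)) powr p * gw \<tau> \<Delta> t"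
  shows strip_gw_integrable:
      "x \<in> {a..b} \<Longrightarrow> integrable lborel (\<lambda>t. norm (\<Phi> (Complex x t)) powr p * gw \<tau> \<Delta> t)"
    and strip_gw_convexity: "x \<in> {a..b} \<Longrightarrow> \<kappa> \<ge> 0 \<Longrightarrow>
      I x \<le> exp (- \<kappa> * (x - a)) * I a + exp (\<kappa> * (b - x) + b\<^sup>2 / 2) * I b"
proof -
  define \<Psi> where "\<Psi> = (\<lambda>\<kappa> z. \<Phi> z * exp (((z - \<i> * of_real \<tau>)\<^sup>2 / of_real (2 * \<Delta>\<^sup>2) + of_real \<kappa> * z) / of_real p))"
  have norm_\<Psi>: "norm (\<Psi> \<kappa> z) powr p =
      norm (\<Phi> z) powr p * gw \<tau> \<Delta> (Im z) * exp ((Re z)\<^sup>2 / (2 * \<Delta>\<^sup>2) + \<kappa> * Re z)" for \<kappa> z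
  proof -
    have "Re ((z - \<i> * of_real \<tau>)\<^sup>2 / of_real (2 * \<Delta>\<^sup>2)) = ((Re z)\<^sup>2 - (Im z - \<tau>)\<^sup>2) / (2 * \<Delta>\<^sup>2)"
      by (simp only: Re_divide_of_real) (simp add: power2_eq_square)
    then have "norm (exp (((z - \<i> * of_real \<tau>)\<^sup>2 / of_real (2 * \<Delta>\<^sup>2) + of_real \<kappa> * z) / of_real p)) powr p =
        exp (((Re z)\<^sup>2 - (Im z - \<tau>)\<^sup>2) / (2 * \<Delta>\<^sup>2) + \<kappa> * Re z)"
      using p by (simp add: powr_def)
    also have "\<dots> = gw \<tau> \<Delta> (Im z) * exp ((Re z)\<^sup>2 / (2 * \<Delta>\<^sup>2) + \<kappa> * Re z)"
      by (simp add: gw_def diff_divide_distrib flip: exp_add)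
    finally show ?thesis by (simp add: \<Psi>_def norm_mult powr_mult)
  qed
  have ana\<Psi>: "\<Psi> \<kappa> analytic_on {z. a \<le> Re z \<and> Re z \<le> b}" for \<kappa>
    unfolding \<Psi>_def using \<Delta> p by (intro analytic_intros ana) auto
  define n where "n = nat \<lceil>real N * p\<rceil>"
  have K: "K \<ge> 0" using order_trans[OF norm_ge_zero growth[of "of_real a"]] ab by simp
  obtain C where C: "\<And>t. (1 + \<bar>t\<bar>) ^ n * gw \<tau> \<Delta> t \<le> C / (1 + t\<^sup>2)"
    using poly_gw_decay[of \<Delta> n \<tau>] \<Delta> by auto
  have bound: "norm (\<Psi> \<kappa> z) powr p \<le> (K powr p * C * exp (b\<^sup>2 / (2 * \<Delta>\<^sup>2) + \<kappa> * b)) / (1 + (Im z)\<^sup>2)"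
    if "a \<le> Re z" "Re z \<le> b" "\<kappa> \<ge> 0" for \<kappa> z
  proof -
    have "norm (\<Phi> z) powr p \<le> (K * (1 + \<bar>Im z\<bar>) ^ N) powr p"
      using growth[OF that(1,2)] p by (intro powr_mono2) auto
    also have "\<dots> = K powr p * (1 + \<bar>Im z\<bar>) powr (real N * p)"
      using K by (simp add: powr_mult powr_powr flip: powr_realpow)
    also have "(1 + \<bar>Im z\<bar>) powr (real N * p) \<le> (1 + \<bar>Im z\<bar>) powr (real n)"
      unfolding n_def by (intro powr_mono) linarith+
    also have "\<dots> = (1 + \<bar>Im z\<bar>) ^ n" by (simp add: powr_realpow)
    finally have 1: "norm (\<Phi> z) powr p \<le> K powr p * (1 + \<bar>Im z\<bar>) ^ n" by (simp add: mult_left_mono)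
    have "norm (\<Phi> z) powr p * gw \<tau> \<Delta> (Im z) \<le> K powr p * ((1 + \<bar>Im z\<bar>) ^ n * gw \<tau> \<Delta> (Im z))"
      using mult_right_mono[OF 1 less_imp_le[OF gw_pos[of \<tau> \<Delta> "Im z"]]] by (simp add: mult_ac)
    also have "\<dots> \<le> K powr p * (C / (1 + (Im z)\<^sup>2))" by (intro mult_left_mono C) simp
    finally have 2: "norm (\<Phi> z) powr p * gw \<tau> \<Delta> (Im z) \<le> K powr p * (C / (1 + (Im z)\<^sup>2))" .
    have "(Re z)\<^sup>2 \<le> b\<^sup>2" using that ab by (intro power_mono) auto
    then have "exp ((Re z)\<^sup>2 / (2 * \<Delta>\<^sup>2) + \<kappa> * Re z) \<le> exp (b\<^sup>2 / (2 * \<Delta>\<^sup>2) + \<kappa> * b)"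
      using that by (intro exp_le_cancel_iff[THEN iffD2] add_mono divide_right_mono mult_left_mono) auto
    with 2 have "norm (\<Psi> \<kappa> z) powr p \<le> K powr p * (C / (1 + (Im z)\<^sup>2)) * exp (b\<^sup>2 / (2 * \<Delta>\<^sup>2) + \<kappa> * b)"
      unfolding norm_\<Psi> using gw_pos[of \<tau> \<Delta> "Im z"]
      by (intro mult_mono order_trans[OF _ 2]) auto
    then show ?thesis by (simp add: mult_ac)
  qed
  define E where "E = (\<lambda>\<kappa> x. exp (x\<^sup>2 / (2 * \<Delta>\<^sup>2) + \<kappa> * x))"
  have E_pos: "E \<kappa> x > 0" for \<kappa> x by (simp add: E_def)
  have norm_\<Psi>': "norm (\<Psi> \<kappa> (Complex x t)) powr p = E \<kappa> x * (norm (\<Phi> (Complex x t)) powr p * gw \<tau> \<Delta> t)" for \<kappa> x t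
    unfolding norm_\<Psi> by (simp add: E_def mult_ac)
  have int: "integrable lborel (\<lambda>t. norm (\<Phi> (Complex x t)) powr p * gw \<tau> \<Delta> t)" if "x \<in> {a..b}" for x
  proof -
    have "integrable lborel (\<lambda>t. norm (\<Psi> 0 (Complex x t)) powr p)"
      by (rule strip_integrable[OF ana\<Psi> ab(2) p bound that]) auto
    then show ?thesis using E_pos[of 0 x] by (simp add: norm_\<Psi>')
  qed
  then show "x \<in> {a..b} \<Longrightarrow> integrable lborel (\<lambda>t. norm (\<Phi> (Complex x t)) powr p * gw \<tau> \<Delta> t)" .
  assume x: "x \<in> {a..b}" and \<kappa>: "\<kappa> \<ge> 0"
  have I0: "I y \<ge> 0" for y unfolding I_def
    by (intro integral_nonneg_AE always_eventually allI mult_nonneg_nonneg less_imp_le[OF gw_pos]) auto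
  have bk: "norm (\<Psi> \<kappa> z) powr p \<le> (K powr p * C * exp (b\<^sup>2 / (2 * \<Delta>\<^sup>2) + \<kappa> * b)) / (1 + (Im z)\<^sup>2)"
    if "a \<le> Re z" "Re z \<le> b" for z using bound that \<kappa> by blast
  have "E \<kappa> x * I x \<le> ((b - x) * (E \<kappa> a * I a) + (x - a) * (E \<kappa> b * I b)) / (b - a)"
    using hardy_convexity[OF ana\<Psi> ab(2) p bk x] by (simp add: norm_\<Psi>' I_def)
  also have "\<dots> = ((b - x) / (b - a)) * (E \<kappa> a * I a) + ((x - a) / (b - a)) * (E \<kappa> b * I b)"
    by (simp add: add_divide_distrib)
  also have "\<dots> \<le> 1 * (E \<kappa> a * I a) + 1 * (E \<kappa> b * I b)"
    using x ab I0 E_pos by (intro add_mono mult_right_mono mult_nonneg_nonneg less_imp_le[OF E_pos]) auto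
  finally have "I x \<le> E \<kappa> a / E \<kappa> x * I a + E \<kappa> b / E \<kappa> x * I b"
    using E_pos[of \<kappa> x] by (simp add: field_simps)
  also have "\<dots> \<le> exp (- \<kappa> * (x - a)) * I a + exp (\<kappa> * (b - x) + b\<^sup>2 / 2) * I b"
  proof (intro add_mono mult_right_mono I0)
    have "a\<^sup>2 \<le> x\<^sup>2" using x ab by (intro power_mono) auto
    then have "a\<^sup>2 / (2 * \<Delta>\<^sup>2) \<le> x\<^sup>2 / (2 * \<Delta>\<^sup>2)" by (intro divide_right_mono) auto
    then show "E \<kappa> a / E \<kappa> x \<le> exp (- \<kappa> * (x - a))"
      by (simp add: E_def algebra_simps flip: exp_diff)
    have "b\<^sup>2 / (2 * \<Delta>\<^sup>2) \<le> b\<^sup>2 / 2" using \<Delta> by (intro divide_left_mono) (auto simp: one_le_power)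
    moreover have "x\<^sup>2 / (2 * \<Delta>\<^sup>2) \<ge> 0" by simp
    ultimately have "b\<^sup>2 / (2 * \<Delta>\<^sup>2) - x\<^sup>2 / (2 * \<Delta>\<^sup>2) \<le> b\<^sup>2 / 2" by linarith
    then show "E \<kappa> b / E \<kappa> x \<le> exp (\<kappa> * (b - x) + b\<^sup>2 / 2)"
      by (simp add: E_def algebra_simps flip: exp_diff)
  qed
  finally show "I x \<le> exp (- \<kappa> * (x - a)) * I a + exp (\<kappa> * (b - x) + b\<^sup>2 / 2) * I b" .
qed

text \<open>The substitution \<open>t = \<tau> + \<Delta> * x\<close> reduces the integral to the
  characteristic function of the standard normal distribution.\<close>

lemma
  assumes "\<Delta> > 0"
  shows gw_fourier_integrable: "integrable lborel (\<lambda>t. of_real (gw \<tau> \<Delta> t) * iexp (\<omega> * t))"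
    and gw_fourier: "(CLINT t|lborel. of_real (gw \<tau> \<Delta> t) * iexp (\<omega> * t)) =
      of_real (sqrt (2 * pi) * \<Delta>) * iexp (\<omega> * \<tau>) * of_real (exp (- (\<omega> * \<Delta>)\<^sup>2 / 2))"
proof -
  let ?g = "\<lambda>x. std_normal_density x *\<^sub>R iexp (\<omega> * \<Delta> * x)"
  have ic: "integrable std_normal_distribution (\<lambda>x. iexp (\<omega> * \<Delta> * x))"
    by (rule finite_measure.integrable_const_bound[where B = 1])
       (auto intro!: prob_space.finite_measure prob_space_normal_density)
  have ig: "integrable lborel ?g"
    using ic by (subst (asm) integrable_density) (auto simp: normal_density_nonneg)
  have eq: "of_real (gw \<tau> \<Delta> (\<tau> + \<Delta> * x)) * iexp (\<omega> * (\<tau> + \<Delta> * x)) =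
      (of_real (sqrt (2 * pi)) * iexp (\<omega> * \<tau>)) * ?g x" for x
  proof -
    have "gw \<tau> \<Delta> (\<tau> + \<Delta> * x) = sqrt (2 * pi) * std_normal_density x"
      using assms by (simp add: gw_def std_normal_density_def power_mult_distrib)
    moreover have "iexp (\<omega> * (\<tau> + \<Delta> * x)) = iexp (\<omega> * \<tau>) * iexp (\<omega> * \<Delta> * x)"
      by (simp add: algebra_simps flip: exp_add)
    ultimately show ?thesis by (simp add: scaleR_conv_of_real)
  qed
  have "integrable lborel (\<lambda>x. of_real (gw \<tau> \<Delta> (\<tau> + \<Delta> * x)) * iexp (\<omega> * (\<tau> + \<Delta> * x)))"
    unfolding eq by (intro integrable_mult_right ig)
  then show "integrable lborel (\<lambda>t. of_real (gw \<tau> \<Delta> t) * iexp (\<omega> * t))"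
    using assms by (subst (asm) lborel_integrable_real_affine_iff) auto
  have "(CLINT t|lborel. of_real (gw \<tau> \<Delta> t) * iexp (\<omega> * t)) =
      \<bar>\<Delta>\<bar> *\<^sub>R (CLINT x|lborel. of_real (gw \<tau> \<Delta> (\<tau> + \<Delta> * x)) * iexp (\<omega> * (\<tau> + \<Delta> * x)))"
    using assms by (intro lborel_integral_real_affine) auto
  also have "(CLINT x|lborel. of_real (gw \<tau> \<Delta> (\<tau> + \<Delta> * x)) * iexp (\<omega> * (\<tau> + \<Delta> * x))) =
      (of_real (sqrt (2 * pi)) * iexp (\<omega> * \<tau>)) * (CLINT x|lborel. ?g x)"
    unfolding eq by (intro Bochner_Integration.integral_mult_right ig)
  also have "(CLINT x|lborel. ?g x) = char std_normal_distribution (\<omega> * \<Delta>)"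
    unfolding char_def by (subst integral_density) (auto simp: normal_density_nonneg)
  also have "\<dots> = of_real (exp (- (\<omega> * \<Delta>)\<^sup>2 / 2))" by (simp add: char_std_normal_distribution)
  finally show "(CLINT t|lborel. of_real (gw \<tau> \<Delta> t) * iexp (\<omega> * t)) =
      of_real (sqrt (2 * pi) * \<Delta>) * iexp (\<omega> * \<tau>) * of_real (exp (- (\<omega> * \<Delta>)\<^sup>2 / 2))"
    using assms by (simp add: scaleR_conv_of_real mult_ac)
qed

lemma
  assumes "\<Delta> > 0"
  shows gw_integrable: "integrable lborel (gw \<tau> \<Delta>)"
    and gw_integral: "(LINT t|lborel. gw \<tau> \<Delta> t) = sqrt (2 * pi) * \<Delta>"
proof -
  have i: "integrable lborel (\<lambda>t. complex_of_real (gw \<tau> \<Delta> t))"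
    using gw_fourier_integrable[OF assms, of \<tau> 0] by simp
  then have "integrable lborel (\<lambda>t. Re (complex_of_real (gw \<tau> \<Delta> t)))" by (rule integrable_Re)
  then show j: "integrable lborel (gw \<tau> \<Delta>)" by simp
  have "complex_of_real (LINT t|lborel. gw \<tau> \<Delta> t) = of_real (sqrt (2 * pi) * \<Delta>)"
    using gw_fourier[OF assms, of \<tau> 0] by (simp flip: integral_complex_of_real)
  then show "(LINT t|lborel. gw \<tau> \<Delta> t) = sqrt (2 * pi) * \<Delta>" by (simp only: of_real_eq_iff)
qed

lemma nat_powr_Complex:
  assumes "n > 0"
  shows "of_nat n powr (- Complex x t) = of_real (real n powr - x) * iexp (- ln (real n) * t)"
proof -
  have "of_nat n powr (- Complex x t) = exp (- Complex x t * of_real (ln (real n)))"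
    using assms Ln_of_nat[of n] by (simp add: powr_def)
  also have "- Complex x t * of_real (ln (real n)) = of_real (- x * ln (real n)) + \<i> * of_real (- ln (real n) * t)"
    by (simp add: complex_eq_iff)
  also have "exp \<dots> = of_real (exp (- x * ln (real n))) * iexp (- ln (real n) * t)"
    by (simp only: exp_add exp_of_real)
  finally show ?thesis using assms by (simp add: powr_def)
qed

lemma ln_diff_nat_ge:
  assumes "m \<in> {1..Z}" "n \<in> {1..Z}" "m \<noteq> n"
  shows "\<bar>ln (real m) - ln (real n)\<bar> \<ge> 1 / real Z"
proof -
  have *: "ln (real n) - ln (real m) \<ge> 1 / real Z" if "m \<in> {1..Z}" "n \<in> {1..Z}" "m < n" for m n :: nat
  proof -
    have "ln (real m / real n) \<le> real m / real n - 1" using that by (intro ln_le_minus_one) auto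
    also have "\<dots> = (real m - real n) / real n" using that by (simp add: field_simps)
    also have "\<dots> \<le> (- 1) / real n" using that by (intro divide_right_mono) auto
    also have "\<dots> \<le> - 1 / real Z" using that by (simp add: frac_le)
    finally show ?thesis using that by (simp add: ln_div)
  qed
  consider "m < n" | "n < m" using assms by linarith
  then show ?thesis using *[of m n] *[of n m] assms by cases linarith+
qed

text \<open>Different integers up to \<open>Z\<close> have logarithms at least \<open>1 / Z\<close>
  apart, so the Fourier transform of the Gaussian damps each off-diagonal term by
  \<open>exp (- (\<Delta> / Z)^2 / 2)\<close>, which is at most \<open>exp (- Z^2 / 2)\<close>. By
  the Cauchy-Schwarz inequality all these terms together stay below half of the diagonal. The index
  set with an injection \<open>\<nu>\<close> allows tuples of block integers to serve as
  frequencies.\<close>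

lemma
  fixes \<nu> :: "'g \<Rightarrow> nat" and c :: "'g \<Rightarrow> complex" and x \<tau> :: real
  assumes fin: "finite G" and inj: "inj_on \<nu> G" and range: "\<nu> ` G \<subseteq> {1..Z}" and \<Delta>: "(real Z)\<^sup>2 \<le> \<Delta>" "\<Delta> > 0"
  defines "I \<equiv> LINT t|lborel. (norm (\<Sum>g\<in>G. c g * of_nat (\<nu> g) powr (- Complex x t)))\<^sup>2 * gw \<tau> \<Delta> t"
    and "S \<equiv> sqrt (2 * pi) * \<Delta> * (\<Sum>g\<in>G. (norm (c g))\<^sup>2 * real (\<nu> g) powr (- 2 * x))"
  shows gauss_mean_value_upper: "I \<le> 3 / 2 * S"
    and gauss_mean_value_lower: "I \<ge> 1 / 2 * S"
    and gauss_mean_value_integrable: 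
      "integrable lborel (\<lambda>t. (norm (\<Sum>g\<in>G. c g * of_nat (\<nu> g) powr (- Complex x t)))\<^sup>2 * gw \<tau> \<Delta> t)"
proof -
  define d where "d = (\<lambda>g. c g * of_real (real (\<nu> g) powr - x))"
  define \<omega> where "\<omega> = (\<lambda>g h. ln (real (\<nu> h)) - ln (real (\<nu> g)))"
  define F where "F = (\<lambda>\<omega>. (CLINT t|lborel. of_real (gw \<tau> \<Delta> t) * iexp (\<omega> * t)))"
  have \<nu>: "\<nu> g \<ge> 1" "\<nu> g \<le> Z" if "g \<in> G" for g using range that by auto
  have trm: "c g * of_nat (\<nu> g) powr (- Complex x t) = d g * iexp (- ln (real (\<nu> g)) * t)" if "g \<in> G" for g t
    using \<nu>[OF that] by (simp add: nat_powr_Complex d_def mult_ac del: of_real_minus of_real_mult)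
  have sq: "complex_of_real ((norm (\<Sum>g\<in>G. c g * of_nat (\<nu> g) powr (- Complex x t)))\<^sup>2 * gw \<tau> \<Delta> t) =
      (\<Sum>g\<in>G. \<Sum>h\<in>G. d g * cnj (d h) * (of_real (gw \<tau> \<Delta> t) * iexp (\<omega> g h * t)))" for t
  proof -
    have "(\<Sum>g\<in>G. c g * of_nat (\<nu> g) powr (- Complex x t)) = (\<Sum>g\<in>G. d g * iexp (- ln (real (\<nu> g)) * t))"
      by (intro sum.cong refl trm)
    then have "complex_of_real ((norm (\<Sum>g\<in>G. c g * of_nat (\<nu> g) powr (- Complex x t)))\<^sup>2) =
       (\<Sum>g\<in>G. d g * iexp (- ln (real (\<nu> g)) * t)) * cnj (\<Sum>g\<in>G. d g * iexp (- ln (real (\<nu> g)) * t))"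
      by (simp only: complex_norm_square)
    also have "\<dots> = (\<Sum>g\<in>G. \<Sum>h\<in>G. d g * iexp (- ln (real (\<nu> g)) * t) * cnj (d h * iexp (- ln (real (\<nu> h)) * t)))"
      by (simp only: cnj_sum sum_product)
    also have "\<dots> = (\<Sum>g\<in>G. \<Sum>h\<in>G. d g * cnj (d h) * iexp (\<omega> g h * t))"
    proof (intro sum.cong refl)
      fix g h
      have "iexp (- ln (real (\<nu> g)) * t) * cnj (iexp (- ln (real (\<nu> h)) * t)) = iexp (\<omega> g h * t)"
        by (simp add: exp_cnj \<omega>_def algebra_simps flip: exp_add)
      then show "d g * iexp (- ln (real (\<nu> g)) * t) * cnj (d h * iexp (- ln (real (\<nu> h)) * t)) =
          d g * cnj (d h) * iexp (\<omega> g h * t)"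
        by (simp only: complex_cnj_mult mult_ac)
    qed
    finally show ?thesis by (simp add: sum_distrib_left mult_ac)
  qed
  have intg: "integrable lborel (\<lambda>t. d g * cnj (d h) * (of_real (gw \<tau> \<Delta> t) * iexp (\<omega> g h * t)))" for g h
    by (intro integrable_mult_right gw_fourier_integrable \<Delta>)
  have int_c: "integrable lborel (\<lambda>t. complex_of_real ((norm (\<Sum>g\<in>G. c g * of_nat (\<nu> g) powr (- Complex x t)))\<^sup>2 * gw \<tau> \<Delta> t))"
    unfolding sq by (intro Bochner_Integration.integrable_sum intg)
  then show int: "integrable lborel (\<lambda>t. (norm (\<Sum>g\<in>G. c g * of_nat (\<nu> g) powr (- Complex x t)))\<^sup>2 * gw \<tau> \<Delta> t)"
    by (simp only: complex_of_real_integrable_eq)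
  have "complex_of_real I = (CLINT t|lborel. complex_of_real ((norm (\<Sum>g\<in>G. c g * of_nat (\<nu> g) powr (- Complex x t)))\<^sup>2 * gw \<tau> \<Delta> t))"
    unfolding I_def by (simp only: integral_complex_of_real)
  also have "\<dots> = (\<Sum>g\<in>G. CLINT t|lborel. (\<Sum>h\<in>G. d g * cnj (d h) * (of_real (gw \<tau> \<Delta> t) * iexp (\<omega> g h * t))))"
    unfolding sq by (intro Bochner_Integration.integral_sum Bochner_Integration.integrable_sum intg)
  also have "\<dots> = (\<Sum>g\<in>G. \<Sum>h\<in>G. CLINT t|lborel. d g * cnj (d h) * (of_real (gw \<tau> \<Delta> t) * iexp (\<omega> g h * t)))"
    by (intro sum.cong refl Bochner_Integration.integral_sum intg)
  also have "\<dots> = (\<Sum>g\<in>G. \<Sum>h\<in>G. d g * cnj (d h) * F (\<omega> g h))"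
    unfolding F_def
    by (intro sum.cong refl Bochner_Integration.integral_mult_right gw_fourier_integrable \<Delta>)
  also have "\<dots> = (\<Sum>g\<in>G. d g * cnj (d g) * F 0 + (\<Sum>h\<in>G - {g}. d g * cnj (d h) * F (\<omega> g h)))"
    by (intro sum.cong refl) (subst sum.remove[OF fin], auto simp: \<omega>_def)
  also have "\<dots> = complex_of_real S + (\<Sum>g\<in>G. \<Sum>h\<in>G - {g}. d g * cnj (d h) * F (\<omega> g h))"
  proof -
    have "d g * cnj (d g) * F 0 = of_real (sqrt (2 * pi) * \<Delta> * ((norm (c g))\<^sup>2 * real (\<nu> g) powr (- 2 * x)))"
      if "g \<in> G" for g
    proof -
      have "(real (\<nu> g) powr - x)\<^sup>2 = real (\<nu> g) powr (- 2 * x)"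
        using \<nu>[OF that] by (simp add: powr_def flip: exp_double)
      then have "d g * cnj (d g) = of_real ((norm (c g))\<^sup>2 * real (\<nu> g) powr (- 2 * x))"
        by (simp add: complex_norm_square[symmetric] d_def norm_mult power_mult_distrib del: complex_cnj_mult)
      then show ?thesis using gw_fourier[OF \<Delta>(2), of \<tau> 0] by (simp add: F_def mult_ac)
    qed
    then show ?thesis by (simp add: sum.distrib S_def sum_distrib_left cong: sum.cong)
  qed
  finally have main: "complex_of_real (I - S) = (\<Sum>g\<in>G. \<Sum>h\<in>G - {g}. d g * cnj (d h) * F (\<omega> g h))"
    by simp
  define \<epsilon> where "\<epsilon> = sqrt (2 * pi) * \<Delta> * exp (- (\<Delta> / Z)\<^sup>2 / 2)"
  have Fb: "norm (F (\<omega> g h)) \<le> \<epsilon>" if "g \<in> G" "h \<in> G - {g}" for g h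
  proof -
    have "\<nu> g \<noteq> \<nu> h" using that inj by (auto dest: inj_onD)
    then have "1 / real Z \<le> \<bar>\<omega> g h\<bar>" unfolding \<omega>_def using \<nu> that by (intro ln_diff_nat_ge) auto
    then have "1 / real Z * \<Delta> \<le> \<bar>\<omega> g h\<bar> * \<Delta>" using \<Delta> by (intro mult_right_mono) auto
    then have "(\<Delta> / Z)\<^sup>2 \<le> (\<bar>\<omega> g h\<bar> * \<Delta>)\<^sup>2" using \<Delta> by (intro power_mono) auto
    then have "exp (- (\<omega> g h * \<Delta>)\<^sup>2 / 2) \<le> exp (- (\<Delta> / Z)\<^sup>2 / 2)" by (simp add: power_mult_distrib)
    moreover have "norm (F (\<omega> g h)) = sqrt (2 * pi) * \<Delta> * exp (- (\<omega> g h * \<Delta>)\<^sup>2 / 2)"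
      unfolding F_def gw_fourier[OF \<Delta>(2)] using \<Delta> by (simp add: norm_mult)
    ultimately show ?thesis unfolding \<epsilon>_def using \<Delta> by (simp add: mult_left_mono)
  qed
  have \<epsilon>0: "\<epsilon> \<ge> 0" using \<Delta> by (simp add: \<epsilon>_def)
  have nd: "(norm (d g))\<^sup>2 = (norm (c g))\<^sup>2 * real (\<nu> g) powr (- 2 * x)" if "g \<in> G" for g
    using \<nu>[OF that] by (simp add: d_def norm_mult power_mult_distrib powr_def flip: exp_double)
  have Ssum: "S = sqrt (2 * pi) * \<Delta> * (\<Sum>g\<in>G. (norm (d g))\<^sup>2)"
    unfolding S_def by (simp add: nd cong: sum.cong)
  have "\<bar>I - S\<bar> = norm (complex_of_real (I - S))" by (simp only: norm_of_real)
  also have "\<dots> \<le> 1 / 2 * S"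
  \<comment> \<open>For \<open>Z = 1\<close> the number \<open>exp (- Z^2 / 2) * Z\<close> exceeds
    1/2, but then there is no off-diagonal term at all.\<close>
  proof (cases "Z \<le> 1")
    case True
    have "h = g" if "g \<in> G" "h \<in> G" for g h
      using \<nu>[OF that(1)] \<nu>[OF that(2)] True that by (intro inj_onD[OF inj]) linarith+
    then have e: "G - {g} = {}" if "g \<in> G" for g using that by blast
    have "norm (complex_of_real (I - S)) = 0"
      unfolding main by (simp only: e sum.empty sum.neutral_const norm_zero cong: sum.cong)
    moreover have "S \<ge> 0" unfolding Ssum using \<Delta> by (intro mult_nonneg_nonneg sum_nonneg) auto
    ultimately show ?thesis by simp
  next
    case False
    have "norm (complex_of_real (I - S)) \<le> (\<Sum>g\<in>G. \<Sum>h\<in>G - {g}. norm (d g) * norm (d h) * \<epsilon>)"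
      unfolding main
      by (intro sum_norm_le) (auto simp: norm_mult intro!: mult_left_mono Fb)
    also have "\<dots> \<le> (\<Sum>g\<in>G. \<Sum>h\<in>G. norm (d g) * norm (d h) * \<epsilon>)"
      using fin \<epsilon>0 by (intro sum_mono sum_mono2) auto
    also have "\<dots> = \<epsilon> * (\<Sum>g\<in>G. norm (d g))\<^sup>2"
      by (simp add: power2_eq_square sum_product sum_distrib_left mult_ac)
    also have "\<dots> \<le> \<epsilon> * (real Z * (\<Sum>g\<in>G. (norm (d g))\<^sup>2))"
    proof (rule mult_left_mono[OF _ \<epsilon>0])
      have "(\<Sum>g\<in>G. norm (d g))\<^sup>2 \<le> real (card G) * (\<Sum>g\<in>G. (norm (d g))\<^sup>2)"
        using sum_squared_le_sum_of_squares[of "\<lambda>g. norm (d g)" G] fin by (cases "G = {}") (auto simp: mult.commute)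
      moreover have "card G \<le> Z" using card_inj_on_le[OF inj range] by simp
      ultimately show "(\<Sum>g\<in>G. norm (d g))\<^sup>2 \<le> real Z * (\<Sum>g\<in>G. (norm (d g))\<^sup>2)"
        by (elim order_trans) (intro mult_right_mono sum_nonneg, auto)
    qed
    also have "\<dots> \<le> 1 / 2 * S"
    proof -
      have Z2: "real Z \<ge> 2" using False by linarith
      have "real Z \<le> \<Delta> / real Z" using \<Delta> Z2 by (simp add: field_simps power2_eq_square)
      then have "(real Z)\<^sup>2 \<le> (\<Delta> / real Z)\<^sup>2" by (intro power_mono) auto
      then have "exp (- (\<Delta> / real Z)\<^sup>2 / 2) \<le> exp (- (real Z)\<^sup>2 / 2)" by simp
      also have "\<dots> \<le> exp (- real Z)" using Z2 by (simp add: power2_eq_square)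
      finally have "exp (- (\<Delta> / real Z)\<^sup>2 / 2) * real Z \<le> exp (- real Z) * real Z" using Z2 by simp
      also have "\<dots> \<le> 1 / 2"
      proof -
        have "2 * real Z \<le> exp (real Z)"
          using exp_lower_Taylor_quadratic[OF of_nat_0_le_iff[of Z]] mult_right_mono[OF Z2, of "real Z"] Z2
          unfolding power2_eq_square by linarith
        then show ?thesis by (simp add: exp_minus field_simps)
      qed
      finally have "exp (- (\<Delta> / real Z)\<^sup>2 / 2) * real Z \<le> 1 / 2" .
      then have "(sqrt (2 * pi) * \<Delta> * (\<Sum>g\<in>G. (norm (d g))\<^sup>2)) * (exp (- (\<Delta> / real Z)\<^sup>2 / 2) * real Z) \<le>
          (sqrt (2 * pi) * \<Delta> * (\<Sum>g\<in>G. (norm (d g))\<^sup>2)) * (1 / 2)"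
        using \<Delta> by (intro mult_left_mono mult_nonneg_nonneg sum_nonneg) auto
      then show ?thesis unfolding Ssum \<epsilon>_def by (simp add: mult_ac)
    qed
    finally show ?thesis .
  qed
  finally show "I \<le> 3 / 2 * S" "I \<ge> 1 / 2 * S" by linarith+
qed

subsection \<open>Integers composed of blocks of primes\<close>

definition Omega :: "nat \<Rightarrow> nat" where "Omega n = size (prime_factorization n)"

definition bpart :: "nat set \<Rightarrow> nat \<Rightarrow> nat" where
  "bpart B n = prod_mset (filter_mset (\<lambda>p. p \<in> B) (prime_factorization n))"

text \<open>These are the Dirichlet coefficients of \<open>exp (\<Sum>p. x p * p powr - s)\<close>.\<close>

definition hcoef :: "(nat \<Rightarrow> 'a::field_char_0) \<Rightarrow> nat \<Rightarrow> 'a" where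
  "hcoef x n = (\<Prod>p\<in>prime_factors n. x p ^ multiplicity p n / fact (multiplicity p n))"

definition smooth :: "nat set \<Rightarrow> nat \<Rightarrow> nat set" where
  "smooth B r = {n. n > 0 \<and> prime_factors n \<subseteq> B \<and> Omega n = r}"

lemma Omega_mult: "m > 0 \<Longrightarrow> n > 0 \<Longrightarrow> Omega (m * n) = Omega m + Omega n"
  by (simp add: Omega_def prime_factorization_mult)

lemma Omega_prime_power: "prime p \<Longrightarrow> Omega (p ^ e) = e"
  by (simp add: Omega_def prime_factorization_prime_power)

lemma Omega_1 [simp]: "Omega (Suc 0) = 0"
  by (simp add: Omega_def)

lemma bpart_pos [simp]: "bpart B n > 0"
proof -
  have "0 \<notin># filter_mset (\<lambda>p. p \<in> B) (prime_factorization n)"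
    by (auto dest: in_prime_factors_imp_prime)
  then show ?thesis unfolding bpart_def by (simp add: prod_mset_zero_iff del: neq0_conv flip: neq0_conv)
qed

lemma prime_factorization_bpart:
  "prime_factorization (bpart B n) = filter_mset (\<lambda>p. p \<in> B) (prime_factorization n)"
  unfolding bpart_def
  by (rule prime_factorization_prod_mset_primes) (auto dest: in_prime_factors_imp_prime)

lemma nat_eq_prime_factorization:
  fixes m n :: nat
  assumes "m > 0" "n > 0" "prime_factorization m = prime_factorization n"
  shows "m = n"
proof -
  have "m = prod_mset (prime_factorization m)"
    using assms(1) by (rule prod_mset_prime_factorization_nat[symmetric])
  also have "\<dots> = prod_mset (prime_factorization n)" by (simp only: assms(3))
  also have "\<dots> = n" using assms(2) by (rule prod_mset_prime_factorization_nat)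
  finally show ?thesis .
qed

lemma prime_factors_bpart: "prime_factors (bpart B n) = prime_factors n \<inter> B"
  by (auto simp: prime_factorization_bpart)

lemma bpart_mult: "m > 0 \<Longrightarrow> n > 0 \<Longrightarrow> bpart B (m * n) = bpart B m * bpart B n"
  unfolding bpart_def by (subst prime_factorization_mult) simp_all

lemma bpart_id: "n > 0 \<Longrightarrow> prime_factors n \<subseteq> B \<Longrightarrow> bpart B n = n"
  by (intro nat_eq_prime_factorization) (auto simp: prime_factorization_bpart filter_mset_eq_conv)

lemma bpart_eq_1:
  assumes "prime_factors n \<inter> B = {}"
  shows "bpart B n = 1"
proof -
  have "filter_mset (\<lambda>p. p \<in> B) (prime_factorization n) = {#}"
    using assms by (intro set_mset_eq_empty_iff[THEN iffD1]) auto
  then show ?thesis unfolding bpart_def by (simp only: prod_mset_empty)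
qed

lemma bpart_prime: "prime p \<Longrightarrow> bpart {p} n = p ^ multiplicity p n"
proof (intro nat_eq_prime_factorization)
  assume p: "prime p"
  have "filter_mset (\<lambda>q. q = p) (prime_factorization n) = replicate_mset (multiplicity p n) p"
    using p by (simp add: filter_eq_replicate_mset count_prime_factorization)
  then show "prime_factorization (bpart {p} n) = prime_factorization (p ^ multiplicity p n)"
    using p by (simp add: prime_factorization_bpart prime_factorization_prime_power)
qed (auto simp: prime_gt_0_nat)

lemma bpart_le: "n > 0 \<Longrightarrow> bpart B n \<le> n"
proof -
  assume n: "n > 0"
  have "prime_factorization (bpart B n) \<subseteq># prime_factorization n"
    by (simp add: prime_factorization_bpart)
  then have "bpart B n dvd n" using n by (subst (asm) prime_factorization_subset_iff_dvd) auto
  then show ?thesis using n by (rule dvd_imp_le)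
qed

lemma prod_bpart:
  assumes "finite I" "disjoint_family_on B I" "n > 0" "prime_factors n \<subseteq> (\<Union>i\<in>I. B i)"
  shows "(\<Prod>i\<in>I. bpart (B i) n) = n"
proof -
  have "(\<Prod>i\<in>J. bpart (B i) n) = bpart (\<Union>i\<in>J. B i) n" if "J \<subseteq> I" for J
    using finite_subset[OF that assms(1)] that
  proof (induction J rule: finite_induct)
    case empty
    then show ?case by (simp add: bpart_def)
  next
    case (insert j J)
    have "B j \<inter> (\<Union>i\<in>J. B i) = {}"
      using assms(2) insert by (fastforce simp: disjoint_family_on_def)
    then have "filter_mset (\<lambda>p. p \<in> B j \<union> (\<Union>i\<in>J. B i)) M =
       filter_mset (\<lambda>p. p \<in> B j) M + filter_mset (\<lambda>p. p \<in> (\<Union>i\<in>J. B i)) M" for M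
      by (intro multiset_eqI) auto
    then have "bpart (B j \<union> (\<Union>i\<in>J. B i)) n = bpart (B j) n * bpart (\<Union>i\<in>J. B i) n"
      by (simp add: bpart_def)
    then show ?case using insert by simp
  qed
  from this[of I] show ?thesis using bpart_id[OF assms(3,4)] by simp
qed

lemma bpart_prod:
  assumes "finite I" "disjoint_family_on B I" "\<And>i. i \<in> I \<Longrightarrow> g i > 0"
    "\<And>i. i \<in> I \<Longrightarrow> prime_factors (g i) \<subseteq> B i" "j \<in> I"
  shows "bpart (B j) (\<Prod>i\<in>I. g i) = g j"
proof -
  have "bpart (B j) (\<Prod>i\<in>J. g i) = (\<Prod>i\<in>J. bpart (B j) (g i))" if "J \<subseteq> I" for J
    using finite_subset[OF that assms(1)] that
  proof (induction J rule: finite_induct)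
    case (insert i J)
    have "(\<Prod>i\<in>J. g i) > 0" "g i > 0" using insert assms(3) by (auto intro!: prod_pos)
    then show ?case using insert by (simp add: bpart_mult)
  qed (simp add: bpart_def)
  also have "(\<Prod>i\<in>I. bpart (B j) (g i)) = (\<Prod>i\<in>I. if i = j then g j else 1)"
  proof (intro prod.cong refl)
    fix i assume i: "i \<in> I"
    show "bpart (B j) (g i) = (if i = j then g j else 1)"
    proof (cases "i = j")
      case False
      have "B i \<inter> B j = {}" using assms(2) i assms(5) False by (auto simp: disjoint_family_on_def)
      then have "prime_factors (g i) \<inter> B j = {}" using assms(4)[OF i] by blast
      then show ?thesis using bpart_eq_1 False by simp
    qed (use assms bpart_id in auto)
  qed
  also have "\<dots> = g j" using assms by simp
  finally show ?thesis by simp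
qed

text \<open>A sum of a product over blocks of primes is dominated by the product of the sums, the
  bound that replaces Euler products for quantities that are only multiplicative between blocks.\<close>

lemma sum_prod_bpart_le:
  fixes \<phi> :: "'i \<Rightarrow> nat \<Rightarrow> real"
  assumes "finite I" "disjoint_family_on B I" "finite S" "\<And>n. n \<in> S \<Longrightarrow> n > 0"
    "\<And>n. n \<in> S \<Longrightarrow> prime_factors n \<subseteq> (\<Union>i\<in>I. B i)" "\<And>i x. i \<in> I \<Longrightarrow> \<phi> i x \<ge> 0"
  shows "(\<Sum>n\<in>S. \<Prod>i\<in>I. \<phi> i (bpart (B i) n)) \<le> (\<Prod>i\<in>I. \<Sum>x\<in>bpart (B i) ` S. \<phi> i x)"
proof -
  define \<rho> where "\<rho> = (\<lambda>n. restrict (\<lambda>i. bpart (B i) n) I)"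
  have inj: "inj_on \<rho> S"
  proof (rule inj_onI)
    fix m n assume mn: "m \<in> S" "n \<in> S" "\<rho> m = \<rho> n"
    have "bpart (B i) m = bpart (B i) n" if "i \<in> I" for i
      using fun_cong[OF mn(3), of i] that by (simp add: \<rho>_def)
    then have "(\<Prod>i\<in>I. bpart (B i) m) = (\<Prod>i\<in>I. bpart (B i) n)" by (intro prod.cong) auto
    then show "m = n" using prod_bpart[OF assms(1,2)] assms(4,5) mn by metis
  qed
  have "(\<Sum>n\<in>S. \<Prod>i\<in>I. \<phi> i (bpart (B i) n)) = (\<Sum>n\<in>S. \<Prod>i\<in>I. \<phi> i (\<rho> n i))"
    by (intro sum.cong prod.cong) (auto simp: \<rho>_def)
  also have "\<dots> = (\<Sum>g\<in>\<rho> ` S. \<Prod>i\<in>I. \<phi> i (g i))"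
    by (subst sum.reindex[OF inj]) simp
  also have "\<dots> \<le> (\<Sum>g\<in>PiE I (\<lambda>i. bpart (B i) ` S). \<Prod>i\<in>I. \<phi> i (g i))"
    using assms by (intro sum_mono2 finite_PiE) (auto simp: \<rho>_def intro!: prod_nonneg)
  also have "\<dots> = (\<Prod>i\<in>I. \<Sum>x\<in>bpart (B i) ` S. \<phi> i x)"
    using assms by (intro prod_sum_PiE[symmetric]) auto
  finally show ?thesis .
qed

lemma hcoef_mult_coprime:
  assumes "coprime m n" "m > 0" "n > 0"
  shows "hcoef x (m * n) = hcoef x m * hcoef x n"
proof -
  have disj: "prime_factors m \<inter> prime_factors n = {}"
  proof -
    have False if "p \<in> prime_factors m" "p \<in> prime_factors n" for p
    proof -
      have "is_unit p" using that by (intro coprime_common_divisor[OF assms(1)]) auto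
      then show False using that(1) by (meson in_prime_factors_imp_prime not_prime_unit)
    qed
    then show ?thesis by blast
  qed
  have "hcoef x (m * n) = (\<Prod>p\<in>prime_factors m \<union> prime_factors n.
      x p ^ multiplicity p (m * n) / fact (multiplicity p (m * n)))"
    using assms by (simp add: hcoef_def prime_factorization_mult)
  also have "\<dots> = (\<Prod>p\<in>prime_factors m. x p ^ multiplicity p (m * n) / fact (multiplicity p (m * n))) *
      (\<Prod>p\<in>prime_factors n. x p ^ multiplicity p (m * n) / fact (multiplicity p (m * n)))"
    using disj by (intro prod.union_disjoint) auto
  also have "(\<Prod>p\<in>prime_factors m. x p ^ multiplicity p (m * n) / fact (multiplicity p (m * n))) = hcoef x m"
    unfolding hcoef_def
  proof (intro prod.cong refl)
    fix p assume p: "p \<in> prime_factors m"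
    then have "\<not> p dvd n" using disj assms by (auto simp: prime_factors_dvd)
    then have "multiplicity p n = 0" by (rule not_dvd_imp_multiplicity_0)
    then have "multiplicity p (m * n) = multiplicity p m"
      using p assms by (subst prime_elem_multiplicity_mult_distrib) (auto intro!: prime_imp_prime_elem)
    then show "x p ^ multiplicity p (m * n) / fact (multiplicity p (m * n)) =
       x p ^ multiplicity p m / fact (multiplicity p m)" by simp
  qed
  also have "(\<Prod>p\<in>prime_factors n. x p ^ multiplicity p (m * n) / fact (multiplicity p (m * n))) = hcoef x n"
    unfolding hcoef_def
  proof (intro prod.cong refl)
    fix p assume p: "p \<in> prime_factors n"
    then have "\<not> p dvd m" using disj assms by (auto simp: prime_factors_dvd)
    then have "multiplicity p m = 0" by (rule not_dvd_imp_multiplicity_0)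
    then have "multiplicity p (m * n) = multiplicity p n"
      using p assms by (subst prime_elem_multiplicity_mult_distrib) (auto intro!: prime_imp_prime_elem)
    then show "x p ^ multiplicity p (m * n) / fact (multiplicity p (m * n)) =
       x p ^ multiplicity p n / fact (multiplicity p n)" by simp
  qed
  finally show ?thesis .
qed

lemma hcoef_prime_power: "prime p \<Longrightarrow> hcoef x (p ^ e) = x p ^ e / fact e"
  by (cases "e = 0") (auto simp: hcoef_def prime_factorization_prime_power)

lemma smooth_insert:
  assumes "prime p" "p \<notin> B"
  shows "smooth (insert p B) r = (\<Union>e\<le>r. (\<lambda>n. p ^ e * n) ` smooth B (r - e))"
proof (intro equalityI subsetI)
  fix n assume n: "n \<in> smooth (insert p B) r"
  then have n0: "n > 0" "Omega n = r" "prime_factors n \<subseteq> insert p B" by (auto simp: smooth_def)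
  obtain m where m: "n = p ^ multiplicity p n * m" "\<not> p dvd m"
    using multiplicity_decompose'[of n p] n0 assms
    by (metis mult.commute not_prime_unit less_numeral_extra(3))
  have m0: "m > 0" by (metis m(1) mult_0_right n0(1) not_gr_zero)
  have sub: "prime_factors m \<subseteq> prime_factors n" by (metis m(1) dvd_prime_factors dvd_triv_right n0(1) less_numeral_extra(3))
  have "Omega n = multiplicity p n + Omega m"
    using m m0 assms by (metis Omega_mult Omega_prime_power prime_gt_0_nat zero_less_power)
  moreover have "prime_factors m \<subseteq> B" using sub n0 m(2) by (auto simp: prime_factors_dvd)
  ultimately show "n \<in> (\<Union>e\<le>r. (\<lambda>n. p ^ e * n) ` smooth B (r - e))"
    using m n0 m0 by (intro UN_I[of "multiplicity p n"]) (auto simp: smooth_def intro!: image_eqI[of _ _ m])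
next
  fix n assume "n \<in> (\<Union>e\<le>r. (\<lambda>n. p ^ e * n) ` smooth B (r - e))"
  then obtain e m where "e \<le> r" "m \<in> smooth B (r - e)" "n = p ^ e * m" by auto
  then show "n \<in> smooth (insert p B) r"
    using assms by (auto simp: smooth_def Omega_mult Omega_prime_power prime_factorization_mult
        prime_factorization_prime_power prime_gt_0_nat split: if_splits)
qed

text \<open>This is the multinomial theorem in arithmetic form. A new prime \<open>p\<close> is
  split off by its exponent \<open>e\<close>, and the binomial theorem collects the result.\<close>

lemma
  assumes "finite B" "\<And>p. p \<in> B \<Longrightarrow> prime p"
  shows finite_smooth: "finite (smooth B r)"
    and sum_hcoef_smooth: "(\<Sum>n\<in>smooth B r. hcoef x n) = (\<Sum>p\<in>B. x p) ^ r / fact r"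
proof -
  have "finite (smooth B r) \<and> (\<Sum>n\<in>smooth B r. hcoef x n) = (\<Sum>p\<in>B. x p) ^ r / fact r"
    using assms
proof (induction B arbitrary: r rule: finite_induct)
  case empty
  have "smooth {} r = (if r = 0 then {1} else {})"
    by (auto simp: smooth_def Omega_def prime_factorization_empty_iff)
  then show ?case by (auto simp: hcoef_def)
next
  case (insert p B)
  have p: "prime p" using insert by auto
  have fin: "finite (smooth B r)" and IH: "(\<Sum>n\<in>smooth B r. hcoef x n) = (\<Sum>p\<in>B. x p) ^ r / fact r" for r
    using insert by auto
  have fin': "finite (smooth (insert p B) r)" using fin smooth_insert[OF p insert(2)] by auto
  have ndvd: "\<not> p dvd n" if "n \<in> smooth B e" for n e
    using that insert(2) p by (auto simp: smooth_def prime_factors_dvd subset_iff)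
  have mult_e: "multiplicity p (p ^ e * n) = e" if "n \<in> smooth B e'" for n e e'
  proof -
    have "n > 0" using that by (simp add: smooth_def)
    then have "multiplicity p (p ^ e * n) = multiplicity p (p ^ e) + multiplicity p n"
      using p by (intro prime_elem_multiplicity_mult_distrib) (auto simp: prime_gt_0_nat)
    then show ?thesis using not_dvd_imp_multiplicity_0[OF ndvd[OF that]] p by simp
  qed
  have "(\<Sum>n\<in>smooth (insert p B) r. hcoef x n) = (\<Sum>e\<le>r. \<Sum>n\<in>(\<lambda>n. p ^ e * n) ` smooth B (r - e). hcoef x n)"
    unfolding smooth_insert[OF p insert(2)]
  proof (intro sum.UNION_disjoint ballI impI)
    fix e e' :: nat assume "e \<noteq> e'"
    then show "(\<lambda>n. p ^ e * n) ` smooth B (r - e) \<inter> (\<lambda>n. p ^ e' * n) ` smooth B (r - e') = {}"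
      using mult_e by (metis (no_types, lifting) disjoint_iff imageE)
  qed (use fin in auto)
  also have "\<dots> = (\<Sum>e\<le>r. \<Sum>n\<in>smooth B (r - e). hcoef x (p ^ e * n))"
    using p by (intro sum.cong refl sum.reindex[unfolded comp_def]) (auto simp: inj_on_def)
  also have "\<dots> = (\<Sum>e\<le>r. \<Sum>n\<in>smooth B (r - e). x p ^ e / fact e * hcoef x n)"
  proof (intro sum.cong refl)
    fix e n :: nat assume n: "n \<in> smooth B (r - e)"
    have "coprime (p ^ e) n" using ndvd[OF n] p by (simp add: prime_imp_coprime)
    then show "hcoef x (p ^ e * n) = x p ^ e / fact e * hcoef x n"
      using n p by (subst hcoef_mult_coprime) (auto simp: hcoef_prime_power smooth_def prime_gt_0_nat)
  qed
  also have "\<dots> = (\<Sum>e\<le>r. (x p ^ e / fact e) * ((\<Sum>p\<in>B. x p) ^ (r - e) / fact (r - e)))"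
    by (simp only: IH sum_distrib_left[symmetric])
  also have "\<dots> = (\<Sum>e\<le>r. of_nat (r choose e) * x p ^ e * (\<Sum>p\<in>B. x p) ^ (r - e)) / fact r"
    unfolding sum_divide_distrib by (intro sum.cong refl) (simp add: binomial_fact)
  also have "\<dots> = (x p + (\<Sum>p\<in>B. x p)) ^ r / fact r" by (simp only: binomial_ring)
  finally show ?case using insert fin' by simp
qed
  then show "finite (smooth B r)" "(\<Sum>n\<in>smooth B r. hcoef x n) = (\<Sum>p\<in>B. x p) ^ r / fact r" by auto
qed

lemma of_nat_mult_powr: "m > 0 \<Longrightarrow> n > 0 \<Longrightarrow> (of_nat (m * n) :: complex) powr s = of_nat m powr s * of_nat n powr s"
  by (simp add: powr_times_real)

lemma of_nat_prod_powr:
  assumes "finite I" "\<And>i. i \<in> I \<Longrightarrow> g i > 0"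
  shows "(of_nat (\<Prod>i\<in>I. g i) :: complex) powr s = (\<Prod>i\<in>I. of_nat (g i) powr s)"
  using assms
proof (induction I rule: finite_induct)
  case (insert i I)
  then have "(\<Prod>i\<in>I. g i) > 0" by (auto intro!: prod_pos)
  then show ?case using insert of_nat_mult_powr[of "g i" "\<Prod>i\<in>I. g i"] by simp
qed simp

lemma of_nat_power_powr: "n > 0 \<Longrightarrow> (of_nat (n ^ e) :: complex) powr s = (of_nat n powr s) ^ e"
  using of_nat_prod_powr[of "{..<e}" "\<lambda>_. n" s] by simp

lemma nat_prime_decomp: "n > 0 \<Longrightarrow> n = (\<Prod>p\<in>prime_factors n. p ^ multiplicity p n)" for n :: nat
  by (rule prime_factorization_nat)

lemma hcoef_powr:
  assumes "n > 0"
  shows "hcoef (\<lambda>p. f p * of_nat p powr s) n = hcoef f n * of_nat n powr (s::complex)"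
proof -
  have "(of_nat n :: complex) powr s = of_nat (\<Prod>p\<in>prime_factors n. p ^ multiplicity p n) powr s"
    using nat_prime_decomp[OF assms] by simp
  also have "\<dots> = (\<Prod>p\<in>prime_factors n. (of_nat p powr s) ^ multiplicity p n)"
  proof (subst of_nat_prod_powr)
    show "(\<Prod>p\<in>prime_factors n. of_nat (p ^ multiplicity p n) powr s) =
        (\<Prod>p\<in>prime_factors n. (of_nat p powr s) ^ multiplicity p n)"
      by (intro prod.cong refl of_nat_power_powr) (auto dest: in_prime_factors_imp_prime prime_gt_0_nat)
  qed (auto dest: in_prime_factors_imp_prime prime_gt_0_nat)
  finally show ?thesis
    unfolding hcoef_def by (simp add: power_mult_distrib flip: prod.distrib)
qed

text \<open>Squaring puts \<open>(fact e)^2\<close> into each denominator; only one of the two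
  factorials is kept, so that the right-hand side is again of the form \<open>hcoef\<close> and can
  be summed in closed form.\<close>

lemma norm_hcoef_sq_le:
  fixes f :: "nat \<Rightarrow> complex"
  shows "(norm (hcoef f n))\<^sup>2 \<le> hcoef (\<lambda>p. (norm (f p))\<^sup>2) n"
proof -
  have "(norm (hcoef f n))\<^sup>2 = (\<Prod>p\<in>prime_factors n.
      (norm (f p ^ multiplicity p n / fact (multiplicity p n)))\<^sup>2)"
    unfolding hcoef_def prod_norm[symmetric] by (rule prod_power_distrib)
  also have "\<dots> \<le> hcoef (\<lambda>p. (norm (f p))\<^sup>2) n"
    unfolding hcoef_def
  proof (intro prod_mono conjI)
    fix p
    define e where "e = multiplicity p n"
    have "(norm (f p ^ e / fact e))\<^sup>2 = ((norm (f p))\<^sup>2) ^ e / (fact e)\<^sup>2"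
      by (simp add: norm_divide norm_power power_divide power_commutes flip: power_mult)
         (simp add: mult.commute)
    also have "\<dots> \<le> ((norm (f p))\<^sup>2) ^ e / fact e"
      by (intro divide_left_mono) (auto simp: power2_eq_square)
    finally show "(norm (f p ^ multiplicity p n / fact (multiplicity p n)))\<^sup>2 \<le>
        ((norm (f p))\<^sup>2) ^ multiplicity p n / fact (multiplicity p n)" by (simp add: e_def)
  qed auto
  finally show ?thesis .
qed

lemma hcoef_powr_real:
  assumes "n > 0"
  shows "hcoef (\<lambda>p. f p * real p powr s) n = hcoef f n * real n powr s"
proof -
  have "real n powr s = real (\<Prod>p\<in>prime_factors n. p ^ multiplicity p n) powr s"
    using nat_prime_decomp[OF assms] by simp
  also have "\<dots> = (\<Prod>p\<in>prime_factors n. (real p ^ multiplicity p n) powr s)"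
    by (simp add: prod_powr_distrib)
  also have "\<dots> = (\<Prod>p\<in>prime_factors n. (real p powr s) ^ multiplicity p n)"
  proof (intro prod.cong refl)
    fix p assume "p \<in> prime_factors n"
    then have "real p > 0" by (auto dest: in_prime_factors_imp_prime prime_gt_0_nat)
    then show "(real p ^ multiplicity p n) powr s = (real p powr s) ^ multiplicity p n"
      by (simp add: powr_def ln_realpow mult_ac flip: exp_of_nat_mult)
  qed
  finally show ?thesis
    unfolding hcoef_def by (simp add: power_mult_distrib flip: prod.distrib)
qed

lemma ln_smooth_le:
  assumes "n \<in> smooth B r" "\<And>p. p \<in> B \<Longrightarrow> ln (real p) \<le> y" 
  shows "ln (real n) \<le> y * real r"
proof -
  have n: "n > 0" "prime_factors n \<subseteq> B" "Omega n = r" using assms(1) by (auto simp: smooth_def)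
  have "ln (real (prod_mset M)) \<le> y * real (size M)" if "\<And>p. p \<in># M \<Longrightarrow> p > 0 \<and> ln (real p) \<le> y" for M
    using that
  proof (induction M)
    case (add p M)
    then have "0 \<notin># M" by force
    then have "prod_mset M > 0" by (simp add: prod_mset_zero_iff del: neq0_conv flip: neq0_conv)
    moreover have "ln (real (prod_mset M)) \<le> y * real (size M)" using add by auto
    moreover have "ln (real (prod_mset (add_mset p M))) = ln (real p) + ln (real (prod_mset M))"
    proof -
      have "real p > 0" "real (prod_mset M) > 0"
        using add.prems[of p] \<open>prod_mset M > 0\<close> unfolding of_nat_0_less_iff by auto
      then show ?thesis unfolding prod_mset.add_mset of_nat_mult by (rule ln_mult_pos)
    qed
    moreover have "ln (real p) \<le> y" using add.prems[of p] by simp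
    ultimately show ?case by (simp add: distrib_left)
  qed simp
  from this[of "prime_factorization n"] show ?thesis
    using n assms(2) by (auto simp: Omega_def prod_mset_prime_factorization prime_gt_0_nat
        in_prime_factors_imp_prime subset_iff)
qed

definition block_nums :: "nat set \<Rightarrow> nat \<Rightarrow> nat set" where
  "block_nums B l = (\<Union>r\<le>l. smooth B r)"

lemma block_nums_altdef: "block_nums B l = {n. n > 0 \<and> prime_factors n \<subseteq> B \<and> Omega n \<le> l}"
  by (auto simp: block_nums_def smooth_def)

lemma finite_block_nums: "finite B \<Longrightarrow> (\<And>p. p \<in> B \<Longrightarrow> prime p) \<Longrightarrow> finite (block_nums B l)"
  by (auto simp: block_nums_def finite_smooth)

lemma sum_block_nums:
  assumes "finite B" "\<And>p. p \<in> B \<Longrightarrow> prime p"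
  shows "(\<Sum>n\<in>block_nums B l. h n) = (\<Sum>r\<le>l. \<Sum>n\<in>smooth B r. h n)"
  unfolding block_nums_def
  by (intro sum.UNION_disjoint ballI finite_smooth assms) (auto simp: smooth_def)

lemma block_sum_expand:
  assumes "finite B" "\<And>p. p \<in> B \<Longrightarrow> prime p"
  shows "(\<Sum>r\<le>l. \<phi> r * (\<Sum>p\<in>B. x p) ^ r / fact r) = (\<Sum>n\<in>block_nums B l. \<phi> (Omega n) * hcoef x n)"
proof -
  have "(\<Sum>r\<le>l. \<phi> r * (\<Sum>p\<in>B. x p) ^ r / fact r) = (\<Sum>r\<le>l. \<phi> r * (\<Sum>n\<in>smooth B r. hcoef x n))"
    by (simp add: sum_hcoef_smooth[OF assms])
  also have "\<dots> = (\<Sum>r\<le>l. \<Sum>n\<in>smooth B r. \<phi> (Omega n) * hcoef x n)"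
    by (intro sum.cong refl) (auto simp: sum_distrib_left smooth_def intro!: sum.cong)
  finally show ?thesis by (simp add: sum_block_nums[OF assms])
qed

text \<open>The free coefficients \<open>\<phi>\<close> let one formula serve both the truncated
  exponentials (\<open>\<phi>\<close> constant) and single high powers (\<open>\<phi>\<close>
  supported on one degree).\<close>

lemma block_poly_expand:
  fixes f :: "nat \<Rightarrow> complex"
  assumes I: "finite I" "\<And>i. i \<in> I \<Longrightarrow> finite (B i)" "\<And>i p. i \<in> I \<Longrightarrow> p \<in> B i \<Longrightarrow> prime p"
  shows "(\<Prod>i\<in>I. \<Sum>r\<le>l i. \<phi> i r * (\<Sum>p\<in>B i. f p * of_nat p powr s) ^ r / fact r) =
    (\<Sum>g\<in>PiE I (\<lambda>i. block_nums (B i) (l i)).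
      (\<Prod>i\<in>I. \<phi> i (Omega (g i)) * hcoef f (g i)) * of_nat (\<Prod>i\<in>I. g i) powr s)"
proof -
  have "(\<Prod>i\<in>I. \<Sum>r\<le>l i. \<phi> i r * (\<Sum>p\<in>B i. f p * of_nat p powr s) ^ r / fact r) =
      (\<Prod>i\<in>I. \<Sum>n\<in>block_nums (B i) (l i). \<phi> i (Omega n) * hcoef f n * of_nat n powr s)"
  proof (intro prod.cong refl)
    fix i assume i: "i \<in> I"
    have "(\<Sum>r\<le>l i. \<phi> i r * (\<Sum>p\<in>B i. f p * of_nat p powr s) ^ r / fact r) =
      (\<Sum>n\<in>block_nums (B i) (l i). \<phi> i (Omega n) * hcoef (\<lambda>p. f p * of_nat p powr s) n)"
      using I i by (intro block_sum_expand) auto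
    also have "\<dots> = (\<Sum>n\<in>block_nums (B i) (l i). \<phi> i (Omega n) * hcoef f n * of_nat n powr s)"
      by (intro sum.cong refl) (auto simp: hcoef_powr block_nums_altdef)
    finally show "(\<Sum>r\<le>l i. \<phi> i r * (\<Sum>p\<in>B i. f p * of_nat p powr s) ^ r / fact r) =
      (\<Sum>n\<in>block_nums (B i) (l i). \<phi> i (Omega n) * hcoef f n * of_nat n powr s)" .
  qed
  also have "\<dots> = (\<Sum>g\<in>PiE I (\<lambda>i. block_nums (B i) (l i)).
      \<Prod>i\<in>I. \<phi> i (Omega (g i)) * hcoef f (g i) * of_nat (g i) powr s)"
    using I by (intro prod_sum_PiE finite_block_nums) auto
  also have "\<dots> = (\<Sum>g\<in>PiE I (\<lambda>i. block_nums (B i) (l i)).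
      (\<Prod>i\<in>I. \<phi> i (Omega (g i)) * hcoef f (g i)) * of_nat (\<Prod>i\<in>I. g i) powr s)"
  proof (intro sum.cong refl)
    fix g assume g: "g \<in> PiE I (\<lambda>i. block_nums (B i) (l i))"
    have "of_nat (\<Prod>i\<in>I. g i) powr s = (\<Prod>i\<in>I. of_nat (g i) powr s)"
      using I g by (intro of_nat_prod_powr) (auto simp: PiE_def Pi_def block_nums_altdef)
    then show "(\<Prod>i\<in>I. \<phi> i (Omega (g i)) * hcoef f (g i) * of_nat (g i) powr s) =
      (\<Prod>i\<in>I. \<phi> i (Omega (g i)) * hcoef f (g i)) * of_nat (\<Prod>i\<in>I. g i) powr s"
      by (simp add: prod.distrib)
  qed
  finally show ?thesis .
qed

lemma block_prod_inj:
  assumes "finite I" "disjoint_family_on B I"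
  shows "inj_on (\<lambda>g. \<Prod>i\<in>I. g i) (PiE I (\<lambda>i. block_nums (B i) (l i)))"
proof (rule inj_onI)
  fix g h assume gh: "g \<in> PiE I (\<lambda>i. block_nums (B i) (l i))" "h \<in> PiE I (\<lambda>i. block_nums (B i) (l i))"
    "(\<Prod>i\<in>I. g i) = (\<Prod>i\<in>I. h i)"
  show "g = h"
  proof (rule PiE_ext[OF gh(1,2)])
    fix j assume j: "j \<in> I"
    have "g j = bpart (B j) (\<Prod>i\<in>I. g i)"
      using gh(1) by (intro bpart_prod[symmetric] assms j) (auto simp: PiE_def Pi_def block_nums_altdef)
    also have "\<dots> = bpart (B j) (\<Prod>i\<in>I. h i)" by (simp only: gh(3))
    also have "\<dots> = h j"
      using gh(2) by (intro bpart_prod assms j) (auto simp: PiE_def Pi_def block_nums_altdef)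
    finally show "g j = h j" .
  qed
qed

lemma block_nums_le:
  assumes "n \<in> block_nums B l" "\<And>p. p \<in> B \<Longrightarrow> ln (real p) \<le> y" "y \<ge> 0"
  shows "real n \<le> exp (y * real l)"
proof -
  obtain r where r: "r \<le> l" "n \<in> smooth B r" using assms by (auto simp: block_nums_def)
  have "ln (real n) \<le> y * real r" by (rule ln_smooth_le[OF r(2) assms(2)])
  also have "\<dots> \<le> y * real l" using r assms by (intro mult_left_mono) auto
  finally have "exp (ln (real n)) \<le> exp (y * real l)" by simp
  moreover have "n > 0" using r by (simp add: smooth_def)
  ultimately show ?thesis by simp
qed

lemma block_prod_le:
  assumes "finite I" "\<And>i p. i \<in> I \<Longrightarrow> p \<in> B i \<Longrightarrow> ln (real p) \<le> y i" "\<And>i. i \<in> I \<Longrightarrow> y i \<ge> 0"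
    "g \<in> PiE I (\<lambda>i. block_nums (B i) (l i))"
  shows "real (\<Prod>i\<in>I. g i) \<le> exp (\<Sum>i\<in>I. y i * real (l i))"
proof -
  have "real (\<Prod>i\<in>I. g i) = (\<Prod>i\<in>I. real (g i))" by simp
  also have "\<dots> \<le> (\<Prod>i\<in>I. exp (y i * real (l i)))"
  proof (intro prod_mono conjI)
    fix i assume i: "i \<in> I"
    then have "g i \<in> block_nums (B i) (l i)" using assms(4) by auto
    then show "real (g i) \<le> exp (y i * real (l i))" using assms i by (intro block_nums_le) auto
  qed simp
  finally show ?thesis by (simp add: exp_sum assms(1))
qed

lemma block_second_moment:
  fixes f :: "nat \<Rightarrow> complex" and \<phi> :: "nat \<Rightarrow> complex"
  assumes "finite B" "\<And>p. p \<in> B \<Longrightarrow> prime p"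
  shows "(\<Sum>n\<in>block_nums B l. (norm (\<phi> (Omega n) * hcoef f n))\<^sup>2 * real n powr (- 2 * x)) \<le>
    (\<Sum>r\<le>l. (norm (\<phi> r))\<^sup>2 * (\<Sum>p\<in>B. (norm (f p))\<^sup>2 * real p powr (- 2 * x)) ^ r / fact r)"
proof -
  have "(\<Sum>n\<in>block_nums B l. (norm (\<phi> (Omega n) * hcoef f n))\<^sup>2 * real n powr (- 2 * x)) \<le>
     (\<Sum>n\<in>block_nums B l. (norm (\<phi> (Omega n)))\<^sup>2 * hcoef (\<lambda>p. (norm (f p))\<^sup>2 * real p powr (- 2 * x)) n)"
  proof (rule sum_mono)
    fix n assume "n \<in> block_nums B l"
    then have n: "n > 0" by (simp add: block_nums_altdef)
    have "(norm (\<phi> (Omega n) * hcoef f n))\<^sup>2 * real n powr (- 2 * x) =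
        (norm (\<phi> (Omega n)))\<^sup>2 * ((norm (hcoef f n))\<^sup>2 * real n powr (- 2 * x))"
      by (simp add: norm_mult power_mult_distrib)
    also have "\<dots> \<le> (norm (\<phi> (Omega n)))\<^sup>2 * (hcoef (\<lambda>p. (norm (f p))\<^sup>2) n * real n powr (- 2 * x))"
      by (intro mult_left_mono mult_right_mono norm_hcoef_sq_le) auto
    finally show "(norm (\<phi> (Omega n) * hcoef f n))\<^sup>2 * real n powr (- 2 * x) \<le>
      (norm (\<phi> (Omega n)))\<^sup>2 * hcoef (\<lambda>p. (norm (f p))\<^sup>2 * real p powr (- 2 * x)) n"
      using n by (simp only: hcoef_powr_real)
  qed
  also have "\<dots> = (\<Sum>r\<le>l. (norm (\<phi> r))\<^sup>2 * (\<Sum>p\<in>B. (norm (f p))\<^sup>2 * real p powr (- 2 * x)) ^ r / fact r)"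
    by (rule block_sum_expand[OF assms, symmetric])
  finally show ?thesis .
qed

text \<open>Unique factorization across disjoint blocks makes the product a Dirichlet polynomial
  with distinct frequencies up to \<open>exp (\<Sum>i\<in>I. y i * real (l i))\<close>. Its diagonal
  sum factorizes over the blocks, although the coefficients need not be multiplicative inside a
  block.\<close>

lemma
  fixes f :: "nat \<Rightarrow> complex" and \<phi> :: "'i \<Rightarrow> nat \<Rightarrow> complex" and x \<tau> :: real
  assumes I: "finite I" "disjoint_family_on B I"
      "\<And>i. i \<in> I \<Longrightarrow> finite (B i)" "\<And>i p. i \<in> I \<Longrightarrow> p \<in> B i \<Longrightarrow> prime p"
    and y: "\<And>i p. i \<in> I \<Longrightarrow> p \<in> B i \<Longrightarrow> ln (real p) \<le> y i" "\<And>i. i \<in> I \<Longrightarrow> y i \<ge> 0"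
    and \<Delta>: "exp (\<Sum>i\<in>I. y i * real (l i)) ^ 2 \<le> \<Delta>"
  defines "F \<equiv> \<lambda>t. (norm (\<Prod>i\<in>I. \<Sum>r\<le>l i. \<phi> i r *
      (\<Sum>p\<in>B i. f p * of_nat p powr (- Complex x t)) ^ r / fact r))\<^sup>2 * gw \<tau> \<Delta> t"
  shows block_mean_square: "(LINT t|lborel. F t) \<le> 3 / 2 * (sqrt (2 * pi) * \<Delta> *
      (\<Prod>i\<in>I. \<Sum>r\<le>l i. (norm (\<phi> i r))\<^sup>2 *
        (\<Sum>p\<in>B i. (norm (f p))\<^sup>2 * real p powr (- 2 * x)) ^ r / fact r))"
    and block_mean_square_integrable: "integrable lborel F"
proof -
  define G where "G = PiE I (\<lambda>i. block_nums (B i) (l i))"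
  define \<nu> where "\<nu> = (\<lambda>g. \<Prod>i\<in>I. g i :: nat)"
  define c where "c = (\<lambda>g. \<Prod>i\<in>I. \<phi> i (Omega (g i)) * hcoef f (g i))"
  define Z where "Z = nat \<lfloor>exp (\<Sum>i\<in>I. y i * real (l i))\<rfloor>"
  have F: "F = (\<lambda>t. (norm (\<Sum>g\<in>G. c g * of_nat (\<nu> g) powr (- Complex x t)))\<^sup>2 * gw \<tau> \<Delta> t)"
    unfolding F_def G_def c_def \<nu>_def by (subst block_poly_expand) (use I in auto)
  have fin: "finite G" unfolding G_def using I by (intro finite_PiE finite_block_nums) auto
  have inj: "inj_on \<nu> G" unfolding \<nu>_def G_def by (rule block_prod_inj[OF I(1,2)])
  have gpos: "g i > 0" if "g \<in> G" "i \<in> I" for g i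
    using that by (auto simp: G_def PiE_def Pi_def block_nums_altdef)
  have range: "\<nu> ` G \<subseteq> {1..Z}"
  proof clarify
    fix g assume g: "g \<in> G"
    have "\<nu> g > 0" unfolding \<nu>_def using gpos[OF g] by (intro prod_pos) auto
    moreover have "real (\<nu> g) \<le> exp (\<Sum>i\<in>I. y i * real (l i))"
      unfolding \<nu>_def using g by (intro block_prod_le I y) (auto simp: G_def)
    then have "\<nu> g \<le> Z" unfolding Z_def by (simp add: le_nat_floor)
    ultimately show "\<nu> g \<in> {1..Z}" by simp
  qed
  have "real Z \<le> exp (\<Sum>i\<in>I. y i * real (l i))" unfolding Z_def by simp
  then have "(real Z)\<^sup>2 \<le> exp (\<Sum>i\<in>I. y i * real (l i)) ^ 2" by (intro power_mono) auto
  also note \<Delta>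
  finally have Z: "(real Z)\<^sup>2 \<le> \<Delta>" .
  have \<Delta>0: "\<Delta> > 0" using \<Delta> by (smt (verit) exp_gt_zero zero_less_power)
  show "integrable lborel F"
    unfolding F by (rule gauss_mean_value_integrable[OF fin inj range Z \<Delta>0])
  have "(LINT t|lborel. F t) \<le> 3 / 2 * (sqrt (2 * pi) * \<Delta> * (\<Sum>g\<in>G. (norm (c g))\<^sup>2 * real (\<nu> g) powr (- 2 * x)))"
    unfolding F by (rule gauss_mean_value_upper[OF fin inj range Z \<Delta>0])
  also have "(\<Sum>g\<in>G. (norm (c g))\<^sup>2 * real (\<nu> g) powr (- 2 * x)) =
      (\<Sum>g\<in>G. \<Prod>i\<in>I. (norm (\<phi> i (Omega (g i)) * hcoef f (g i)))\<^sup>2 * real (g i) powr (- 2 * x))"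
  proof (intro sum.cong refl)
    fix g
    have "(norm (c g))\<^sup>2 = (\<Prod>i\<in>I. (norm (\<phi> i (Omega (g i)) * hcoef f (g i)))\<^sup>2)"
      unfolding c_def prod_norm[symmetric] by (rule prod_power_distrib)
    moreover have "real (\<nu> g) powr (- 2 * x) = (\<Prod>i\<in>I. real (g i) powr (- 2 * x))"
      by (simp add: \<nu>_def prod_powr_distrib)
    ultimately show "(norm (c g))\<^sup>2 * real (\<nu> g) powr (- 2 * x) =
        (\<Prod>i\<in>I. (norm (\<phi> i (Omega (g i)) * hcoef f (g i)))\<^sup>2 * real (g i) powr (- 2 * x))"
      by (simp only: prod.distrib)
  qed
  also have "\<dots> = (\<Prod>i\<in>I. \<Sum>n\<in>block_nums (B i) (l i). (norm (\<phi> i (Omega n) * hcoef f n))\<^sup>2 * real n powr (- 2 * x))"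
    unfolding G_def using I by (intro prod_sum_PiE[symmetric] finite_block_nums) auto
  also have "\<dots> \<le> (\<Prod>i\<in>I. \<Sum>r\<le>l i. (norm (\<phi> i r))\<^sup>2 *
        (\<Sum>p\<in>B i. (norm (f p))\<^sup>2 * real p powr (- 2 * x)) ^ r / fact r)"
    using I by (intro prod_mono conjI block_second_moment sum_nonneg) auto
  finally show "(LINT t|lborel. F t) \<le> 3 / 2 * (sqrt (2 * pi) * \<Delta> *
      (\<Prod>i\<in>I. \<Sum>r\<le>l i. (norm (\<phi> i r))\<^sup>2 *
        (\<Sum>p\<in>B i. (norm (f p))\<^sup>2 * real p powr (- 2 * x)) ^ r / fact r))"
    using \<Delta>0 by (simp add: mult_left_mono)
qed

section \<open>Truncated exponentials near to and far from the origin\<close>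

definition texp :: "nat \<Rightarrow> complex \<Rightarrow> complex" where
  "texp l z = (\<Sum>r\<le>l. z ^ r / fact r)"

text \<open>The Taylor remainder is at most \<open>exp u * u ^ Suc l / fact l\<close> with
  \<open>u = norm z\<close>. Of the gain \<open>(1 / 32) ^ l\<close>, a factor \<open>4 ^ l\<close>
  pays for \<open>exp l\<close> (from \<open>fact l\<close>) together with the
  \<open>exp (2 * u)\<close> lost in passing to a relative error, and \<open>2 ^ l\<close> pays for
  the additional \<open>u\<close>; what remains is
  \<open>(4 * 2 / 32) ^ l = (1 / 4) ^ l\<close>.\<close>

lemma texp_rel_error:
  assumes "l \<ge> 1" "norm z \<le> real l / 32"
  shows "norm (texp l z - exp z) \<le> (1 / 4) ^ l * norm (exp z)"
proof -
  define u where "u = norm z"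
  have u: "0 \<le> u" "32 * u \<le> l" using assms by (auto simp: u_def)
  have "norm (texp l z - exp z) \<le> exp \<bar>Re z\<bar> * u ^ Suc l / fact l"
    using Taylor_exp[of z l] by (simp add: texp_def norm_minus_commute u_def)
  also have "\<dots> \<le> exp u * u ^ Suc l / fact l"
    using abs_Re_le_cmod[of z] u by (intro divide_right_mono mult_right_mono) (auto simp: u_def)
  also have "\<dots> = exp u * u * (u ^ l / fact l)" by simp
  also have "\<dots> \<le> exp u * u * ((1 / 32) ^ l * exp (real l))"
  proof (rule mult_left_mono)
    have "(32 * u) ^ l \<le> real l ^ l" using u by (intro power_mono) auto
    also have "\<dots> \<le> fact l * exp (real l)" by (rule power_le_fact_exp) simp
    finally show "u ^ l / fact l \<le> (1 / 32) ^ l * exp (real l)" by (simp add: field_simps power_mult_distrib power_divide)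
  qed (use u in auto)
  also have "exp u * u * ((1 / 32) ^ l * exp (real l)) \<le> exp u * 2 ^ l / 32 * ((1 / 32) ^ l * exp (real l))"
  proof -
    have "u \<le> real l / 32" using u by simp
    also have "real l \<le> 2 ^ l" by (simp add: less_imp_le)
    finally have "u \<le> 2 ^ l / 32" by simp
    then have "exp u * u \<le> exp u * (2 ^ l / 32)" by (intro mult_left_mono) auto
    then show ?thesis by (intro mult_right_mono) auto
  qed
  also have "\<dots> \<le> (1 / 4) ^ l * exp (- u)"
  proof -
    have "exp (2 * u) \<le> exp (real l / 16)" using u by simp
    also have "\<dots> \<le> exp (real l * (1/16))" by simp
    finally have "exp (2 * u) * exp (real l) \<le> exp (real l * (17/16))"
      by (simp flip: exp_add)
    also have "\<dots> \<le> 4 ^ l"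
    proof -
      have "exp (17/16 :: real) \<le> 4"
      proof -
        have "exp (17/16 :: real) \<le> exp (1 + 1/16)" by simp
        also have "\<dots> = exp 1 * exp (1/16)" by (rule exp_add)
        also have "\<dots> \<le> 3 * (4/3)"
        proof (intro mult_mono)
          show "exp 1 \<le> (3::real)" by (rule exp_le)
          have "exp (1/16 :: real) \<le> 1 + 1/16 + (1/16)\<^sup>2" by (rule exp_bound) auto
          then show "exp (1/16 :: real) \<le> 4/3" by (simp add: power2_eq_square)
        qed auto
        finally show ?thesis by simp
      qed
      then have "exp (17/16 :: real) ^ l \<le> 4 ^ l" by (intro power_mono) auto
      then show ?thesis by (simp add: exp_of_nat_mult[symmetric] mult.commute)
    qed
    finally have *: "exp (2 * u) * exp (real l) \<le> 4 ^ l" .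
    have "exp u * 2 ^ l / 32 * ((1 / 32) ^ l * exp (real l)) = exp (2 * u) * exp (real l) * exp (- u) * ((2 / 32) ^ l / 32)"
    proof -
      have "exp (2 * u) * exp (real l) * exp (- u) = exp u * exp (real l)" by (simp flip: exp_add)
      moreover have "(2 / 32 :: real) ^ l = 2 ^ l * (1 / 32) ^ l" by (simp flip: power_mult_distrib)
      ultimately show ?thesis by simp
    qed
    also have "\<dots> \<le> 4 ^ l * exp (- u) * ((2 / 32) ^ l / 32)"
      using * by (intro mult_right_mono) auto
    also have "\<dots> = (4 * (2 / 32)) ^ l * exp (- u) / 32" by (subst power_mult_distrib) simp
    also have "\<dots> \<le> (1 / 4) ^ l * exp (- u)" by (simp add: field_simps)
    finally show ?thesis .
  qed
  also have "\<dots> \<le> (1 / 4) ^ l * norm (exp z)"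
    using abs_Re_le_cmod[of z] by (intro mult_left_mono) (auto simp: u_def)
  finally show ?thesis .
qed

text \<open>With \<open>v = 32 * norm z / l >= 1\<close> every power of \<open>v\<close> is at most
  \<open>v ^ l\<close>; the sum left over is part of the series of
  \<open>exp (l / 32) <= 2 ^ l\<close>.\<close>

lemma texp_large:
  assumes "l \<ge> 1" "norm z \<ge> real l / 32" "norm w \<le> norm z"
  shows "norm (texp l w) \<le> (64 * norm z / real l) ^ l"
proof -
  define v where "v = 32 * norm z / real l"
  have v: "v \<ge> 1" using assms by (simp add: v_def field_simps)
  have "norm (texp l w) \<le> (\<Sum>r\<le>l. norm (w ^ r / fact r))" unfolding texp_def by (rule norm_sum)
  also have "\<dots> \<le> (\<Sum>r\<le>l. v ^ l * ((real l / 32) ^ r / fact r))"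
  proof (intro sum_mono)
    fix r assume r: "r \<in> {..l}"
    have "norm (w ^ r / fact r) \<le> norm z ^ r / fact r"
      using assms by (simp add: norm_divide norm_power divide_right_mono power_mono)
    also have "norm z = v * (real l / 32)" using assms by (simp add: v_def)
    also have "(v * (real l / 32)) ^ r / fact r = v ^ r * ((real l / 32) ^ r / fact r)"
      by (subst power_mult_distrib) simp
    also have "\<dots> \<le> v ^ l * ((real l / 32) ^ r / fact r)"
      using v r by (intro mult_right_mono power_increasing) auto
    finally show "norm (w ^ r / fact r) \<le> v ^ l * ((real l / 32) ^ r / fact r)" .
  qed
  also have "\<dots> = v ^ l * (\<Sum>r\<le>l. (real l / 32) ^ r / fact r)" by (simp add: sum_distrib_left)
  also have "(\<Sum>r\<le>l. (real l / 32) ^ r / fact r) \<le> exp (real l / 32)"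
  proof -
    have "(\<Sum>r\<le>l. (real l / 32) ^ r / fact r) \<le> (\<Sum>r. (real l / 32) ^ r / fact r)"
      using summable_exp[of "real l / 32"] by (intro sum_le_suminf) (auto simp: field_simps)
    then show ?thesis by (simp add: exp_def field_simps)
  qed
  also have "exp (real l / 32) \<le> 2 ^ l"
  proof -
    have "exp (1/32 :: real) \<le> 1 + 1/32 + (1/32)\<^sup>2" by (rule exp_bound) auto
    then have "exp (1/32 :: real) \<le> 2" by (simp add: power2_eq_square)
    then have "exp (1/32 :: real) ^ l \<le> 2 ^ l" by (intro power_mono) auto
    then show ?thesis by (simp add: exp_of_nat_mult[symmetric])
  qed
  also have "v ^ l * 2 ^ l = (64 * norm z / real l) ^ l" by (simp add: v_def flip: power_mult_distrib)
  finally show ?thesis using v by (simp add: mult_left_mono)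
qed

text \<open>With \<open>q * \<beta> = k\<close> a non-even power of the truncated exponential is dominated by squares of
  polynomials, which makes its mean value computable.\<close>

lemma texp_powr_le:
  fixes \<beta> k q :: real and z :: complex
  assumes l: "l \<ge> 1" and \<beta>: "0 \<le> \<beta>" "\<beta> \<le> k" and q: "q * \<beta> = k" "0 < q" "q \<le> real Q"
  shows "norm (texp l (\<beta> * z)) powr (2 * q) \<le>
    exp ((2 * q + 4) * (1 / 4) ^ l) * (norm (texp l (k * z)))\<^sup>2 + (norm (64 * k * z / l)) ^ (2 * Q * l)"
proof (cases "norm (of_real k * z) \<le> real l / 32")
  case True
  \<comment> \<open>Small argument: both polynomials agree with their exponentials up to a factor
    \<open>1 + O(\<delta>)\<close>, and for the exponentials the two sides coincide, as
    \<open>q * \<beta> = k\<close>. The factor in front collects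
    \<open>exp (2 * q * \<delta>)\<close> from the upper and \<open>exp (4 * \<delta>)\<close> from
    the lower comparison.\<close>
  define \<delta> where "\<delta> = (1 / 4 :: real) ^ l"
  have \<delta>: "0 \<le> \<delta>" "\<delta> \<le> 1 / 4"
    using power_decreasing[OF l, of "1/4 :: real"] by (auto simp: \<delta>_def)
  have 1: "norm (of_real \<beta> * z) \<le> real l / 32"
  proof -
    have "norm (of_real \<beta> * z) \<le> norm (of_real k * z)" using \<beta> by (simp add: norm_mult mult_right_mono)
    with True show ?thesis by linarith
  qed
  have "norm (texp l (\<beta> * z)) \<le> norm (exp (\<beta> * z)) + norm (texp l (\<beta> * z) - exp (\<beta> * z))"
    by (rule norm_triangle_sub)
  also have "\<dots> \<le> norm (exp (\<beta> * z)) * (1 + \<delta>)"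
    using texp_rel_error[OF l 1] by (simp add: \<delta>_def algebra_simps)
  also have "\<dots> \<le> norm (exp (\<beta> * z)) * exp \<delta>" by (intro mult_left_mono) auto
  finally have "norm (texp l (\<beta> * z)) powr (2 * q) \<le> (norm (exp (\<beta> * z)) * exp \<delta>) powr (2 * q)"
    using q by (intro powr_mono2) auto
  also have "\<dots> = (norm (exp (k * z)))\<^sup>2 * exp (2 * q * \<delta>)"
  proof -
    have "(norm (exp (\<beta> * z)) * exp \<delta>) powr (2 * q) = exp ((\<beta> * Re z + \<delta>) * (2 * q))"
      by (simp add: exp_powr_real flip: exp_add)
    also have "(\<beta> * Re z + \<delta>) * (2 * q) = 2 * (k * Re z) + 2 * q * \<delta>"
      unfolding q(1)[symmetric] by (simp add: algebra_simps)
    also have "exp \<dots> = (norm (exp (k * z)))\<^sup>2 * exp (2 * q * \<delta>)"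
      by (simp add: exp_add exp_double)
    finally show ?thesis .
  qed
  also have "(norm (exp (k * z)))\<^sup>2 \<le> (norm (texp l (k * z)) * exp (2 * \<delta>))\<^sup>2"
  proof (intro power_mono)
    have "norm (exp (k * z)) \<le> norm (texp l (k * z)) + norm (exp (k * z) - texp l (k * z))"
      by (rule norm_triangle_sub)
    also have "\<dots> \<le> norm (texp l (k * z)) + \<delta> * norm (exp (k * z))"
      using texp_rel_error[OF l True] by (simp add: \<delta>_def norm_minus_commute)
    finally have "norm (exp (k * z)) * (1 - \<delta>) \<le> norm (texp l (k * z))" by (simp add: algebra_simps)
    moreover have "exp (- 2 * \<delta>) \<le> 1 - \<delta>"
    proof -
      have "1 + 2 * \<delta> \<le> exp (2 * \<delta>)" by simp
      then have "exp (- 2 * \<delta>) \<le> 1 / (1 + 2 * \<delta>)" using \<delta> by (simp add: exp_minus field_simps)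
      also have "\<dots> \<le> 1 - \<delta>"
      proof -
        have "0 \<le> \<delta> * (1 - 2 * \<delta>)" using \<delta> by (intro mult_nonneg_nonneg) auto
        then have "1 \<le> (1 - \<delta>) * (1 + 2 * \<delta>)" by (simp add: algebra_simps)
        then show ?thesis using \<delta> by (subst pos_divide_le_eq) auto
      qed
      finally show ?thesis .
    qed
    ultimately have "norm (exp (k * z)) * exp (- 2 * \<delta>) \<le> norm (texp l (k * z))"
      by (meson mult_left_mono norm_ge_zero order_trans)
    then show "norm (exp (k * z)) \<le> norm (texp l (k * z)) * exp (2 * \<delta>)"
      by (simp add: exp_minus field_simps)
  qed simp
  also have "(norm (texp l (k * z)) * exp (2 * \<delta>))\<^sup>2 * exp (2 * q * \<delta>) =
      exp ((2 * q + 4) * \<delta>) * (norm (texp l (k * z)))\<^sup>2"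
  proof -
    have "(exp (2 * \<delta>))\<^sup>2 * exp (2 * q * \<delta>) = exp ((2 * q + 4) * \<delta>)"
      by (simp add: algebra_simps flip: exp_double exp_add)
    then show ?thesis by (simp add: power_mult_distrib mult_ac)
  qed
  finally show ?thesis by (simp add: \<delta>_def add_increasing2 mult_right_mono)
next
  case False
  \<comment> \<open>Large argument: the exponential is out of reach, but here the base
    \<open>64 * k * norm z / l\<close> is at least 1, so its power may be raised from
    \<open>2 * q * l\<close> to the even integer \<open>2 * Q * l\<close>.\<close>
  have kz: "norm (of_real \<beta> * z) \<le> norm (of_real k * z)" using \<beta> by (auto simp: norm_mult intro: mult_right_mono)
  define v where "v = 64 * norm (of_real k * z) / real l"
  have v: "v \<ge> 1" using False l by (simp add: v_def field_simps)
  have "norm (texp l (\<beta> * z)) \<le> v ^ l"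
    unfolding v_def using False by (intro texp_large[OF l _ kz]) auto
  then have "norm (texp l (\<beta> * z)) powr (2 * q) \<le> (v ^ l) powr (2 * q)"
    using q by (intro powr_mono2) auto
  also have "\<dots> \<le> (v ^ l) powr (2 * real Q)" using v q by (intro powr_mono) auto
  also have "\<dots> = v ^ (2 * Q * l)"
    using v by (simp add: powr_powr mult_ac flip: powr_realpow)
  also have "v = norm (64 * k * z / l)" by (simp add: v_def norm_mult norm_divide)
  finally show ?thesis by (simp add: add_increasing)
qed

subsection \<open>Roots and powers of Dirichlet series\<close>

lemma sum_divisors_coprime_mult:
  fixes m n :: nat
  assumes "coprime m n" "m > 0" "n > 0"
  shows "(\<Sum>d | d dvd m * n. F d) = (\<Sum>(x,y)\<in>{x. x dvd m} \<times> {y. y dvd n}. F (x * y))"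
proof -
  let ?S = "{x. x dvd m} \<times> {y. y dvd n}"
  have img: "{d. d dvd m * n} = (\<lambda>(x,y). x * y) ` ?S"
  proof (intro equalityI subsetI)
    fix d assume "d \<in> {d. d dvd m * n}"
    then obtain x y where "d = x * y" "x dvd m" "y dvd n" using division_decomp[of d m n] by auto
    then show "d \<in> (\<lambda>(x,y). x * y) ` ?S" by (intro image_eqI[of _ _ "(x, y)"]) auto
  qed (auto intro: mult_dvd_mono)
  have gcds: "gcd (x * y) m = x" "gcd (x * y) n = y" if "x dvd m" "y dvd n" for x y
  proof -
    have "coprime y m" "coprime x n"
      using assms(1) that by (meson coprime_commute coprime_divisors dvd_refl)+
    then have "gcd (x * y) m = gcd x m" "gcd (x * y) n = gcd y n"
      by (simp_all add: gcd_mult_left_right_cancel gcd_mult_left_left_cancel coprime_commute)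
    then show "gcd (x * y) m = x" "gcd (x * y) n = y" using that by (simp_all add: gcd_nat.absorb1)
  qed
  have "inj_on (\<lambda>(x,y). x * y) ?S"
  proof (rule inj_onI, clarify)
    fix x y x' y' assume *: "x dvd m" "y dvd n" "x' dvd m" "y' dvd n" "x * y = x' * y'"
    show "x = x' \<and> y = y'" using gcds[OF *(1,2)] gcds[OF *(3,4)] *(5) by simp
  qed
  then show ?thesis unfolding img by (subst sum.reindex) (auto simp: case_prod_unfold)
qed

text \<open>Multiplicativity is demanded only between divisors of \<open>m\<close> and divisors of
  \<open>n\<close>, since truncated exponentials are multiplicative only across different
  blocks.\<close>

lemma dirichlet_conv_coprime:
  assumes "coprime m n" "m > 0" "n > 0"
    "\<And>d e. d dvd m \<Longrightarrow> e dvd n \<Longrightarrow> f (d * e) = f d * f e"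
    "\<And>d e. d dvd m \<Longrightarrow> e dvd n \<Longrightarrow> g (d * e) = g d * g e"
  shows "dirichlet_conv f g (m * n) = dirichlet_conv f g m * dirichlet_conv f g n"
proof -
  have "dirichlet_conv f g (m * n) =
      (\<Sum>(x,y)\<in>{x. x dvd m} \<times> {y. y dvd n}. f (x * y) * g (m * n div (x * y)))"
    unfolding dirichlet_conv_def by (rule sum_divisors_coprime_mult[OF assms(1-3)])
  also have "\<dots> = (\<Sum>(x,y)\<in>{x. x dvd m} \<times> {y. y dvd n}. (f x * g (m div x)) * (f y * g (n div y)))"
  proof (intro sum.cong refl, clarify)
    fix x y assume xy: "x dvd m" "y dvd n"
    have "m * n div (x * y) = (m div x) * (n div y)"
      using xy by (simp add: div_mult_div_if_dvd)
    moreover have "m div x dvd m" "n div y dvd n" using xy by (auto simp: dvd_div_eq_mult elim!: dvdE)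
    ultimately show "f (x * y) * g (m * n div (x * y)) = (f x * g (m div x)) * (f y * g (n div y))"
      using assms(4)[OF xy] assms(5)[of "m div x" "n div y"] by (simp add: mult_ac)
  qed
  also have "\<dots> = dirichlet_conv f g m * dirichlet_conv f g n"
    unfolding dirichlet_conv_def sum_product sum.cartesian_product by (simp add: case_prod_unfold)
  finally show ?thesis .
qed

lemma multiplicative_dirichlet_conv:
  assumes "multiplicative f" "multiplicative g"
  shows "multiplicative (dirichlet_conv f g)"
  unfolding multiplicative_def
proof (intro allI impI)
  fix m n :: nat assume mn: "m \<ge> 1" "n \<ge> 1" "coprime m n"
  have *: "h (d * e) = h d * h e" if "multiplicative h" "d dvd m" "e dvd n" for h d e
  proof -
    have "coprime d e" using mn(3) that by (meson coprime_divisors)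
    moreover have "d \<ge> 1" "e \<ge> 1" using mn that by (auto simp: Suc_le_eq dest: dvd_pos_nat)
    ultimately show ?thesis using that(1) by (auto simp: multiplicative_def)
  qed
  show "dirichlet_conv f g (m * n) = dirichlet_conv f g m * dirichlet_conv f g n"
    using mn * assms by (intro dirichlet_conv_coprime) auto
qed

lemma multiplicative_dirichlet_power:
  assumes "multiplicative g"
  shows "multiplicative (dirichlet_power r g)"
proof (induction r)
  case 0
  then show ?case by (auto simp: multiplicative_def)
next
  case (Suc r)
  then show ?case using multiplicative_dirichlet_conv[OF assms] by simp
qed

lemma multiplicative_1:
  assumes "multiplicative f" "\<exists>n\<ge>1. f n \<noteq> 0"
  shows "f 1 = 1"
proof -
  obtain n where n: "n \<ge> 1" "f n \<noteq> 0" using assms(2) by auto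
  have "f (n * 1) = f n * f 1" using assms(1) n(1) unfolding multiplicative_def by (metis coprime_1_right order_refl)
  then show ?thesis using n by simp
qed

lemma multiplicative_prod_prime_powers:
  assumes "multiplicative f" "f 1 = 1" "n > 0"
  shows "f n = (\<Prod>p\<in>prime_factors n. f (p ^ multiplicity p n))"
proof -
  have "f (\<Prod>p\<in>P. p ^ e p) = (\<Prod>p\<in>P. f (p ^ e p))" if "finite P" "\<And>p. p \<in> P \<Longrightarrow> prime p" for P and e :: "nat \<Rightarrow> nat"
    using that
  proof (induction P rule: finite_induct)
    case (insert q P)
    have "coprime (q ^ e q) (\<Prod>p\<in>P. p ^ e p)"
    proof (rule prod_coprime_right)
      fix p assume "p \<in> P"
      then have "coprime q p" using insert by (intro primes_coprime) auto
      then show "coprime (q ^ e q) (p ^ e p)" by simp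
    qed
    moreover have "(\<Prod>p\<in>P. p ^ e p) \<ge> 1" "q ^ e q \<ge> 1"
      using insert by (auto simp: Suc_le_eq prime_gt_0_nat intro!: prod_pos)
    ultimately have "f (q ^ e q * (\<Prod>p\<in>P. p ^ e p)) = f (q ^ e q) * f (\<Prod>p\<in>P. p ^ e p)"
      using assms(1) by (auto simp: multiplicative_def)
    then show ?case using insert by simp
  qed (use assms in auto)
  then have "f (\<Prod>p\<in>prime_factors n. p ^ multiplicity p n) = (\<Prod>p\<in>prime_factors n. f (p ^ multiplicity p n))"
    by (simp add: in_prime_factors_imp_prime)
  moreover have "f n = f (\<Prod>p\<in>prime_factors n. p ^ multiplicity p n)"
    by (rule arg_cong[OF nat_prime_decomp[OF assms(3)]])
  ultimately show ?thesis by (simp only:)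
qed

lemma multiplicative_eqI:
  assumes "multiplicative f" "multiplicative g" "f 1 = 1" "g 1 = 1"
    "\<And>p e. prime p \<Longrightarrow> f (p ^ e) = g (p ^ e)" "n > 0"
  shows "f n = g n"
proof -
  have "f n = (\<Prod>p\<in>prime_factors n. f (p ^ multiplicity p n))"
    by (rule multiplicative_prod_prime_powers[OF assms(1,3,6)])
  also have "\<dots> = (\<Prod>p\<in>prime_factors n. g (p ^ multiplicity p n))"
    by (intro prod.cong refl assms(5)) (auto dest: in_prime_factors_imp_prime)
  also have "\<dots> = g n" by (rule multiplicative_prod_prime_powers[OF assms(2,4,6), symmetric])
  finally show ?thesis .
qed

lemma dirichlet_power_prime_power_cong:
  assumes "prime p" "\<And>e. g (p ^ e) = h (p ^ e)"
  shows "dirichlet_power r g (p ^ e) = dirichlet_power r h (p ^ e)"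
proof (induction r arbitrary: e)
  case (Suc r)
  show ?case unfolding dirichlet_power.simps dirichlet_conv_def
  proof (intro sum.cong refl)
    fix d assume "d \<in> {d. d dvd p ^ e}"
    then obtain i where i: "i \<le> e" "d = p ^ i" using divides_primepow_nat[OF assms(1)] by auto
    then have "p ^ e div d = p ^ (e - i)" using assms(1) by (simp add: power_diff prime_gt_0_nat)
    then show "g d * dirichlet_power r g (p ^ e div d) = h d * dirichlet_power r h (p ^ e div d)"
      using i assms(2) Suc by simp
  qed
qed simp

text \<open>The multiplicative function \<open>G\<close> with the values of the root at prime powers
  is itself a root: its \<open>r\<close>-th convolution power is multiplicative and agrees with
  \<open>f\<close> at prime powers. Uniqueness of the root gives \<open>G = g\<close>; the
  convention \<open>G 0 = 0\<close> matches the normalization in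
  \<open>is_dirichlet_root\<close>.\<close>

lemma multiplicative_dirichlet_root:
  assumes "multiplicative f" "f 1 = 1" "r \<ge> 1"
  shows "multiplicative (dirichlet_root r f)"
proof -
  define g where "g = dirichlet_root r f"
  have g: "is_dirichlet_root r f g" unfolding g_def using assms by (intro is_dirichlet_root_dirichlet_root) auto
  then have g01: "g 0 = 0" "g 1 = 1" by (auto simp: is_dirichlet_root_def)
  define G where "G = (\<lambda>n. if n = 0 then 0 else \<Prod>p\<in>prime_factors n. g (p ^ multiplicity p n))"
  have G_pow: "G (p ^ e) = g (p ^ e)" if "prime p" for p e
    using that g01 prime_gt_0_nat[OF that] by (cases "e = 0") (auto simp: G_def prime_factorization_prime_power)
  have multG: "multiplicative G" unfolding multiplicative_def
  proof (intro allI impI)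
    fix m n :: nat assume mn: "m \<ge> 1" "n \<ge> 1" "coprime m n"
    have disj: "prime_factors m \<inter> prime_factors n = {}"
    proof -
      have False if "p \<in> prime_factors m" "p \<in> prime_factors n" for p
      proof -
        have "is_unit p" using that by (intro coprime_common_divisor[OF mn(3)]) auto
        then show False using that(1) by (meson in_prime_factors_imp_prime not_prime_unit)
      qed
      then show ?thesis by blast
    qed
    have mult: "multiplicity p (m * n) = multiplicity p m + multiplicity p n" if "prime p" for p
      using mn that by (intro prime_elem_multiplicity_mult_distrib) auto
    have z1: "multiplicity p n = 0" if "p \<in> prime_factors m" for p
      using that disj mn by (intro not_dvd_imp_multiplicity_0) (auto simp: in_prime_factors_iff)
    have z2: "multiplicity p m = 0" if "p \<in> prime_factors n" for p
      using that disj mn by (intro not_dvd_imp_multiplicity_0) (auto simp: in_prime_factors_iff)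
    have "prime_factors (m * n) = prime_factors m \<union> prime_factors n"
      using mn by (simp add: prime_factorization_mult)
    then have "G (m * n) = (\<Prod>p\<in>prime_factors m \<union> prime_factors n. g (p ^ multiplicity p (m * n)))"
      using mn by (simp add: G_def)
    also have "\<dots> = (\<Prod>p\<in>prime_factors m. g (p ^ multiplicity p (m * n))) *
        (\<Prod>p\<in>prime_factors n. g (p ^ multiplicity p (m * n)))"
      using disj by (intro prod.union_disjoint) auto
    also have "(\<Prod>p\<in>prime_factors m. g (p ^ multiplicity p (m * n))) = (\<Prod>p\<in>prime_factors m. g (p ^ multiplicity p m))"
      by (intro prod.cong refl) (simp add: mult z1 in_prime_factors_imp_prime)
    also have "(\<Prod>p\<in>prime_factors n. g (p ^ multiplicity p (m * n))) = (\<Prod>p\<in>prime_factors n. g (p ^ multiplicity p n))"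
      by (intro prod.cong refl) (simp add: mult z2 in_prime_factors_imp_prime)
    finally show "G (m * n) = G m * G n" using mn by (simp add: G_def)
  qed
  have G1: "G 1 = 1" by (simp add: G_def)
  have "dirichlet_power r G n = f n" if "n \<ge> 1" for n
  proof (rule multiplicative_eqI)
    show "multiplicative (dirichlet_power r G)" by (rule multiplicative_dirichlet_power[OF multG])
    show "dirichlet_power r G (p ^ e) = f (p ^ e)" if "prime p" for p e
    proof -
      have "dirichlet_power r G (p ^ e) = dirichlet_power r g (p ^ e)"
        using that G_pow[OF that] by (rule dirichlet_power_prime_power_cong)
      also have "\<dots> = f (p ^ e)" using g that prime_gt_0_nat[OF that] by (simp add: is_dirichlet_root_def Suc_le_eq)
      finally show ?thesis .
    qed
  qed (use assms that G1 dirichlet_power_1[of G r] in auto)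
  then have "is_dirichlet_root r f G" using G1 by (simp add: is_dirichlet_root_def G_def)
  then have "G = g" using dirichlet_root_ex1[of r f, OF assms(3,2)] g by auto
  then show ?thesis using multG by (simp add: g_def)
qed

lemma dirichlet_conv_prime_power:
  assumes "prime p"
  shows "dirichlet_conv f g (p ^ e) = (\<Sum>i\<le>e. f (p ^ i) * g (p ^ (e - i)))"
proof -
  have "{d. d dvd p ^ e} = (\<lambda>i. p ^ i) ` {..e}" using divides_primepow_nat[OF assms] by auto
  moreover have "inj_on (\<lambda>i. p ^ i) {..e}"
    using prime_gt_1_nat[OF assms] by (auto simp: inj_on_def)
  moreover have "p ^ e div p ^ i = p ^ (e - i)" if "i \<le> e" for i
    using that assms by (simp add: power_diff prime_gt_0_nat)
  ultimately show ?thesis by (simp add: dirichlet_conv_def sum.reindex)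
qed

text \<open>Only the divisors 1 and \<open>p\<close> of a prime enter, so convolution is additive
  there.\<close>

lemma dirichlet_power_prime:
  assumes "prime p" "g 1 = 1"
  shows "dirichlet_power r g p = of_nat r * g p"
proof (induction r)
  case 0
  then show ?case using assms prime_gt_1_nat[OF assms(1)] by auto
next
  case (Suc r)
  then show ?case
    using dirichlet_conv_prime_power[OF assms(1), of g "dirichlet_power r g" 1] assms(2) dirichlet_power_1[of g r]
    by (simp add: algebra_simps)
qed

lemma dirichlet_root_prime:
  assumes "f 1 = 1" "r \<ge> 1" "prime p"
  shows "dirichlet_root r f p = f p / of_nat r"
proof -
  have "is_dirichlet_root r f (dirichlet_root r f)" using assms by (intro is_dirichlet_root_dirichlet_root) auto
  then have "dirichlet_power r (dirichlet_root r f) p = f p" "dirichlet_root r f 1 = 1"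
    using assms prime_gt_0_nat[OF assms(3)] by (auto simp: is_dirichlet_root_def Suc_le_eq)
  then show ?thesis using dirichlet_power_prime[OF assms(3), of "dirichlet_root r f" r] assms by (simp add: field_simps)
qed

text \<open>Through this the growth hypothesis on the roots, taken for \<open>r = 1\<close>, becomes
  a bound for \<open>f\<close> itself.\<close>

lemma dirichlet_root_1:
  assumes "f 1 = 1" "n \<ge> 1"
  shows "dirichlet_root 1 f n = f n"
proof -
  have "is_dirichlet_root 1 f (dirichlet_root 1 f)" using assms by (intro is_dirichlet_root_dirichlet_root) auto
  then have "dirichlet_power 1 (dirichlet_root 1 f) n = f n" using assms by (simp add: is_dirichlet_root_def)
  moreover have "dirichlet_power 1 (dirichlet_root 1 f) n = (\<Sum>d\<in>{d. d dvd n}. if d = n then dirichlet_root 1 f n else 0)"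
    unfolding One_nat_def dirichlet_power.simps dirichlet_conv_def
  proof (intro sum.cong refl)
    fix d assume "d \<in> {d. d dvd n}"
    then obtain e where e: "n = d * e" by (auto elim: dvdE)
    then have "d > 0" "n div d = e" using assms(2) by auto
    then have "n div d = 1 \<longleftrightarrow> d = n" using e by auto
    then show "dirichlet_root (Suc 0) f d * (if n div d = Suc 0 then 1 else 0) =
        (if d = n then dirichlet_root (Suc 0) f n else 0)" by auto
  qed
  ultimately show ?thesis using assms by (simp add: sum.delta')
qed

definition dseries :: "(nat \<Rightarrow> complex) \<Rightarrow> complex \<Rightarrow> complex" where
  "dseries f s = (\<Sum>\<^sub>\<infinity>n\<in>{1..}. f n * of_nat n powr - s)"

definition dsummable :: "(nat \<Rightarrow> complex) \<Rightarrow> complex \<Rightarrow> bool" where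
  "dsummable f s \<longleftrightarrow> (\<lambda>n. norm (f n * of_nat n powr - s)) summable_on {1..}"

text \<open>The absolutely convergent double sum over \<open>(d, e)\<close> is rearranged according
  to the product \<open>n = d * e\<close>.\<close>

lemma
  assumes "dsummable f s" "dsummable g s"
  shows dsummable_dirichlet_conv: "dsummable (dirichlet_conv f g) s"
    and dseries_dirichlet_conv: "dseries (dirichlet_conv f g) s = dseries f s * dseries g s"
proof -
  define a where "a = (\<lambda>n. f n * of_nat n powr - s)"
  define b where "b = (\<lambda>n. g n * of_nat n powr - s)"
  have a: "(\<lambda>n. norm (a n)) summable_on {1..}" and b: "(\<lambda>n. norm (b n)) summable_on {1..}"
    using assms by (simp_all add: a_def b_def dsummable_def)
  define h where "h = (\<lambda>(x,y). a x * b y)"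
  have h: "(\<lambda>z. norm (h z)) summable_on {1..} \<times> {1..}"
    unfolding Infinite_Sum.abs_summable_on_Sigma_iff[of h "{1..}" "\<lambda>_. {1..}"]
  proof (intro conjI ballI)
    fix x :: nat
    show "(\<lambda>y. norm (h (x, y))) summable_on {1..}"
      using b by (simp add: h_def norm_mult summable_on_cmult_right)
  next
    have "(\<lambda>x. norm (a x) * (\<Sum>\<^sub>\<infinity>y\<in>{1..}. norm (b y))) summable_on {1..}"
      using a by (rule summable_on_cmult_left)
    then show "(\<lambda>x. norm (\<Sum>\<^sub>\<infinity>y\<in>{1..}. norm (h (x, y)))) summable_on {1..}"
      using infsum_nonneg[of "{1..}" "\<lambda>y. norm (b y)"] by (simp add: h_def norm_mult infsum_cmult_right' abs_mult)
  qed
  define T where "T = Sigma {1..} (\<lambda>n. {d. d dvd (n::nat)})"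
  define k where "k = (\<lambda>(n,d). a d * b (n div d))"
  \<comment> \<open>Pairs \<open>(n, d)\<close> with \<open>d dvd n\<close> correspond to pairs
    \<open>(d, n div d)\<close> of positive integers.\<close>
  have bij: "bij_betw (\<lambda>(n,d). (d, n div d)) T ({1..} \<times> {1..})"
  proof (rule bij_betwI[where g = "\<lambda>(x,y). (x * y, x)"])
    show "(\<lambda>(n,d). (d, n div d)) \<in> T \<rightarrow> {1..} \<times> {1..}"
    proof (rule Pi_I)
      fix z assume "z \<in> T"
      then obtain n d where z: "z = (n, d)" "n \<ge> 1" "d dvd n" by (auto simp: T_def)
      then obtain e where "n = d * e" by (auto elim: dvdE)
      with z show "(\<lambda>(n,d). (d, n div d)) z \<in> {1..} \<times> {1..}" by (cases "d = 0"; cases "e = 0") auto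
    qed
    show "(\<lambda>(x,y). (x * y, x)) \<in> {1..} \<times> {1..} \<rightarrow> T" by (auto simp: T_def Suc_le_eq)
  qed (auto simp: T_def)
  have kh: "k = (\<lambda>z. h ((\<lambda>(n,d). (d, n div d)) z))" by (auto simp: k_def h_def)
  have kabs: "(\<lambda>z. norm (k z)) summable_on T"
    unfolding kh using summable_on_reindex_bij_betw[OF bij, of "\<lambda>z. norm (h z)"] h by simp
  have ksum: "infsum k T = infsum h ({1..} \<times> {1..})" unfolding kh by (rule infsum_reindex_bij_betw[OF bij])
  have inner: "(\<Sum>\<^sub>\<infinity>d\<in>{d. d dvd n}. k (n, d)) = dirichlet_conv f g n * of_nat n powr - s" if "n \<in> {1..}" for n
  proof -
    have n: "n > 0" using that by auto
    have "(\<Sum>\<^sub>\<infinity>d\<in>{d. d dvd n}. k (n, d)) = (\<Sum>d | d dvd n. k (n, d))" using n by (intro infsum_finite) auto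
    also have "\<dots> = (\<Sum>d | d dvd n. f d * g (n div d) * of_nat n powr - s)"
    proof (intro sum.cong refl)
      fix d assume d: "d \<in> {d. d dvd n}"
      have "d > 0" "n div d > 0" "d * (n div d) = n" using d n by (auto elim!: dvdE)
      then have "(of_nat n :: complex) powr - s = of_nat d powr - s * of_nat (n div d) powr - s"
        using of_nat_mult_powr[of d "n div d" "- s"] by simp
      then show "k (n, d) = f d * g (n div d) * of_nat n powr - s" by (simp add: k_def a_def b_def)
    qed
    finally show ?thesis by (simp add: dirichlet_conv_def sum_distrib_right)
  qed
  have inner_norm: "norm (dirichlet_conv f g n * of_nat n powr - s) \<le> (\<Sum>\<^sub>\<infinity>d\<in>{d. d dvd n}. norm (k (n, d)))" if "n \<in> {1..}" for n
    unfolding inner[OF that, symmetric]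
    by (rule norm_infsum_bound) (use that in \<open>auto intro!: summable_on_finite\<close>)
  have "(\<lambda>n. \<Sum>\<^sub>\<infinity>d\<in>{d. d dvd n}. norm (k (n, d))) summable_on {1..}"
    using kabs unfolding T_def by (rule summable_on_Sigma_banach[where f = "\<lambda>n d. norm (k (n, d))", unfolded case_prod_unfold prod.collapse])
  then show "dsummable (dirichlet_conv f g) s"
    unfolding dsummable_def by (rule summable_on_comparison_test) (use inner_norm in auto)
  have "dseries (dirichlet_conv f g) s = (\<Sum>\<^sub>\<infinity>n\<in>{1..}. \<Sum>\<^sub>\<infinity>d\<in>{d. d dvd n}. k (n, d))"
    unfolding dseries_def by (intro infsum_cong inner[symmetric])
  also have "\<dots> = infsum k T"
    unfolding T_def using abs_summable_summable[OF kabs] by (intro infsum_Sigma_banach) (simp add: T_def)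
  also have "\<dots> = (\<Sum>\<^sub>\<infinity>x\<in>{1..}. \<Sum>\<^sub>\<infinity>y\<in>{1..}. h (x, y))"
    unfolding ksum using abs_summable_summable[OF h] by (intro infsum_Sigma_banach[symmetric])
  also have "\<dots> = (\<Sum>\<^sub>\<infinity>x\<in>{1..}. a x) * (\<Sum>\<^sub>\<infinity>y\<in>{1..}. b y)"
    by (simp add: h_def infsum_cmult_right' infsum_cmult_left')
  finally show "dseries (dirichlet_conv f g) s = dseries f s * dseries g s"
    by (simp add: dseries_def a_def b_def)
qed

lemma dseries_dirichlet_power:
  assumes "dsummable g s"
  shows "dseries (dirichlet_power r g) s = dseries g s ^ r"
proof -
  have "dsummable (dirichlet_power r g) s \<and> dseries (dirichlet_power r g) s = dseries g s ^ r"
  proof (induction r)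
    case 0
    have eq: "(if n = 1 then 1 else 0) * of_nat n powr - s = (if n = 1 then 1 else (0::complex))" for n :: nat by simp
    have "((\<lambda>n. if n = 1 then 1 else (0::complex)) has_sum 1) {1::nat..}"
      by (rule has_sum_finite_neutralI[of "{1}"]) auto
    moreover have "(\<lambda>n. norm (if n = 1 then 1 else (0::complex))) summable_on {1::nat..}"
      by (rule summable_on_cong_neutral[THEN iffD1, OF _ _ _ summable_on_finite[of "{1}"]]) auto
    ultimately show ?case
      unfolding dirichlet_power.simps dsummable_def dseries_def eq by (simp add: infsumI)
  next
    case (Suc r)
    then show ?case using dsummable_dirichlet_conv[OF assms] dseries_dirichlet_conv[OF assms] by simp
  qed
  then show ?thesis by simp
qed

subsection \<open>Convolution with truncated exponentials over blocks\<close>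

lemma multiplicative_hcoef: "multiplicative (hcoef x)"
  by (auto simp: multiplicative_def intro!: hcoef_mult_coprime)

lemma hcoef_1 [simp]: "hcoef x (Suc 0) = 1"
  by (simp add: hcoef_def)

lemma coprime_if_disjoint_prime_factors:
  fixes m n :: nat
  assumes "m > 0" "n > 0" "prime_factors m \<inter> prime_factors n = {}"
  shows "coprime m n"
proof (rule ccontr)
  assume "\<not> coprime m n"
  then have "gcd m n \<noteq> 1" by (simp add: coprime_iff_gcd_eq_1)
  then obtain p where "prime p" "p dvd gcd m n" using prime_factor_nat by blast
  then have "p \<in> prime_factors m \<inter> prime_factors n" using assms by (auto simp: in_prime_factors_iff)
  then show False using assms by simp
qed

lemma prime_factors_dvd_subset: "d dvd n \<Longrightarrow> n > 0 \<Longrightarrow> prime_factors d \<subseteq> prime_factors n" for d n :: nat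
  by (rule dvd_prime_factors) auto

text \<open>The case of singleton blocks in \<open>sum_prod_bpart_le\<close>: an Euler product with
  exponents cut at \<open>E\<close>, as an inequality for non-negative terms. \<open>M\<close> is
  real-valued and assumed to factorize on \<open>S\<close> only, which suits weights such as
  \<open>4 ^ Omega m\<close>.\<close>

lemma multiplicative_sum_le_prod:
  fixes M :: "nat \<Rightarrow> real"
  assumes "finite P" "\<And>p. p \<in> P \<Longrightarrow> prime p" "finite S" "\<And>m. m \<in> S \<Longrightarrow> m > 0"
    "\<And>m. m \<in> S \<Longrightarrow> prime_factors m \<subseteq> P" "\<And>m p. m \<in> S \<Longrightarrow> p \<in> P \<Longrightarrow> multiplicity p m \<le> E"
    "\<And>m. M m \<ge> 0" "\<And>m. m \<in> S \<Longrightarrow> M m = (\<Prod>p\<in>prime_factors m. M (p ^ multiplicity p m))" "M 1 = 1"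
  shows "(\<Sum>m\<in>S. M m) \<le> (\<Prod>p\<in>P. \<Sum>e\<le>E. M (p ^ e))"
proof -
  have "M m = (\<Prod>p\<in>P. M (bpart {p} m))" if "m \<in> S" for m
  proof -
    have "M m = (\<Prod>p\<in>prime_factors m. M (p ^ multiplicity p m))" using assms(8) that by blast
    also have "\<dots> = (\<Prod>p\<in>P. M (p ^ multiplicity p m))"
      using assms(1,2,4,5,9) that
      by (intro prod.mono_neutral_left) (auto simp: in_prime_factors_iff not_dvd_imp_multiplicity_0)
    also have "\<dots> = (\<Prod>p\<in>P. M (bpart {p} m))" using assms(2) by (intro prod.cong refl) (simp add: bpart_prime)
    finally show ?thesis .
  qed
  then have "(\<Sum>m\<in>S. M m) = (\<Sum>m\<in>S. \<Prod>p\<in>P. M (bpart {p} m))" by (intro sum.cong) auto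
  also have "\<dots> \<le> (\<Prod>p\<in>P. \<Sum>x\<in>bpart {p} ` S. M x)"
    using assms by (intro sum_prod_bpart_le) (auto simp: disjoint_family_on_def)
  also have "\<dots> \<le> (\<Prod>p\<in>P. \<Sum>e\<le>E. M (p ^ e))"
  proof (intro prod_mono conjI sum_nonneg assms(7))
    fix p assume p: "p \<in> P"
    have "inj_on (\<lambda>e. p ^ e) {..E}" using prime_gt_1_nat[OF assms(2)[OF p]] by (auto simp: inj_on_def)
    then have "(\<Sum>e\<le>E. M (p ^ e)) = (\<Sum>x\<in>(\<lambda>e. p ^ e) ` {..E}. M x)" by (simp add: sum.reindex)
    moreover have "(\<Sum>x\<in>bpart {p} ` S. M x) \<le> (\<Sum>x\<in>(\<lambda>e. p ^ e) ` {..E}. M x)"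
      using assms p by (intro sum_mono2) (auto simp: bpart_prime)
    ultimately show "(\<Sum>x\<in>bpart {p} ` S. M x) \<le> (\<Sum>e\<le>E. M (p ^ e))" by simp
  qed
  finally show ?thesis .
qed

text \<open>Bounds the coefficients that arise from convolving \<open>g\<close> with any truncation
  of the exponential of \<open>x\<close>. It stays complex-valued, so that the lemmas on
  multiplicative functions and convolutions apply to it.\<close>

definition majorant :: "(nat \<Rightarrow> complex) \<Rightarrow> (nat \<Rightarrow> complex) \<Rightarrow> nat \<Rightarrow> complex" where
  "majorant g x = dirichlet_conv (\<lambda>n. of_real (norm (g n))) (hcoef (\<lambda>p. of_real (norm (x p))))"

lemma hcoef_norm: "hcoef (\<lambda>p. of_real (norm (x p))) n = complex_of_real (norm (hcoef x n))" for x :: "nat \<Rightarrow> complex"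
  by (simp add: hcoef_def norm_power norm_divide flip: prod_norm)

lemma norm_majorant: "norm (majorant g x n) = (\<Sum>d | d dvd n. norm (g d) * norm (hcoef x (n div d)))"
proof -
  have "majorant g x n = of_real (\<Sum>d | d dvd n. norm (g d) * norm (hcoef x (n div d)))"
    by (simp add: majorant_def dirichlet_conv_def hcoef_norm)
  then have "norm (majorant g x n) = \<bar>\<Sum>d | d dvd n. norm (g d) * norm (hcoef x (n div d))\<bar>"
    by (simp only: norm_of_real)
  then show ?thesis by (simp add: sum_nonneg)
qed

locale prime_blocks =
  fixes I :: "'i set" and B :: "'i \<Rightarrow> nat set" and l :: "'i \<Rightarrow> nat"
  assumes fin_I: "finite I" and disj: "disjoint_family_on B I"
    and fin_B: "\<And>i. i \<in> I \<Longrightarrow> finite (B i)" and prime_B: "\<And>i p. i \<in> I \<Longrightarrow> p \<in> B i \<Longrightarrow> prime p"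
begin

definition primes :: "nat set" where "primes = (\<Union>i\<in>I. B i)"

text \<open>The Dirichlet coefficients of the product over \<open>i\<close> of the exponential series of \<open>\<Sum>p\<in>B i. x p * p powr - s\<close>,
  each cut off after degree \<open>l i\<close>.\<close>

definition bexp :: "(nat \<Rightarrow> complex) \<Rightarrow> nat \<Rightarrow> complex" where
  "bexp x n = (if n > 0 \<and> prime_factors n \<subseteq> primes
     then \<Prod>i\<in>I. if Omega (bpart (B i) n) \<le> l i then hcoef x (bpart (B i) n) else 0 else 0)"

definition bsupp :: "nat set" where
  "bsupp = (\<lambda>g. \<Prod>i\<in>I. g i) ` PiE I (\<lambda>i. block_nums (B i) (l i))"

lemma finite_bsupp: "finite bsupp"
  unfolding bsupp_def using fin_I fin_B prime_B by (intro finite_imageI finite_PiE finite_block_nums) auto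

lemma bsupp_pos: "n \<in> bsupp \<Longrightarrow> n > 0"
  by (auto simp: bsupp_def PiE_def Pi_def block_nums_altdef intro!: prod_pos)

lemma bexp_prod:
  assumes "g \<in> PiE I (\<lambda>i. block_nums (B i) (l i))"
  shows "bexp x (\<Prod>i\<in>I. g i) = (\<Prod>i\<in>I. hcoef x (g i))"
proof -
  have g: "g i > 0" "prime_factors (g i) \<subseteq> B i" "Omega (g i) \<le> l i" if "i \<in> I" for i
    using assms that by (auto simp: PiE_def Pi_def block_nums_altdef)
  have b: "bpart (B i) (\<Prod>i\<in>I. g i) = g i" if "i \<in> I" for i
    by (rule bpart_prod[OF fin_I disj g(1,2) that])
  have "prime_factors (\<Prod>i\<in>I. g i) \<subseteq> primes"
  proof
    fix p assume "p \<in> prime_factors (\<Prod>i\<in>I. g i)"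
    then have p: "prime p" "p dvd (\<Prod>i\<in>I. g i)" by auto
    then obtain i where "i \<in> I" "p dvd g i" using prime_dvd_prod_iff[OF fin_I p(1)] by auto
    then show "p \<in> primes" using g[of i] p(1) by (auto simp: primes_def in_prime_factors_iff)
  qed
  moreover have "(\<Prod>i\<in>I. g i) > 0" using g by (intro prod_pos) auto
  ultimately show ?thesis using b g(3) by (simp add: bexp_def cong: prod.cong)
qed

lemma bexp_outside:
  assumes "n \<notin> bsupp"
  shows "bexp x n = 0"
proof (rule ccontr)
  assume nz: "bexp x n \<noteq> 0"
  then have n: "n > 0" "prime_factors n \<subseteq> primes" by (auto simp: bexp_def split: if_splits)
  have O: "Omega (bpart (B i) n) \<le> l i" if "i \<in> I" for i
    using nz n fin_I that by (auto simp: bexp_def split: if_splits)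
  have "restrict (\<lambda>i. bpart (B i) n) I \<in> PiE I (\<lambda>i. block_nums (B i) (l i))"
    using O by (auto simp: block_nums_altdef prime_factors_bpart)
  moreover have "n = (\<Prod>i\<in>I. restrict (\<lambda>i. bpart (B i) n) I i)"
    using prod_bpart[OF fin_I disj n(1)] n(2) by (simp add: primes_def)
  ultimately show False using assms unfolding bsupp_def by blast
qed

lemma sum_bexp:
  "(\<Sum>n\<in>bsupp. bexp x n * of_nat n powr s) = (\<Prod>i\<in>I. texp (l i) (\<Sum>p\<in>B i. x p * of_nat p powr s))"
proof -
  have "(\<Prod>i\<in>I. texp (l i) (\<Sum>p\<in>B i. x p * of_nat p powr s)) =
      (\<Sum>g\<in>PiE I (\<lambda>i. block_nums (B i) (l i)). (\<Prod>i\<in>I. hcoef x (g i)) * of_nat (\<Prod>i\<in>I. g i) powr s)"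
    using block_poly_expand[OF fin_I fin_B prime_B, where \<phi> = "\<lambda>_ _. 1" and f = x and s = s and l = l]
    by (simp add: texp_def)
  also have "\<dots> = (\<Sum>g\<in>PiE I (\<lambda>i. block_nums (B i) (l i)). bexp x (\<Prod>i\<in>I. g i) * of_nat (\<Prod>i\<in>I. g i) powr s)"
    by (intro sum.cong refl) (simp add: bexp_prod del: of_nat_prod)
  also have "\<dots> = (\<Sum>n\<in>bsupp. bexp x n * of_nat n powr s)"
    unfolding bsupp_def by (subst sum.reindex[OF block_prod_inj[OF fin_I disj]]) simp
  finally show ?thesis by simp
qed

lemma
  shows dsummable_bexp: "dsummable (bexp x) s"
    and dseries_bexp: "dseries (bexp x) s = (\<Prod>i\<in>I. texp (l i) (\<Sum>p\<in>B i. x p * of_nat p powr - s))"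
proof -
  have sub: "bsupp \<subseteq> {1..}" using bsupp_pos by (auto simp: Suc_le_eq)
  have "((\<lambda>n. bexp x n * of_nat n powr - s) has_sum (\<Sum>n\<in>bsupp. bexp x n * of_nat n powr - s)) {1..}"
    by (rule has_sum_finite_neutralI[OF finite_bsupp sub]) (auto simp: bexp_outside)
  then show "dseries (bexp x) s = (\<Prod>i\<in>I. texp (l i) (\<Sum>p\<in>B i. x p * of_nat p powr - s))"
    unfolding dseries_def by (simp add: infsumI sum_bexp)
  show "dsummable (bexp x) s" unfolding dsummable_def
    by (rule has_sum_imp_summable[OF has_sum_finite_neutralI[OF finite_bsupp sub _ refl]]) (auto simp: bexp_outside)
qed

text \<open>The cut-off condition inspects every block separately, so it cannot be violated by a
  product unless both factors share a block.\<close>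

lemma bexp_mult:
  assumes "d > 0" "e > 0" "\<And>i. i \<in> I \<Longrightarrow> bpart (B i) d = 1 \<or> bpart (B i) e = 1"
  shows "bexp x (d * e) = bexp x d * bexp x e"
proof -
  have "prime_factors (d * e) = prime_factors d \<union> prime_factors e"
    using assms by (simp add: prime_factorization_mult)
  moreover have "(\<Prod>i\<in>I. if Omega (bpart (B i) (d * e)) \<le> l i then hcoef x (bpart (B i) (d * e)) else 0) =
      (\<Prod>i\<in>I. (if Omega (bpart (B i) d) \<le> l i then hcoef x (bpart (B i) d) else 0) *
        (if Omega (bpart (B i) e) \<le> l i then hcoef x (bpart (B i) e) else 0))"
    by (intro prod.cong refl) (use assms in \<open>auto simp: bpart_mult dest!: assms(3)\<close>)
  ultimately show ?thesis using assms by (auto simp: bexp_def prod.distrib)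
qed

lemma coprime_blocks:
  assumes "j \<in> I" "J \<subseteq> I" "j \<notin> J" "m > 0" "n > 0"
    "prime_factors m \<subseteq> B j" "prime_factors n \<subseteq> (\<Union>i\<in>J. B i)"
  shows "coprime m n"
proof (rule coprime_if_disjoint_prime_factors[OF assms(4,5)])
  have "B j \<inter> (\<Union>i\<in>J. B i) = {}" using disj assms(1-3) by (fastforce simp: disjoint_family_on_def)
  then show "prime_factors m \<inter> prime_factors n = {}" using assms(6,7) by blast
qed

text \<open>Inside a block the truncation breaks multiplicativity; between blocks it survives by
  \<open>bexp_mult\<close>. Hence the blocks are split off one at a time, in an induction over
  subsets of \<open>I\<close>.\<close>

lemma conv_bexp_blocks:
  assumes g: "multiplicative g" "g 1 = 1" and n: "n > 0" "prime_factors n \<subseteq> primes"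
  shows "dirichlet_conv g (bexp x) n = (\<Prod>i\<in>I. dirichlet_conv g (bexp x) (bpart (B i) n))"
proof -
  define v where "v = dirichlet_conv g (bexp x)"
  have "v (\<Prod>i\<in>J. bpart (B i) n) = (\<Prod>i\<in>J. v (bpart (B i) n)) \<and> prime_factors (\<Prod>i\<in>J. bpart (B i) n) \<subseteq> (\<Union>i\<in>J. B i)"
    if "J \<subseteq> I" for J
    using finite_subset[OF that fin_I] that
  proof (induction J rule: finite_induct)
    case empty
    have "bexp x 1 = 1" by (simp add: bexp_def bpart_def)
    then show ?case using g by (simp add: v_def dirichlet_conv_def)
  next
    case (insert j J)
    define N where "N = (\<Prod>i\<in>J. bpart (B i) n)"
    define M where "M = bpart (B j) n"
    have N: "N > 0" "prime_factors N \<subseteq> (\<Union>i\<in>J. B i)" using insert by (auto simp: N_def)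
    have M: "M > 0" "prime_factors M \<subseteq> B j" by (auto simp: M_def prime_factors_bpart)
    have djJ: "B j \<inter> (\<Union>i\<in>J. B i) = {}" using disj insert by (fastforce simp: disjoint_family_on_def)
    have "v (M * N) = v M * v N"
      unfolding v_def
    proof (rule dirichlet_conv_coprime)
      show "coprime M N" using insert M N by (intro coprime_blocks[of j J]) auto
      fix d e assume de: "d dvd M" "e dvd N"
      have pos: "d > 0" "e > 0" using de M N by (auto intro: Nat.gr0I)
      have pd: "prime_factors d \<subseteq> B j" "prime_factors e \<subseteq> (\<Union>i\<in>J. B i)"
        using prime_factors_dvd_subset[OF de(1) M(1)] prime_factors_dvd_subset[OF de(2) N(1)] M N by auto
      have "coprime d e" using insert pos pd by (intro coprime_blocks[of j J]) auto
      then show "g (d * e) = g d * g e" using g(1) pos by (auto simp: multiplicative_def Suc_le_eq)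
      show "bexp x (d * e) = bexp x d * bexp x e"
      proof (rule bexp_mult[OF pos])
        fix i assume i: "i \<in> I"
        show "bpart (B i) d = 1 \<or> bpart (B i) e = 1"
        proof (cases "i = j")
          case True
          then have "prime_factors e \<inter> B i = {}" using pd djJ by blast
          then show ?thesis using bpart_eq_1 by blast
        next
          case False
          then have "B i \<inter> B j = {}" using disj i insert by (auto simp: disjoint_family_on_def)
          then have "prime_factors d \<inter> B i = {}" using pd by blast
          then show ?thesis using bpart_eq_1 by blast
        qed
      qed
    qed (use M N in auto)
    moreover have "prime_factors (M * N) \<subseteq> (\<Union>i\<in>insert j J. B i)"
      using M N by (auto simp: prime_factorization_mult)
    ultimately show ?case using insert by (simp add: M_def N_def)
  qed
  from this[of I] have "v (\<Prod>i\<in>I. bpart (B i) n) = (\<Prod>i\<in>I. v (bpart (B i) n))" by simp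
  then show ?thesis using prod_bpart[OF fin_I disj n(1)] n(2) by (simp add: v_def primes_def)
qed

lemma bexp_eq_hcoef:
  assumes "n > 0" "prime_factors n \<subseteq> primes" "\<And>i. i \<in> I \<Longrightarrow> Omega (bpart (B i) n) \<le> l i"
  shows "bexp x n = hcoef x n"
proof -
  have "(\<Prod>i\<in>J. hcoef x (bpart (B i) n)) = hcoef x (\<Prod>i\<in>J. bpart (B i) n) \<and>
      prime_factors (\<Prod>i\<in>J. bpart (B i) n) \<subseteq> (\<Union>i\<in>J. B i)" if "J \<subseteq> I" for J
    using finite_subset[OF that fin_I] that
  proof (induction J rule: finite_induct)
    case (insert j J)
    have pos: "(\<Prod>i\<in>J. bpart (B i) n) > 0" by (intro prod_pos) auto
    have "coprime (bpart (B j) n) (\<Prod>i\<in>J. bpart (B i) n)"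
      using insert pos by (intro coprime_blocks[of j J]) (auto simp: prime_factors_bpart)
    then show ?case
      using insert pos by (auto simp: hcoef_mult_coprime prime_factorization_mult prime_factors_bpart)
  qed simp
  from this[of I] have "(\<Prod>i\<in>I. hcoef x (bpart (B i) n)) = hcoef x n"
    using prod_bpart[OF fin_I disj assms(1)] assms(2) by (simp add: primes_def)
  then show ?thesis using assms by (simp add: bexp_def cong: prod.cong)
qed

lemma Omega_bpart_dvd: "d dvd n \<Longrightarrow> n > 0 \<Longrightarrow> Omega (bpart A d) \<le> Omega (bpart A n)"
proof -
  assume d: "d dvd n" "n > 0"
  then obtain e where e: "n = d * e" by (auto elim: dvdE)
  then have "bpart A n = bpart A d * bpart A e" using d by (intro bpart_mult[of d e A, folded e]) (auto intro: Nat.gr0I)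
  then show ?thesis by (simp add: Omega_mult)
qed

lemma conv_bexp_eq:
  assumes "n > 0" "prime_factors n \<subseteq> primes" "\<And>i. i \<in> I \<Longrightarrow> Omega (bpart (B i) n) \<le> l i"
  shows "dirichlet_conv g (bexp x) n = dirichlet_conv g (hcoef x) n"
  unfolding dirichlet_conv_def
proof (intro sum.cong refl)
  fix d assume "d \<in> {d. d dvd n}"
  then have d: "n div d dvd n" by (metis dvd_div_eq_mult dvd_triv_right mem_Collect_eq mult.commute dvdI dvd_mult_div_cancel)
  have "bexp x (n div d) = hcoef x (n div d)"
  proof (rule bexp_eq_hcoef)
    show "n div d > 0" using d assms(1) by (auto intro: Nat.gr0I)
    show "prime_factors (n div d) \<subseteq> primes" using prime_factors_dvd_subset[OF d assms(1)] assms(2) by auto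
    show "Omega (bpart (B i) (n div d)) \<le> l i" if "i \<in> I" for i
      using Omega_bpart_dvd[OF d assms(1), of "B i"] assms(3)[OF that] by linarith
  qed
  then show "g d * bexp x (n div d) = g d * hcoef x (n div d)" by simp
qed

lemma norm_bexp_le: 
  assumes "i \<in> I" "n > 0" "prime_factors n \<subseteq> B i"
  shows "norm (bexp x n) \<le> norm (hcoef x n)"
proof (cases "Omega n \<le> l i")
  case True
  have "bexp x n = hcoef x n"
  proof (rule bexp_eq_hcoef)
    fix j assume "j \<in> I"
    show "Omega (bpart (B j) n) \<le> l j"
    proof (cases "i = j")
      case False
      then have "B i \<inter> B j = {}" using disj assms(1) \<open>j \<in> I\<close> by (auto simp: disjoint_family_on_def)
      then have "bpart (B j) n = 1" using assms(3) by (intro bpart_eq_1) blast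
      then show ?thesis by simp
    qed (use True assms bpart_id in auto)
  qed (use assms in \<open>auto simp: primes_def\<close>)
  then show ?thesis by simp
next
  case False
  then have "bexp x n = 0" using assms bpart_id[OF assms(2,3)] fin_I by (auto simp: bexp_def intro!: bexI[of _ i])
  then show ?thesis by simp
qed

text \<open>If \<open>Omega n <= l i\<close> the truncation is not felt. Otherwise
  \<open>4 ^ Omega n / 4 ^ l i >= 1\<close>, and this factor is inserted in front of the majorant:
  the second term then factorizes over primes and carries the small constant
  \<open>(1 / 4) ^ l i\<close>.\<close>

lemma conv_bexp_block_bound:
  assumes "i \<in> I" "n > 0" "prime_factors n \<subseteq> B i"
  shows "(norm (dirichlet_conv g (bexp x) n))\<^sup>2 \<le> (norm (dirichlet_conv g (hcoef x) n))\<^sup>2 +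
    (1 / 4) ^ l i * (4 ^ Omega n * (norm (majorant g x n))\<^sup>2)"
proof (cases "Omega n \<le> l i")
  case True
  have "dirichlet_conv g (bexp x) n = dirichlet_conv g (hcoef x) n"
  proof (rule conv_bexp_eq)
    fix j assume "j \<in> I"
    show "Omega (bpart (B j) n) \<le> l j"
    proof (cases "i = j")
      case False
      then have "B i \<inter> B j = {}" using disj assms(1) \<open>j \<in> I\<close> by (auto simp: disjoint_family_on_def)
      then have "bpart (B j) n = 1" using assms(3) by (intro bpart_eq_1) blast
      then show ?thesis by simp
    qed (use True assms bpart_id in auto)
  qed (use assms in \<open>auto simp: primes_def\<close>)
  then show ?thesis by simp
next
  case False
  have "norm (dirichlet_conv g (bexp x) n) \<le> (\<Sum>d | d dvd n. norm (g d * bexp x (n div d)))"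
    unfolding dirichlet_conv_def by (rule norm_sum)
  also have "\<dots> \<le> norm (majorant g x n)"
    unfolding norm_majorant
  proof (rule sum_mono)
    fix d assume "d \<in> {d. d dvd n}"
    then obtain e where e: "n = d * e" by (auto elim: dvdE)
    then have "d > 0" "e > 0" using assms(2) by (auto intro: Nat.gr0I)
    then have nd: "n div d = e" "e dvd n" using e by auto
    have "norm (bexp x e) \<le> norm (hcoef x e)"
      using prime_factors_dvd_subset[OF nd(2) assms(2)] assms \<open>e > 0\<close> by (intro norm_bexp_le[OF assms(1)]) auto
    then show "norm (g d * bexp x (n div d)) \<le> norm (g d) * norm (hcoef x (n div d))"
      by (simp add: nd norm_mult mult_left_mono)
  qed
  finally have "(norm (dirichlet_conv g (bexp x) n))\<^sup>2 \<le> (norm (majorant g x n))\<^sup>2" by (intro power_mono) auto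
  also have "\<dots> = 1 * (norm (majorant g x n))\<^sup>2" by simp
  also have "\<dots> \<le> ((1 / 4) ^ l i * 4 ^ Omega n) * (norm (majorant g x n))\<^sup>2"
  proof (intro mult_right_mono)
    have "(4::real) ^ l i \<le> 4 ^ Omega n" using False by (intro power_increasing) auto
    then show "1 \<le> (1 / 4 :: real) ^ l i * 4 ^ Omega n" by (simp add: power_divide)
  qed simp
  finally show ?thesis by (simp add: add_increasing mult.assoc)
qed

lemma sum_conv_bexp_le_prod:
  assumes g: "multiplicative g" "g 1 = 1"
    and S: "finite S" "\<And>n. n \<in> S \<Longrightarrow> n > 0" "\<And>n. n \<in> S \<Longrightarrow> prime_factors n \<subseteq> primes"
  shows "(\<Sum>n\<in>S. (norm (dirichlet_conv g (bexp x) n))\<^sup>2 / real n) \<le>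
    (\<Prod>i\<in>I. \<Sum>m\<in>bpart (B i) ` S. (norm (dirichlet_conv g (bexp x) m))\<^sup>2 / real m)"
proof -
  define v where "v = dirichlet_conv g (bexp x)"
  have "(\<Sum>n\<in>S. (norm (v n))\<^sup>2 / real n) = (\<Sum>n\<in>S. \<Prod>i\<in>I. (norm (v (bpart (B i) n)))\<^sup>2 / real (bpart (B i) n))"
  proof (intro sum.cong refl)
    fix n assume n: "n \<in> S"
    have "real n = (\<Prod>i\<in>I. real (bpart (B i) n))"
      using prod_bpart[OF fin_I disj] S(2,3)[OF n] by (metis of_nat_prod primes_def)
    moreover have "(norm (v n))\<^sup>2 = (\<Prod>i\<in>I. (norm (v (bpart (B i) n)))\<^sup>2)"
      unfolding v_def conv_bexp_blocks[OF g S(2,3)[OF n]] prod_norm[symmetric] by (rule prod_power_distrib)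
    ultimately show "(norm (v n))\<^sup>2 / real n = (\<Prod>i\<in>I. (norm (v (bpart (B i) n)))\<^sup>2 / real (bpart (B i) n))"
      by (simp add: prod_dividef)
  qed
  also have "\<dots> \<le> (\<Prod>i\<in>I. \<Sum>m\<in>bpart (B i) ` S. (norm (v m))\<^sup>2 / real m)"
    using S by (intro sum_prod_bpart_le fin_I disj) (auto simp: primes_def)
  finally show ?thesis by (simp only: v_def)
qed

text \<open>Both terms of \<open>conv_bexp_block_bound\<close> are sums of multiplicative quantities
  and are bounded by Euler products. The first product belongs to the untruncated exponential; the
  second one is merely bounded later on, its weight \<open>(1 / 4) ^ l i\<close> being summable over
  the blocks.\<close>

lemma conv_bexp_block_sum:
  assumes g: "multiplicative g" "g 1 = 1" and i: "i \<in> I"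
    and T: "finite T" "\<And>m. m \<in> T \<Longrightarrow> m > 0" "\<And>m. m \<in> T \<Longrightarrow> prime_factors m \<subseteq> B i"
    and TE: "\<And>m p. m \<in> T \<Longrightarrow> p \<in> B i \<Longrightarrow> multiplicity p m \<le> E"
  shows "(\<Sum>m\<in>T. (norm (dirichlet_conv g (bexp x) m))\<^sup>2 / real m) \<le>
    (\<Prod>p\<in>B i. \<Sum>e\<le>E. (norm (dirichlet_conv g (hcoef x) (p ^ e)))\<^sup>2 / real (p ^ e)) +
      (1 / 4) ^ l i * (\<Prod>p\<in>B i. \<Sum>e\<le>E. 4 ^ e * (norm (majorant g x (p ^ e)))\<^sup>2 / real (p ^ e))"
proof -
  define v where "v = dirichlet_conv g (bexp x)"
  define w where "w = dirichlet_conv g (hcoef x)"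
  define u where "u = majorant g x"
  have multw: "multiplicative w" unfolding w_def by (intro multiplicative_dirichlet_conv g multiplicative_hcoef)
  have multu: "multiplicative u" unfolding u_def majorant_def
    by (intro multiplicative_dirichlet_conv multiplicative_hcoef)
       (use g(1) in \<open>auto simp: multiplicative_def norm_mult\<close>)
  have w1: "w 1 = 1" and u1: "u 1 = 1" using g by (auto simp: w_def u_def majorant_def dirichlet_conv_def)
    have real_n: "real m = (\<Prod>p\<in>prime_factors m. real (p ^ multiplicity p m))" if "m \<in> T" for m
      using nat_prime_decomp[OF T(2)[OF that]] by (metis of_nat_prod)
    have "(\<Sum>m\<in>T. (norm (v m))\<^sup>2 / real m) \<le>
       (\<Sum>m\<in>T. (norm (w m))\<^sup>2 / real m + (1 / 4) ^ l i * (4 ^ Omega m * (norm (u m))\<^sup>2 / real m))"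
    proof (rule sum_mono)
      fix m assume m: "m \<in> T"
      have "(norm (v m))\<^sup>2 / real m \<le> ((norm (w m))\<^sup>2 + (1 / 4) ^ l i * (4 ^ Omega m * (norm (u m))\<^sup>2)) / real m"
        unfolding v_def w_def u_def by (intro divide_right_mono conv_bexp_block_bound i T m) auto
      then show "(norm (v m))\<^sup>2 / real m \<le> (norm (w m))\<^sup>2 / real m + (1 / 4) ^ l i * (4 ^ Omega m * (norm (u m))\<^sup>2 / real m)"
        by (simp add: add_divide_distrib)
    qed
    also have "\<dots> = (\<Sum>m\<in>T. (norm (w m))\<^sup>2 / real m) + (1 / 4) ^ l i * (\<Sum>m\<in>T. 4 ^ Omega m * (norm (u m))\<^sup>2 / real m)"
      by (simp add: sum.distrib sum_distrib_left)
    also have "\<dots> \<le> (\<Prod>p\<in>B i. \<Sum>e\<le>E. (norm (w (p ^ e)))\<^sup>2 / real (p ^ e)) +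
      (1 / 4) ^ l i * (\<Prod>p\<in>B i. \<Sum>e\<le>E. 4 ^ Omega (p ^ e) * (norm (u (p ^ e)))\<^sup>2 / real (p ^ e))"
    proof (intro add_mono mult_left_mono)
      show "(\<Sum>m\<in>T. (norm (w m))\<^sup>2 / real m) \<le> (\<Prod>p\<in>B i. \<Sum>e\<le>E. (norm (w (p ^ e)))\<^sup>2 / real (p ^ e))"
      proof (rule multiplicative_sum_le_prod[OF fin_B[OF i] prime_B[OF i] T TE])
        fix m assume m: "m \<in> T"
        have "(norm (w m))\<^sup>2 = (\<Prod>p\<in>prime_factors m. (norm (w (p ^ multiplicity p m)))\<^sup>2)"
          unfolding multiplicative_prod_prime_powers[OF multw w1 T(2)[OF m]] prod_norm[symmetric] by (rule prod_power_distrib)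
        then show "(norm (w m))\<^sup>2 / real m = (\<Prod>p\<in>prime_factors m. (norm (w (p ^ multiplicity p m)))\<^sup>2 / real (p ^ multiplicity p m))"
          using real_n[OF m] by (simp only: prod_dividef)
      qed (use w1 in auto)
      show "(\<Sum>m\<in>T. 4 ^ Omega m * (norm (u m))\<^sup>2 / real m) \<le>
        (\<Prod>p\<in>B i. \<Sum>e\<le>E. 4 ^ Omega (p ^ e) * (norm (u (p ^ e)))\<^sup>2 / real (p ^ e))"
      proof (rule multiplicative_sum_le_prod[OF fin_B[OF i] prime_B[OF i] T TE])
        fix m assume m: "m \<in> T"
        have "(norm (u m))\<^sup>2 = (\<Prod>p\<in>prime_factors m. (norm (u (p ^ multiplicity p m)))\<^sup>2)"
          unfolding multiplicative_prod_prime_powers[OF multu u1 T(2)[OF m]] prod_norm[symmetric] by (rule prod_power_distrib)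
        moreover have "(4::real) ^ Omega m = (\<Prod>p\<in>prime_factors m. 4 ^ Omega (p ^ multiplicity p m))"
        proof -
          have "Omega m = (\<Sum>p\<in>prime_factors m. multiplicity p m)"
            unfolding Omega_def size_multiset_overloaded_eq
            by (intro sum.cong refl) (auto simp: count_prime_factorization dest: in_prime_factors_imp_prime)
          also have "\<dots> = (\<Sum>p\<in>prime_factors m. Omega (p ^ multiplicity p m))"
            by (intro sum.cong refl) (auto simp: Omega_prime_power dest: in_prime_factors_imp_prime)
          finally show ?thesis by (simp add: power_sum)
        qed
        ultimately show "4 ^ Omega m * (norm (u m))\<^sup>2 / real m =
            (\<Prod>p\<in>prime_factors m. 4 ^ Omega (p ^ multiplicity p m) * (norm (u (p ^ multiplicity p m)))\<^sup>2 / real (p ^ multiplicity p m))"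
          using real_n[OF m] by (simp only: prod_dividef prod.distrib)
      qed (use u1 in auto)
    qed auto
    also have "(\<Prod>p\<in>B i. \<Sum>e\<le>E. 4 ^ Omega (p ^ e) * (norm (u (p ^ e)))\<^sup>2 / real (p ^ e)) =
       (\<Prod>p\<in>B i. \<Sum>e\<le>E. 4 ^ e * (norm (u (p ^ e)))\<^sup>2 / real (p ^ e))"
      using prime_B[OF i] by (intro prod.cong sum.cong refl) (simp add: Omega_prime_power)
    finally show ?thesis by (simp only: v_def w_def u_def)
qed

text \<open>For the block of the small primes, which has length 0: its truncated exponential is the
  constant 1.\<close>

lemma conv_bexp_trivial_block:
  assumes i: "i \<in> I" "l i = 0" and m: "m > 0" "prime_factors m \<subseteq> B i"
  shows "dirichlet_conv g (bexp x) m = g m"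
proof -
  have "bexp x e = (if e = 1 then 1 else 0)" if "e dvd m" for e
  proof (cases "e = 1")
    case True
    then show ?thesis by (simp add: bexp_def bpart_def)
  next
    case False
    have e: "e > 0" "prime_factors e \<subseteq> B i"
      using that m prime_factors_dvd_subset[OF that m(1)] by (auto intro: Nat.gr0I)
    then have "Omega (bpart (B i) e) > 0" using False prime_factorization_empty_iff[of e]
      by (auto simp: bpart_id Omega_def nonempty_has_size[symmetric])
    then have "bexp x e = 0" using i fin_I by (auto simp: bexp_def intro!: bexI[of _ i])
    then show ?thesis using False by simp
  qed
  then have "dirichlet_conv g (bexp x) m = (\<Sum>d | d dvd m. if d = m then g m else 0)"
    unfolding dirichlet_conv_def
  proof (intro sum.cong refl)
    fix d assume *: "\<And>e. e dvd m \<Longrightarrow> bexp x e = (if e = 1 then 1 else 0)" "d \<in> {d. d dvd m}"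
    then obtain e where e: "m = d * e" by (auto elim: dvdE)
    then have "d > 0" "m div d = e" "e dvd m" using m by (auto intro: Nat.gr0I)
    then show "g d * bexp x (m div d) = (if d = m then g m else 0)" using e *(1)[of e] m(1) by auto
  qed
  then show ?thesis using m by simp
qed

text \<open>The basis of the lower bound: at a square-free integer with few prime factors in each
  block no truncation is felt, and the coefficient is an exact product over the primes.\<close>

lemma conv_bexp_squarefree:
  assumes g: "multiplicative g" "g 1 = 1" and S: "finite S" "S \<subseteq> primes" "\<And>i. i \<in> I \<Longrightarrow> card (S \<inter> B i) \<le> l i"
  shows "dirichlet_conv g (bexp x) (\<Prod>S) = (\<Prod>p\<in>S. g p + x p)"
proof -
  have pS: "prime p" if "p \<in> S" for p using that S(2) prime_B by (auto simp: primes_def)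
  define n where "n = \<Prod>S"
  have "prime_factorization (prod_mset (mset_set S)) = mset_set S"
    by (rule prime_factorization_prod_mset_primes) (use S(1) pS in auto)
  then have pf: "prime_factorization n = mset_set S" by (simp add: n_def prod_unfold_prod_mset)
  have n0: "n > 0" unfolding n_def using pS by (intro prod_pos) (auto simp: prime_gt_0_nat)
  have pfn: "prime_factors n = S" using S(1) by (simp add: pf)
  have mult1: "multiplicity p n = 1" if "p \<in> S" for p
  proof -
    have "multiplicity p n = count (prime_factorization n) p" using pS[OF that] by (simp add: count_prime_factorization)
    then show ?thesis using S(1) that by (simp add: pf)
  qed
  have "dirichlet_conv g (bexp x) n = dirichlet_conv g (hcoef x) n"
  proof (rule conv_bexp_eq[OF n0])
    show "prime_factors n \<subseteq> primes" using pfn S(2) by simp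
    fix i assume i: "i \<in> I"
    have "Omega (bpart (B i) n) = size (mset_set {p \<in> S. p \<in> B i})"
      using S(1) by (simp add: Omega_def prime_factorization_bpart pf)
    also have "{p \<in> S. p \<in> B i} = S \<inter> B i" by auto
    finally have "Omega (bpart (B i) n) = card (S \<inter> B i)" by simp
    then show "Omega (bpart (B i) n) \<le> l i" using S(3)[OF i] by simp
  qed
  also have "\<dots> = (\<Prod>p\<in>prime_factors n. dirichlet_conv g (hcoef x) (p ^ multiplicity p n))"
    by (intro multiplicative_prod_prime_powers multiplicative_dirichlet_conv g multiplicative_hcoef n0)
       (use g in \<open>simp add: dirichlet_conv_def\<close>)
  also have "\<dots> = (\<Prod>p\<in>S. g p + x p)"
    unfolding pfn
  proof (intro prod.cong refl)
    fix p assume p: "p \<in> S"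
    have "dirichlet_conv g (hcoef x) (p ^ 1) = g p + x p"
      using g(2) hcoef_prime_power[OF pS[OF p], of x 1]
      by (subst dirichlet_conv_prime_power[OF pS[OF p]]) simp
    then show "dirichlet_conv g (hcoef x) (p ^ multiplicity p n) = g p + x p" using mult1[OF p] by simp
  qed
  finally show ?thesis by (simp add: n_def)
qed

end

subsection \<open>Blocks of primes of doubly exponential size\<close>

text \<open>The double logarithm of the bound on \<open>p\<close> advances by \<open>ln 4\<close>
  with each \<open>j\<close>, so the Mertens-type hypothesis gives every block a bounded sum
  \<open>N * ln 4 + O(1)\<close>.\<close>

definition pr :: "nat \<Rightarrow> nat set" where "pr j = {p. prime p \<and> ln (real p) \<le> 4 ^ j}"

definition bl :: "nat \<Rightarrow> nat set" where "bl i = pr (Suc i) - pr i"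

lemma pr_altdef: "pr j = {p. prime p \<and> real p \<le> exp (4 ^ j)}"
proof -
  have "ln (real p) \<le> 4 ^ j \<longleftrightarrow> real p \<le> exp (4 ^ j)" if "prime p" for p
    using prime_gt_0_nat[OF that] by (metis exp_le_cancel_iff exp_ln of_nat_0_less_iff)
  then show ?thesis by (auto simp: pr_def)
qed

lemma finite_pr: "finite (pr j)"
proof (rule finite_subset)
  show "pr j \<subseteq> {..nat \<lfloor>exp ((4::real) ^ j)\<rfloor>}" by (auto simp: pr_altdef le_nat_floor)
qed simp

lemma pr_mono: "i \<le> j \<Longrightarrow> pr i \<subseteq> pr j"
proof
  fix p assume "i \<le> j" "p \<in> pr i"
  moreover have "(4::real) ^ i \<le> 4 ^ j" using \<open>i \<le> j\<close> by (intro power_increasing) auto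
  ultimately show "p \<in> pr j" by (auto simp: pr_def intro: order_trans)
qed

lemma finite_bl: "finite (bl i)" by (simp add: bl_def finite_pr)

lemma in_bl_iff: "p \<in> bl i \<longleftrightarrow> prime p \<and> 4 ^ i < ln (real p) \<and> ln (real p) \<le> 4 ^ Suc i"
  by (auto simp: bl_def pr_def)

lemma bl_disjoint:
  assumes "i < j"
  shows "bl i \<inter> bl j = {}"
  using pr_mono[of "Suc i" j] assms by (auto simp: bl_def)

lemma disjoint_bl: "disjoint_family_on bl A"
  using bl_disjoint by (auto simp: disjoint_family_on_def) (metis Int_iff empty_iff linorder_neqE_nat)

lemma pr_diff_eq_UN:
  assumes "i \<le> j"
  shows "pr j - pr i = (\<Union>k\<in>{i..<j}. bl k)"
  using assms
proof (induction j rule: dec_induct)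
  case (step n)
  have "pr (Suc n) - pr i = (pr n - pr i) \<union> bl n"
    using pr_mono[of i n] pr_mono[of n "Suc n"] step by (auto simp: bl_def)
  then show ?case using step by (simp add: atLeastLessThanSuc Un_commute)
qed simp

lemma sum_pr_diff:
  assumes "i \<le> j"
  shows "(\<Sum>p\<in>pr j - pr i. h p) = (\<Sum>k=i..<j. \<Sum>p\<in>bl k. h p)"
  unfolding pr_diff_eq_UN[OF assms] using disjoint_bl[of UNIV]
  by (intro sum.UNION_disjoint) (auto simp: finite_bl disjoint_family_on_def)

lemma real_le_power_4: "real j \<le> 4 ^ j"
proof (induction j)
  case (Suc j)
  have "(1::real) \<le> 4 ^ j" by simp
  with Suc show ?case unfolding power_Suc of_nat_Suc by linarith
qed simp

lemma geometric_sum_le_2: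
  fixes y :: real
  assumes "0 \<le> y" "y \<le> 1 / 2"
  shows "(\<Sum>e<n. y ^ e) \<le> 2"
proof (induction n)
  case (Suc n)
  have "(\<Sum>e<Suc n. y ^ e) = 1 + y * (\<Sum>e<n. y ^ e)"
    by (simp add: sum.lessThan_Suc_shift sum_distrib_left del: sum.lessThan_Suc)
  also have "\<dots> \<le> 1 + 1 / 2 * 2"
    using assms Suc by (intro add_left_mono mult_mono) (auto intro!: sum_nonneg)
  finally show ?case by simp
qed simp

text \<open>The \<open>O\<close>-estimate holds from some \<open>j0\<close> on; the finitely many
  earlier deviations are added to the constant, so that it serves for every
  \<open>j\<close>.\<close>

lemma prime_sum_bound:
  fixes F :: "nat \<Rightarrow> real"
  assumes "(\<lambda>x::real. (\<Sum>p | prime p \<and> real p \<le> x. F p) - N * ln (ln x)) \<in> O[at_top](\<lambda>_. 1)"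
  obtains C where "\<And>j. \<bar>(\<Sum>p\<in>pr j. F p) - N * real j * ln 4\<bar> \<le> C"
proof -
  define G where "G = (\<lambda>x::real. (\<Sum>p | prime p \<and> real p \<le> x. F p) - N * ln (ln x))"
  obtain c where c: "c > 0" "eventually (\<lambda>x. norm (G x) \<le> c * norm (1::real)) at_top"
    using assms unfolding G_def by (elim landau_o.bigE)
  then obtain x0 where x0: "\<And>x. x \<ge> x0 \<Longrightarrow> \<bar>G x\<bar> \<le> c" unfolding eventually_at_top_linorder by auto
  obtain j0 where j0: "x0 \<le> real j0" using real_arch_simple by blast
  have G: "G (exp (4 ^ j)) = (\<Sum>p\<in>pr j. F p) - N * real j * ln 4" for j
    by (simp add: G_def pr_altdef ln_realpow)
  have big: "\<bar>(\<Sum>p\<in>pr j. F p) - N * real j * ln 4\<bar> \<le> c" if "j \<ge> j0" for j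
  proof -
    have "x0 \<le> real j" using j0 that by linarith
    also have "real j \<le> 4 ^ j" by (rule real_le_power_4)
    also have "\<dots> \<le> exp (4 ^ j)" using exp_ge_add_one_self[of "4 ^ j"] by linarith
    finally show ?thesis using x0[of "exp (4 ^ j)"] G by simp
  qed
  define C where "C = c + (\<Sum>j<j0. \<bar>(\<Sum>p\<in>pr j. F p) - N * real j * ln 4\<bar>)"
  have "\<bar>(\<Sum>p\<in>pr j. F p) - N * real j * ln 4\<bar> \<le> C" for j
  proof (cases "j < j0")
    case True
    have "\<bar>(\<Sum>p\<in>pr j. F p) - N * real j * ln 4\<bar> \<le> (\<Sum>j<j0. \<bar>(\<Sum>p\<in>pr j. F p) - N * real j * ln 4\<bar>)"
      using True by (intro member_le_sum) auto
    then show ?thesis using c by (simp add: C_def)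
  next
    case False
    then have "\<bar>(\<Sum>p\<in>pr j. F p) - N * real j * ln 4\<bar> \<le> c" by (intro big) simp
    moreover have "(\<Sum>j<j0. \<bar>(\<Sum>p\<in>pr j. F p) - N * real j * ln 4\<bar>) \<ge> 0" by (intro sum_nonneg) auto
    ultimately show ?thesis unfolding C_def by linarith
  qed
  then show ?thesis by (rule that)
qed

lemma block_sum_bound:
  fixes F :: "nat \<Rightarrow> real"
  assumes "\<And>j. \<bar>(\<Sum>p\<in>pr j. F p) - N * real j * ln 4\<bar> \<le> C"
  shows "(\<Sum>p\<in>bl i. F p) \<le> N * ln 4 + 2 * C"
proof -
  have "(\<Sum>p\<in>bl i. F p) = (\<Sum>p\<in>pr (Suc i). F p) - (\<Sum>p\<in>pr i. F p)"
    unfolding bl_def by (intro sum_diff finite_pr pr_mono) simp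
  then show ?thesis using assms[of "Suc i"] assms[of i] by (simp add: algebra_simps abs_le_iff)
qed

lemma prime_powr_bl:
  assumes "p \<in> bl i" "\<eta> > 0"
  shows "real p powr - \<eta> \<le> exp (- \<eta> * 4 ^ i)"
proof -
  have p: "prime p" "4 ^ i < ln (real p)" using assms by (auto simp: in_bl_iff)
  have "real p powr - \<eta> = exp (- \<eta> * ln (real p))" using prime_gt_0_nat[OF p(1)] by (simp add: powr_def)
  also have "\<dots> \<le> exp (- \<eta> * 4 ^ i)" using p assms by simp
  finally show ?thesis .
qed

text \<open>In block \<open>k\<close> the factor \<open>p powr - \<eta>\<close> is at most
  \<open>exp (- \<eta> * 4 ^ k) <= 1 / (\<eta> * 4 ^ k)\<close>, so the bounded block sums are
  weighted by a geometric sequence.\<close>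

lemma sum_powr_decay:
  fixes F :: "nat \<Rightarrow> real"
  assumes "\<And>i. (\<Sum>p\<in>bl i. F p) \<le> D" "\<And>p. F p \<ge> 0" "\<eta> > 0" "i \<le> j"
  shows "(\<Sum>p\<in>pr j - pr i. F p * real p powr - \<eta>) \<le> 2 * D / \<eta>"
proof -
  have D: "D \<ge> 0" using assms(1)[of 0] sum_nonneg[of "bl 0" F] assms(2) by (meson order_trans)
  have "(\<Sum>p\<in>pr j - pr i. F p * real p powr - \<eta>) = (\<Sum>k=i..<j. \<Sum>p\<in>bl k. F p * real p powr - \<eta>)"
    by (rule sum_pr_diff[OF assms(4)])
  also have "\<dots> \<le> (\<Sum>k=i..<j. D / \<eta> * (1 / 4) ^ k)"
  proof (rule sum_mono)
    fix k
    have "(\<Sum>p\<in>bl k. F p * real p powr - \<eta>) \<le> (\<Sum>p\<in>bl k. F p * exp (- \<eta> * 4 ^ k))"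
      using assms by (intro sum_mono mult_left_mono prime_powr_bl) auto
    also have "\<dots> = (\<Sum>p\<in>bl k. F p) * exp (- \<eta> * 4 ^ k)" by (simp add: sum_distrib_right)
    also have "\<dots> \<le> D * (1 / (\<eta> * 4 ^ k))"
    proof (intro mult_mono assms D)
      have "\<eta> * 4 ^ k \<le> exp (\<eta> * 4 ^ k)" using exp_ge_add_one_self[of "\<eta> * 4 ^ k"] by linarith
      then have "1 / exp (\<eta> * 4 ^ k) \<le> 1 / (\<eta> * 4 ^ k)" using assms by (intro divide_left_mono mult_pos_pos) auto
      then show "exp (- \<eta> * 4 ^ k) \<le> 1 / (\<eta> * 4 ^ k)" by (simp add: exp_minus inverse_eq_divide)
    qed simp
    finally show "(\<Sum>p\<in>bl k. F p * real p powr - \<eta>) \<le> D / \<eta> * (1 / 4) ^ k" by (simp add: power_divide)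
  qed
  also have "\<dots> = D / \<eta> * (\<Sum>k=i..<j. (1 / 4) ^ k)" by (simp add: sum_distrib_left)
  also have "\<dots> \<le> D / \<eta> * 2"
  proof (intro mult_left_mono)
    have "(\<Sum>k=i..<j. (1 / 4 :: real) ^ k) \<le> (\<Sum>k<j. (1 / 4) ^ k)" by (intro sum_mono2) auto
    also have "\<dots> \<le> 2" by (rule geometric_sum_le_2) auto
    finally show "(\<Sum>k=i..<j. (1 / 4 :: real) ^ k) \<le> 2" .
  qed (use D assms in auto)
  finally show ?thesis by (simp add: mult.commute)
qed

lemma geometric_tail_le:
  fixes y :: real
  assumes "0 \<le> y" "y \<le> 1 / 2" "finite A" "\<And>e. e \<in> A \<Longrightarrow> e \<ge> m"
  shows "(\<Sum>e\<in>A. y ^ e) \<le> 2 * y ^ m"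
proof -
  define M where "M = Max (insert m A)"
  have "(\<Sum>e\<in>A. y ^ e) \<le> (\<Sum>e=m..M. y ^ e)"
    using assms by (intro sum_mono2) (auto simp: M_def)
  also have "\<dots> = (\<Sum>e=0..M - m. y ^ (m + e))"
    using assms(3) by (subst sum.atLeastAtMost_shift_0) (auto simp: M_def add.commute)
  also have "\<dots> = y ^ m * (\<Sum>e\<le>M - m. y ^ e)" by (simp add: power_add sum_distrib_left atLeast0AtMost)
  also have "\<dots> \<le> y ^ m * 2"
  proof (rule mult_left_mono)
    show "(\<Sum>e\<le>M - m. y ^ e) \<le> 2"
      unfolding lessThan_Suc_atMost[symmetric] by (rule geometric_sum_le_2[OF assms(1,2)])
  qed (use assms in auto)
  finally show ?thesis by simp
qed

lemma norm_majorant_prime_power: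
  assumes "prime p"
  shows "norm (majorant g x (p ^ e)) = (\<Sum>i\<le>e. norm (g (p ^ i)) * (norm (x p) ^ (e - i) / fact (e - i)))"
proof -
  have "norm (majorant g x (p ^ e)) = (\<Sum>d | d dvd p ^ e. norm (g d) * norm (hcoef x (p ^ e div d)))"
    by (rule norm_majorant)
  also have "{d. d dvd p ^ e} = (\<lambda>i. p ^ i) ` {..e}" using divides_primepow_nat[OF assms] by auto
  also have "(\<Sum>d\<in>(\<lambda>i. p ^ i) ` {..e}. norm (g d) * norm (hcoef x (p ^ e div d))) =
      (\<Sum>i\<le>e. norm (g (p ^ i)) * norm (hcoef x (p ^ e div p ^ i)))"
    using prime_gt_1_nat[OF assms] by (subst sum.reindex) (auto simp: inj_on_def)
  also have "\<dots> = (\<Sum>i\<le>e. norm (g (p ^ i)) * (norm (x p) ^ (e - i) / fact (e - i)))"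
  proof (intro sum.cong refl)
    fix i assume "i \<in> {..e}"
    then have "p ^ e div p ^ i = p ^ (e - i)" using assms by (simp add: power_diff prime_gt_0_nat)
    then show "norm (g (p ^ i)) * norm (hcoef x (p ^ e div p ^ i)) = norm (g (p ^ i)) * (norm (x p) ^ (e - i) / fact (e - i))"
      using hcoef_prime_power[OF assms, of x] by (simp add: norm_divide norm_power)
  qed
  finally show ?thesis .
qed

text \<open>The term \<open>i = e\<close> is kept apart, as the hypothesis on prime powers controls
  it in square mean. In all others one factor \<open>norm (x p)\<close> is left unestimated: its
  square divided by \<open>p\<close> has bounded block sums, whereas the bound
  \<open>C1 * p powr \<theta>\<close> alone would be too weak.\<close>

lemma majorant_prime_power_le:
  assumes p: "prime p" and e: "e \<ge> 1" and x: "norm (x p) \<le> C1 * real p powr \<theta>"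
    and g: "\<And>n. n \<ge> 1 \<Longrightarrow> norm (g n) \<le> C2 * real n powr \<theta>"
  shows "norm (majorant g x (p ^ e)) \<le> norm (g (p ^ e)) + C2 * exp C1 * norm (x p) * real p powr (\<theta> * real (e - 1))"
proof -
  have p0: "real p > 0" using prime_gt_0_nat[OF p] by simp
  have "0 \<le> C1 * real p powr \<theta>" using x norm_ge_zero by (rule order_trans[rotated])
  then have C1: "C1 \<ge> 0" using p0 by (simp add: zero_le_mult_iff)
  have C2: "C2 \<ge> 0" using order_trans[OF norm_ge_zero g[of 1]] by simp
  have "norm (majorant g x (p ^ e)) = norm (g (p ^ e)) +
      (\<Sum>i<e. norm (g (p ^ i)) * (norm (x p) ^ (e - i) / fact (e - i)))"
    unfolding norm_majorant_prime_power[OF p] by (simp add: lessThan_Suc_atMost[symmetric])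
  also have "\<dots> \<le> norm (g (p ^ e)) +
      (\<Sum>i<e. C2 * norm (x p) * real p powr (\<theta> * real (e - 1)) * (C1 ^ (e - 1 - i) / fact (e - 1 - i)))"
  proof (intro add_left_mono sum_mono)
    fix i assume "i \<in> {..<e}"
    then have i: "i < e" by simp
    define r where "r = e - 1 - i"
    have r: "e - i = Suc r" "e - 1 = i + r" using i by (auto simp: r_def)
    have 1: "norm (g (p ^ i)) \<le> C2 * real p powr (\<theta> * real i)"
    proof -
      have "p ^ i \<ge> 1" using p0 by simp
      then have "norm (g (p ^ i)) \<le> C2 * real (p ^ i) powr \<theta>" by (rule g)
      also have "real (p ^ i) powr \<theta> = real p powr (\<theta> * real i)"
        using p0 by (simp add: powr_powr mult.commute flip: powr_realpow)
      finally show ?thesis .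
    qed
    have 2: "norm (x p) ^ r \<le> C1 ^ r * real p powr (\<theta> * real r)"
    proof -
      have "norm (x p) ^ r \<le> (C1 * real p powr \<theta>) ^ r" using x by (intro power_mono) auto
      also have "\<dots> = C1 ^ r * real p powr (\<theta> * real r)"
        using p0 by (simp add: power_mult_distrib powr_power mult.commute)
      finally show ?thesis .
    qed
    have "norm (g (p ^ i)) * (norm (x p) ^ (e - i) / fact (e - i)) =
        norm (g (p ^ i)) * norm (x p) * (norm (x p) ^ r / fact (Suc r))" by (simp add: r)
    also have "\<dots> \<le> norm (g (p ^ i)) * norm (x p) * (norm (x p) ^ r / fact r)"
      by (intro mult_left_mono divide_left_mono fact_mono) auto
    also have "\<dots> \<le> (C2 * real p powr (\<theta> * real i)) * norm (x p) * ((C1 ^ r * real p powr (\<theta> * real r)) / fact r)"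
      using C1 C2 by (intro mult_mono divide_right_mono 1 2) auto
    also have "\<dots> = C2 * norm (x p) * real p powr (\<theta> * real (e - 1)) * (C1 ^ r / fact r)"
    proof -
      have "real (e - 1) = real i + real r" unfolding r(2) by simp
      then show ?thesis by (simp only: distrib_left powr_add) simp
    qed
    finally show "norm (g (p ^ i)) * (norm (x p) ^ (e - i) / fact (e - i)) \<le>
        C2 * norm (x p) * real p powr (\<theta> * real (e - 1)) * (C1 ^ (e - 1 - i) / fact (e - 1 - i))"
      by (simp add: r_def)
  qed
  also have "\<dots> = norm (g (p ^ e)) + C2 * norm (x p) * real p powr (\<theta> * real (e - 1)) * (\<Sum>i<e. C1 ^ (e - 1 - i) / fact (e - 1 - i))"
    by (simp add: sum_distrib_left)
  also have "(\<Sum>i<e. C1 ^ (e - 1 - i) / fact (e - 1 - i)) = (\<Sum>i<e. C1 ^ i / fact i)"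
    using sum.nat_diff_reindex[of "\<lambda>i. C1 ^ i / fact i" e] by simp
  also have "norm (g (p ^ e)) + C2 * norm (x p) * real p powr (\<theta> * real (e - 1)) * (\<Sum>i<e. C1 ^ i / fact i) \<le>
      norm (g (p ^ e)) + C2 * norm (x p) * real p powr (\<theta> * real (e - 1)) * exp C1"
  proof (intro add_left_mono mult_left_mono)
    have "(\<Sum>i<e. C1 ^ i / fact i) \<le> (\<Sum>i. C1 ^ i / fact i)"
      using summable_exp[of C1] C1 by (intro sum_le_suminf) (auto simp: field_simps)
    then show "(\<Sum>i<e. C1 ^ i / fact i) \<le> exp C1" by (simp add: exp_def field_simps)
  qed (use C2 in auto)
  finally show ?thesis by (simp add: mult_ac)
qed

lemma sum_inverse_squares_le: "finite A \<Longrightarrow> 0 \<notin> A \<Longrightarrow> (\<Sum>n\<in>A. 1 / (real n)\<^sup>2) \<le> pi\<^sup>2 / 6"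
proof -
  assume A: "finite A" "0 \<notin> A"
  have "(\<lambda>n. 1 / real (n + 1) ^ 2) sums (pi\<^sup>2 / 6)" using inverse_squares_sums by simp
  then have s: "summable (\<lambda>n. 1 / real (n + 1) ^ 2)" "(\<Sum>n. 1 / real (n + 1) ^ 2) = pi\<^sup>2 / 6"
    by (auto simp: sums_iff)
  have "(\<Sum>n\<in>A. 1 / (real n)\<^sup>2) = (\<Sum>n\<in>(\<lambda>n. n - 1) ` A. 1 / real (n + 1) ^ 2)"
  proof -
    have pos: "n > 0" if "n \<in> A" for n using A that by (cases n) auto
    have inj: "inj_on (\<lambda>n. n - 1) A"
    proof (rule inj_onI)
      fix m n assume "m \<in> A" "n \<in> A" "m - 1 = n - 1"
      then show "m = n" using pos[of m] pos[of n] by linarith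
    qed
    have "(\<Sum>n\<in>(\<lambda>n. n - 1) ` A. 1 / real (n + 1) ^ 2) = (\<Sum>n\<in>A. 1 / real (n - 1 + 1) ^ 2)"
      by (subst sum.reindex[OF inj]) simp
    also have "\<dots> = (\<Sum>n\<in>A. 1 / (real n)\<^sup>2)"
    proof (intro sum.cong refl)
      fix n assume "n \<in> A"
      then have "n - 1 + 1 = n" using pos[of n] by linarith
      then show "1 / real (n - 1 + 1) ^ 2 = 1 / (real n)\<^sup>2" by (simp only:)
    qed
    finally show ?thesis by simp
  qed
  also have "\<dots> \<le> (\<Sum>n. 1 / real (n + 1) ^ 2)" using A s by (intro sum_le_suminf) auto
  finally show ?thesis using s by simp
qed

text \<open>The weight \<open>4 ^ e\<close> is harmless for bounded \<open>e\<close>, where the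
  hypothesis on prime powers applies, and for large \<open>e\<close>, where the pointwise bound
  beats it. The rest of the majorant contributes geometric series of size
  \<open>(norm (x p))^2 / p * p powr - \<eta>\<close>. The bound \<open>R\<close> is uniform in the
  starting index \<open>i0\<close>, so one index can later serve several functions at once.\<close>

lemma prime_power_tail:
  fixes g x :: "nat \<Rightarrow> complex"
  assumes \<theta>: "0 < \<theta>" "\<theta> < 1 / 2"
    and x: "\<And>p. prime p \<Longrightarrow> norm (x p) \<le> C1 * real p powr \<theta>"
    and g: "\<And>n. n \<ge> 1 \<Longrightarrow> norm (g n) \<le> C2 * real n powr \<theta>"
    and summ: "(\<lambda>(p, m). (norm (g (p ^ m)))\<^sup>2 / real p ^ m) summable_on ({p. prime p} \<times> {2..})"
    and D: "\<And>i. (\<Sum>p\<in>bl i. (norm (x p))\<^sup>2 / real p) \<le> D"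
  obtains R i1 where "i1 \<ge> 1" "\<And>i0 J E. i1 \<le> i0 \<Longrightarrow> i0 \<le> J \<Longrightarrow>
     (\<Sum>p\<in>pr J - pr i0. \<Sum>e=2..E. 4 ^ e * (norm (majorant g x (p ^ e)))\<^sup>2 / real (p ^ e)) \<le> R"
proof -
  define \<eta> where "\<eta> = 1 - 2 * \<theta>"
  have \<eta>: "\<eta> > 0" using \<theta> by (simp add: \<eta>_def)
  \<comment> \<open>Beyond this index \<open>y = p powr - \<eta>\<close> is at most 1/64. With
    \<open>z = sqrt y <= 1 / 8\<close> this yields \<open>4 * y <= z\<close>, and both
    \<open>z\<close> and \<open>4 * y\<close> are ratios of geometric series below 1/2.\<close>
  obtain i1 :: nat where i1: "ln 64 / \<eta> < real i1" using reals_Archimedean2 by blast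
  define i1' where "i1' = max i1 1"
  have big: "real p powr - \<eta> \<le> 1 / 64" if "prime p" "p \<notin> pr i1'" for p
  proof -
    have "real i1' \<le> 4 ^ i1'" by (rule real_le_power_4)
    moreover have "real i1 \<le> real i1'" by (simp add: i1'_def)
    ultimately have "ln 64 / \<eta> < 4 ^ i1'" using i1 by linarith
    also have "\<dots> < ln (real p)" using that by (simp add: pr_def)
    finally have "ln 64 < \<eta> * ln (real p)" using \<eta> by (simp add: field_simps)
    then have "exp (- \<eta> * ln (real p)) \<le> exp (- ln 64)" by simp
    then show ?thesis using prime_gt_0_nat[OF that(1)] by (simp add: powr_def exp_minus)
  qed
  \<comment> \<open>\<open>E0 >= 4 / \<eta>\<close> makes \<open>z ^ E0 <= p powr (- 2)\<close>,
    which is summable over the primes.\<close>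
  obtain E0 :: nat where E0: "4 / \<eta> \<le> real E0" using real_arch_simple by blast
  define K where "K = C2 * exp C1"
  define Q where "Q = infsum (\<lambda>(p, m). (norm (g (p ^ m)))\<^sup>2 / real p ^ m) ({p. prime p} \<times> {2..})"
  define R where "R = 2 * 4 ^ E0 * Q + 4 * C2\<^sup>2 * (pi\<^sup>2 / 6) + 64 * K\<^sup>2 * (2 * D / \<eta>)"
  have per_prime: "(\<Sum>e=2..E. 4 ^ e * (norm (majorant g x (p ^ e)))\<^sup>2 / real (p ^ e)) \<le>
      2 * 4 ^ E0 * (\<Sum>e=2..E. (norm (g (p ^ e)))\<^sup>2 / real p ^ e) + 4 * C2\<^sup>2 * (1 / (real p)\<^sup>2) +
      64 * K\<^sup>2 * ((norm (x p))\<^sup>2 / real p * real p powr - \<eta>)" if p: "prime p" "p \<notin> pr i1'" for p E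
  proof -
    have p0: "real p > 0" using prime_gt_0_nat[OF p(1)] by simp
    define y where "y = real p powr - \<eta>"
    define z where "z = real p powr (- \<eta> / 2)"
    have y: "0 \<le> y" "y \<le> 1 / 64" using big[OF p] by (auto simp: y_def)
    have zz: "z\<^sup>2 = y" using p0 by (simp add: z_def y_def power2_eq_square flip: powr_add)
    have z: "0 \<le> z" "z \<le> 1 / 8"
    proof -
      have "z\<^sup>2 \<le> (1 / 8)\<^sup>2" using y zz by (simp add: power2_eq_square)
      then show "z \<le> 1 / 8" by (rule power2_le_imp_le) simp
    qed (simp add: z_def)
    have ye: "real p powr (2 * \<theta> * real e) / real p ^ e = y ^ e" for e
    proof -
      have "real p powr (2 * \<theta> * real e) / real p ^ e = real p powr (2 * \<theta> * real e - real e)"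
        using p0 by (simp add: powr_diff powr_realpow)
      also have "2 * \<theta> * real e - real e = - \<eta> * real e" by (simp add: \<eta>_def algebra_simps)
      also have "real p powr (- \<eta> * real e) = y ^ e" using p0 by (simp add: y_def powr_power mult.commute)
      finally show ?thesis .
    qed
    have g_part: "4 ^ e * (norm (g (p ^ e)))\<^sup>2 / real p ^ e \<le>
        4 ^ E0 * ((norm (g (p ^ e)))\<^sup>2 / real p ^ e) + (if e \<ge> E0 then C2\<^sup>2 * z ^ e else 0)" for e
    proof (cases "e \<ge> E0")
      case True
      have "p ^ e \<ge> 1" using p0 by simp
      then have "norm (g (p ^ e)) \<le> C2 * real (p ^ e) powr \<theta>" by (rule g)
      then have "(norm (g (p ^ e)))\<^sup>2 \<le> (C2 * real (p ^ e) powr \<theta>)\<^sup>2" by (intro power_mono) auto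
      also have "\<dots> = C2\<^sup>2 * real p powr (2 * \<theta> * real e)"
        using p0 by (simp add: power_mult_distrib powr_powr power2_eq_square mult_ac flip: powr_realpow powr_add)
      finally have "4 ^ e * (norm (g (p ^ e)))\<^sup>2 / real p ^ e \<le> 4 ^ e * (C2\<^sup>2 * real p powr (2 * \<theta> * real e)) / real p ^ e"
        by (intro divide_right_mono mult_left_mono) auto
      also have "\<dots> = C2\<^sup>2 * (4 ^ e * y ^ e)" unfolding ye[symmetric] by simp
      also have "4 ^ e * y ^ e \<le> z ^ e"
      proof -
        have "4 * y \<le> z" using mult_right_mono[OF z(2) z(1)] z(1) by (simp add: zz[symmetric] power2_eq_square)
        then have "(4 * y) ^ e \<le> z ^ e" using y by (intro power_mono) auto
        then show ?thesis by (simp add: power_mult_distrib)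
      qed
      finally have "4 ^ e * (norm (g (p ^ e)))\<^sup>2 / real p ^ e \<le> C2\<^sup>2 * z ^ e" by (simp add: mult_left_mono)
      moreover have "4 ^ E0 * ((norm (g (p ^ e)))\<^sup>2 / real p ^ e) \<ge> 0" by simp
      ultimately show ?thesis unfolding if_P[OF True] by linarith
    next
      case False
      then have "(4::real) ^ e \<le> 4 ^ E0" by (intro power_increasing) auto
      then have "4 ^ e * ((norm (g (p ^ e)))\<^sup>2 / real p ^ e) \<le> 4 ^ E0 * ((norm (g (p ^ e)))\<^sup>2 / real p ^ e)"
        by (intro mult_right_mono) auto
      then show ?thesis using False by simp
    qed
    have term_bound: "4 ^ e * (norm (majorant g x (p ^ e)))\<^sup>2 / real (p ^ e) \<le>
       2 * (4 ^ E0 * ((norm (g (p ^ e)))\<^sup>2 / real p ^ e) + (if e \<ge> E0 then C2\<^sup>2 * z ^ e else 0)) +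
       8 * K\<^sup>2 * ((norm (x p))\<^sup>2 / real p) * (4 * y) ^ (e - 1)" if e: "e \<in> {2..E}" for e
    proof -
      have e1: "e \<ge> 1" using e by simp
      have "norm (majorant g x (p ^ e)) \<le> norm (g (p ^ e)) + K * norm (x p) * real p powr (\<theta> * real (e - 1))"
        unfolding K_def using p(1) e1 x[OF p(1)] g by (rule majorant_prime_power_le)
      then have "(norm (majorant g x (p ^ e)))\<^sup>2 \<le> (norm (g (p ^ e)) + K * norm (x p) * real p powr (\<theta> * real (e - 1)))\<^sup>2"
        by (intro power_mono) auto
      also have "\<dots> \<le> 2 * (norm (g (p ^ e)))\<^sup>2 + 2 * (K * norm (x p) * real p powr (\<theta> * real (e - 1)))\<^sup>2"
        using sum_squares_bound[of "norm (g (p ^ e))" "K * norm (x p) * real p powr (\<theta> * real (e - 1))"]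
        unfolding power2_sum by linarith
      finally have sq: "(norm (majorant g x (p ^ e)))\<^sup>2 \<le>
         2 * (norm (g (p ^ e)))\<^sup>2 + 2 * (K * norm (x p) * real p powr (\<theta> * real (e - 1)))\<^sup>2" .
      have pe: "real (p ^ e) = real p ^ e" by simp
      have "4 ^ e * (norm (majorant g x (p ^ e)))\<^sup>2 / real (p ^ e) \<le>
         4 ^ e * (2 * (norm (g (p ^ e)))\<^sup>2 + 2 * (K * norm (x p) * real p powr (\<theta> * real (e - 1)))\<^sup>2) / real p ^ e"
        unfolding pe using sq by (intro divide_right_mono mult_left_mono) auto
      also have "\<dots> = 2 * (4 ^ e * (norm (g (p ^ e)))\<^sup>2 / real p ^ e) +
         4 ^ e * (2 * (K * norm (x p) * real p powr (\<theta> * real (e - 1)))\<^sup>2) / real p ^ e"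
        by (simp add: distrib_left add_divide_distrib mult_ac)
      also have "4 ^ e * (2 * (K * norm (x p) * real p powr (\<theta> * real (e - 1)))\<^sup>2) / real p ^ e =
         8 * K\<^sup>2 * ((norm (x p))\<^sup>2 / real p) * (4 * y) ^ (e - 1)"
      proof -
        obtain r where r: "e = Suc r" using e1 by (cases e) auto
        have "(real p powr (\<theta> * real r))\<^sup>2 / real p ^ r = y ^ r"
          using ye[of r] by (simp add: power2_eq_square mult_ac flip: powr_add)
        then have "(real p powr (\<theta> * real r))\<^sup>2 = y ^ r * real p ^ r" using p0 by (simp add: field_simps)
        then show ?thesis using p0 by (simp add: r power_mult_distrib field_simps)
      qed
      also have "2 * (4 ^ e * (norm (g (p ^ e)))\<^sup>2 / real p ^ e) + 8 * K\<^sup>2 * ((norm (x p))\<^sup>2 / real p) * (4 * y) ^ (e - 1) \<le>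
         2 * (4 ^ E0 * ((norm (g (p ^ e)))\<^sup>2 / real p ^ e) + (if e \<ge> E0 then C2\<^sup>2 * z ^ e else 0)) +
         8 * K\<^sup>2 * ((norm (x p))\<^sup>2 / real p) * (4 * y) ^ (e - 1)"
        by (intro add_right_mono mult_left_mono g_part) simp
      finally show ?thesis .
    qed
    have "(\<Sum>e=2..E. 4 ^ e * (norm (majorant g x (p ^ e)))\<^sup>2 / real (p ^ e)) \<le>
      (\<Sum>e=2..E. 2 * (4 ^ E0 * ((norm (g (p ^ e)))\<^sup>2 / real p ^ e) + (if e \<ge> E0 then C2\<^sup>2 * z ^ e else 0)) +
       8 * K\<^sup>2 * ((norm (x p))\<^sup>2 / real p) * (4 * y) ^ (e - 1))" by (intro sum_mono term_bound)
    also have "\<dots> = 2 * 4 ^ E0 * (\<Sum>e=2..E. (norm (g (p ^ e)))\<^sup>2 / real p ^ e) +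
       2 * C2\<^sup>2 * (\<Sum>e=2..E. if e \<ge> E0 then z ^ e else 0) + 8 * K\<^sup>2 * ((norm (x p))\<^sup>2 / real p) * (\<Sum>e=2..E. (4 * y) ^ (e - 1))"
      unfolding sum_distrib_left sum.distrib[symmetric] by (intro sum.cong refl) (auto simp: distrib_left)
    also have "\<dots> \<le> 2 * 4 ^ E0 * (\<Sum>e=2..E. (norm (g (p ^ e)))\<^sup>2 / real p ^ e) +
       2 * C2\<^sup>2 * (2 * (1 / (real p)\<^sup>2)) + 8 * K\<^sup>2 * ((norm (x p))\<^sup>2 / real p) * (8 * y)"
    proof (intro add_mono mult_left_mono order_refl)
      have "(\<Sum>e=2..E. if e \<ge> E0 then z ^ e else 0) = (\<Sum>e\<in>{e\<in>{2..E}. e \<ge> E0}. z ^ e)"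
        by (rule sum.inter_filter[symmetric]) simp
      also have "\<dots> \<le> 2 * z ^ E0" using z by (intro geometric_tail_le) auto
      also have "\<dots> \<le> 2 * (1 / (real p)\<^sup>2)"
      proof (rule mult_left_mono)
        have "z ^ E0 = real p powr (- (\<eta> / 2 * real E0))" using p0 by (simp add: z_def powr_power mult.commute)
        also have "\<dots> \<le> real p powr (- 2)"
        proof (rule powr_mono)
          show "- (\<eta> / 2 * real E0) \<le> - 2" using E0 \<eta> by (simp add: field_simps)
          show "1 \<le> real p" using prime_gt_1_nat[OF p(1)] by simp
        qed
        also have "\<dots> = 1 / (real p)\<^sup>2" using p0 by (simp add: powr_minus_divide)
        finally show "z ^ E0 \<le> 1 / (real p)\<^sup>2" .
      qed simp
      finally show "(\<Sum>e=2..E. if e \<ge> E0 then z ^ e else 0) \<le> 2 * (1 / (real p)\<^sup>2)" .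
      have "(\<Sum>e=2..E. (4 * y) ^ (e - 1)) = (\<Sum>e\<in>(\<lambda>e. e - 1) ` {2..E}. (4 * y) ^ e)"
        by (subst sum.reindex) (auto simp: inj_on_def)
      also have "\<dots> \<le> 2 * (4 * y) ^ 1" using y by (intro geometric_tail_le) auto
      finally show "(\<Sum>e=2..E. (4 * y) ^ (e - 1)) \<le> 8 * y" by simp
    qed auto
    finally show ?thesis by (simp add: y_def mult_ac)
  qed
  show ?thesis
  proof (rule that[of i1' R])
    show "i1' \<ge> 1" by (simp add: i1'_def)
    fix i0 J E assume ij: "i1' \<le> i0" "i0 \<le> J"
    have pJ: "prime p" "p \<notin> pr i1'" if "p \<in> pr J - pr i0" for p
      using that pr_mono[OF ij(1)] by (auto simp: pr_def)
    have "(\<Sum>p\<in>pr J - pr i0. \<Sum>e=2..E. 4 ^ e * (norm (majorant g x (p ^ e)))\<^sup>2 / real (p ^ e)) \<le>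
      (\<Sum>p\<in>pr J - pr i0. 2 * 4 ^ E0 * (\<Sum>e=2..E. (norm (g (p ^ e)))\<^sup>2 / real p ^ e) + 4 * C2\<^sup>2 * (1 / (real p)\<^sup>2) +
      64 * K\<^sup>2 * ((norm (x p))\<^sup>2 / real p * real p powr - \<eta>))"
      by (intro sum_mono per_prime pJ)
    also have "\<dots> = 2 * 4 ^ E0 * (\<Sum>p\<in>pr J - pr i0. \<Sum>e=2..E. (norm (g (p ^ e)))\<^sup>2 / real p ^ e) +
       4 * C2\<^sup>2 * (\<Sum>p\<in>pr J - pr i0. 1 / (real p)\<^sup>2) +
       64 * K\<^sup>2 * (\<Sum>p\<in>pr J - pr i0. (norm (x p))\<^sup>2 / real p * real p powr - \<eta>)"
      by (simp only: sum.distrib sum_distrib_left)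
    also have "\<dots> \<le> R" unfolding R_def
    proof (intro add_mono mult_left_mono)
      have "(\<Sum>p\<in>pr J - pr i0. \<Sum>e=2..E. (norm (g (p ^ e)))\<^sup>2 / real p ^ e) =
          (\<Sum>(p, m)\<in>(pr J - pr i0) \<times> {2..E}. (norm (g (p ^ m)))\<^sup>2 / real p ^ m)"
        by (rule sum.cartesian_product)
      also have "\<dots> \<le> Q" unfolding Q_def
        using finite_pr pJ by (intro finite_sum_le_infsum summ) auto
      finally show "(\<Sum>p\<in>pr J - pr i0. \<Sum>e=2..E. (norm (g (p ^ e)))\<^sup>2 / real p ^ e) \<le> Q" .
      show "(\<Sum>p\<in>pr J - pr i0. 1 / (real p)\<^sup>2) \<le> pi\<^sup>2 / 6"
        using finite_pr by (intro sum_inverse_squares_le) (auto simp: pr_def)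
      show "(\<Sum>p\<in>pr J - pr i0. (norm (x p))\<^sup>2 / real p * real p powr - \<eta>) \<le> 2 * D / \<eta>"
        by (intro sum_powr_decay D \<eta> ij) auto
    qed auto
    finally show "(\<Sum>p\<in>pr J - pr i0. \<Sum>e=2..E. 4 ^ e * (norm (majorant g x (p ^ e)))\<^sup>2 / real (p ^ e)) \<le> R" .
  qed
qed

subsection \<open>Coefficients of the mollified Dirichlet series\<close>

text \<open>The index 0 stands for the primes up to \<open>exp (4 ^ i1)\<close>, whose factor is truncated to the constant 1, so that
  no estimate is needed for them. The lengths grow towards the small primes, but so slowly that
  the product still is a Dirichlet polynomial of length \<open>exp (O(4 ^ J))\<close>.\<close>

definition idx :: "nat \<Rightarrow> nat \<Rightarrow> nat set" where "idx i1 J = insert 0 {i1..<J}"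

definition blk :: "nat \<Rightarrow> nat \<Rightarrow> nat set" where "blk i1 i = (if i = 0 then pr i1 else bl i)"

definition len :: "nat \<Rightarrow> nat \<Rightarrow> nat \<Rightarrow> nat" where "len L0 J i = (if i = 0 then 0 else L0 * 2 ^ (J - i))"

lemma prime_blocks_idx:
  assumes "i1 \<ge> 1"
  shows "prime_blocks (idx i1 J) (blk i1)"
proof
  show "finite (idx i1 J)" by (simp add: idx_def)
  have *: "pr i1 \<inter> bl i = {}" if "i \<ge> i1" for i using pr_mono[OF that] by (auto simp: bl_def)
  show "disjoint_family_on (blk i1) (idx i1 J)"
    unfolding disjoint_family_on_def
  proof (intro ballI impI)
    fix m n assume "m \<in> idx i1 J" "n \<in> idx i1 J" "m \<noteq> n"
    then show "blk i1 m \<inter> blk i1 n = {}"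
      using assms * disjoint_bl[of UNIV]
      by (cases "m = 0"; cases "n = 0") (auto simp: idx_def blk_def disjoint_family_on_def)
  qed
  show "finite (blk i1 i)" for i by (simp add: blk_def finite_pr finite_bl)
  show "prime p" if "p \<in> blk i1 i" for i p using that by (auto simp: blk_def pr_def in_bl_iff split: if_splits)
qed

lemma primes_idx:
  assumes "1 \<le> i1" "i1 \<le> J"
  shows "(\<Union>i\<in>idx i1 J. blk i1 i) = pr J"
proof -
  have "(\<Union>i\<in>idx i1 J. blk i1 i) = pr i1 \<union> (\<Union>i\<in>{i1..<J}. bl i)"
    using assms by (auto simp: idx_def blk_def)
  also have "\<dots> = pr i1 \<union> (pr J - pr i1)" by (simp add: pr_diff_eq_UN[OF assms(2)])
  finally show ?thesis using pr_mono[OF assms(2)] by auto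
qed

abbreviation acoef :: "nat \<Rightarrow> nat \<Rightarrow> nat \<Rightarrow> (nat \<Rightarrow> complex) \<Rightarrow> nat \<Rightarrow> complex" where
  "acoef i1 J L0 \<equiv> prime_blocks.bexp (idx i1 J) (blk i1) (len L0 J)"

text \<open>For \<open>g\<close> the \<open>m\<close>-th root of \<open>f j\<close>, these are the
  coefficients of \<open>L(s, f_j) powr (1/m) * a(s)\<close>.\<close>

definition vcoef :: "nat \<Rightarrow> nat \<Rightarrow> nat \<Rightarrow> (nat \<Rightarrow> complex) \<Rightarrow> (nat \<Rightarrow> complex) \<Rightarrow> nat \<Rightarrow> complex" where
  "vcoef i1 J L0 g x = dirichlet_conv g (acoef i1 J L0 x)"

text \<open>The integer part of the parameter \<open>X\<close>, for which
  \<open>log X = 4 ^ J\<close>.\<close>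

definition cutoff :: "nat \<Rightarrow> nat" where "cutoff J = nat \<lfloor>exp (4 ^ J :: real)\<rfloor>"

lemma cutoff_ge_1: "cutoff J \<ge> 1"
  unfolding cutoff_def by (simp add: le_nat_floor)

lemma le_cutoff_iff: "n \<le> cutoff J \<longleftrightarrow> real n \<le> exp (4 ^ J)"
  unfolding cutoff_def by (simp add: le_nat_iff le_floor_iff)

lemma len_ge:
  assumes "L0 \<ge> 1" "i < J" "i \<noteq> 0"
  shows "len L0 J i \<ge> L0 + (J - i)"
proof -
  have "Suc (J - i) \<le> 2 ^ (J - i)" by (rule Suc_leI[OF less_exp])
  then have "L0 * Suc (J - i) \<le> len L0 J i" using assms by (simp add: len_def del: mult_Suc_right)
  moreover have "1 * (J - i) \<le> L0 * (J - i)" using assms(1) by (rule mult_le_mono1)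
  then have "L0 + (J - i) \<le> L0 * Suc (J - i)" by simp
  ultimately show ?thesis by linarith
qed

text \<open>The lengths increase at least linearly away from the last block, so the truncation
  errors of all blocks add up to a bound that does not depend on \<open>J\<close>.\<close>

lemma sum_len_decay:
  fixes y :: real
  assumes "L0 \<ge> 1" "1 \<le> i1" "0 \<le> y" "y \<le> 1 / 2" "J' \<le> J"
  shows "(\<Sum>i=i1..<J'. y ^ len L0 J i) \<le> y ^ L0"
proof -
  have "(\<Sum>i=i1..<J'. y ^ len L0 J i) \<le> (\<Sum>i=i1..<J. y ^ len L0 J i)"
    using assms by (intro sum_mono2) auto
  also have "\<dots> \<le> (\<Sum>i=i1..<J. y ^ L0 * y ^ (J - i))"
  proof (rule sum_mono)
    fix i assume i: "i \<in> {i1..<J}"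
    have "y ^ len L0 J i \<le> y ^ (L0 + (J - i))"
      using len_ge[of L0 i J] i assms by (intro power_decreasing) auto
    then show "y ^ len L0 J i \<le> y ^ L0 * y ^ (J - i)" by (simp add: power_add)
  qed
  also have "\<dots> = y ^ L0 * (\<Sum>i=i1..<J. y ^ (J - i))" by (simp add: sum_distrib_left)
  also have "(\<Sum>i=i1..<J. y ^ (J - i)) = (\<Sum>e\<in>(\<lambda>i. J - i) ` {i1..<J}. y ^ e)"
    by (subst sum.reindex) (auto simp: inj_on_def)
  also have "y ^ L0 * (\<Sum>e\<in>(\<lambda>i. J - i) ` {i1..<J}. y ^ e) \<le> y ^ L0 * (2 * y ^ 1)"
    using assms by (intro mult_left_mono geometric_tail_le) auto
  also have "\<dots> \<le> y ^ L0 * 1" using assms by (intro mult_left_mono) auto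
  finally show ?thesis by simp
qed

text \<open>After factorization over blocks, the small primes contribute a constant. Every other
  block contributes the exponential of its main sum plus its prime-power sum, plus an error
  \<open>exp K * (1/4) ^ len\<close>. Written as one exponent, the errors have a bounded total by
  \<open>sum_len_decay\<close> and the prime-power sums one by \<open>R\<close>.\<close>

lemma vcoef_second_moment_upper:
  fixes g x :: "nat \<Rightarrow> complex"
  assumes g: "multiplicative g" "g 1 = 1" "\<And>n. n \<ge> 1 \<Longrightarrow> norm (g n) \<le> C2 * real n powr \<theta>"
    and \<theta>: "0 < \<theta>" "\<theta> < 1 / 2" and i1: "i1 \<ge> 1" and L0: "L0 \<ge> 1"
    and D: "\<And>i. (\<Sum>p\<in>bl i. (norm (x p))\<^sup>2 / real p) \<le> D" "\<And>i. (\<Sum>p\<in>bl i. (norm (g p))\<^sup>2 / real p) \<le> D'"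
    and R: "\<And>J E. i1 \<le> J \<Longrightarrow>
     (\<Sum>p\<in>pr J - pr i1. \<Sum>e=2..E. 4 ^ e * (norm (majorant g x (p ^ e)))\<^sup>2 / real (p ^ e)) \<le> R"
  obtains C where "C > 0" "\<And>J. i1 \<le> J \<Longrightarrow> (\<Sum>n=1..cutoff J. (norm (vcoef i1 J L0 g x n))\<^sup>2 / real n) \<le>
    C * exp (\<Sum>p\<in>pr J - pr i1. (norm (g p + x p))\<^sup>2 / real p)"
proof -
  define \<eta> where "\<eta> = 1 - 2 * \<theta>"
  define y where "y = (2::real) powr - \<eta>"
  have \<eta>: "\<eta> > 0" using \<theta> by (simp add: \<eta>_def)
  have y: "0 < y" "y < 1" using \<eta> by (auto simp: y_def powr_less_one)
  \<comment> \<open>Bounds the exponent of the weighted majorant over one block; the 8 is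
    \<open>4 * 2\<close>, from the weight \<open>4 ^ 1\<close> and from
    \<open>(u + v)^2 <= 2 * u^2 + 2 * v^2\<close>.\<close>
  define K where "K = 8 * D' + 8 * D + R"
  define C0 where "C0 = (\<Prod>p\<in>pr i1. C2\<^sup>2 * (1 / (1 - y)))"
  define C where "C = (C0 + 1) * exp (R + exp K)"
  have C2: "C2 \<noteq> 0" using g(3)[of 1] g(2) by auto
  have C0: "C0 \<ge> 0" unfolding C0_def using y by (intro prod_nonneg) auto
  have "C > 0" using C0 by (simp add: C_def)
  moreover have "(\<Sum>n=1..cutoff J. (norm (vcoef i1 J L0 g x n))\<^sup>2 / real n) \<le>
    C * exp (\<Sum>p\<in>pr J - pr i1. (norm (g p + x p))\<^sup>2 / real p)" if J: "i1 \<le> J" for J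
  proof -
    interpret PB: prime_blocks "idx i1 J" "blk i1" "len L0 J" by (rule prime_blocks_idx[OF i1])
    define X where "X = cutoff J"
    have X1: "X \<ge> 1" unfolding X_def by (rule cutoff_ge_1)
    have primes: "PB.primes = pr J" unfolding PB.primes_def by (rule primes_idx[OF i1 J])
    have S: "prime_factors n \<subseteq> pr J" "multiplicity p n \<le> X" if "n \<in> {1..X}" for n p
    proof -
      show "prime_factors n \<subseteq> pr J"
      proof
        fix q assume "q \<in> prime_factors n"
        then have "prime q" "q \<le> n" using that by (auto intro: dvd_imp_le)
        then have "q \<le> cutoff J" using that by (simp add: X_def)
        then show "q \<in> pr J" using \<open>prime q\<close> by (simp add: pr_altdef le_cutoff_iff)
      qed
      show "multiplicity p n \<le> X"
      proof (cases "p \<le> 1")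
        case True
        then have "p = 0 \<or> p = 1" by auto
        then show ?thesis by (auto simp: multiplicity_unit_left)
      next
        case False
        have "multiplicity p n < p ^ multiplicity p n" using False by (intro power_gt_expt) simp
        also have "\<dots> \<le> n" using that by (intro dvd_imp_le multiplicity_dvd) auto
        finally show ?thesis using that by simp
      qed
    qed
    have "(\<Sum>n=1..X. (norm (vcoef i1 J L0 g x n))\<^sup>2 / real n) \<le>
      (\<Prod>i\<in>idx i1 J. \<Sum>m\<in>bpart (blk i1 i) ` {1..X}. (norm (vcoef i1 J L0 g x m))\<^sup>2 / real m)"
      unfolding vcoef_def using S by (intro PB.sum_conv_bexp_le_prod g) (auto simp: primes)
    also have "\<dots> = (\<Sum>m\<in>bpart (pr i1) ` {1..X}. (norm (vcoef i1 J L0 g x m))\<^sup>2 / real m) *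
        (\<Prod>i\<in>{i1..<J}. \<Sum>m\<in>bpart (bl i) ` {1..X}. (norm (vcoef i1 J L0 g x m))\<^sup>2 / real m)"
    proof -
      have "(\<Prod>i\<in>{i1..<J}. \<Sum>m\<in>bpart (blk i1 i) ` {1..X}. (norm (vcoef i1 J L0 g x m))\<^sup>2 / real m) =
        (\<Prod>i\<in>{i1..<J}. \<Sum>m\<in>bpart (bl i) ` {1..X}. (norm (vcoef i1 J L0 g x m))\<^sup>2 / real m)"
        using i1 by (intro prod.cong refl) (auto simp: blk_def)
      moreover have "0 \<notin> {i1..<J}" using i1 by auto
      ultimately show ?thesis unfolding idx_def by (simp add: blk_def)
    qed
    also have "\<dots> \<le> C0 * (\<Prod>i\<in>{i1..<J}. exp ((\<Sum>p\<in>bl i. (norm (g p + x p))\<^sup>2 / real p) +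
        (\<Sum>p\<in>bl i. \<Sum>e=2..X. 4 ^ e * (norm (majorant g x (p ^ e)))\<^sup>2 / real (p ^ e)) + exp K * (1/4) ^ len L0 J i))"
    proof (intro mult_mono prod_mono conjI C0 prod_nonneg sum_nonneg)
      have i0: "0 \<in> idx i1 J" "len L0 J 0 = 0" "blk i1 0 = pr i1" by (auto simp: idx_def len_def blk_def)
      \<comment> \<open>In this block only \<open>g\<close> is left, and
        \<open>norm (g (p ^ e)) ^ 2 / p ^ e <= C2^2 * (p powr - \<eta>) ^ e\<close> already yields a
        geometric series for every prime, however small.\<close>
      have "(\<Sum>m\<in>bpart (pr i1) ` {1..X}. (norm (vcoef i1 J L0 g x m))\<^sup>2 / real m) =
          (\<Sum>m\<in>bpart (pr i1) ` {1..X}. (norm (g m))\<^sup>2 / real m)"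
      proof (intro sum.cong refl)
        fix m assume "m \<in> bpart (pr i1) ` {1..X}"
        then have "vcoef i1 J L0 g x m = g m"
          unfolding vcoef_def using PB.conv_bexp_trivial_block[OF i0(1,2), of m g x] i0(3)
          by (auto simp: prime_factors_bpart)
        then show "(norm (vcoef i1 J L0 g x m))\<^sup>2 / real m = (norm (g m))\<^sup>2 / real m" by simp
      qed
      also have "\<dots> \<le> (\<Prod>p\<in>pr i1. \<Sum>e\<le>X. (norm (g (p ^ e)))\<^sup>2 / real (p ^ e))"
      proof (rule multiplicative_sum_le_prod)
        show "multiplicity p m \<le> X" if m: "m \<in> bpart (pr i1) ` {1..X}" and "p \<in> pr i1" for m p
        proof -
          obtain n where n: "n \<in> {1..X}" "m = bpart (pr i1) n" using m by auto
          then have "m \<in> {1..X}" using bpart_le[of n "pr i1"] by (auto simp: Suc_le_eq)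
          then show ?thesis by (rule S)
        qed
        fix m assume "m \<in> bpart (pr i1) ` {1..X}"
        then have m0: "m > 0" by auto
        have "(norm (g m))\<^sup>2 = (\<Prod>p\<in>prime_factors m. (norm (g (p ^ multiplicity p m)))\<^sup>2)"
          unfolding multiplicative_prod_prime_powers[OF g(1,2) m0] prod_norm[symmetric] by (rule prod_power_distrib)
        moreover have "real m = (\<Prod>p\<in>prime_factors m. real (p ^ multiplicity p m))"
          using nat_prime_decomp[OF m0] by (metis of_nat_prod)
        ultimately show "(norm (g m))\<^sup>2 / real m = (\<Prod>p\<in>prime_factors m. (norm (g (p ^ multiplicity p m)))\<^sup>2 / real (p ^ multiplicity p m))"
          by (simp only: prod_dividef)
      qed (use g(2) finite_pr in \<open>auto simp: pr_def prime_factors_bpart\<close>)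
      also have "\<dots> \<le> C0" unfolding C0_def
      proof (intro prod_mono conjI sum_nonneg)
        fix p assume "p \<in> pr i1"
        then have p: "prime p" by (simp add: pr_def)
        have p2: "real p \<ge> 2" using prime_ge_2_nat[OF p] by simp
        have "(\<Sum>e\<le>X. (norm (g (p ^ e)))\<^sup>2 / real (p ^ e)) \<le> (\<Sum>e\<le>X. C2\<^sup>2 * y ^ e)"
        proof (rule sum_mono)
          fix e
          have "(norm (g (p ^ e)))\<^sup>2 \<le> (C2 * real (p ^ e) powr \<theta>)\<^sup>2"
            using p2 by (intro power_mono g) auto
          then have "(norm (g (p ^ e)))\<^sup>2 / real (p ^ e) \<le> (C2 * real (p ^ e) powr \<theta>)\<^sup>2 / real (p ^ e)"
            by (intro divide_right_mono) auto
          also have "\<dots> = C2\<^sup>2 * (real (p ^ e) powr \<theta> * real (p ^ e) powr \<theta> / real (p ^ e) powr 1)"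
            by (simp add: power2_eq_square)
          also have "real (p ^ e) powr \<theta> * real (p ^ e) powr \<theta> / real (p ^ e) powr 1 = real (p ^ e) powr - \<eta>"
            by (simp only: powr_add[symmetric] powr_diff[symmetric]) (simp add: \<eta>_def)
          also have "\<dots> = (real p powr - \<eta>) ^ e"
            using p2 by (simp add: powr_powr powr_power mult.commute flip: powr_realpow)
          also have "C2\<^sup>2 * (real p powr - \<eta>) ^ e \<le> C2\<^sup>2 * y ^ e"
            unfolding y_def using p2 \<eta> by (intro mult_left_mono power_mono powr_mono2') auto
          finally show "(norm (g (p ^ e)))\<^sup>2 / real (p ^ e) \<le> C2\<^sup>2 * y ^ e" .
        qed
        also have "\<dots> = C2\<^sup>2 * (\<Sum>e\<le>X. y ^ e)" by (simp add: sum_distrib_left)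
        also have "\<dots> \<le> C2\<^sup>2 * (1 / (1 - y))"
        proof (rule mult_left_mono)
          have "(\<Sum>e\<le>X. y ^ e) \<le> (\<Sum>e. y ^ e)" using y by (intro sum_le_suminf summable_geometric) auto
          then show "(\<Sum>e\<le>X. y ^ e) \<le> 1 / (1 - y)" using y by (simp add: suminf_geometric)
        qed simp
        finally show "(\<Sum>e\<le>X. (norm (g (p ^ e)))\<^sup>2 / real (p ^ e)) \<le> C2\<^sup>2 * (1 / (1 - y))" .
      qed auto
      finally show "(\<Sum>m\<in>bpart (pr i1) ` {1..X}. (norm (vcoef i1 J L0 g x m))\<^sup>2 / real m) \<le> C0" .
    next
      fix i assume i: "i \<in> {i1..<J}"
      then have ii: "i \<in> idx i1 J" "blk i1 i = bl i" using i1 by (auto simp: idx_def blk_def)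
      define r where "r = (\<lambda>p. \<Sum>e=2..X. 4 ^ e * (norm (majorant g x (p ^ e)))\<^sup>2 / real (p ^ e))"
      have r0: "r p \<ge> 0" for p unfolding r_def by (intro sum_nonneg) auto
      have split: "(\<Sum>e\<le>X. h e) = h 0 + h 1 + (\<Sum>e=2..X. h e)" for h :: "nat \<Rightarrow> real"
      proof -
        have "{..X} = insert 0 (insert 1 {2..X})" using X1 by auto
        then show ?thesis by (simp add: add.assoc)
      qed
      have pp: "prime p" if "p \<in> bl i" for p using that by (simp add: in_bl_iff)
      have one: "dirichlet_conv g (hcoef x) (p ^ 0) = 1" "norm (majorant g x (p ^ 0)) = 1"
        "dirichlet_conv g (hcoef x) (p ^ 1) = g p + x p" "norm (majorant g x (p ^ 1)) = norm (g p) + norm (x p)"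
        if "prime p" for p
        using g(2) hcoef_prime_power[OF that, of x 1] hcoef_prime_power[OF that, of x 0]
        by (simp_all only: dirichlet_conv_prime_power[OF that] norm_majorant_prime_power[OF that]) simp_all
      have "(\<Sum>m\<in>bpart (blk i1 i) ` {1..X}. (norm (dirichlet_conv g (PB.bexp x) m))\<^sup>2 / real m) \<le>
        (\<Prod>p\<in>blk i1 i. \<Sum>e\<le>X. (norm (dirichlet_conv g (hcoef x) (p ^ e)))\<^sup>2 / real (p ^ e)) +
         (1 / 4) ^ len L0 J i * (\<Prod>p\<in>blk i1 i. \<Sum>e\<le>X. 4 ^ e * (norm (majorant g x (p ^ e)))\<^sup>2 / real (p ^ e))"
      proof (rule PB.conv_bexp_block_sum[OF g(1,2) ii(1)])
        show "multiplicity p m \<le> X" if m: "m \<in> bpart (blk i1 i) ` {1..X}" and "p \<in> blk i1 i" for m p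
        proof -
          obtain n where n: "n \<in> {1..X}" "m = bpart (blk i1 i) n" using m by auto
          then have "m \<in> {1..X}" using bpart_le[of n "blk i1 i"] by (auto simp: Suc_le_eq)
          then show ?thesis by (rule S)
        qed
      qed (auto simp: prime_factors_bpart)
      also have "\<dots> \<le> exp ((\<Sum>p\<in>bl i. (norm (g p + x p))\<^sup>2 / real p) + (\<Sum>p\<in>bl i. r p)) + (1 / 4) ^ len L0 J i * exp K"
      proof (intro add_mono mult_left_mono)
        have "(\<Prod>p\<in>bl i. \<Sum>e\<le>X. (norm (dirichlet_conv g (hcoef x) (p ^ e)))\<^sup>2 / real (p ^ e)) \<le>
            (\<Prod>p\<in>bl i. exp ((norm (g p + x p))\<^sup>2 / real p + r p))"
        proof (intro prod_mono conjI sum_nonneg)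
          fix p assume p: "p \<in> bl i"
          have "(\<Sum>e=2..X. (norm (dirichlet_conv g (hcoef x) (p ^ e)))\<^sup>2 / real (p ^ e)) \<le> r p"
            unfolding r_def
          proof (intro sum_mono divide_right_mono)
            fix e
            have "norm (dirichlet_conv g (hcoef x) (p ^ e)) \<le> norm (majorant g x (p ^ e))"
              unfolding norm_majorant dirichlet_conv_def
              by (intro order_trans[OF norm_sum] sum_mono) (simp add: norm_mult)
            then have "(norm (dirichlet_conv g (hcoef x) (p ^ e)))\<^sup>2 \<le> 1 * (norm (majorant g x (p ^ e)))\<^sup>2" by (simp add: power_mono)
            also have "\<dots> \<le> 4 ^ e * (norm (majorant g x (p ^ e)))\<^sup>2" by (intro mult_right_mono) auto
            finally show "(norm (dirichlet_conv g (hcoef x) (p ^ e)))\<^sup>2 \<le> 4 ^ e * (norm (majorant g x (p ^ e)))\<^sup>2" .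
          qed simp
          then have "(\<Sum>e\<le>X. (norm (dirichlet_conv g (hcoef x) (p ^ e)))\<^sup>2 / real (p ^ e)) \<le>
              1 + ((norm (g p + x p))\<^sup>2 / real p + r p)"
            unfolding split one[OF pp[OF p]] by simp
          also have "\<dots> \<le> exp ((norm (g p + x p))\<^sup>2 / real p + r p)" by (rule exp_ge_add_one_self)
          finally show "(\<Sum>e\<le>X. (norm (dirichlet_conv g (hcoef x) (p ^ e)))\<^sup>2 / real (p ^ e)) \<le>
              exp ((norm (g p + x p))\<^sup>2 / real p + r p)" .
        qed auto
        also have "\<dots> = exp ((\<Sum>p\<in>bl i. (norm (g p + x p))\<^sup>2 / real p) + (\<Sum>p\<in>bl i. r p))"
          by (simp add: exp_sum[OF finite_bl, symmetric] sum.distrib)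
        finally show "(\<Prod>p\<in>blk i1 i. \<Sum>e\<le>X. (norm (dirichlet_conv g (hcoef x) (p ^ e)))\<^sup>2 / real (p ^ e)) \<le>
          exp ((\<Sum>p\<in>bl i. (norm (g p + x p))\<^sup>2 / real p) + (\<Sum>p\<in>bl i. r p))" by (simp add: ii)
        have "(\<Prod>p\<in>bl i. \<Sum>e\<le>X. 4 ^ e * (norm (majorant g x (p ^ e)))\<^sup>2 / real (p ^ e)) \<le>
            (\<Prod>p\<in>bl i. exp (8 * ((norm (g p))\<^sup>2 / real p) + 8 * ((norm (x p))\<^sup>2 / real p) + r p))"
        proof (intro prod_mono conjI sum_nonneg)
          fix p assume p: "p \<in> bl i"
          have "(norm (g p) + norm (x p))\<^sup>2 \<le> 2 * (norm (g p))\<^sup>2 + 2 * (norm (x p))\<^sup>2"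
            using sum_squares_bound[of "norm (g p)" "norm (x p)"] by (simp add: power2_sum)
          then have "4 * (norm (g p) + norm (x p))\<^sup>2 / real p \<le> (8 * (norm (g p))\<^sup>2 + 8 * (norm (x p))\<^sup>2) / real p"
            by (intro divide_right_mono) auto
          then have "(\<Sum>e\<le>X. 4 ^ e * (norm (majorant g x (p ^ e)))\<^sup>2 / real (p ^ e)) \<le>
             1 + (8 * ((norm (g p))\<^sup>2 / real p) + 8 * ((norm (x p))\<^sup>2 / real p) + r p)"
            unfolding split one[OF pp[OF p]] r_def by (simp add: add_divide_distrib)
          also have "\<dots> \<le> exp (8 * ((norm (g p))\<^sup>2 / real p) + 8 * ((norm (x p))\<^sup>2 / real p) + r p)"
            by (rule exp_ge_add_one_self)
          finally show "(\<Sum>e\<le>X. 4 ^ e * (norm (majorant g x (p ^ e)))\<^sup>2 / real (p ^ e)) \<le> \<dots>" .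
        qed auto
        also have "\<dots> = exp (8 * (\<Sum>p\<in>bl i. (norm (g p))\<^sup>2 / real p) + 8 * (\<Sum>p\<in>bl i. (norm (x p))\<^sup>2 / real p) + (\<Sum>p\<in>bl i. r p))"
          by (simp only: exp_sum[OF finite_bl, symmetric] sum.distrib sum_distrib_left)
        also have "\<dots> \<le> exp K"
        proof -
          have "bl i \<subseteq> pr J - pr i1" using pr_diff_eq_UN[OF J] i by auto
          then have "(\<Sum>p\<in>bl i. r p) \<le> (\<Sum>p\<in>pr J - pr i1. r p)" using r0 finite_pr by (intro sum_mono2) auto
          also have "\<dots> \<le> R" unfolding r_def by (rule R[OF J])
          finally have "(\<Sum>p\<in>bl i. r p) \<le> R" .
          then show ?thesis unfolding K_def exp_le_cancel_iff using D(1)[of i] D(2)[of i] by linarith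
        qed
        finally show "(\<Prod>p\<in>blk i1 i. \<Sum>e\<le>X. 4 ^ e * (norm (majorant g x (p ^ e)))\<^sup>2 / real (p ^ e)) \<le> exp K"
          by (simp add: ii)
      qed simp
      also have "\<dots> \<le> exp ((\<Sum>p\<in>bl i. (norm (g p + x p))\<^sup>2 / real p) + (\<Sum>p\<in>bl i. r p) + exp K * (1 / 4) ^ len L0 J i)"
      proof -
        \<comment> \<open>The additive error becomes a factor \<open>exp \<delta>\<close>, because
          the main exponent \<open>A\<close> is non-negative.\<close>
        define A where "A = (\<Sum>p\<in>bl i. (norm (g p + x p))\<^sup>2 / real p) + (\<Sum>p\<in>bl i. r p)"
        define \<delta> where "\<delta> = exp K * (1 / 4) ^ len L0 J i"
        have "A \<ge> 0" unfolding A_def using r0 by (intro add_nonneg_nonneg sum_nonneg) auto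
        then have "1 \<le> exp A" by simp
        moreover have \<delta>: "\<delta> \<ge> 0" by (simp add: \<delta>_def)
        ultimately have "exp A + \<delta> \<le> exp A * (1 + \<delta>)"
          using mult_right_mono[of 1 "exp A" \<delta>] by (simp add: distrib_left)
        also have "\<dots> \<le> exp A * exp \<delta>" by (intro mult_left_mono exp_ge_add_one_self) simp
        finally show ?thesis by (simp add: A_def \<delta>_def exp_add mult_ac)
      qed
      finally show "(\<Sum>m\<in>bpart (bl i) ` {1..X}. (norm (vcoef i1 J L0 g x m))\<^sup>2 / real m) \<le>
         exp ((\<Sum>p\<in>bl i. (norm (g p + x p))\<^sup>2 / real p) +
           (\<Sum>p\<in>bl i. \<Sum>e=2..X. 4 ^ e * (norm (majorant g x (p ^ e)))\<^sup>2 / real (p ^ e)) + exp K * (1/4) ^ len L0 J i)"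
        by (simp add: ii vcoef_def r_def)
    qed auto
    also have "(\<Prod>i\<in>{i1..<J}. exp ((\<Sum>p\<in>bl i. (norm (g p + x p))\<^sup>2 / real p) +
        (\<Sum>p\<in>bl i. \<Sum>e=2..X. 4 ^ e * (norm (majorant g x (p ^ e)))\<^sup>2 / real (p ^ e)) + exp K * (1/4) ^ len L0 J i)) =
      exp ((\<Sum>p\<in>pr J - pr i1. (norm (g p + x p))\<^sup>2 / real p) +
        (\<Sum>p\<in>pr J - pr i1. \<Sum>e=2..X. 4 ^ e * (norm (majorant g x (p ^ e)))\<^sup>2 / real (p ^ e)) +
        exp K * (\<Sum>i=i1..<J. (1/4) ^ len L0 J i))"
      unfolding sum_pr_diff[OF J] by (simp add: exp_sum[symmetric] sum.distrib sum_distrib_left)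
    also have "C0 * \<dots> \<le> (C0 + 1) * exp ((\<Sum>p\<in>pr J - pr i1. (norm (g p + x p))\<^sup>2 / real p) + R + exp K)"
    proof (intro mult_mono)
      have "(\<Sum>i=i1..<J. (1/4 :: real) ^ len L0 J i) \<le> (1/4) ^ L0"
        using L0 i1 by (intro sum_len_decay) auto
      also have "\<dots> \<le> 1" by (intro power_le_one) auto
      finally have "exp K * (\<Sum>i=i1..<J. (1/4) ^ len L0 J i) \<le> exp K * 1" by (intro mult_left_mono) auto
      then show "exp ((\<Sum>p\<in>pr J - pr i1. (norm (g p + x p))\<^sup>2 / real p) +
        (\<Sum>p\<in>pr J - pr i1. \<Sum>e=2..X. 4 ^ e * (norm (majorant g x (p ^ e)))\<^sup>2 / real (p ^ e)) +
        exp K * (\<Sum>i=i1..<J. (1/4) ^ len L0 J i)) \<le> exp ((\<Sum>p\<in>pr J - pr i1. (norm (g p + x p))\<^sup>2 / real p) + R + exp K)"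
        unfolding exp_le_cancel_iff using R[OF J, of X] by linarith
    qed (use C0 in auto)
    finally show ?thesis by (simp add: C_def X_def exp_add mult_ac)
  qed
  ultimately show ?thesis by (rule that)
qed

lemma bl_eq_if_common: "p \<in> bl i \<Longrightarrow> p \<in> bl j \<Longrightarrow> i = j"
  using bl_disjoint[of i j] bl_disjoint[of j i] by (metis disjoint_iff linorder_neqE_nat)

lemma sum_UN_le:
  fixes u :: "'b \<Rightarrow> real"
  assumes "finite I" "\<And>i. i \<in> I \<Longrightarrow> finite (A i)" "\<And>i x. i \<in> I \<Longrightarrow> x \<in> A i \<Longrightarrow> u x \<ge> 0"
  shows "sum u (\<Union>i\<in>I. A i) \<le> (\<Sum>i\<in>I. sum u (A i))"
  using assms
proof (induction I rule: finite_induct)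
  case (insert j I)
  have "sum u (A j \<union> (\<Union>i\<in>I. A i)) = sum u (A j) + sum u (\<Union>i\<in>I. A i) - sum u (A j \<inter> (\<Union>i\<in>I. A i))"
    using insert by (intro sum_Un) auto
  moreover have "sum u (A j \<inter> (\<Union>i\<in>I. A i)) \<ge> 0" using insert by (intro sum_nonneg) auto
  moreover have "sum u (\<Union>i\<in>I. A i) \<le> (\<Sum>i\<in>I. sum u (A i))" using insert by auto
  ultimately show ?case using insert by simp
qed simp

text \<open>Rankin's trick: the weight \<open>2 ^ card (A \<inter> b)\<close> dominates \<open>2 ^ l\<close> on the subsets with more than \<open>l\<close> elements in \<open>b\<close>.\<close>

lemma rankin_subsets:
  fixes \<kappa> :: "'a \<Rightarrow> real"
  assumes "finite P" "b \<subseteq> P" "\<And>p. p \<in> P \<Longrightarrow> \<kappa> p \<ge> 0"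
  shows "(\<Sum>A | A \<subseteq> P \<and> card (A \<inter> b) > l. \<Prod>p\<in>A. \<kappa> p) \<le>
    (1 / 2) ^ l * exp (\<Sum>p\<in>b. \<kappa> p) * (\<Prod>p\<in>P. 1 + \<kappa> p)"
proof -
  define w where "w = (\<lambda>p. if p \<in> b then 2 else 1 :: real)"
  have finA: "finite A" if "A \<subseteq> P" for A using that assms(1) by (rule finite_subset)
  have wA: "(\<Prod>p\<in>A. w p) = 2 ^ card (A \<inter> b)" if "A \<subseteq> P" for A
    unfolding w_def using finA[OF that] by (simp add: prod.If_cases Int_def)
  have "(\<Sum>A | A \<subseteq> P \<and> card (A \<inter> b) > l. \<Prod>p\<in>A. \<kappa> p) \<le>
      (\<Sum>A | A \<subseteq> P \<and> card (A \<inter> b) > l. (1 / 2) ^ l * (\<Prod>p\<in>A. w p * \<kappa> p))"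
  proof (rule sum_mono)
    fix A assume A: "A \<in> {A. A \<subseteq> P \<and> card (A \<inter> b) > l}"
    have "(\<Prod>p\<in>A. \<kappa> p) \<ge> 0" using A assms(3) by (intro prod_nonneg) auto
    moreover have "1 \<le> (1 / 2) ^ l * (2::real) ^ card (A \<inter> b)"
    proof -
      have "(2::real) ^ l \<le> 2 ^ card (A \<inter> b)" using A by (intro power_increasing) auto
      then show ?thesis by (simp add: power_divide)
    qed
    ultimately have "1 * (\<Prod>p\<in>A. \<kappa> p) \<le> ((1 / 2) ^ l * 2 ^ card (A \<inter> b)) * (\<Prod>p\<in>A. \<kappa> p)"
      by (intro mult_right_mono)
    then show "(\<Prod>p\<in>A. \<kappa> p) \<le> (1 / 2) ^ l * (\<Prod>p\<in>A. w p * \<kappa> p)"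
      using A by (simp add: prod.distrib wA mult.assoc)
  qed
  also have "\<dots> \<le> (\<Sum>A\<in>Pow P. (1 / 2) ^ l * (\<Prod>p\<in>A. w p * \<kappa> p))"
    using assms by (intro sum_mono2) (auto simp: w_def intro!: mult_nonneg_nonneg prod_nonneg)
  also have "\<dots> = (1 / 2) ^ l * (\<Prod>p\<in>P. w p * \<kappa> p + 1)"
    using prod_add[OF assms(1), of "\<lambda>p. w p * \<kappa> p" "\<lambda>_. 1"] by (simp add: sum_distrib_left)
  also have "\<dots> \<le> (1 / 2) ^ l * (\<Prod>p\<in>P. (if p \<in> b then exp (\<kappa> p) else 1) * (1 + \<kappa> p))"
  proof (intro mult_left_mono prod_mono conjI)
    fix p assume p: "p \<in> P"
    show "0 \<le> w p * \<kappa> p + 1" using assms(3)[OF p] by (auto simp: w_def)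
    have "2 * \<kappa> p + 1 \<le> (1 + \<kappa> p) * (1 + \<kappa> p)" by (simp add: algebra_simps)
    also have "\<dots> \<le> exp (\<kappa> p) * (1 + \<kappa> p)" using assms(3)[OF p] by (intro mult_right_mono) auto
    finally show "w p * \<kappa> p + 1 \<le> (if p \<in> b then exp (\<kappa> p) else 1) * (1 + \<kappa> p)" by (auto simp: w_def)
  qed simp
  also have "(\<Prod>p\<in>P. (if p \<in> b then exp (\<kappa> p) else 1) * (1 + \<kappa> p)) = exp (\<Sum>p\<in>b. \<kappa> p) * (\<Prod>p\<in>P. 1 + \<kappa> p)"
  proof -
    have "(\<Prod>p\<in>P. if p \<in> b then exp (\<kappa> p) else 1) = (\<Prod>p\<in>b. exp (\<kappa> p))"
      using assms(1,2) by (simp add: prod.If_cases Int_absorb1 Int_def[symmetric] Int_commute)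
    then show ?thesis using finite_subset[OF assms(2,1)] by (simp add: prod.distrib exp_sum)
  qed
  finally show ?thesis by (simp add: mult.assoc)
qed

lemma prod_one_plus_ge_exp:
  fixes \<kappa> :: "'a \<Rightarrow> real"
  assumes "finite P" "\<And>p. p \<in> P \<Longrightarrow> 0 \<le> \<kappa> p" "\<And>p. p \<in> P \<Longrightarrow> \<kappa> p \<le> 1"
  shows "exp ((\<Sum>p\<in>P. \<kappa> p) - (\<Sum>p\<in>P. (\<kappa> p)\<^sup>2)) \<le> (\<Prod>p\<in>P. 1 + \<kappa> p)"
proof -
  have "exp ((\<Sum>p\<in>P. \<kappa> p) - (\<Sum>p\<in>P. (\<kappa> p)\<^sup>2)) = (\<Prod>p\<in>P. exp (\<kappa> p - (\<kappa> p)\<^sup>2))"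
    using assms(1) by (simp add: exp_sum flip: sum_subtractf)
  also have "\<dots> \<le> (\<Prod>p\<in>P. 1 + \<kappa> p)"
  proof (intro prod_mono conjI)
    fix p assume p: "p \<in> P"
    have "\<kappa> p - (\<kappa> p)\<^sup>2 \<le> ln (1 + \<kappa> p)" by (rule ln_one_plus_pos_lower_bound[OF assms(2,3)[OF p]])
    then have "exp (\<kappa> p - (\<kappa> p)\<^sup>2) \<le> exp (ln (1 + \<kappa> p))" by simp
    then show "exp (\<kappa> p - (\<kappa> p)\<^sup>2) \<le> 1 + \<kappa> p" using assms(2)[OF p] by simp
  qed auto
  finally show ?thesis .
qed

text \<open>The sum is restricted to square-free integers made of primes up to
  \<open>exp (4 ^ (J - h))\<close>, with at most \<open>len L0 J i\<close> primes from block
  \<open>i\<close>. There the coefficients are exact, and Rankin's trick shows that this restriction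
  loses at most half of the full product over primes. These integers stay below
  \<open>exp (\<epsilon> * 4 ^ J)\<close> with \<open>\<epsilon> = 4 * L0 / 2 ^ h\<close>, so moving
  the abscissa by \<open>\<delta>\<close> costs only
  \<open>exp (- 2 * \<delta> * \<epsilon> * 4 ^ J)\<close>; that \<open>\<epsilon>\<close> can be
  made small is what \<open>h\<close> is for.\<close>

lemma vcoef_second_moment_lower:
  fixes g x :: "nat \<Rightarrow> complex"
  defines "\<kappa> \<equiv> \<lambda>p. (norm (g p + x p))\<^sup>2 / real p"
  assumes g: "multiplicative g" "g 1 = 1" and i1: "i1 \<ge> 1" and L0: "L0 \<ge> 1"
    and D: "\<And>i. (\<Sum>p\<in>bl i. \<kappa> p) \<le> D" and L0D: "(1 / 2) ^ L0 * exp D \<le> 1 / 2"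
    and \<kappa>1: "\<And>p. prime p \<Longrightarrow> p \<notin> pr i1 \<Longrightarrow> \<kappa> p \<le> 1"
    and J: "i1 + h \<le> J" and h: "4 * real L0 / 2 ^ h \<le> 1" and \<delta>: "\<delta> \<ge> 0"
  shows "(\<Sum>n=1..cutoff J. (norm (vcoef i1 J L0 g x n))\<^sup>2 * real n powr (- 2 * (1 / 2 + \<delta>))) \<ge>
    exp (- 2 * \<delta> * (4 * real L0 / 2 ^ h) * 4 ^ J) / 2 *
      exp ((\<Sum>p\<in>pr (J - h) - pr i1. \<kappa> p) - (\<Sum>p\<in>pr (J - h) - pr i1. (\<kappa> p)\<^sup>2))"
proof -
  have i1J: "i1 \<le> J" "i1 \<le> J - h" using J by auto
  interpret PB: prime_blocks "idx i1 J" "blk i1" "len L0 J" by (rule prime_blocks_idx[OF i1])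
  have primes: "PB.primes = pr J" unfolding PB.primes_def by (rule primes_idx[OF i1 i1J(1)])
  define P where "P = pr (J - h) - pr i1"
  have finP: "finite P" by (simp add: P_def finite_pr)
  have PJ: "P \<subseteq> pr J" unfolding P_def using pr_mono[of "J - h" J] by auto
  have pP: "prime p" "p \<notin> pr i1" if "p \<in> P" for p using that by (auto simp: P_def pr_def)
  have P_UN: "P = (\<Union>i\<in>{i1..<J - h}. bl i)" unfolding P_def by (rule pr_diff_eq_UN[OF i1J(2)])
  have \<kappa>0: "\<kappa> p \<ge> 0" for p by (simp add: \<kappa>_def)
  \<comment> \<open>Sets of primes standing for their products; no prime comes from the last
    \<open>h\<close> blocks.\<close>
  define good where "good = {A. A \<subseteq> P \<and> (\<forall>i\<in>{i1..<J - h}. card (A \<inter> bl i) \<le> len L0 J i)}"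
  have fin_good: "finite good" unfolding good_def using finP by (intro finite_subset[OF _ finite_Pow_iff[THEN iffD2, OF finP]]) auto
  have finA: "finite A" if "A \<subseteq> P" for A using that finP by (rule finite_subset)
  define \<epsilon> where "\<epsilon> = 4 * real L0 / 2 ^ h"
  have prod_pos: "\<Prod>A > 0" if "A \<subseteq> P" for A
    using that pP by (intro prod_pos) (auto simp: prime_gt_0_nat)
  have inj: "inj_on (\<lambda>A. \<Prod>A) good"
  proof (rule inj_onI)
    fix A A' assume A: "A \<in> good" "A' \<in> good" "\<Prod>A = \<Prod>A'"
    have "prime_factors (\<Prod>A) = A" if "A \<in> good" for A
    proof -
      have "prime_factorization (prod_mset (mset_set A)) = mset_set A"
        using that pP finA by (intro prime_factorization_prod_mset_primes) (auto simp: good_def)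
      then show ?thesis using that finA[of A] by (simp add: prod_unfold_prod_mset good_def)
    qed
    then show "A = A'" using A by metis
  qed
  have prod_le: "real (\<Prod>A) \<le> exp (\<epsilon> * 4 ^ J)" if A: "A \<in> good" for A
  proof -
    have AP: "A \<subseteq> P" using A by (simp add: good_def)
    have "real (\<Prod>A) = (\<Prod>p\<in>A. exp (ln (real p)))"
      using AP pP by (simp add: prime_gt_0_nat subset_iff cong: prod.cong)
    also have "\<dots> = exp (\<Sum>p\<in>A. ln (real p))" using finA[OF AP] by (simp add: exp_sum)
    also have "(\<Sum>p\<in>A. ln (real p)) = (\<Sum>i=i1..<J - h. \<Sum>p\<in>A \<inter> bl i. ln (real p))"
    proof -
      have "A = (\<Union>i\<in>{i1..<J - h}. A \<inter> bl i)" using AP P_UN by auto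
      then have "(\<Sum>p\<in>A. ln (real p)) = (\<Sum>p\<in>(\<Union>i\<in>{i1..<J - h}. A \<inter> bl i). ln (real p))" by simp
      also have "\<dots> = (\<Sum>i=i1..<J - h. \<Sum>p\<in>A \<inter> bl i. ln (real p))"
        by (intro sum.UNION_disjoint) (auto simp: finite_bl dest: bl_eq_if_common)
      finally show ?thesis .
    qed
    also have "\<dots> \<le> (\<Sum>i=i1..<J - h. 4 * real L0 * 2 ^ J * 2 ^ i)"
    proof (rule sum_mono)
      fix i assume i: "i \<in> {i1..<J - h}"
      have "(\<Sum>p\<in>A \<inter> bl i. ln (real p)) \<le> real (card (A \<inter> bl i)) * 4 ^ Suc i"
        by (intro sum_bounded_above) (auto simp: in_bl_iff)
      also have "\<dots> \<le> real (len L0 J i) * 4 ^ Suc i"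
        using A i by (intro mult_right_mono) (auto simp: good_def)
      also have "\<dots> = 4 * real L0 * 2 ^ J * 2 ^ i"
      proof -
        have "J - i + i = J" using i by auto
        then have "(2::real) ^ (J - i) * 2 ^ i = 2 ^ J" by (simp flip: power_add)
        moreover have "(4::real) ^ i = 2 ^ i * 2 ^ i" by (simp flip: power_mult_distrib)
        ultimately show ?thesis using i i1 by (simp add: len_def)
      qed
      finally show "(\<Sum>p\<in>A \<inter> bl i. ln (real p)) \<le> 4 * real L0 * 2 ^ J * 2 ^ i" .
    qed
    also have "\<dots> = 4 * real L0 * 2 ^ J * (\<Sum>i=i1..<J - h. 2 ^ i)" by (simp add: sum_distrib_left)
    also have "\<dots> \<le> 4 * real L0 * 2 ^ J * 2 ^ (J - h)"
    proof (rule mult_left_mono)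
      have "(\<Sum>i=i1..<J - h. 2 ^ i) \<le> (\<Sum>i<J - h. (2::real) ^ i)" by (intro sum_mono2) auto
      also have "\<dots> \<le> 2 ^ (J - h)" by (simp add: geometric_sum)
      finally show "(\<Sum>i=i1..<J - h. 2 ^ i) \<le> (2::real) ^ (J - h)" .
    qed simp
    also have "4 * real L0 * 2 ^ J * 2 ^ (J - h) = \<epsilon> * 4 ^ J"
    proof -
      have "(2::real) ^ (J - h) = 2 ^ J / 2 ^ h" using J by (simp add: power_diff)
      moreover have "(4::real) ^ J = 2 ^ J * 2 ^ J" by (simp flip: power_mult_distrib)
      ultimately show ?thesis by (simp add: \<epsilon>_def)
    qed
    finally show ?thesis by simp
  qed
  have v_good: "vcoef i1 J L0 g x (\<Prod>A) = (\<Prod>p\<in>A. g p + x p)" if A: "A \<in> good" for A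
    unfolding vcoef_def
  proof (rule PB.conv_bexp_squarefree[OF g])
    have AP: "A \<subseteq> P" using A by (simp add: good_def)
    show "finite A" by (rule finA[OF AP])
    show "A \<subseteq> PB.primes" using AP PJ by (auto simp: primes)
    fix i assume i: "i \<in> idx i1 J"
    show "card (A \<inter> blk i1 i) \<le> len L0 J i"
    proof (cases "i \<in> {i1..<J - h}")
      case True
      then show ?thesis using A i1 by (auto simp: good_def blk_def)
    next
      case False
      have "A \<inter> blk i1 i = {}"
      proof (cases "i = 0")
        case True
        then show ?thesis using AP by (auto simp: blk_def P_def)
      next
        case i0: False
        show ?thesis
        proof (rule ccontr)
          assume "A \<inter> blk i1 i \<noteq> {}"
          then obtain p where p: "p \<in> A" "p \<in> bl i" using i0 by (auto simp: blk_def)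
          then obtain j where "j \<in> {i1..<J - h}" "p \<in> bl j" using AP P_UN by auto
          then show False using bl_eq_if_common[of p i j] p False by simp
        qed
      qed
      then show ?thesis by simp
    qed
  qed
  have "exp ((\<Sum>p\<in>P. \<kappa> p) - (\<Sum>p\<in>P. (\<kappa> p)\<^sup>2)) / 2 \<le> (\<Prod>p\<in>P. 1 + \<kappa> p) / 2"
    using \<kappa>0 \<kappa>1 pP by (intro divide_right_mono prod_one_plus_ge_exp finP) auto
  also have "\<dots> \<le> (\<Sum>A\<in>good. \<Prod>p\<in>A. \<kappa> p)"
  proof -
    have "(\<Prod>p\<in>P. 1 + \<kappa> p) = (\<Sum>A\<in>Pow P. \<Prod>p\<in>A. \<kappa> p)"
      using prod_add[OF finP, of \<kappa> "\<lambda>_. 1"] by (simp add: add.commute)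
    \<comment> \<open>A set that is not good has too many primes in some block; the union bound over
      blocks loses nothing essential, as the Rankin factors \<open>(1 / 2) ^ len\<close> sum to at
      most \<open>(1 / 2) ^ L0\<close>.\<close>
    also have "\<dots> \<le> (\<Sum>A\<in>good \<union> (\<Union>i\<in>{i1..<J - h}. {A. A \<subseteq> P \<and> card (A \<inter> bl i) > len L0 J i}). \<Prod>p\<in>A. \<kappa> p)"
    proof (rule sum_mono2)
      show "finite (good \<union> (\<Union>i\<in>{i1..<J - h}. {A. A \<subseteq> P \<and> card (A \<inter> bl i) > len L0 J i}))"
        using finP by (intro finite_UnI fin_good finite_UN_I) (auto intro: finite_subset[OF _ finite_Pow_iff[THEN iffD2, OF finP]])
    qed (auto simp: good_def not_le intro!: prod_nonneg \<kappa>0)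
    also have "\<dots> \<le> (\<Sum>A\<in>good. \<Prod>p\<in>A. \<kappa> p) +
        (\<Sum>A\<in>(\<Union>i\<in>{i1..<J - h}. {A. A \<subseteq> P \<and> card (A \<inter> bl i) > len L0 J i}). \<Prod>p\<in>A. \<kappa> p)"
      using \<kappa>0 finP fin_good
      by (subst sum_Un[OF fin_good])
         (auto intro!: sum_nonneg prod_nonneg finite_UN_I intro: finite_subset[OF _ finite_Pow_iff[THEN iffD2, OF finP]])
    also have "(\<Sum>A\<in>(\<Union>i\<in>{i1..<J - h}. {A. A \<subseteq> P \<and> card (A \<inter> bl i) > len L0 J i}). \<Prod>p\<in>A. \<kappa> p) \<le>
        (\<Sum>i=i1..<J - h. \<Sum>A | A \<subseteq> P \<and> card (A \<inter> bl i) > len L0 J i. \<Prod>p\<in>A. \<kappa> p)"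
      using \<kappa>0 finP by (intro sum_UN_le) (auto intro!: prod_nonneg intro: finite_subset[OF _ finite_Pow_iff[THEN iffD2, OF finP]])
    also have "\<dots> \<le> (\<Sum>i=i1..<J - h. (1 / 2) ^ len L0 J i * exp D * (\<Prod>p\<in>P. 1 + \<kappa> p))"
    proof (rule sum_mono)
      fix i assume i: "i \<in> {i1..<J - h}"
      have "bl i \<subseteq> P" using P_UN i by auto
      then have "(\<Sum>A | A \<subseteq> P \<and> card (A \<inter> bl i) > len L0 J i. \<Prod>p\<in>A. \<kappa> p) \<le>
          (1 / 2) ^ len L0 J i * exp (\<Sum>p\<in>bl i. \<kappa> p) * (\<Prod>p\<in>P. 1 + \<kappa> p)"
        using \<kappa>0 by (intro rankin_subsets finP)
      also have "\<dots> \<le> (1 / 2) ^ len L0 J i * exp D * (\<Prod>p\<in>P. 1 + \<kappa> p)"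
        using D[of i] \<kappa>0 by (intro mult_right_mono mult_left_mono prod_nonneg) (auto intro: add_nonneg_nonneg)
      finally show "(\<Sum>A | A \<subseteq> P \<and> card (A \<inter> bl i) > len L0 J i. \<Prod>p\<in>A. \<kappa> p) \<le>
          (1 / 2) ^ len L0 J i * exp D * (\<Prod>p\<in>P. 1 + \<kappa> p)" .
    qed
    also have "\<dots> = (\<Sum>i=i1..<J - h. (1 / 2) ^ len L0 J i) * (exp D * (\<Prod>p\<in>P. 1 + \<kappa> p))"
      by (simp add: sum_distrib_right mult.assoc)
    also have "\<dots> \<le> (1 / 2) ^ L0 * (exp D * (\<Prod>p\<in>P. 1 + \<kappa> p))"
      using L0 i1 \<kappa>0 by (intro mult_right_mono sum_len_decay mult_nonneg_nonneg prod_nonneg) (auto intro: add_nonneg_nonneg)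
    also have "\<dots> \<le> 1 / 2 * (\<Prod>p\<in>P. 1 + \<kappa> p)"
      unfolding mult.assoc[symmetric] using L0D \<kappa>0 by (intro mult_right_mono prod_nonneg) (auto intro: add_nonneg_nonneg)
    finally show ?thesis by simp
  qed
  finally have main: "exp ((\<Sum>p\<in>P. \<kappa> p) - (\<Sum>p\<in>P. (\<kappa> p)\<^sup>2)) / 2 \<le> (\<Sum>A\<in>good. \<Prod>p\<in>A. \<kappa> p)" by simp
  have "exp (- 2 * \<delta> * \<epsilon> * 4 ^ J) / 2 * exp ((\<Sum>p\<in>P. \<kappa> p) - (\<Sum>p\<in>P. (\<kappa> p)\<^sup>2)) =
      exp (- 2 * \<delta> * \<epsilon> * 4 ^ J) * (exp ((\<Sum>p\<in>P. \<kappa> p) - (\<Sum>p\<in>P. (\<kappa> p)\<^sup>2)) / 2)" by simp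
  also have "\<dots> \<le> exp (- 2 * \<delta> * \<epsilon> * 4 ^ J) * (\<Sum>A\<in>good. \<Prod>p\<in>A. \<kappa> p)" by (intro mult_left_mono main) simp
  also have "\<dots> = (\<Sum>A\<in>good. exp (- 2 * \<delta> * \<epsilon> * 4 ^ J) * (\<Prod>p\<in>A. \<kappa> p))" by (simp add: sum_distrib_left)
  also have "\<dots> \<le> (\<Sum>A\<in>good. (norm (vcoef i1 J L0 g x (\<Prod>A)))\<^sup>2 * real (\<Prod>A) powr (- 2 * (1 / 2 + \<delta>)))"
  proof (rule sum_mono)
    fix A assume A: "A \<in> good"
    have AP: "A \<subseteq> P" using A by (simp add: good_def)
    have n0: "real (\<Prod>A) > 0" using prod_pos[OF AP] by (simp only: of_nat_0_less_iff)
    have "(\<Prod>p\<in>A. \<kappa> p) = (norm (vcoef i1 J L0 g x (\<Prod>A)))\<^sup>2 / real (\<Prod>A)"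
      unfolding v_good[OF A] \<kappa>_def prod_dividef by (simp add: prod_power_distrib flip: prod_norm)
    moreover have "real (\<Prod>A) powr (- 2 * (1 / 2 + \<delta>)) = real (\<Prod>A) powr (- 2 * \<delta>) / real (\<Prod>A)"
    proof -
      have e: "- 2 * (1 / 2 + \<delta>) = - 2 * \<delta> - 1" by simp
      show ?thesis unfolding e powr_diff using n0 by (simp only: powr_one less_imp_le)
    qed
    moreover have "exp (- 2 * \<delta> * \<epsilon> * 4 ^ J) \<le> real (\<Prod>A) powr (- 2 * \<delta>)"
    proof -
      have "ln (real (\<Prod>A)) \<le> \<epsilon> * 4 ^ J" using prod_le[OF A] n0 by (metis exp_le_cancel_iff exp_ln)
      then have "2 * \<delta> * ln (real (\<Prod>A)) \<le> 2 * \<delta> * (\<epsilon> * 4 ^ J)" using \<delta> by (intro mult_left_mono) auto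
      then have "exp (- (2 * \<delta> * (\<epsilon> * 4 ^ J))) \<le> exp (- (2 * \<delta> * ln (real (\<Prod>A))))" by simp
      moreover have "real (\<Prod>A) powr (- 2 * \<delta>) = exp (- (2 * \<delta> * ln (real (\<Prod>A))))" using n0 by (simp only: powr_def) simp
      ultimately show ?thesis by (simp add: mult.assoc)
    qed
    ultimately have "exp (- 2 * \<delta> * \<epsilon> * 4 ^ J) * (\<Prod>p\<in>A. \<kappa> p) \<le>
        real (\<Prod>A) powr (- 2 * \<delta>) * ((norm (vcoef i1 J L0 g x (\<Prod>A)))\<^sup>2 / real (\<Prod>A))"
      by (metis divide_nonneg_nonneg mult_right_mono of_nat_0_le_iff zero_le_power2)
    also have "\<dots> = (norm (vcoef i1 J L0 g x (\<Prod>A)))\<^sup>2 * real (\<Prod>A) powr (- 2 * (1 / 2 + \<delta>))"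
      unfolding \<open>real (\<Prod>A) powr (- 2 * (1 / 2 + \<delta>)) = real (\<Prod>A) powr (- 2 * \<delta>) / real (\<Prod>A)\<close>
      by (simp only: times_divide_eq_right mult.commute)
    finally show "exp (- 2 * \<delta> * \<epsilon> * 4 ^ J) * (\<Prod>p\<in>A. \<kappa> p) \<le>
      (norm (vcoef i1 J L0 g x (\<Prod>A)))\<^sup>2 * real (\<Prod>A) powr (- 2 * (1 / 2 + \<delta>))" .
  qed
  also have "\<dots> = (\<Sum>n\<in>(\<lambda>A. \<Prod>A) ` good. (norm (vcoef i1 J L0 g x n))\<^sup>2 * real n powr (- 2 * (1 / 2 + \<delta>)))"
    by (subst sum.reindex[OF inj]) (simp only: o_def)
  also have "\<dots> \<le> (\<Sum>n=1..cutoff J. (norm (vcoef i1 J L0 g x n))\<^sup>2 * real n powr (- 2 * (1 / 2 + \<delta>)))"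
  proof (intro sum_mono2)
    show "(\<lambda>A. \<Prod>A) ` good \<subseteq> {1..cutoff J}"
    proof clarify
      fix A assume A: "A \<in> good"
      have "real (\<Prod>A) \<le> exp (\<epsilon> * 4 ^ J)" by (rule prod_le[OF A])
      also have "\<dots> \<le> exp (1 * 4 ^ J)"
        unfolding exp_le_cancel_iff \<epsilon>_def using h by (intro mult_right_mono) auto
      also have "\<dots> = exp (4 ^ J)" by simp
      finally have "\<Prod>A \<le> cutoff J" by (simp only: le_cutoff_iff)
      moreover have "\<Prod>A > 0" using A by (intro prod_pos) (simp add: good_def)
      ultimately show "\<Prod>A \<in> {1..cutoff J}" by (simp only: atLeastAtMost_iff) simp
    qed
  qed auto
  finally show ?thesis unfolding P_def \<epsilon>_def .
qed

subsection \<open>Moments of the truncated exponentials\<close>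

definition apoly :: "nat \<Rightarrow> nat \<Rightarrow> nat \<Rightarrow> (nat \<Rightarrow> complex) \<Rightarrow> complex \<Rightarrow> complex" where
  "apoly i1 J L0 x s = (\<Prod>i\<in>idx i1 J. texp (len L0 J i) (\<Sum>p\<in>blk i1 i. x p * of_nat p powr - s))"

lemma apoly_altdef:
  assumes "i1 \<ge> 1"
  shows "apoly i1 J L0 x s = (\<Prod>i=i1..<J. texp (len L0 J i) (\<Sum>p\<in>bl i. x p * of_nat p powr - s))"
proof -
  have "0 \<notin> {i1..<J}" using assms by auto
  then have "apoly i1 J L0 x s = (\<Prod>i=i1..<J. texp (len L0 J i) (\<Sum>p\<in>blk i1 i. x p * of_nat p powr - s))"
    unfolding apoly_def idx_def by (simp add: len_def texp_def)
  also have "\<dots> = (\<Prod>i=i1..<J. texp (len L0 J i) (\<Sum>p\<in>bl i. x p * of_nat p powr - s))"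
    using assms by (intro prod.cong refl) (auto simp: blk_def)
  finally show ?thesis .
qed

lemma continuous_apoly:
  assumes "i1 \<ge> 1"
  shows "continuous_on X (\<lambda>t. apoly i1 J L0 x (Complex \<sigma> t))"
proof -
  have "p > 0" if "p \<in> bl i" for p i using that by (simp add: in_bl_iff prime_gt_0_nat)
  then show ?thesis
    unfolding apoly_altdef[OF assms] texp_def by (intro continuous_intros) auto
qed

lemma fact_times_power_le:
  fixes u :: real
  assumes "u \<ge> 0"
  shows "u ^ n * fact n \<le> (u * real n) ^ n"
proof -
  have "fact n \<le> (real n) ^ n" using fact_le_power[of n, where 'a = real] by simp
  then have "u ^ n * fact n \<le> u ^ n * real n ^ n" using assms by (intro mult_left_mono) auto
  then show ?thesis by (simp add: power_mult_distrib)
qed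

text \<open>By \<open>texp_powr_le\<close> each block is bounded by a sum of two squares of
  polynomials. The product of these sums is expanded over the sets \<open>T\<close> of blocks where
  the first alternative is taken; every summand is the square of a Dirichlet polynomial whose mean
  square factorizes over blocks. Summed over \<open>T\<close>, the bounds recombine into the product
  of \<open>E i * exp (k\<^sup>2 * \<sigma> i) + (1 / 4) ^ l i\<close>.\<close>

lemma
  fixes f :: "nat \<Rightarrow> complex" and \<beta> k q \<tau> \<Delta> :: real
  assumes \<beta>: "0 \<le> \<beta>" "\<beta> \<le> k" and q: "q * \<beta> = k" "0 < q" "q \<le> real Q" and Q: "Q \<ge> 1"
    and D: "\<And>i. (\<Sum>p\<in>bl i. (norm (f p))\<^sup>2 / real p) \<le> D" and i1: "i1 \<ge> 1" and L0: "L0 \<ge> 1"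
    and L0D: "4 * (4096 * k\<^sup>2 * D * real Q) \<le> real L0"
    and J: "i1 \<le> J" and \<Delta>: "exp (8 * real Q * real L0 * 4 ^ J) \<le> \<Delta>"
  defines "F \<equiv> \<lambda>t. norm (apoly i1 J L0 (\<lambda>p. of_real \<beta> * f p) (Complex (1 / 2) t)) powr (2 * q) * gw \<tau> \<Delta> t"
  shows apoly_moment: "(LINT t|lborel. F t) \<le> 3 / 2 * sqrt (2 * pi) * exp (2 * q + 5) *
      \<Delta> * exp (k\<^sup>2 * (\<Sum>p\<in>pr J - pr i1. (norm (f p))\<^sup>2 / real p))"
    and apoly_moment_integrable: "integrable lborel F"
proof -
  define I' where "I' = {i1..<J}"
  define c where "c = 2 * q + 4"
  define z where "z = (\<lambda>i t. \<Sum>p\<in>bl i. f p * of_nat p powr (- Complex (1 / 2) t))"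
  define l where "l = len L0 J"
  define \<sigma> where "\<sigma> = (\<lambda>i. \<Sum>p\<in>bl i. (norm (f p))\<^sup>2 / real p)"
  \<comment> \<open>Chosen so that the polynomial of block \<open>i\<close> is the truncated
    exponential of \<open>k * z i t\<close> for \<open>i\<close> in \<open>T\<close> and a pure
    power of degree \<open>Q * l i\<close> otherwise.\<close>
  define \<phi> where "\<phi> = (\<lambda>T i r. if i \<in> T then (if r \<le> l i then complex_of_real k ^ r else 0)
    else (if r = Q * l i then of_real ((64 * k / real (l i)) ^ (Q * l i) * fact (Q * l i)) else 0))"
  define G where "G = (\<lambda>T t. (norm (\<Prod>i\<in>I'. \<Sum>r\<le>Q * l i. \<phi> T i r * z i t ^ r / fact r))\<^sup>2 * gw \<tau> \<Delta> t)"
  define E where "E = (\<lambda>i. exp (c * (1 / 4) ^ l i))"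
  have k0: "k \<ge> 0" using \<beta> by simp
  have c0: "c \<ge> 0" using q by (simp add: c_def)
  have \<sigma>0: "\<sigma> i \<ge> 0" for i unfolding \<sigma>_def by (intro sum_nonneg) auto
  have D0: "D \<ge> 0" using \<sigma>0[of 0] D[of 0] by (simp add: \<sigma>_def)
  have finI: "finite I'" by (simp add: I'_def)
  have i0: "i \<noteq> 0" "i < J" if "i \<in> I'" for i using that i1 by (auto simp: I'_def)
  have lL0: "l i \<ge> L0" if "i \<in> I'" for i using len_ge[OF L0 i0(2)[OF that] i0(1)[OF that]] by (simp add: l_def)
  have l1: "l i \<ge> 1" if "i \<in> I'" for i using lL0[OF that] L0 by linarith
  have lenl: "l i = L0 * 2 ^ (J - i)" if "i \<in> I'" for i using i0[OF that] by (simp add: l_def len_def)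
  have lQ: "l i \<le> Q * l i" for i using Q by simp
  have \<phi>T: "(\<Sum>r\<le>Q * l i. \<phi> T i r * w ^ r / fact r) = texp (l i) (of_real k * w)" if "i \<in> T" for T i w
  proof -
    have "(\<Sum>r\<le>Q * l i. \<phi> T i r * w ^ r / fact r) = (\<Sum>r\<le>l i. of_real k ^ r * w ^ r / fact r)"
      using that lQ[of i] by (intro sum.mono_neutral_cong_right) (auto simp: \<phi>_def)
    then show ?thesis by (simp add: texp_def power_mult_distrib)
  qed
  have \<phi>nT: "(\<Sum>r\<le>Q * l i. \<phi> T i r * w ^ r / fact r) = (64 * of_real k * w / of_nat (l i)) ^ (Q * l i)" if "i \<notin> T" for T i w
  proof -
    have "(\<Sum>r\<le>Q * l i. \<phi> T i r * w ^ r / fact r) =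
        (\<Sum>r\<le>Q * l i. if r = Q * l i then of_real ((64 * k / real (l i)) ^ (Q * l i)) * w ^ (Q * l i) else 0)"
      using that by (intro sum.cong refl) (auto simp: \<phi>_def)
    then show ?thesis by (simp add: power_mult_distrib power_divide)
  qed
  \<comment> \<open>The degree in block \<open>i\<close> may reach \<open>Q * l i\<close>; the
    resulting length is at most \<open>exp (4 * Q * L0 * 4 ^ J)\<close>, and its square is the lower
    bound required of \<open>\<Delta>\<close>.\<close>
  have len_sum: "exp (\<Sum>i\<in>I'. 4 ^ Suc i * real (Q * l i)) ^ 2 \<le> \<Delta>"
  proof -
    have "(\<Sum>i\<in>I'. 4 ^ Suc i * real (Q * l i)) = (\<Sum>i\<in>I'. 4 * real Q * real L0 * 2 ^ J * 2 ^ i)"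
    proof (intro sum.cong refl)
      fix i assume i: "i \<in> I'"
      have "J - i + i = J" using i0[OF i] by auto
      then have "(2::real) ^ (J - i) * 2 ^ i = 2 ^ J" by (simp flip: power_add)
      moreover have "(4::real) ^ i = 2 ^ i * 2 ^ i" by (simp flip: power_mult_distrib)
      ultimately show "4 ^ Suc i * real (Q * l i) = 4 * real Q * real L0 * 2 ^ J * 2 ^ i"
        using lenl[OF i] by (simp add: mult_ac)
    qed
    also have "\<dots> = 4 * real Q * real L0 * 2 ^ J * (\<Sum>i\<in>I'. 2 ^ i)" by (simp add: sum_distrib_left)
    also have "\<dots> \<le> 4 * real Q * real L0 * 2 ^ J * 2 ^ J"
    proof (rule mult_left_mono)
      have "(\<Sum>i\<in>I'. (2::real) ^ i) \<le> (\<Sum>i<J. 2 ^ i)" unfolding I'_def by (intro sum_mono2) auto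
      also have "\<dots> \<le> 2 ^ J" by (simp add: geometric_sum)
      finally show "(\<Sum>i\<in>I'. (2::real) ^ i) \<le> 2 ^ J" .
    qed simp
    also have "\<dots> = 4 * real Q * real L0 * 4 ^ J" by (simp flip: power_mult_distrib)
    finally have "2 * (\<Sum>i\<in>I'. 4 ^ Suc i * real (Q * l i)) \<le> 8 * real Q * real L0 * 4 ^ J" by linarith
    then have "exp (2 * (\<Sum>i\<in>I'. 4 ^ Suc i * real (Q * l i))) \<le> exp (8 * real Q * real L0 * 4 ^ J)" by (simp only: exp_le_cancel_iff)
    then show ?thesis using \<Delta> unfolding exp_double by linarith
  qed
  have \<Delta>0: "\<Delta> > 0" using \<Delta> by (meson exp_gt_zero less_le_trans)
  have bms: "(LINT t|lborel. G T t) \<le> 3 / 2 * (sqrt (2 * pi) * \<Delta> *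
      (\<Prod>i\<in>I'. \<Sum>r\<le>Q * l i. (norm (\<phi> T i r))\<^sup>2 * \<sigma> i ^ r / fact r)) \<and> integrable lborel (G T)" for T
  proof -
    have hyps: "finite I'" "disjoint_family_on bl I'" "\<And>i. i \<in> I' \<Longrightarrow> finite (bl i)"
      "\<And>i p. i \<in> I' \<Longrightarrow> p \<in> bl i \<Longrightarrow> prime p" "\<And>i p. i \<in> I' \<Longrightarrow> p \<in> bl i \<Longrightarrow> ln (real p) \<le> 4 ^ Suc i"
      "\<And>i. i \<in> I' \<Longrightarrow> (4::real) ^ Suc i \<ge> 0"
      using finI disjoint_bl finite_bl by (auto simp: in_bl_iff)
    have \<sigma>': "(\<Sum>p\<in>bl i. (norm (f p))\<^sup>2 * real p powr (- 2 * (1 / 2))) = \<sigma> i" for i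
      unfolding \<sigma>_def by (intro sum.cong refl) (auto simp: powr_minus_divide in_bl_iff)
    have "(LINT t|lborel. G T t) \<le> 3 / 2 * (sqrt (2 * pi) * \<Delta> *
        (\<Prod>i\<in>I'. \<Sum>r\<le>Q * l i. (norm (\<phi> T i r))\<^sup>2 * \<sigma> i ^ r / fact r))"
      unfolding G_def z_def \<sigma>'[symmetric]
    proof (rule block_mean_square[where y = "\<lambda>i. 4 ^ Suc i"])
    qed (rule len_sum | use hyps in blast)+
    moreover have "integrable lborel (G T)"
      unfolding G_def z_def
    proof (rule block_mean_square_integrable[where y = "\<lambda>i. 4 ^ Suc i"])
    qed (rule len_sum | use hyps in blast)+
    ultimately show ?thesis by blast
  qed
  have M: "(\<Prod>i\<in>I'. \<Sum>r\<le>Q * l i. (norm (\<phi> T i r))\<^sup>2 * \<sigma> i ^ r / fact r) \<le>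
      (\<Prod>i\<in>T. exp (k\<^sup>2 * \<sigma> i)) * (\<Prod>i\<in>I' - T. (1 / 4) ^ l i)" if T: "T \<subseteq> I'" for T
  proof -
    have "(\<Prod>i\<in>I'. \<Sum>r\<le>Q * l i. (norm (\<phi> T i r))\<^sup>2 * \<sigma> i ^ r / fact r) \<le>
       (\<Prod>i\<in>I'. if i \<in> T then exp (k\<^sup>2 * \<sigma> i) else (1 / 4) ^ l i)"
    proof (intro prod_mono conjI sum_nonneg)
      fix i assume i: "i \<in> I'"
      show "(\<Sum>r\<le>Q * l i. (norm (\<phi> T i r))\<^sup>2 * \<sigma> i ^ r / fact r) \<le> (if i \<in> T then exp (k\<^sup>2 * \<sigma> i) else (1 / 4) ^ l i)"
      proof (cases "i \<in> T")
        case True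
        have "(\<Sum>r\<le>Q * l i. (norm (\<phi> T i r))\<^sup>2 * \<sigma> i ^ r / fact r) = (\<Sum>r\<le>l i. (k\<^sup>2 * \<sigma> i) ^ r / fact r)"
          using True lQ[of i] k0
          by (intro sum.mono_neutral_cong_right)
             (auto simp: \<phi>_def norm_power power_mult_distrib mult.commute simp flip: power_mult)
        also have "\<dots> \<le> exp (k\<^sup>2 * \<sigma> i)"
        proof -
          have "(\<Sum>r\<le>l i. (k\<^sup>2 * \<sigma> i) ^ r / fact r) \<le> (\<Sum>r. (k\<^sup>2 * \<sigma> i) ^ r / fact r)"
            using summable_exp[of "k\<^sup>2 * \<sigma> i"] \<sigma>0[of i] by (intro sum_le_suminf) (auto simp: field_simps)
          then show ?thesis by (simp add: exp_def field_simps)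
        qed
        finally show ?thesis using True by simp
      next
        case False
        define n where "n = Q * l i"
        \<comment> \<open>The mean square of the pure power is \<open>u ^ n * fact n\<close>, at
          most \<open>(u * n) ^ n\<close>. Here
          \<open>u * n = 4096 * k^2 * \<sigma> i * Q / l i\<close> with \<open>4096 = 64^2\<close>,
          so taking \<open>L0\<close> large makes it at most 1/4.\<close>
        define u where "u = (64 * k / real (l i))\<^sup>2 * \<sigma> i"
        have u0: "u \<ge> 0" using \<sigma>0 by (simp add: u_def)
        have "(\<Sum>r\<le>Q * l i. (norm (\<phi> T i r))\<^sup>2 * \<sigma> i ^ r / fact r) =
            (\<Sum>r\<le>n. if r = n then ((64 * k / real (l i)) ^ n * fact n)\<^sup>2 * \<sigma> i ^ n / fact n else 0)"
          using False by (intro sum.cong) (auto simp: \<phi>_def n_def simp del: of_real_mult of_real_power)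
        also have "\<dots> = ((64 * k / real (l i)) ^ n * fact n)\<^sup>2 * \<sigma> i ^ n / fact n" by simp
        also have "\<dots> = u ^ n * fact n"
        proof -
          have "(V ^ n * fact n)\<^sup>2 * s ^ n / fact n = (V\<^sup>2 * s) ^ n * fact n" for V s :: real
            by (simp add: power_mult_distrib power2_eq_square)
          then show ?thesis by (simp only: u_def)
        qed
        also have "\<dots> \<le> (u * real n) ^ n" by (rule fact_times_power_le[OF u0])
        also have "\<dots> \<le> (1 / 4) ^ n"
        proof (intro power_mono)
          have li: "real (l i) > 0" using l1[OF i] by simp
          have "u * real n = 4096 * k\<^sup>2 * \<sigma> i * real Q / real (l i)"
            using li by (simp add: u_def n_def power2_eq_square field_simps)
          also have "\<dots> \<le> 4096 * k\<^sup>2 * D * real Q / real (l i)"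
            using D[of i] li by (intro divide_right_mono mult_right_mono mult_left_mono) (auto simp: \<sigma>_def)
          also have "\<dots> \<le> 1 / 4"
          proof -
            have "4 * (4096 * k\<^sup>2 * D * real Q) \<le> real (l i)" using L0D lL0[OF i] by linarith
            then show ?thesis using li by (simp add: field_simps)
          qed
          finally show "u * real n \<le> 1 / 4" .
        qed (use u0 in auto)
        also have "\<dots> \<le> (1 / 4) ^ l i" unfolding n_def using lQ by (intro power_decreasing) auto
        finally show ?thesis using False by simp
      qed
    qed (use \<sigma>0 in auto)
    also have "\<dots> = (\<Prod>i\<in>T. exp (k\<^sup>2 * \<sigma> i)) * (\<Prod>i\<in>I' - T. (1 / 4) ^ l i)"
      using T finI by (simp add: prod.If_cases Int_absorb1 Diff_eq[symmetric] Int_commute Int_absorb2 set_diff_eq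
          Collect_conj_eq[symmetric])
    finally show ?thesis .
  qed
  have Fb: "F t \<le> (\<Sum>T\<in>Pow I'. (\<Prod>i\<in>T. E i) * G T t)" for t
  proof -
    have "norm (apoly i1 J L0 (\<lambda>p. of_real \<beta> * f p) (Complex (1 / 2) t)) powr (2 * q) =
        (\<Prod>i\<in>I'. norm (texp (l i) (of_real \<beta> * z i t)) powr (2 * q))"
      unfolding apoly_altdef[OF i1] z_def l_def I'_def prod_norm[symmetric]
      by (subst prod_powr_distrib) (auto simp: sum_distrib_left mult.assoc)
    also have "\<dots> \<le> (\<Prod>i\<in>I'. E i * (norm (texp (l i) (of_real k * z i t)))\<^sup>2 +
        (norm (64 * of_real k * z i t / of_nat (l i))) ^ (2 * Q * l i))"
    proof (intro prod_mono conjI)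
      fix i assume i: "i \<in> I'"
      show "norm (texp (l i) (of_real \<beta> * z i t)) powr (2 * q) \<le> E i * (norm (texp (l i) (of_real k * z i t)))\<^sup>2 +
        (norm (64 * of_real k * z i t / of_nat (l i))) ^ (2 * Q * l i)"
        using texp_powr_le[OF l1[OF i] \<beta> q, of "z i t"] by (simp add: E_def c_def)
    qed simp
    also have "\<dots> = (\<Sum>T\<in>Pow I'. (\<Prod>i\<in>T. E i * (norm (texp (l i) (of_real k * z i t)))\<^sup>2) *
        (\<Prod>i\<in>I' - T. (norm (64 * of_real k * z i t / of_nat (l i))) ^ (2 * Q * l i)))"
      by (rule prod_add[OF finI])
    also have "\<dots> = (\<Sum>T\<in>Pow I'. (\<Prod>i\<in>T. E i) * (norm (\<Prod>i\<in>I'. \<Sum>r\<le>Q * l i. \<phi> T i r * z i t ^ r / fact r))\<^sup>2)"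
    proof (intro sum.cong refl)
      fix T assume "T \<in> Pow I'"
      then have T: "T \<subseteq> I'" by simp
      have "(\<Prod>i\<in>I'. \<Sum>r\<le>Q * l i. \<phi> T i r * z i t ^ r / fact r) =
         (\<Prod>i\<in>T. texp (l i) (of_real k * z i t)) * (\<Prod>i\<in>I' - T. (64 * of_real k * z i t / of_nat (l i)) ^ (Q * l i))"
      proof -
        have "(\<Prod>i\<in>I'. \<Sum>r\<le>Q * l i. \<phi> T i r * z i t ^ r / fact r) =
          (\<Prod>i\<in>I' - T. \<Sum>r\<le>Q * l i. \<phi> T i r * z i t ^ r / fact r) * (\<Prod>i\<in>T. \<Sum>r\<le>Q * l i. \<phi> T i r * z i t ^ r / fact r)"
          by (rule prod.subset_diff[OF T finI])
        also have "(\<Prod>i\<in>I' - T. \<Sum>r\<le>Q * l i. \<phi> T i r * z i t ^ r / fact r) =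
          (\<Prod>i\<in>I' - T. (64 * of_real k * z i t / of_nat (l i)) ^ (Q * l i))"
          by (intro prod.cong refl \<phi>nT) auto
        also have "(\<Prod>i\<in>T. \<Sum>r\<le>Q * l i. \<phi> T i r * z i t ^ r / fact r) = (\<Prod>i\<in>T. texp (l i) (of_real k * z i t))"
          by (intro prod.cong refl \<phi>T) auto
        finally show ?thesis by (simp only: mult.commute)
      qed
      then have "(norm (\<Prod>i\<in>I'. \<Sum>r\<le>Q * l i. \<phi> T i r * z i t ^ r / fact r))\<^sup>2 =
        (\<Prod>i\<in>T. (norm (texp (l i) (of_real k * z i t)))\<^sup>2) *
        (\<Prod>i\<in>I' - T. (norm (64 * of_real k * z i t / of_nat (l i))) ^ (2 * Q * l i))"
      proof -
        have "(norm (w ^ (Q * n)))\<^sup>2 = norm w ^ (2 * Q * n)" for w :: complex and n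
          by (simp add: norm_power mult_ac flip: power_mult)
        moreover assume "(\<Prod>i\<in>I'. \<Sum>r\<le>Q * l i. \<phi> T i r * z i t ^ r / fact r) =
         (\<Prod>i\<in>T. texp (l i) (of_real k * z i t)) * (\<Prod>i\<in>I' - T. (64 * of_real k * z i t / of_nat (l i)) ^ (Q * l i))"
        ultimately show ?thesis by (simp only: norm_mult power_mult_distrib prod_power_distrib prod_norm[symmetric])
      qed
      then show "(\<Prod>i\<in>T. E i * (norm (texp (l i) (of_real k * z i t)))\<^sup>2) *
        (\<Prod>i\<in>I' - T. (norm (64 * of_real k * z i t / of_nat (l i))) ^ (2 * Q * l i)) =
        (\<Prod>i\<in>T. E i) * (norm (\<Prod>i\<in>I'. \<Sum>r\<le>Q * l i. \<phi> T i r * z i t ^ r / fact r))\<^sup>2"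
        by (simp add: prod.distrib)
    qed
    finally have "F t \<le> (\<Sum>T\<in>Pow I'. (\<Prod>i\<in>T. E i) * (norm (\<Prod>i\<in>I'. \<Sum>r\<le>Q * l i. \<phi> T i r * z i t ^ r / fact r))\<^sup>2) * gw \<tau> \<Delta> t"
      unfolding F_def by (intro mult_right_mono less_imp_le[OF gw_pos])
    then show ?thesis by (simp add: G_def sum_distrib_right mult.assoc)
  qed
  have intG: "integrable lborel (\<lambda>t. \<Sum>T\<in>Pow I'. (\<Prod>i\<in>T. E i) * G T t)"
    using bms by (intro Bochner_Integration.integrable_sum integrable_mult_right) auto
  have Fmeas: "F \<in> borel_measurable lborel"
  proof -
    have "continuous_on UNIV F" unfolding F_def using q
      by (intro continuous_intros continuous_on_powr' continuous_apoly[OF i1]) auto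
    then show ?thesis by (simp add: borel_measurable_continuous_onI)
  qed
  have F0: "F t \<ge> 0" for t unfolding F_def by (intro mult_nonneg_nonneg less_imp_le[OF gw_pos]) auto
  show intF: "integrable lborel F"
    by (rule Bochner_Integration.integrable_bound[OF intG Fmeas]) (use Fb F0 in \<open>auto intro!: always_eventually order_trans[OF Fb]\<close>)
  have "(LINT t|lborel. F t) \<le> (LINT t|lborel. (\<Sum>T\<in>Pow I'. (\<Prod>i\<in>T. E i) * G T t))"
    by (intro integral_mono intF intG Fb)
  also have "\<dots> = (\<Sum>T\<in>Pow I'. (\<Prod>i\<in>T. E i) * (LINT t|lborel. G T t))"
    using bms by (subst Bochner_Integration.integral_sum) (auto intro!: integrable_mult_right sum.cong)
  also have "\<dots> \<le> (\<Sum>T\<in>Pow I'. (\<Prod>i\<in>T. E i) * (3 / 2 * (sqrt (2 * pi) * \<Delta> *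
      ((\<Prod>i\<in>T. exp (k\<^sup>2 * \<sigma> i)) * (\<Prod>i\<in>I' - T. (1 / 4) ^ l i)))))"
  proof (intro sum_mono mult_left_mono)
    fix T assume "T \<in> Pow I'"
    then have "(\<Prod>i\<in>I'. \<Sum>r\<le>Q * l i. (norm (\<phi> T i r))\<^sup>2 * \<sigma> i ^ r / fact r) \<le>
      (\<Prod>i\<in>T. exp (k\<^sup>2 * \<sigma> i)) * (\<Prod>i\<in>I' - T. (1 / 4) ^ l i)" by (intro M) simp
    then have "3 / 2 * (sqrt (2 * pi) * \<Delta> * (\<Prod>i\<in>I'. \<Sum>r\<le>Q * l i. (norm (\<phi> T i r))\<^sup>2 * \<sigma> i ^ r / fact r)) \<le>
      3 / 2 * (sqrt (2 * pi) * \<Delta> * ((\<Prod>i\<in>T. exp (k\<^sup>2 * \<sigma> i)) * (\<Prod>i\<in>I' - T. (1 / 4) ^ l i)))"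
      using \<Delta>0 by (intro mult_left_mono) auto
    then show "(LINT t|lborel. G T t) \<le> 3 / 2 * (sqrt (2 * pi) * \<Delta> * ((\<Prod>i\<in>T. exp (k\<^sup>2 * \<sigma> i)) * (\<Prod>i\<in>I' - T. (1 / 4) ^ l i)))"
      using bms[of T] by linarith
  qed (simp add: E_def prod_nonneg)
  also have "\<dots> = 3 / 2 * sqrt (2 * pi) * \<Delta> * (\<Sum>T\<in>Pow I'. (\<Prod>i\<in>T. E i * exp (k\<^sup>2 * \<sigma> i)) * (\<Prod>i\<in>I' - T. (1 / 4) ^ l i))"
    by (simp add: sum_distrib_left prod.distrib mult_ac)
  also have "(\<Sum>T\<in>Pow I'. (\<Prod>i\<in>T. E i * exp (k\<^sup>2 * \<sigma> i)) * (\<Prod>i\<in>I' - T. (1 / 4) ^ l i)) =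
      (\<Prod>i\<in>I'. E i * exp (k\<^sup>2 * \<sigma> i) + (1 / 4) ^ l i)"
    by (rule prod_add[OF finI, symmetric])
  also have "3 / 2 * sqrt (2 * pi) * \<Delta> * (\<Prod>i\<in>I'. E i * exp (k\<^sup>2 * \<sigma> i) + (1 / 4) ^ l i) \<le>
      3 / 2 * sqrt (2 * pi) * \<Delta> * (exp (c + 1) * exp (k\<^sup>2 * (\<Sum>i\<in>I'. \<sigma> i)))"
  proof (rule mult_left_mono)
    have "(\<Prod>i\<in>I'. E i * exp (k\<^sup>2 * \<sigma> i) + (1 / 4) ^ l i) \<le> (\<Prod>i\<in>I'. exp (k\<^sup>2 * \<sigma> i + (c + 1) * (1 / 4) ^ l i))"
    proof (intro prod_mono conjI)
      fix i
      define u where "u = (1 / 4 :: real) ^ l i"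
      \<comment> \<open>As the first summand is the exponential of \<open>A >= 0\<close>, the rare
        alternative raises the exponent by at most \<open>(1 / 4) ^ l i\<close>.\<close>
      define A where "A = c * u + k\<^sup>2 * \<sigma> i"
      have u0: "u \<ge> 0" by (simp add: u_def)
      have "A \<ge> 0" unfolding A_def using u0 c0 \<sigma>0 by (intro add_nonneg_nonneg mult_nonneg_nonneg) auto
      then have "u * 1 \<le> u * exp A" using u0 by (intro mult_left_mono) auto
      then have "exp A + u \<le> exp A * (1 + u)" by (simp add: distrib_left mult.commute)
      also have "\<dots> \<le> exp A * exp u" by (intro mult_left_mono exp_ge_add_one_self) simp
      finally show "E i * exp (k\<^sup>2 * \<sigma> i) + (1 / 4) ^ l i \<le> exp (k\<^sup>2 * \<sigma> i + (c + 1) * (1 / 4) ^ l i)"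
        by (simp add: E_def A_def u_def algebra_simps flip: exp_add)
    qed (simp add: E_def)
    also have "\<dots> = exp (k\<^sup>2 * (\<Sum>i\<in>I'. \<sigma> i) + (c + 1) * (\<Sum>i\<in>I'. (1 / 4) ^ l i))"
      using finI by (simp add: exp_sum[symmetric] sum.distrib sum_distrib_left)
    also have "\<dots> \<le> exp (k\<^sup>2 * (\<Sum>i\<in>I'. \<sigma> i) + (c + 1) * 1)"
    proof -
      have "(\<Sum>i\<in>I'. (1 / 4 :: real) ^ l i) \<le> (1 / 4) ^ L0"
        unfolding I'_def l_def using L0 i1 by (intro sum_len_decay) auto
      also have "\<dots> \<le> 1" by (intro power_le_one) auto
      finally have "(c + 1) * (\<Sum>i\<in>I'. (1 / 4 :: real) ^ l i) \<le> (c + 1) * 1" using c0 by (intro mult_left_mono) auto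
      then show ?thesis by simp
    qed
    finally show "(\<Prod>i\<in>I'. E i * exp (k\<^sup>2 * \<sigma> i) + (1 / 4) ^ l i) \<le> exp (c + 1) * exp (k\<^sup>2 * (\<Sum>i\<in>I'. \<sigma> i))"
      by (simp add: exp_add mult.commute)
  qed (use \<Delta>0 in auto)
  also have "(\<Sum>i\<in>I'. \<sigma> i) = (\<Sum>p\<in>pr J - pr i1. (norm (f p))\<^sup>2 / real p)"
    unfolding I'_def \<sigma>_def by (rule sum_pr_diff[OF J, symmetric])
  finally show "(LINT t|lborel. F t) \<le> 3 / 2 * sqrt (2 * pi) * exp (2 * q + 5) *
      \<Delta> * exp (k\<^sup>2 * (\<Sum>p\<in>pr J - pr i1. (norm (f p))\<^sup>2 / real p))"
    by (simp add: c_def mult_ac add_ac)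
qed

subsection \<open>Approximation on the right and removal of the pole\<close>

text \<open>The value \<open>zeta(3/2)\<close>. The exponent is \<open>1/2 - 2\<close>: coefficients
  of size below \<open>n powr (1/2)\<close> in series taken at real part at least 2.\<close>

definition zconst :: real where "zconst = (\<Sum>\<^sub>\<infinity>n\<in>{1::nat..}. real n powr (- 3 / 2))"

lemma summable_on_zconst: "(\<lambda>n. real n powr (- 3 / 2)) summable_on {1::nat..}"
proof -
  have "summable (\<lambda>n. real n powr (- 3 / 2))" by (subst summable_real_powr_iff) simp
  then have "(\<lambda>n. real n powr (- 3 / 2)) summable_on UNIV" by (intro norm_summable_imp_summable_on) simp
  then show ?thesis by (rule summable_on_subset_banach) simp
qed

lemma norm_nat_powr: "n > 0 \<Longrightarrow> norm (of_nat n powr s) = real n powr Re s"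
  by (simp add: norm_powr_real_powr)

lemma
  assumes g: "\<And>n. n \<ge> 1 \<Longrightarrow> norm (g n) \<le> C * real n powr \<theta>" and \<theta>: "\<theta> < 1 / 2" and s: "Re s \<ge> 2"
  shows dsummable_bound: "dsummable g s" and norm_dseries_le: "norm (dseries g s) \<le> C * zconst"
proof -
  have C: "C \<ge> 0" using order_trans[OF norm_ge_zero g[of 1]] by simp
  have b: "norm (g n * of_nat n powr - s) \<le> C * real n powr (- 3 / 2)" if "n \<in> {1..}" for n
  proof -
    have n: "real n \<ge> 1" using that by simp
    have "norm (g n * of_nat n powr - s) \<le> C * real n powr \<theta> * real n powr (- Re s)"
      using g[of n] that n by (simp add: norm_mult norm_nat_powr mult_right_mono)
    also have "\<dots> = C * real n powr (\<theta> - Re s)" by (simp add: powr_add[symmetric])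
    also have "\<dots> \<le> C * real n powr (- 3 / 2)" using \<theta> s n C by (intro mult_left_mono powr_mono) auto
    finally show ?thesis .
  qed
  have sz: "(\<lambda>n. C * real n powr (- 3 / 2)) summable_on {1::nat..}"
    by (intro summable_on_cmult_right summable_on_zconst)
  show "dsummable g s"
    unfolding dsummable_def by (rule summable_on_comparison_test[OF sz]) (use b in auto)
  then have "(\<lambda>n. g n * of_nat n powr - s) summable_on {1..}" unfolding dsummable_def by (rule abs_summable_summable)
  then have "norm (dseries g s) \<le> (\<Sum>\<^sub>\<infinity>n\<in>{1::nat..}. C * real n powr (- 3 / 2))"
    unfolding dseries_def by (intro norm_infsum_le[OF has_sum_infsum has_sum_infsum[OF sz]] b)
  also have "\<dots> = C * zconst" unfolding zconst_def by (rule infsum_cmult_right') 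
  finally show "norm (dseries g s) \<le> C * zconst" .
qed

text \<open>A truncated exponential is bounded by the exponential of the modulus, whatever its
  length. Hence the estimate is independent of \<open>J\<close> and of \<open>L0\<close>.\<close>

lemma norm_apoly_le:
  assumes x: "\<And>p. prime p \<Longrightarrow> norm (x p) \<le> C * real p powr \<theta>" and C: "C \<ge> 0" and \<theta>: "\<theta> < 1 / 2" and s: "Re s \<ge> 2"
    and i1: "1 \<le> i1" "i1 \<le> J"
  shows "norm (apoly i1 J L0 x s) \<le> exp (C * zconst)"
proof -
  have "norm (apoly i1 J L0 x s) = (\<Prod>i=i1..<J. norm (texp (len L0 J i) (\<Sum>p\<in>bl i. x p * of_nat p powr - s)))"
    unfolding apoly_altdef[OF i1(1)] by (simp add: prod_norm)
  also have "\<dots> \<le> (\<Prod>i=i1..<J. exp (\<Sum>p\<in>bl i. C * real p powr (- 3 / 2)))"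
  proof (intro prod_mono conjI)
    fix i
    define w where "w = (\<Sum>p\<in>bl i. x p * of_nat p powr - s)"
    have "norm (texp (len L0 J i) w) \<le> (\<Sum>r\<le>len L0 J i. norm w ^ r / fact r)"
      unfolding texp_def by (intro order_trans[OF norm_sum] sum_mono) (simp add: norm_divide norm_power)
    also have "\<dots> \<le> exp (norm w)"
    proof -
      have "(\<Sum>r\<le>len L0 J i. norm w ^ r / fact r) \<le> (\<Sum>r. norm w ^ r / fact r)"
        using summable_exp[of "norm w"] by (intro sum_le_suminf) (auto simp: field_simps)
      then show ?thesis by (simp add: exp_def field_simps)
    qed
    also have "norm w \<le> (\<Sum>p\<in>bl i. C * real p powr (- 3 / 2))"
      unfolding w_def
    proof (intro order_trans[OF norm_sum] sum_mono)
      fix p assume "p \<in> bl i"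
      then have p: "prime p" by (simp add: in_bl_iff)
      then have p1: "real p \<ge> 1" using prime_ge_1_nat by auto
      have "norm (x p * of_nat p powr - s) \<le> C * real p powr \<theta> * real p powr (- Re s)"
        using x[OF p] p1 by (simp add: norm_mult norm_nat_powr mult_right_mono)
      also have "\<dots> = C * real p powr (\<theta> - Re s)" by (simp add: powr_add[symmetric])
      also have "\<dots> \<le> C * real p powr (- 3 / 2)" using \<theta> s p1 C by (intro mult_left_mono powr_mono) auto
      finally show "norm (x p * of_nat p powr - s) \<le> C * real p powr (- 3 / 2)" .
    qed
    finally show "norm (texp (len L0 J i) (\<Sum>p\<in>bl i. x p * of_nat p powr - s)) \<le> exp (\<Sum>p\<in>bl i. C * real p powr (- 3 / 2))"
      by (simp add: w_def)
  qed simp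
  also have "\<dots> = exp (C * (\<Sum>p\<in>pr J - pr i1. real p powr (- 3 / 2)))"
    unfolding sum_pr_diff[OF i1(2)] by (simp add: exp_sum[symmetric] sum_distrib_left)
  also have "\<dots> \<le> exp (C * zconst)"
  proof -
    have "(\<Sum>p\<in>pr J - pr i1. real p powr (- 3 / 2)) \<le> zconst"
      unfolding zconst_def
      using finite_pr by (intro finite_sum_le_infsum summable_on_zconst) (auto simp: pr_def Suc_le_eq prime_gt_0_nat)
    then show ?thesis using C by (simp add: mult_left_mono)
  qed
  finally show ?thesis .
qed

definition vpoly :: "nat \<Rightarrow> nat \<Rightarrow> nat \<Rightarrow> (nat \<Rightarrow> complex) \<Rightarrow> (nat \<Rightarrow> complex) \<Rightarrow> complex \<Rightarrow> complex" where
  "vpoly i1 J L0 g x s = (\<Sum>n=1..cutoff J. vcoef i1 J L0 g x n * of_nat n powr - s)"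

lemma (in prime_blocks) norm_bexp: "of_real (norm (bexp x n)) = bexp (\<lambda>p. of_real (norm (x p))) n"
proof -
  have "norm (\<Prod>i\<in>I. if Omega (bpart (B i) n) \<le> l i then hcoef x (bpart (B i) n) else 0) =
      (\<Prod>i\<in>I. if Omega (bpart (B i) n) \<le> l i then norm (hcoef x (bpart (B i) n)) else 0)"
    unfolding prod_norm[symmetric] by (intro prod.cong refl) auto
  then show ?thesis by (simp add: bexp_def hcoef_norm if_distrib[of of_real] cong: if_cong)
qed

text \<open>Each term beyond \<open>X = exp (4 ^ J)\<close> contains a factor
  \<open>n powr (- 1 / 4) <= exp (- (4 ^ J) / 4)\<close>. After giving up this 1/4, the real part is
  still at least 2, where the product of the two series with absolute values converges to a bound
  free of \<open>J\<close>.\<close>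

lemma apoly_approx:
  assumes g: "\<And>n. n \<ge> 1 \<Longrightarrow> norm (g n) \<le> C2 * real n powr \<theta>"
    and x: "\<And>p. prime p \<Longrightarrow> norm (x p) \<le> C1 * real p powr \<theta>" and C1: "C1 \<ge> 0" and \<theta>: "\<theta> < 1 / 2"
    and s: "Re s \<ge> 9 / 4" and i1: "1 \<le> i1" "i1 \<le> J"
  shows "norm (dseries g s * apoly i1 J L0 x s - vpoly i1 J L0 g x s) \<le>
    exp (- (4 ^ J) / 4) * (C2 * zconst * exp (C1 * zconst))"
proof -
  interpret PB: prime_blocks "idx i1 J" "blk i1" "len L0 J" by (rule prime_blocks_idx[OF i1(1)])
  define v where "v = vcoef i1 J L0 g x"
  define X where "X = cutoff J"
  define \<kappa> where "\<kappa> = Re s - 1 / 4"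
  have \<kappa>: "\<kappa> \<ge> 2" using s by (simp add: \<kappa>_def)
  have dg: "dsummable g s" using s by (intro dsummable_bound[OF g \<theta>]) auto
  have dv: "dsummable v s" and v_eq: "dseries v s = dseries g s * apoly i1 J L0 x s"
    unfolding v_def vcoef_def
    using dsummable_dirichlet_conv[OF dg PB.dsummable_bexp] dseries_dirichlet_conv[OF dg PB.dsummable_bexp]
    by (auto simp: PB.dseries_bexp apoly_def)
  have sv: "(\<lambda>n. v n * of_nat n powr - s) summable_on {1..}"
    using dv unfolding dsummable_def by (rule abs_summable_summable)
  \<comment> \<open>Absolute values of both factors, kept complex so that the product formula for
    Dirichlet series can be used for the majorant as well.\<close>
  define g' where "g' = (\<lambda>n. complex_of_real (norm (g n)))"
  define a' where "a' = PB.bexp (\<lambda>p. of_real (norm (x p)))"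
  have g': "\<And>n. n \<ge> 1 \<Longrightarrow> norm (g' n) \<le> C2 * real n powr \<theta>" using g by (simp add: g'_def)
  have dg': "dsummable g' (of_real \<kappa>)" using \<kappa> by (intro dsummable_bound[OF g' \<theta>]) auto
  define u where "u = (\<lambda>n. dirichlet_conv g' a' n * of_nat n powr - complex_of_real \<kappa>)"
  have du: "dsummable (dirichlet_conv g' a') (of_real \<kappa>)"
    unfolding a'_def by (intro dsummable_dirichlet_conv dg' PB.dsummable_bexp)
  have su: "u summable_on {1..}" unfolding u_def using du unfolding dsummable_def by (rule abs_summable_summable)
  have vu: "norm (v n) * real n powr (- \<kappa>) \<le> Re (u n)" if "n \<in> {1..}" for n
  proof -
    have n: "n > 0" using that by auto
    have "dirichlet_conv g' a' n = of_real (\<Sum>d | d dvd n. norm (g d) * norm (acoef i1 J L0 x (n div d)))"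
      unfolding a'_def g'_def dirichlet_conv_def PB.norm_bexp[symmetric] by simp
    moreover have "of_nat n powr - complex_of_real \<kappa> = of_real (real n powr (- \<kappa>))"
    proof -
      have e: "complex_of_real \<kappa> = Complex \<kappa> 0" by (simp add: complex_eq_iff)
      show ?thesis unfolding e using nat_powr_Complex[OF n, of \<kappa> 0] by simp
    qed
    ultimately have "Re (u n) = (\<Sum>d | d dvd n. norm (g d) * norm (acoef i1 J L0 x (n div d))) * real n powr (- \<kappa>)"
      unfolding u_def by (simp only: of_real_mult[symmetric] Re_complex_of_real)
    moreover have "norm (v n) \<le> (\<Sum>d | d dvd n. norm (g d) * norm (acoef i1 J L0 x (n div d)))"
      unfolding v_def vcoef_def dirichlet_conv_def by (intro order_trans[OF norm_sum] sum_mono) (simp add: norm_mult)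
    ultimately show ?thesis by (simp add: mult_right_mono)
  qed
  have sRe: "(\<lambda>n. Re (u n)) summable_on {1..}" using su by (rule summable_on_Re)
  have Re_nonneg: "Re (u n) \<ge> 0" if "n \<in> {1..}" for n
    using vu[OF that] by (rule order_trans[rotated]) simp
  have tail: "norm (v n * of_nat n powr - s) \<le> exp (- (4 ^ J) / 4) * Re (u n)" if "n \<in> {X<..}" for n
  proof -
    have "\<not> real n \<le> exp (4 ^ J)" using that by (simp add: X_def flip: le_cutoff_iff)
    then have big: "real n \<ge> exp (4 ^ J)" by simp
    have n0: "n > 0" using that by auto
    have "norm (v n * of_nat n powr - s) = norm (v n) * real n powr (- \<kappa>) * real n powr (- 1 / 4)"
      using n0 by (simp add: norm_mult norm_nat_powr \<kappa>_def powr_add[symmetric])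
    also have "\<dots> \<le> Re (u n) * exp (- (4 ^ J) / 4)"
    proof (intro mult_mono vu)
      have "real n powr (- 1 / 4) \<le> exp (4 ^ J) powr (- 1 / 4)" using big by (intro powr_mono2') auto
      also have "\<dots> = exp (- (4 ^ J) / 4)" by (simp add: exp_powr_real)
      finally show "real n powr (- 1 / 4) \<le> exp (- (4 ^ J) / 4)" .
    qed (use n0 Re_nonneg[of n] in auto)
    finally show ?thesis by (simp add: mult.commute)
  qed
  have "dseries v s = vpoly i1 J L0 g x s + (\<Sum>\<^sub>\<infinity>n\<in>{X<..}. v n * of_nat n powr - s)"
  proof -
    have split: "{1..} = {1..X} \<union> {X<..}" using cutoff_ge_1[of J] by (auto simp: X_def)
    have "dseries v s = infsum (\<lambda>n. v n * of_nat n powr - s) {1..X} + (\<Sum>\<^sub>\<infinity>n\<in>{X<..}. v n * of_nat n powr - s)"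
      unfolding dseries_def split
      by (rule infsum_Un_disjoint) (auto intro: summable_on_subset_banach[OF sv])
    then show ?thesis by (simp add: vpoly_def v_def X_def)
  qed
  then have "norm (dseries g s * apoly i1 J L0 x s - vpoly i1 J L0 g x s) = norm (\<Sum>\<^sub>\<infinity>n\<in>{X<..}. v n * of_nat n powr - s)"
    by (simp add: v_eq[symmetric])
  also have "\<dots> \<le> (\<Sum>\<^sub>\<infinity>n\<in>{X<..}. exp (- (4 ^ J) / 4) * Re (u n))"
  proof (rule norm_infsum_le[OF has_sum_infsum has_sum_infsum tail])
    show "(\<lambda>n. v n * of_nat n powr - s) summable_on {X<..}"
      by (rule summable_on_subset_banach[OF sv]) auto
    show "(\<lambda>n. exp (- (4 ^ J) / 4) * Re (u n)) summable_on {X<..}"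
      by (intro summable_on_cmult_right summable_on_subset_banach[OF sRe]) auto
  qed
  also have "\<dots> \<le> (\<Sum>\<^sub>\<infinity>n\<in>{1..}. exp (- (4 ^ J) / 4) * Re (u n))"
    using Re_nonneg by (intro infsum_mono_neutral summable_on_cmult_right summable_on_subset_banach[OF sRe] sRe) auto
  also have "\<dots> = exp (- (4 ^ J) / 4) * Re (infsum u {1..})"
    by (simp only: infsum_cmult_right' infsum_Re[OF su])
  also have "\<dots> \<le> exp (- (4 ^ J) / 4) * (C2 * zconst * exp (C1 * zconst))"
  proof (rule mult_left_mono)
    have "infsum u {1..} = dseries g' (of_real \<kappa>) * dseries a' (of_real \<kappa>)"
      unfolding u_def a'_def
      using dseries_dirichlet_conv[OF dg' PB.dsummable_bexp] by (simp add: dseries_def)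
    also have "dseries a' (of_real \<kappa>) = apoly i1 J L0 (\<lambda>p. of_real (norm (x p))) (of_real \<kappa>)"
      unfolding a'_def by (simp add: PB.dseries_bexp apoly_def)
    finally have "norm (infsum u {1..}) = norm (dseries g' (of_real \<kappa>)) * norm (apoly i1 J L0 (\<lambda>p. of_real (norm (x p))) (of_real \<kappa>))"
      by (simp add: norm_mult)
    also have "\<dots> \<le> (C2 * zconst) * exp (C1 * zconst)"
    proof (intro mult_mono)
      show n1: "norm (dseries g' (of_real \<kappa>)) \<le> C2 * zconst" using \<kappa> by (intro norm_dseries_le[OF g' \<theta>]) auto
      show "norm (apoly i1 J L0 (\<lambda>p. of_real (norm (x p))) (of_real \<kappa>)) \<le> exp (C1 * zconst)"
        using x C1 \<theta> i1 \<kappa> by (intro norm_apoly_le) auto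
      show "0 \<le> C2 * zconst" using n1 norm_ge_zero by (rule order_trans[rotated])
    qed simp
    finally show "Re (infsum u {1..}) \<le> C2 * zconst * exp (C1 * zconst)"
      using complex_Re_le_cmod[of "infsum u {1..}"] by linarith
  qed simp
  finally show ?thesis .
qed

lemma norm_power_diff_le:
  fixes x y :: complex
  assumes "norm x \<le> K" "norm y \<le> K"
  shows "norm (x ^ m - y ^ m) \<le> real m * K ^ (m - 1) * norm (x - y)"
proof -
  have K: "K \<ge> 0" using assms(1) norm_ge_zero by (rule order_trans[rotated])
  have "x ^ m - y ^ m = (x - y) * (\<Sum>i<m. y ^ (m - Suc i) * x ^ i)" by (rule power_diff_sumr2)
  then have "norm (x ^ m - y ^ m) = norm (x - y) * norm (\<Sum>i<m. y ^ (m - Suc i) * x ^ i)" by (simp only: norm_mult)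
  also have "\<dots> \<le> norm (x - y) * (\<Sum>i<m. K ^ (m - 1))"
  proof (intro mult_left_mono order_trans[OF norm_sum] sum_mono)
    fix i assume i: "i \<in> {..<m}"
    have "norm (y ^ (m - Suc i) * x ^ i) \<le> K ^ (m - Suc i) * K ^ i"
      using assms K unfolding norm_mult norm_power by (intro mult_mono power_mono) auto
    also have "\<dots> = K ^ (m - 1)" using i by (simp flip: power_add)
    finally show "norm (y ^ (m - Suc i) * x ^ i) \<le> K ^ (m - 1)" .
  qed simp
  finally show ?thesis by (simp add: mult_ac)
qed

lemma one_minus_exp_factor: "((\<lambda>w. (1 - exp (1 - w)) / (w - 1)) \<longlongrightarrow> 1) (at (1::complex))"
proof -
  have "((\<lambda>w. 1 - exp (1 - w)) has_field_derivative 1) (at (1::complex))"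
    by (auto intro!: derivative_eq_intros)
  then show ?thesis by (simp add: has_field_derivative_iff)
qed

text \<open>The zeros of \<open>1 - exp (1 - s)\<close> cancel the pole at 1, while this function is bounded on vertical strips and
  bounded away from 0 near the critical line.\<close>

lemma cancel_pole_at_1:
  fixes F :: "complex \<Rightarrow> complex"
  assumes mer: "F meromorphic_on S" and ana: "F analytic_on S - {1}" and S: "1 \<in> S"
  obtains n \<Phi> where "\<Phi> analytic_on S" "\<And>s. s \<in> S \<Longrightarrow> s \<noteq> 1 \<Longrightarrow> \<Phi> s = (1 - exp (1 - s)) ^ n * F s"
proof -
  have mer1: "F meromorphic_on {1}" using S by (intro meromorphic_on_subset[OF mer]) auto
  have iso: "isolated_singularity_at F 1" and ness: "not_essential F 1"
    using mer1 by (auto simp: meromorphic_at_iff)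
  obtain r where r: "r > 0" "F analytic_on ball 1 r - {1}" using iso by (auto simp: isolated_singularity_at_def)
  have "\<exists>n c. ((\<lambda>w. (1 - exp (1 - w)) ^ n * F w) \<longlongrightarrow> c) (at 1)"
  proof (cases "is_pole F 1")
    \<comment> \<open>\<open>1 - exp (1 - w)\<close> has a simple zero with derivative 1 at 1, so
      its power with the order of the pole as exponent leaves the finite limit
      \<open>g 1\<close>.\<close>
    case True
    have holF: "F holomorphic_on ball 1 r - {1}" using r(2) by (rule analytic_imp_holomorphic)
    define n where "n = nat (- zorder F 1)"
    define g where "g = zor_poly F 1"
    obtain r' where r': "r' > 0" "g holomorphic_on cball 1 r'" "\<And>w. w \<in> cball 1 r' - {1} \<Longrightarrow> F w = g w / (w - 1) ^ n"
      using zorder_exist_pole[OF holF open_ball _ True] r(1) unfolding n_def g_def by auto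
    have "g \<midarrow>1\<rightarrow> g 1"
    proof -
      have "isCont g 1" using r'(1) holomorphic_on_imp_continuous_on[OF r'(2)]
        by (intro continuous_on_interior[of "cball 1 r'"]) auto
      then show ?thesis by (simp add: isCont_def)
    qed
    then have "((\<lambda>w. ((1 - exp (1 - w)) / (w - 1)) ^ n * g w) \<longlongrightarrow> 1 ^ n * g 1) (at 1)"
      by (intro tendsto_intros one_minus_exp_factor)
    moreover have "eventually (\<lambda>w. ((1 - exp (1 - w)) / (w - 1)) ^ n * g w = (1 - exp (1 - w)) ^ n * F w) (at 1)"
    proof -
      have "eventually (\<lambda>w. w \<in> ball 1 r' - {1}) (at (1::complex))" using r'(1) by (intro eventually_at_in_open) auto
      then show ?thesis by eventually_elim (use r'(3) in \<open>auto simp: power_divide\<close>)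
    qed
    ultimately have "((\<lambda>w. (1 - exp (1 - w)) ^ n * F w) \<longlongrightarrow> 1 ^ n * g 1) (at 1)" by (rule Lim_transform_eventually)
    then show ?thesis by blast
  next
    case False
    then obtain c where "F \<midarrow>1\<rightarrow> c" using ness by (auto simp: not_essential_def)
    then have "((\<lambda>w. (1 - exp (1 - w)) ^ 0 * F w) \<longlongrightarrow> c) (at 1)" by simp
    then show ?thesis by blast
  qed
  then obtain n c where lim: "((\<lambda>w. (1 - exp (1 - w)) ^ n * F w) \<longlongrightarrow> c) (at 1)" by blast
  define H where "H = (\<lambda>w. (1 - exp (1 - w)) ^ n * F w)"
  \<comment> \<open>The value of \<open>F\<close> at 1 is arbitrary, hence the value is replaced by
    the limit.\<close>
  define \<Phi> where "\<Phi> = (\<lambda>w. if w = 1 then c else H w)"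
  have "H analytic_on ball 1 r - {1}" unfolding H_def by (intro analytic_intros r)
  then have "isolated_singularity_at H 1" using r(1) by (auto simp: isolated_singularity_at_def)
  then have ana1: "\<Phi> analytic_on {1}" unfolding \<Phi>_def using lim unfolding H_def by (intro removable_singularity') auto
  have anaH: "H analytic_on S - {1}" unfolding H_def by (intro analytic_intros ana)
  have "\<Phi> analytic_on {z}" if "z \<in> S - {1}" for z
  proof -
    have "H analytic_on {z}" using that by (intro analytic_on_subset[OF anaH]) auto
    moreover have "eventually (\<lambda>w. H w = \<Phi> w) (nhds z)"
    proof -
      have "eventually (\<lambda>w. w \<in> - {1}) (nhds z)" using that by (intro eventually_nhds_in_open) auto
      then show ?thesis by eventually_elim (auto simp: \<Phi>_def)
    qed
    ultimately show ?thesis using analytic_at_cong[of H \<Phi> z z] by simp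
  qed
  then have "\<Phi> analytic_on S" using ana1 by (subst analytic_on_analytic_at) (metis DiffI singletonD)
  then show ?thesis by (rule that[of \<Phi> n]) (simp add: \<Phi>_def H_def)
qed

lemma norm_one_minus_exp_le:
  assumes "Re s \<ge> 1 / 2"
  shows "norm (1 - exp (1 - s)) \<le> 3"
proof -
  have "norm (1 - exp (1 - s)) \<le> 1 + exp (1 - Re s)"
    using norm_triangle_ineq4[of 1 "exp (1 - s)"] by simp
  also have "exp (1 - Re s) \<le> exp (1 / 2)" using assms by simp
  also have "exp (1 / 2 :: real) \<le> 2" using exp_bound[of "1/2::real"] by (simp add: power2_eq_square)
  finally show ?thesis by simp
qed

text \<open>All zeros lie on \<open>Re s = 1\<close>; to the left of that line
  \<open>exp (1 - s)\<close> has modulus above 1, and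
  \<open>exp (1 / 4) - 1 >= 1 / 4\<close>.\<close>

lemma norm_one_minus_exp_ge:
  assumes "Re s \<le> 3 / 4"
  shows "norm (1 - exp (1 - s)) \<ge> 1 / 4"
proof -
  have "1 + 1 / 4 \<le> exp (1 / 4 :: real)" by (rule exp_ge_add_one_self)
  also have "\<dots> \<le> exp (1 - Re s)" using assms by simp
  also have "\<dots> = norm (exp (1 - s))" by simp
  also have "\<dots> \<le> 1 + norm (1 - exp (1 - s))" using norm_triangle_sub[of "exp (1 - s)" 1] by (simp add: norm_minus_commute)
  finally show ?thesis by simp
qed

text \<open>Small ordinates are covered by compactness. Beyond \<open>t1 >= 1\<close> the point 1 is
  excluded, so the growth of \<open>F\<close> applies, the additional factor being at most
  \<open>3 ^ n\<close>.\<close>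

lemma polynomial_growth_on_strip:
  fixes \<Phi> F :: "complex \<Rightarrow> complex"
  assumes ana: "\<Phi> analytic_on {s. Re s \<ge> 1 / 2}"
    and eq: "\<And>s. Re s \<ge> 1 / 2 \<Longrightarrow> s \<noteq> 1 \<Longrightarrow> \<Phi> s = (1 - exp (1 - s)) ^ n * F s"
    and growth: "\<And>s. Re s \<ge> 1 / 2 \<Longrightarrow> \<bar>Im s\<bar> \<ge> t0 \<Longrightarrow> norm (F s) \<le> C * (1 + \<bar>Im s\<bar>) ^ N"
  obtains K where "\<And>s. Re s \<ge> 1 / 2 \<Longrightarrow> Re s \<le> b \<Longrightarrow> norm (\<Phi> s) \<le> K * (1 + \<bar>Im s\<bar>) ^ N"
proof -
  define t1 where "t1 = max t0 1"
  let ?K = "cbox (Complex (1 / 2) (- t1)) (Complex b t1)"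
  have sub: "?K \<subseteq> {s. Re s \<ge> 1 / 2}" by (auto simp: in_cbox_complex_iff)
  have "continuous_on ?K \<Phi>"
    using analytic_imp_holomorphic[OF ana] holomorphic_on_imp_continuous_on continuous_on_subset sub by blast
  then have "compact (\<Phi> ` ?K)" by (intro compact_continuous_image compact_cbox)
  then obtain M where M: "\<And>s. s \<in> ?K \<Longrightarrow> norm (\<Phi> s) \<le> M"
    using compact_imp_bounded[of "\<Phi> ` ?K"] by (auto simp: bounded_iff)
  have "norm (\<Phi> s) \<le> (\<bar>M\<bar> + 3 ^ n * \<bar>C\<bar>) * (1 + \<bar>Im s\<bar>) ^ N" if s: "Re s \<ge> 1 / 2" "Re s \<le> b" for s
  proof (cases "\<bar>Im s\<bar> \<le> t1")
    case True
    then have "norm (\<Phi> s) \<le> M" using s by (intro M) (auto simp: in_cbox_complex_iff)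
    also have "\<dots> \<le> (\<bar>M\<bar> + 3 ^ n * \<bar>C\<bar>) * 1" by (simp add: add_increasing2)
    also have "\<dots> \<le> (\<bar>M\<bar> + 3 ^ n * \<bar>C\<bar>) * (1 + \<bar>Im s\<bar>) ^ N"
      by (intro mult_left_mono one_le_power) auto
    finally show ?thesis .
  next
    case False
    then have "s \<noteq> 1" "\<bar>Im s\<bar> \<ge> t0" by (auto simp: t1_def)
    then have "norm (\<Phi> s) = norm (1 - exp (1 - s)) ^ n * norm (F s)" using s by (simp add: eq norm_mult norm_power)
    also have "\<dots> \<le> 3 ^ n * (\<bar>C\<bar> * (1 + \<bar>Im s\<bar>) ^ N)"
    proof (intro mult_mono power_mono norm_one_minus_exp_le s)
      have "norm (F s) \<le> C * (1 + \<bar>Im s\<bar>) ^ N" using s \<open>\<bar>Im s\<bar> \<ge> t0\<close> by (intro growth)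
      also have "\<dots> \<le> \<bar>C\<bar> * (1 + \<bar>Im s\<bar>) ^ N" by (intro mult_right_mono) auto
      finally show "norm (F s) \<le> \<bar>C\<bar> * (1 + \<bar>Im s\<bar>) ^ N" .
    qed auto
    also have "\<dots> \<le> (\<bar>M\<bar> + 3 ^ n * \<bar>C\<bar>) * (1 + \<bar>Im s\<bar>) ^ N" by (simp add: distrib_right)
    finally show ?thesis .
  qed
  then show ?thesis by (rule that)
qed

subsection \<open>Transfer of lower bounds to the critical line\<close>

lemma powr_add_le:
  fixes x y p :: real
  assumes "x \<ge> 0" "y \<ge> 0" "0 < p" "p \<le> 1"
  shows "(x + y) powr p \<le> x powr p + y powr p"
proof (cases "x + y = 0")
  case True
  then show ?thesis using assms by (simp add: add_nonneg_eq_0_iff)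
next
  case False
  define s where "s = x + y"
  have s: "s > 0" using False assms by (simp add: s_def)
  have *: "z / s \<le> (z / s) powr p" if "0 \<le> z" "z \<le> s" for z
  proof (cases "z = 0")
    case False
    then have "(z / s) powr 1 \<le> (z / s) powr p" using that s assms by (intro powr_mono') auto
    then show ?thesis using that s by simp
  qed simp
  have "1 = x / s + y / s" using s by (simp add: s_def add_divide_distrib[symmetric])
  also have "\<dots> \<le> (x / s) powr p + (y / s) powr p"
    using assms by (intro add_mono *) (auto simp: s_def)
  finally have "s powr p * 1 \<le> s powr p * ((x / s) powr p + (y / s) powr p)" by (intro mult_left_mono) auto
  also have "\<dots> = x powr p + y powr p"
    using s assms by (simp add: distrib_left powr_divide)
  finally show ?thesis by (simp add: s_def)
qed

lemma norm_add_powr_le: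
  fixes u v :: complex
  assumes "0 < p" "p \<le> 1"
  shows "norm (u + v) powr p \<le> norm u powr p + norm v powr p"
proof -
  have "norm (u + v) powr p \<le> (norm u + norm v) powr p"
    using assms by (intro powr_mono2 norm_triangle_ineq) auto
  also have "\<dots> \<le> norm u powr p + norm v powr p" using assms by (intro powr_add_le) auto
  finally show ?thesis .
qed

lemma norm_sum_powr_le:
  fixes u :: "'a \<Rightarrow> complex"
  assumes "0 < p" "p \<le> 1" "finite A"
  shows "norm (\<Sum>a\<in>A. u a) powr p \<le> (\<Sum>a\<in>A. norm (u a) powr p)"
  using assms(3)
proof (induction A rule: finite_induct)
  case (insert a A)
  have "norm (u a + (\<Sum>a\<in>A. u a)) powr p \<le> norm (u a) powr p + norm (\<Sum>a\<in>A. u a) powr p"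
    by (rule norm_add_powr_le[OF assms(1,2)])
  then show ?case using insert by simp
qed simp

text \<open>The condition \<open>(q - 1) * (P - 1) = 1\<close> says that \<open>P\<close> and
  \<open>q\<close> are conjugate exponents. Comparing \<open>x\<close> with
  \<open>\<eta> * y powr (q - 1)\<close> shows that one of the two terms on the right alone exceeds
  \<open>x * y\<close>.\<close>

lemma weighted_young:
  fixes x y P q \<eta> :: real
  assumes "x \<ge> 0" "y \<ge> 0" "\<eta> > 0" "P > 1" "q > 1" "(q - 1) * (P - 1) = 1"
  shows "x * y \<le> \<eta> powr (- (P - 1)) * x powr P + \<eta> * y powr q"
proof (cases "x = 0 \<or> y = 0")
  case True
  then show ?thesis using assms by auto
next
  case False
  then have xy: "x > 0" "y > 0" using assms by auto
  show ?thesis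
  proof (cases "x \<le> \<eta> * y powr (q - 1)")
    case True
    then have "x * y \<le> \<eta> * y powr (q - 1) * y" using xy by (intro mult_right_mono) auto
    also have "\<dots> = \<eta> * y powr q" using xy powr_add[of y "q - 1" 1] by simp
    finally show ?thesis by (simp add: add_increasing)
  next
    case False
    then have "y powr (q - 1) \<le> x / \<eta>" using assms by (simp add: field_simps)
    then have "(y powr (q - 1)) powr (P - 1) \<le> (x / \<eta>) powr (P - 1)" using assms by (intro powr_mono2) auto
    then have "y \<le> (x / \<eta>) powr (P - 1)" using xy assms(6) by (simp add: powr_powr)
    then have "x * y \<le> x * (x / \<eta>) powr (P - 1)" using xy by (intro mult_left_mono) auto
    also have "\<dots> = \<eta> powr (- (P - 1)) * (x powr (P - 1) * x)"
      unfolding powr_minus_divide using xy assms by (simp add: powr_divide)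
    also have "x powr (P - 1) * x = x powr P" using xy powr_add[of x "P - 1" 1] by simp
    finally show ?thesis using assms by (simp add: add_increasing2)
  qed
qed

text \<open>Convexity is used twice. With \<open>\<kappa> = 0\<close> it bounds
  \<open>\<Phi>\<close> at \<open>1/2 + \<delta>\<close> by its mean value at 1/2. For the
  difference \<open>G = \<Phi> - \<Psi>\<close> the tilt \<open>\<kappa>\<close> equals the rate at
  which \<open>G\<close> is small on the right: the growth \<open>exp (\<kappa> * b)\<close> is
  absorbed there, while at 1/2 the factor \<open>exp (- \<kappa> * \<delta>)\<close> is gained. At
  1/2 itself \<open>G\<close> is just bounded by \<open>\<Phi>\<close> and \<open>\<Psi>\<close>,
  whence the 2 in front of the mean value of \<open>\<Phi>\<close>.\<close>

lemma convexity_transfer: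
  fixes \<tau> :: real
  defines "I \<equiv> \<lambda>p \<Delta> \<Phi> x. LINT t|lborel. norm (\<Phi> (Complex x t)) powr p * gw \<tau> \<Delta> t"
  assumes ana: "\<Phi> analytic_on {z. 1/2 \<le> Re z \<and> Re z \<le> b}" "\<Psi> analytic_on {z. 1/2 \<le> Re z \<and> Re z \<le> b}"
    and growth: "\<And>z. 1/2 \<le> Re z \<Longrightarrow> Re z \<le> b \<Longrightarrow> norm (\<Phi> z) \<le> K1 * (1 + \<bar>Im z\<bar>) ^ N"
      "\<And>z. 1/2 \<le> Re z \<Longrightarrow> Re z \<le> b \<Longrightarrow> norm (\<Psi> z) \<le> K2 * (1 + \<bar>Im z\<bar>) ^ N"
    and p: "0 < p" "p \<le> 1" and \<Delta>: "\<Delta> \<ge> 1" and \<delta>: "0 \<le> \<delta>" "1 / 2 + \<delta> < b" and \<kappa>: "\<kappa> \<ge> 0"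
    and right: "\<And>t. norm (\<Phi> (Complex b t)) powr p \<le> K3"
      "\<And>t. norm (\<Phi> (Complex b t) - \<Psi> (Complex b t)) powr p \<le> K4 * exp (- \<kappa> * b)"
  shows "I p \<Delta> \<Psi> (1 / 2 + \<delta>) \<le> 2 * I p \<Delta> \<Phi> (1 / 2) + exp (- \<kappa> * \<delta>) * I p \<Delta> \<Psi> (1 / 2) +
     exp (b\<^sup>2 / 2) * (K3 + K4) * (sqrt (2 * pi) * \<Delta>)"
proof -
  have half: "(0::real) \<le> 1 / 2" "1 / 2 < b" using \<delta> by auto
  define G where "G = (\<lambda>z. \<Phi> z - \<Psi> z)"
  have anaG: "G analytic_on {z. 1/2 \<le> Re z \<and> Re z \<le> b}" unfolding G_def by (intro analytic_intros ana)
  have growthG: "norm (G z) \<le> (K1 + K2) * (1 + \<bar>Im z\<bar>) ^ N" if "1/2 \<le> Re z" "Re z \<le> b" for z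
    using norm_triangle_ineq4[of "\<Phi> z" "\<Psi> z"] growth[OF that] by (simp add: G_def distrib_right)
  note int\<Phi> = strip_gw_integrable[OF ana(1) half p(1) growth(1) \<Delta>, of _ \<tau>]
  note int\<Psi> = strip_gw_integrable[OF ana(2) half p(1) growth(2) \<Delta>, of _ \<tau>]
  note intG = strip_gw_integrable[OF anaG half p(1) growthG \<Delta>, of _ \<tau>]
  note conv\<Phi> = strip_gw_convexity[OF ana(1) half p(1) growth(1) \<Delta>, of _ _ \<tau>]
  note convG = strip_gw_convexity[OF anaG half p(1) growthG \<Delta>, of _ _ \<tau>]
  define \<sigma> where "\<sigma> = 1 / 2 + \<delta>"
  have \<sigma>: "\<sigma> \<in> {1/2..b}" "1 / 2 \<in> {1/2..b}" "b \<in> {1/2..b}" using \<delta> by (auto simp: \<sigma>_def)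
  define s where "s = sqrt (2 * pi) * \<Delta>"
  have s0: "s \<ge> 0" using \<Delta> by (simp add: s_def)
  have I0: "I p \<Delta> H x \<ge> 0" for H x unfolding I_def
    by (intro integral_nonneg_AE always_eventually allI mult_nonneg_nonneg less_imp_le[OF gw_pos]) auto
  have const: "I p \<Delta> H b \<le> K * s" if H: "integrable lborel (\<lambda>t. norm (H (Complex b t)) powr p * gw \<tau> \<Delta> t)"
    "\<And>t. norm (H (Complex b t)) powr p \<le> K" for H K
  proof -
    have "I p \<Delta> H b \<le> (LINT t|lborel. K * gw \<tau> \<Delta> t)" unfolding I_def
      using \<Delta> H by (intro integral_mono integrable_mult_right gw_integrable mult_right_mono less_imp_le[OF gw_pos]) auto
    also have "\<dots> = K * s" using \<Delta> gw_integral[of \<Delta> \<tau>] by (simp add: s_def)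
    finally show ?thesis .
  qed
  have "I p \<Delta> \<Phi> \<sigma> \<le> exp (- 0 * (\<sigma> - 1/2)) * I p \<Delta> \<Phi> (1/2) + exp (0 * (b - \<sigma>) + b\<^sup>2 / 2) * I p \<Delta> \<Phi> b"
    unfolding I_def by (rule conv\<Phi>[OF _ _ \<sigma>(1)]) auto
  also have "\<dots> \<le> I p \<Delta> \<Phi> (1/2) + exp (b\<^sup>2 / 2) * (K3 * s)"
    using const[OF int\<Phi>[OF _ _ \<sigma>(3)] right(1)] by simp
  finally have A: "I p \<Delta> \<Phi> \<sigma> \<le> I p \<Delta> \<Phi> (1/2) + exp (b\<^sup>2 / 2) * (K3 * s)" .
  have "I p \<Delta> G \<sigma> \<le> exp (- \<kappa> * (\<sigma> - 1/2)) * I p \<Delta> G (1/2) + exp (\<kappa> * (b - \<sigma>) + b\<^sup>2 / 2) * I p \<Delta> G b"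
    unfolding I_def by (rule convG[OF _ _ \<sigma>(1) \<kappa>]) auto
  also have "\<dots> \<le> exp (- \<kappa> * \<delta>) * I p \<Delta> G (1/2) + exp (b\<^sup>2 / 2) * (K4 * s)"
  proof (intro add_mono)
    have "I p \<Delta> G b \<le> K4 * exp (- \<kappa> * b) * s"
      using const[OF intG[OF _ _ \<sigma>(3)]] right(2) by (simp add: G_def)
    then have "exp (\<kappa> * (b - \<sigma>) + b\<^sup>2 / 2) * I p \<Delta> G b \<le> exp (\<kappa> * b + b\<^sup>2 / 2) * (K4 * exp (- \<kappa> * b) * s)"
      using \<kappa> \<sigma> I0 mult_left_mono[of "b - \<sigma>" b \<kappa>] by (intro mult_mono) auto
    also have "\<dots> = (exp (\<kappa> * b) * exp (- \<kappa> * b)) * (exp (b\<^sup>2 / 2) * (K4 * s))"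
      by (simp only: exp_add mult_ac)
    also have "\<dots> = exp (b\<^sup>2 / 2) * (K4 * s)" by (simp flip: exp_add)
    finally show "exp (\<kappa> * (b - \<sigma>) + b\<^sup>2 / 2) * I p \<Delta> G b \<le> exp (b\<^sup>2 / 2) * (K4 * s)" .
  qed (simp add: \<sigma>_def)
  also have "exp (- \<kappa> * \<delta>) * I p \<Delta> G (1/2) \<le> 1 * I p \<Delta> \<Phi> (1/2) + exp (- \<kappa> * \<delta>) * I p \<Delta> \<Psi> (1/2)"
  proof -
    have "I p \<Delta> G (1/2) \<le> (LINT t|lborel. norm (\<Phi> (Complex (1/2) t)) powr p * gw \<tau> \<Delta> t + norm (\<Psi> (Complex (1/2) t)) powr p * gw \<tau> \<Delta> t)"
      unfolding I_def
    proof (intro integral_mono intG int\<Phi> int\<Psi> Bochner_Integration.integrable_add)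
      fix t
      have "norm (\<Phi> (Complex (1/2) t) + - \<Psi> (Complex (1/2) t)) powr p \<le>
          norm (\<Phi> (Complex (1/2) t)) powr p + norm (- \<Psi> (Complex (1/2) t)) powr p"
        by (rule norm_add_powr_le[OF p])
      then show "norm (G (Complex (1/2) t)) powr p * gw \<tau> \<Delta> t \<le>
          norm (\<Phi> (Complex (1/2) t)) powr p * gw \<tau> \<Delta> t + norm (\<Psi> (Complex (1/2) t)) powr p * gw \<tau> \<Delta> t"
        using gw_pos[of \<tau> \<Delta> t] by (simp add: G_def flip: distrib_right)
    qed (use \<sigma> in auto)
    also have "\<dots> = I p \<Delta> \<Phi> (1/2) + I p \<Delta> \<Psi> (1/2)"
      unfolding I_def by (intro Bochner_Integration.integral_add int\<Phi> int\<Psi>) (use \<sigma> in auto)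
    finally have "exp (- \<kappa> * \<delta>) * I p \<Delta> G (1/2) \<le> exp (- \<kappa> * \<delta>) * I p \<Delta> \<Phi> (1/2) + exp (- \<kappa> * \<delta>) * I p \<Delta> \<Psi> (1/2)"
      by (simp add: mult_left_mono flip: distrib_left)
    moreover have "exp (- \<kappa> * \<delta>) * I p \<Delta> \<Phi> (1/2) \<le> 1 * I p \<Delta> \<Phi> (1/2)"
      using \<kappa> \<delta> I0 by (intro mult_right_mono) auto
    ultimately show ?thesis by linarith
  qed
  finally have B: "I p \<Delta> G \<sigma> \<le> I p \<Delta> \<Phi> (1/2) + exp (- \<kappa> * \<delta>) * I p \<Delta> \<Psi> (1/2) + exp (b\<^sup>2 / 2) * (K4 * s)" by simp
  have "I p \<Delta> \<Psi> \<sigma> \<le> (LINT t|lborel. norm (\<Phi> (Complex \<sigma> t)) powr p * gw \<tau> \<Delta> t + norm (G (Complex \<sigma> t)) powr p * gw \<tau> \<Delta> t)"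
    unfolding I_def
  proof (intro integral_mono intG int\<Phi> int\<Psi> Bochner_Integration.integrable_add)
    fix t
    have "norm (\<Phi> (Complex \<sigma> t) + - G (Complex \<sigma> t)) powr p \<le>
        norm (\<Phi> (Complex \<sigma> t)) powr p + norm (- G (Complex \<sigma> t)) powr p"
      by (rule norm_add_powr_le[OF p])
    then show "norm (\<Psi> (Complex \<sigma> t)) powr p * gw \<tau> \<Delta> t \<le>
        norm (\<Phi> (Complex \<sigma> t)) powr p * gw \<tau> \<Delta> t + norm (G (Complex \<sigma> t)) powr p * gw \<tau> \<Delta> t"
      using gw_pos[of \<tau> \<Delta> t] by (simp add: G_def norm_minus_commute flip: distrib_right)
  qed (use \<sigma> in auto)
  also have "\<dots> = I p \<Delta> \<Phi> \<sigma> + I p \<Delta> G \<sigma>"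
    unfolding I_def by (intro Bochner_Integration.integral_add int\<Phi> intG) (use \<sigma> in auto)
  finally show ?thesis using A B unfolding \<sigma>_def s_def[symmetric] by (simp add: algebra_simps)
qed

lemma analytic_nat_powr [analytic_intros]:
  assumes "n > 0"
  shows "(\<lambda>s. of_nat n powr - s) analytic_on S"
proof -
  have "(\<lambda>s. of_nat n powr - s) = (\<lambda>s. exp (- s * Ln (of_nat n)))"
    using assms by (simp add: powr_def)
  then show ?thesis by (simp only:) (intro analytic_intros)
qed

lemma analytic_apoly: "i1 \<ge> 1 \<Longrightarrow> apoly i1 J L0 x analytic_on S"
proof -
  assume i1: "i1 \<ge> 1"
  have "p > 0" if "p \<in> bl i" for p i using that by (simp add: in_bl_iff prime_gt_0_nat)
  then have "(\<lambda>s. apoly i1 J L0 x s) analytic_on S"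
    unfolding apoly_altdef[OF i1] texp_def by (intro analytic_intros) auto
  then show ?thesis by simp
qed

lemma analytic_vpoly: "vpoly i1 J L0 g x analytic_on S"
proof -
  have "(\<lambda>s. vpoly i1 J L0 g x s) analytic_on S"
    unfolding vpoly_def by (intro analytic_intros) auto
  then show ?thesis by simp
qed

lemma norm_nat_powr_le_1: "n > 0 \<Longrightarrow> Re s \<ge> 0 \<Longrightarrow> norm (of_nat n powr - s) \<le> 1"
  using powr_mono[of "- Re s" 0 "real n"] by (simp only: norm_nat_powr) simp

text \<open>This bound may depend on \<open>J\<close>; it only has to meet the growth condition of
  the convexity lemmas and does not enter the final constants.\<close>

lemma apoly_bounded:
  assumes "i1 \<ge> 1"
  obtains K where "\<And>s. Re s \<ge> 0 \<Longrightarrow> norm (apoly i1 J L0 x s) \<le> K"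
proof
  fix s :: complex assume s: "Re s \<ge> 0"
  show "norm (apoly i1 J L0 x s) \<le> (\<Prod>i=i1..<J. \<Sum>r\<le>len L0 J i. (\<Sum>p\<in>bl i. norm (x p)) ^ r / fact r)"
    unfolding apoly_altdef[OF assms] prod_norm[symmetric] texp_def
  proof (intro prod_mono conjI order_trans[OF norm_sum] sum_mono)
    fix i r
    have "norm (\<Sum>p\<in>bl i. x p * of_nat p powr - s) \<le> (\<Sum>p\<in>bl i. norm (x p))"
    proof (intro order_trans[OF norm_sum] sum_mono)
      fix p assume "p \<in> bl i"
      then have "p > 0" by (simp add: in_bl_iff prime_gt_0_nat)
      then show "norm (x p * of_nat p powr - s) \<le> norm (x p)"
        using norm_nat_powr_le_1[OF _ s] by (simp add: norm_mult mult_left_le)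
    qed
    then show "norm ((\<Sum>p\<in>bl i. x p * of_nat p powr - s) ^ r / fact r) \<le> (\<Sum>p\<in>bl i. norm (x p)) ^ r / fact r"
      by (simp add: norm_divide norm_power divide_right_mono power_mono)
  qed simp
qed

lemma vpoly_bounded:
  obtains K where "\<And>s. Re s \<ge> 0 \<Longrightarrow> norm (vpoly i1 J L0 g x s) \<le> K"
proof
  fix s :: complex assume s: "Re s \<ge> 0"
  show "norm (vpoly i1 J L0 g x s) \<le> (\<Sum>n=1..cutoff J. norm (vcoef i1 J L0 g x n))"
    unfolding vpoly_def
  proof (intro order_trans[OF norm_sum] sum_mono)
    fix n assume "n \<in> {1..cutoff J}"
    then show "norm (vcoef i1 J L0 g x n * of_nat n powr - s) \<le> norm (vcoef i1 J L0 g x n)"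
      using norm_nat_powr_le_1[OF _ s, of n] by (simp add: norm_mult mult_left_le)
  qed
qed

lemma
  fixes i1 J L0 :: nat and g x :: "nat \<Rightarrow> complex" and y \<tau> \<Delta> :: real
  assumes "exp (2 * 4 ^ J) \<le> \<Delta>"
  defines "S \<equiv> \<Sum>n=1..cutoff J. (norm (vcoef i1 J L0 g x n))\<^sup>2 * real n powr (- 2 * y)"
  shows vpoly_mean_upper: "(LINT t|lborel. (norm (vpoly i1 J L0 g x (Complex y t)))\<^sup>2 * gw \<tau> \<Delta> t) \<le> 3 / 2 * (sqrt (2 * pi) * \<Delta> * S)"
    and vpoly_mean_lower: "(LINT t|lborel. (norm (vpoly i1 J L0 g x (Complex y t)))\<^sup>2 * gw \<tau> \<Delta> t) \<ge> 1 / 2 * (sqrt (2 * pi) * \<Delta> * S)"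
    and vpoly_integrable: "integrable lborel (\<lambda>t. (norm (vpoly i1 J L0 g x (Complex y t)))\<^sup>2 * gw \<tau> \<Delta> t)"
proof -
  have "real (cutoff J) \<le> exp (4 ^ J)" using le_cutoff_iff by blast
  then have "(real (cutoff J))\<^sup>2 \<le> (exp (4 ^ J))\<^sup>2" by (intro power_mono) auto
  also have "(exp (4 ^ J))\<^sup>2 = exp (2 * 4 ^ J :: real)" by (rule exp_double[symmetric])
  also note assms(1)
  finally have Z: "(real (cutoff J))\<^sup>2 \<le> \<Delta>" .
  have \<Delta>0: "\<Delta> > 0" using assms(1) by (meson exp_gt_zero less_le_trans)
  have inj: "inj_on (\<lambda>n. n) {1..cutoff J}" "(\<lambda>n. n) ` {1..cutoff J} \<subseteq> {1..cutoff J}" by auto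
  show "(LINT t|lborel. (norm (vpoly i1 J L0 g x (Complex y t)))\<^sup>2 * gw \<tau> \<Delta> t) \<le> 3 / 2 * (sqrt (2 * pi) * \<Delta> * S)"
    unfolding vpoly_def S_def by (rule gauss_mean_value_upper[OF finite_atLeastAtMost inj Z \<Delta>0])
  show "(LINT t|lborel. (norm (vpoly i1 J L0 g x (Complex y t)))\<^sup>2 * gw \<tau> \<Delta> t) \<ge> 1 / 2 * (sqrt (2 * pi) * \<Delta> * S)"
    unfolding vpoly_def S_def by (rule gauss_mean_value_lower[OF finite_atLeastAtMost inj Z \<Delta>0])
  show "integrable lborel (\<lambda>t. (norm (vpoly i1 J L0 g x (Complex y t)))\<^sup>2 * gw \<tau> \<Delta> t)"
    unfolding vpoly_def by (rule gauss_mean_value_integrable[OF finite_atLeastAtMost inj Z \<Delta>0])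
qed

lemma norm_power_powr: "m > 0 \<Longrightarrow> norm (z ^ m :: complex) powr (2 / real m) = (norm z)\<^sup>2"
proof (cases "z = 0")
  case False
  assume m: "m > 0"
  have "norm (z ^ m) powr (2 / real m) = (norm z powr real m) powr (2 / real m)"
    using False by (simp add: norm_power powr_realpow)
  also have "\<dots> = norm z powr 2" using m by (simp only: powr_powr) simp
  finally show ?thesis by simp
qed auto

text \<open>\<open>convexity_transfer\<close> for \<open>\<Psi> = (1 - exp (1 - s)) ^ n *
  (\<Sum>j\<in>I. b j * V j s ^ m)\<close> and \<open>p = 2 / m\<close>. Subadditivity of the
  \<open>p\<close>-th power isolates the summand \<open>j1\<close>, and the \<open>p\<close>-th
  power of the modulus of \<open>V j s ^ m\<close> is the square of that of \<open>V j s\<close>.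
  The factors \<open>1 / 4\<close> and \<open>3\<close> bound \<open>1 - exp (1 - s)\<close> from
  below at \<open>1/2 + \<delta>\<close> and from above at 1/2.\<close>

lemma transfer_lower_bound:
  fixes a \<Phi>0 :: "complex \<Rightarrow> complex" and V :: "'i \<Rightarrow> complex \<Rightarrow> complex" and b :: "'i \<Rightarrow> complex"
    and \<tau> \<Delta> \<delta> \<sigma>2 :: real and m n J M :: nat
  defines "p \<equiv> 2 / real m"
  defines "v \<equiv> \<lambda>j y. LINT t|lborel. (norm (V j (Complex y t)))\<^sup>2 * gw \<tau> \<Delta> t"
  assumes I: "finite I" "j1 \<in> I" and m: "m \<ge> 2"
    and ana: "\<Phi>0 analytic_on {s. Re s \<ge> 1 / 2}" "a analytic_on UNIV" "\<And>j. j \<in> I \<Longrightarrow> V j analytic_on UNIV"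
    and growth: "\<And>s. Re s \<ge> 1 / 2 \<Longrightarrow> Re s \<le> \<sigma>2 \<Longrightarrow> norm (\<Phi>0 s) \<le> K0 * (1 + \<bar>Im s\<bar>) ^ M"
    and bdd: "\<And>s. Re s \<ge> 0 \<Longrightarrow> norm (a s) \<le> Ka" "\<And>j s. j \<in> I \<Longrightarrow> Re s \<ge> 0 \<Longrightarrow> norm (V j s) \<le> Kv j"
    and right: "\<And>s. Re s = \<sigma>2 \<Longrightarrow> norm (\<Phi>0 s * a s ^ m) \<le> K3"
      "\<And>s. Re s = \<sigma>2 \<Longrightarrow> norm (\<Phi>0 s * a s ^ m - (1 - exp (1 - s)) ^ n * (\<Sum>j\<in>I. b j * V j s ^ m)) \<le> exp (- (4 ^ J) / 4) * K4"
    and int: "\<And>j y. j \<in> I \<Longrightarrow> integrable lborel (\<lambda>t. (norm (V j (Complex y t)))\<^sup>2 * gw \<tau> \<Delta> t)"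
    and U: "\<And>j y. j \<in> I \<Longrightarrow> y \<ge> 1 / 2 \<Longrightarrow> v j y \<le> U j" and W: "v j1 (1 / 2 + \<delta>) \<ge> W"
    and \<Delta>: "\<Delta> \<ge> 1" and \<delta>: "0 \<le> \<delta>" "\<delta> \<le> 1 / 4" and \<sigma>2: "\<sigma>2 \<ge> 1" and K4: "K4 \<ge> 0"
  shows "((1 / 4) ^ n) powr p * (norm (b j1) powr p * W - (\<Sum>j\<in>I - {j1}. norm (b j) powr p * U j)) \<le>
    2 * (LINT t|lborel. norm (\<Phi>0 (Complex (1 / 2) t) * a (Complex (1 / 2) t) ^ m) powr p * gw \<tau> \<Delta> t) +
    exp (- (p * 4 ^ J / (4 * \<sigma>2)) * \<delta>) * ((3 ^ n) powr p * (\<Sum>j\<in>I. norm (b j) powr p * U j)) +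
    exp (\<sigma>2\<^sup>2 / 2) * (K3 powr p + K4 powr p) * (sqrt (2 * pi) * \<Delta>)"
    and "integrable lborel (\<lambda>t. norm (\<Phi>0 (Complex (1 / 2) t) * a (Complex (1 / 2) t) ^ m) powr p * gw \<tau> \<Delta> t)"
proof -
  have p: "0 < p" "p \<le> 1" and m0: "m > 0" using m by (auto simp: p_def)
  define \<Phi> where "\<Phi> = (\<lambda>s. \<Phi>0 s * a s ^ m)"
  define S where "S = (\<lambda>s. \<Sum>j\<in>I. b j * V j s ^ m)"
  define \<Psi> where "\<Psi> = (\<lambda>s. (1 - exp (1 - s)) ^ n * S s)"
  define IG where "IG = (\<lambda>(p::real) (\<Delta>::real) (\<Phi>::complex \<Rightarrow> complex) x. LINT t|lborel. norm (\<Phi> (Complex x t)) powr p * gw \<tau> \<Delta> t)"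
  have ana\<Phi>: "\<Phi> analytic_on {z. 1/2 \<le> Re z \<and> Re z \<le> \<sigma>2}"
    unfolding \<Phi>_def by (intro analytic_intros analytic_on_subset[OF ana(1)] analytic_on_subset[OF ana(2)]) auto
  have ana\<Psi>: "\<Psi> analytic_on {z. 1/2 \<le> Re z \<and> Re z \<le> \<sigma>2}"
    unfolding \<Psi>_def S_def by (intro analytic_intros analytic_on_subset[OF ana(3)]) auto
  have Ka0: "Ka \<ge> 0" using order_trans[OF norm_ge_zero bdd(1)[of 0]] by simp
  have Kv0: "Kv j \<ge> 0" if "j \<in> I" for j using order_trans[OF norm_ge_zero bdd(2)[OF that, of 0]] by simp
  have gr\<Phi>: "norm (\<Phi> z) \<le> (K0 * Ka ^ m) * (1 + \<bar>Im z\<bar>) ^ M" if z: "1/2 \<le> Re z" "Re z \<le> \<sigma>2" for z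
  proof -
    have "norm (\<Phi> z) \<le> (K0 * (1 + \<bar>Im z\<bar>) ^ M) * Ka ^ m"
      unfolding \<Phi>_def norm_mult norm_power using z growth[OF z] bdd(1)[of z] Ka0 order_trans[OF norm_ge_zero growth[OF z]]
      by (intro mult_mono power_mono) auto
    then show ?thesis by (simp add: mult_ac)
  qed
  define KS where "KS = (\<Sum>j\<in>I. norm (b j) * Kv j ^ m)"
  have gr\<Psi>: "norm (\<Psi> z) \<le> (3 ^ n * KS) * (1 + \<bar>Im z\<bar>) ^ M" if z: "1/2 \<le> Re z" "Re z \<le> \<sigma>2" for z
  proof -
    have KS: "norm (S z) \<le> KS" unfolding S_def KS_def
    proof (intro order_trans[OF norm_sum] sum_mono)
      fix j assume "j \<in> I"
      then show "norm (b j * V j z ^ m) \<le> norm (b j) * Kv j ^ m"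
        using bdd(2)[of j z] z unfolding norm_mult norm_power by (intro mult_left_mono power_mono) auto
    qed
    have "norm (\<Psi> z) \<le> 3 ^ n * KS"
      unfolding \<Psi>_def norm_mult norm_power using KS z
      by (intro mult_mono power_mono norm_one_minus_exp_le) auto
    also have "\<dots> \<le> (3 ^ n * KS) * (1 + \<bar>Im z\<bar>) ^ M"
      using mult_left_mono[of 1 "(1 + \<bar>Im z\<bar>) ^ M" "3 ^ n * KS"] order_trans[OF norm_ge_zero KS] by simp
    finally show ?thesis .
  qed
  \<comment> \<open>Chosen so that \<open>exp (- \<kappa> * \<sigma>2)\<close> is the
    \<open>p\<close>-th power of the approximation error \<open>exp (- (4 ^ J) / 4)\<close> on the
    right line.\<close>
  define \<kappa> where "\<kappa> = p * 4 ^ J / (4 * \<sigma>2)"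
  have r1: "norm (\<Phi> (Complex \<sigma>2 t)) powr p \<le> K3 powr p" for t
    unfolding \<Phi>_def using p by (intro powr_mono2 right(1)) auto
  have r2: "norm (\<Phi> (Complex \<sigma>2 t) - \<Psi> (Complex \<sigma>2 t)) powr p \<le> K4 powr p * exp (- \<kappa> * \<sigma>2)" for t
  proof -
    have "norm (\<Phi> (Complex \<sigma>2 t) - \<Psi> (Complex \<sigma>2 t)) powr p \<le> (exp (- (4 ^ J) / 4) * K4) powr p"
      unfolding \<Phi>_def \<Psi>_def S_def using p by (intro powr_mono2 right(2)) auto
    also have "\<dots> = exp (- (4 ^ J) / 4) powr p * K4 powr p" using K4 by (simp add: powr_mult)
    also have "exp (- (4 ^ J) / 4 :: real) powr p = exp (- \<kappa> * \<sigma>2)" using \<sigma>2 by (simp add: \<kappa>_def powr_def)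
    finally show ?thesis by (simp add: mult.commute)
  qed
  have half: "(0::real) \<le> 1 / 2" "1 / 2 < \<sigma>2" using \<sigma>2 by auto
  have \<kappa>0: "\<kappa> \<ge> 0" using p \<sigma>2 by (simp add: \<kappa>_def)
  have \<delta>2: "1 / 2 + \<delta> < \<sigma>2" using \<delta> \<sigma>2 by linarith
  have T: "IG p \<Delta> \<Psi> (1 / 2 + \<delta>) \<le> 2 * IG p \<Delta> \<Phi> (1 / 2) + exp (- \<kappa> * \<delta>) * IG p \<Delta> \<Psi> (1 / 2) +
     exp (\<sigma>2\<^sup>2 / 2) * (K3 powr p + K4 powr p) * (sqrt (2 * pi) * \<Delta>)"
    unfolding IG_def by (rule convexity_transfer[OF ana\<Phi> ana\<Psi> gr\<Phi> gr\<Psi> p \<Delta> \<delta>(1) \<delta>2 \<kappa>0 r1 r2])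
  show "integrable lborel (\<lambda>t. norm (\<Phi>0 (Complex (1 / 2) t) * a (Complex (1 / 2) t) ^ m) powr p * gw \<tau> \<Delta> t)"
    using strip_gw_integrable[OF ana\<Phi> half p(1) gr\<Phi> \<Delta>, of "1/2" \<tau>] half by (simp add: \<Phi>_def)
  have int\<Psi>: "integrable lborel (\<lambda>t. norm (\<Psi> (Complex y t)) powr p * gw \<tau> \<Delta> t)" if "y \<in> {1/2..\<sigma>2}" for y
    using strip_gw_integrable[OF ana\<Psi> half p(1) gr\<Psi> \<Delta> that] by simp
  have trm: "norm (b j * V j s ^ m) powr p = norm (b j) powr p * (norm (V j s))\<^sup>2" for j s
    using norm_power_powr[OF m0, of "V j s"] by (simp add: norm_mult powr_mult p_def)
  have lint_sum: "(LINT t|lborel. (\<Sum>j\<in>A. norm (b j) powr p * ((norm (V j (Complex y t)))\<^sup>2 * gw \<tau> \<Delta> t))) =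
      (\<Sum>j\<in>A. norm (b j) powr p * v j y)" if "A \<subseteq> I" for y A
  proof -
    have "(LINT t|lborel. (\<Sum>j\<in>A. norm (b j) powr p * ((norm (V j (Complex y t)))\<^sup>2 * gw \<tau> \<Delta> t))) =
        (\<Sum>j\<in>A. LINT t|lborel. norm (b j) powr p * ((norm (V j (Complex y t)))\<^sup>2 * gw \<tau> \<Delta> t))"
      using that by (intro Bochner_Integration.integral_sum integrable_mult_right int) auto
    then show ?thesis by (simp only: Bochner_Integration.integral_mult_right_zero v_def)
  qed
  have up: "IG p \<Delta> \<Psi> (1 / 2) \<le> (3 ^ n) powr p * (\<Sum>j\<in>I. norm (b j) powr p * U j)"
  proof -
    have "IG p \<Delta> \<Psi> (1 / 2) \<le> (LINT t|lborel. (3 ^ n) powr p * (\<Sum>j\<in>I. norm (b j) powr p * ((norm (V j (Complex (1/2) t)))\<^sup>2 * gw \<tau> \<Delta> t)))"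
      unfolding IG_def
    proof (intro integral_mono int\<Psi> integrable_mult_right Bochner_Integration.integrable_sum int)
      fix t
      let ?s = "Complex (1/2) t"
      have "norm (\<Psi> ?s) powr p = (norm (1 - exp (1 - ?s)) ^ n) powr p * norm (S ?s) powr p"
        by (simp add: \<Psi>_def norm_mult powr_mult norm_power)
      also have "\<dots> \<le> (3 ^ n) powr p * (\<Sum>j\<in>I. norm (b j * V j ?s ^ m) powr p)"
        unfolding S_def using p I(1)
        by (intro mult_mono powr_mono2 power_mono norm_one_minus_exp_le norm_sum_powr_le) auto
      finally have "norm (\<Psi> ?s) powr p * gw \<tau> \<Delta> t \<le> ((3 ^ n) powr p * (\<Sum>j\<in>I. norm (b j * V j ?s ^ m) powr p)) * gw \<tau> \<Delta> t"
        using gw_pos[of \<tau> \<Delta> t] by (intro mult_right_mono) auto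
      then show "norm (\<Psi> ?s) powr p * gw \<tau> \<Delta> t \<le> (3 ^ n) powr p * (\<Sum>j\<in>I. norm (b j) powr p * ((norm (V j ?s))\<^sup>2 * gw \<tau> \<Delta> t))"
        by (simp only: trm sum_distrib_right mult.assoc)
    qed (use half in auto)
    also have "\<dots> = (3 ^ n) powr p * (\<Sum>j\<in>I. norm (b j) powr p * v j (1/2))"
      by (simp only: Bochner_Integration.integral_mult_right_zero lint_sum[OF order_refl])
    also have "\<dots> \<le> (3 ^ n) powr p * (\<Sum>j\<in>I. norm (b j) powr p * U j)"
      by (intro mult_left_mono sum_mono U) auto
    finally show ?thesis .
  qed
  have lo: "((1 / 4) ^ n) powr p * (norm (b j1) powr p * W - (\<Sum>j\<in>I - {j1}. norm (b j) powr p * U j)) \<le> IG p \<Delta> \<Psi> (1 / 2 + \<delta>)"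
  proof -
    let ?y = "1 / 2 + \<delta>"
    let ?h = "\<lambda>t. norm (b j1) powr p * ((norm (V j1 (Complex ?y t)))\<^sup>2 * gw \<tau> \<Delta> t) -
       (\<Sum>j\<in>I - {j1}. norm (b j) powr p * ((norm (V j (Complex ?y t)))\<^sup>2 * gw \<tau> \<Delta> t))"
    have "norm (b j1) powr p * W - (\<Sum>j\<in>I - {j1}. norm (b j) powr p * U j) \<le>
        norm (b j1) powr p * v j1 ?y - (\<Sum>j\<in>I - {j1}. norm (b j) powr p * v j ?y)"
      using \<delta> by (intro diff_mono mult_left_mono W sum_mono U) auto
    also have "\<dots> = (LINT t|lborel. ?h t)"
    proof -
      have "(LINT t|lborel. ?h t) = (LINT t|lborel. norm (b j1) powr p * ((norm (V j1 (Complex ?y t)))\<^sup>2 * gw \<tau> \<Delta> t)) -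
          (LINT t|lborel. (\<Sum>j\<in>I - {j1}. norm (b j) powr p * ((norm (V j (Complex ?y t)))\<^sup>2 * gw \<tau> \<Delta> t)))"
        using I(2) by (intro Bochner_Integration.integral_diff Bochner_Integration.integrable_sum integrable_mult_right int) auto
      then show ?thesis by (simp only: lint_sum[OF Diff_subset] Bochner_Integration.integral_mult_right_zero v_def)
    qed
    finally have 1: "((1 / 4) ^ n) powr p * (norm (b j1) powr p * W - (\<Sum>j\<in>I - {j1}. norm (b j) powr p * U j)) \<le>
        (LINT t|lborel. ((1 / 4) ^ n) powr p * ?h t)"
      by (simp add: mult_left_mono)
    also have "\<dots> \<le> IG p \<Delta> \<Psi> ?y"
      unfolding IG_def
    proof (intro integral_mono int\<Psi> integrable_mult_right Bochner_Integration.integrable_diff Bochner_Integration.integrable_sum int)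
      fix t
      let ?s = "Complex ?y t"
      have "b j1 * V j1 ?s ^ m = S ?s + - (\<Sum>j\<in>I - {j1}. b j * V j ?s ^ m)"
        unfolding S_def using I by (simp add: sum.remove)
      then have "norm (b j1 * V j1 ?s ^ m) powr p \<le> norm (S ?s) powr p + norm (- (\<Sum>j\<in>I - {j1}. b j * V j ?s ^ m)) powr p"
        by (simp only: norm_add_powr_le[OF p])
      also have "\<dots> \<le> norm (S ?s) powr p + (\<Sum>j\<in>I - {j1}. norm (b j * V j ?s ^ m) powr p)"
        using norm_sum_powr_le[OF p, of "I - {j1}" "\<lambda>j. b j * V j ?s ^ m"] I(1) by simp
      finally have "norm (b j1 * V j1 ?s ^ m) powr p - (\<Sum>j\<in>I - {j1}. norm (b j * V j ?s ^ m) powr p) \<le> norm (S ?s) powr p" by linarith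
      then have "((1 / 4) ^ n) powr p * (norm (b j1 * V j1 ?s ^ m) powr p - (\<Sum>j\<in>I - {j1}. norm (b j * V j ?s ^ m) powr p))
         \<le> ((1 / 4) ^ n) powr p * norm (S ?s) powr p" by (intro mult_left_mono) auto
      also have "\<dots> \<le> (norm (1 - exp (1 - ?s)) ^ n) powr p * norm (S ?s) powr p"
        using p \<delta> by (intro mult_right_mono powr_mono2 power_mono norm_one_minus_exp_ge) auto
      also have "\<dots> = norm (\<Psi> ?s) powr p" by (simp add: \<Psi>_def norm_mult powr_mult norm_power)
      finally have "(((1 / 4) ^ n) powr p * (norm (b j1 * V j1 ?s ^ m) powr p - (\<Sum>j\<in>I - {j1}. norm (b j * V j ?s ^ m) powr p))) * gw \<tau> \<Delta> t
         \<le> norm (\<Psi> ?s) powr p * gw \<tau> \<Delta> t" using gw_pos[of \<tau> \<Delta> t] by (intro mult_right_mono) auto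
      then show "((1 / 4) ^ n) powr p * ?h t \<le> norm (\<Psi> ?s) powr p * gw \<tau> \<Delta> t"
        by (simp only: trm sum_distrib_right mult.assoc left_diff_distrib)
    qed (use I \<delta> \<sigma>2 in auto)
    finally show ?thesis .
  qed
  have "exp (- \<kappa> * \<delta>) * IG p \<Delta> \<Psi> (1 / 2) \<le> exp (- \<kappa> * \<delta>) * ((3 ^ n) powr p * (\<Sum>j\<in>I. norm (b j) powr p * U j))"
    by (intro mult_left_mono up) auto
  moreover have "(LINT t|lborel. norm (\<Phi>0 (Complex (1 / 2) t) * a (Complex (1 / 2) t) ^ m) powr p * gw \<tau> \<Delta> t) = IG p \<Delta> \<Phi> (1 / 2)"
    by (simp add: IG_def \<Phi>_def)
  ultimately show "((1 / 4) ^ n) powr p * (norm (b j1) powr p * W - (\<Sum>j\<in>I - {j1}. norm (b j) powr p * U j)) \<le>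
    2 * (LINT t|lborel. norm (\<Phi>0 (Complex (1 / 2) t) * a (Complex (1 / 2) t) ^ m) powr p * gw \<tau> \<Delta> t) +
    exp (- (p * 4 ^ J / (4 * \<sigma>2)) * \<delta>) * ((3 ^ n) powr p * (\<Sum>j\<in>I. norm (b j) powr p * U j)) +
    exp (\<sigma>2\<^sup>2 / 2) * (K3 powr p + K4 powr p) * (sqrt (2 * pi) * \<Delta>)"
    using T lo unfolding \<kappa>_def[symmetric] by linarith
qed

text \<open>Young's inequality with exponent \<open>m * k\<close> on the \<open>2/m\<close>-th power
  of \<open>norm (H t)\<close> and the conjugate exponent \<open>q = k / \<beta>\<close> on the
  square of \<open>norm (a t)\<close>, where \<open>\<beta> = k - 1 / m\<close>. The small parameter
  \<open>\<eta>\<close> lets the moment of \<open>a\<close> be absorbed later.\<close>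

lemma young_integral:
  fixes H a :: "real \<Rightarrow> complex" and k q \<eta> :: real and m :: nat
  assumes m: "m > 0" "real m * k > 1" and q: "q * (k - 1 / real m) = k" and \<eta>: "\<eta> > 0"
    and int: "integrable lborel (\<lambda>t. norm (H t * a t ^ m) powr (2 / real m) * gw \<tau> \<Delta> t)"
      "integrable lborel (\<lambda>t. norm (H t) powr (2 * k) * gw \<tau> \<Delta> t)"
      "integrable lborel (\<lambda>t. norm (a t) powr (2 * q) * gw \<tau> \<Delta> t)"
  shows "(LINT t|lborel. norm (H t * a t ^ m) powr (2 / real m) * gw \<tau> \<Delta> t) \<le>
    \<eta> powr (- (real m * k - 1)) * (LINT t|lborel. norm (H t) powr (2 * k) * gw \<tau> \<Delta> t) +
    \<eta> * (LINT t|lborel. norm (a t) powr (2 * q) * gw \<tau> \<Delta> t)"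
proof -
  have k: "k > 1 / real m" using m by (simp add: field_simps)
  have q1: "(q - 1) * (real m * k - 1) = 1"
  proof -
    have "(q - 1) * (real m * k - 1) = real m * (q * (k - 1 / real m)) - real m * k + 1" using m by (simp add: field_simps)
    then show ?thesis using q by simp
  qed
  have "q > 1"
  proof -
    have "(q - 1) * (real m * k - 1) > 0" using q1 by simp
    then show ?thesis using m by (simp add: zero_less_mult_iff)
  qed
  have "(LINT t|lborel. norm (H t * a t ^ m) powr (2 / real m) * gw \<tau> \<Delta> t) \<le>
      (LINT t|lborel. \<eta> powr (- (real m * k - 1)) * (norm (H t) powr (2 * k) * gw \<tau> \<Delta> t) + \<eta> * (norm (a t) powr (2 * q) * gw \<tau> \<Delta> t))"
  proof (intro integral_mono int Bochner_Integration.integrable_add integrable_mult_right)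
    fix t
    define x where "x = norm (H t) powr (2 / real m)"
    define y where "y = (norm (a t))\<^sup>2"
    have "norm (H t * a t ^ m) powr (2 / real m) = x * y"
      using norm_power_powr[OF m(1), of "a t"] by (simp add: norm_mult powr_mult x_def y_def)
    also have "\<dots> \<le> \<eta> powr (- (real m * k - 1)) * x powr (real m * k) + \<eta> * y powr q"
      using m \<open>q > 1\<close> \<eta> q1 by (intro weighted_young) (auto simp: x_def y_def)
    also have "x powr (real m * k) = norm (H t) powr (2 * k)" using m by (simp add: x_def powr_powr)
    also have "y powr q = norm (a t) powr (2 * q)"
    proof -
      have "y = norm (a t) powr 2" by (simp add: y_def)
      then show ?thesis by (simp only: powr_powr)
    qed
    finally have "norm (H t * a t ^ m) powr (2 / real m) * gw \<tau> \<Delta> t \<le>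
        (\<eta> powr (- (real m * k - 1)) * norm (H t) powr (2 * k) + \<eta> * norm (a t) powr (2 * q)) * gw \<tau> \<Delta> t"
      using gw_pos[of \<tau> \<Delta> t] by (intro mult_right_mono) auto
    then show "norm (H t * a t ^ m) powr (2 / real m) * gw \<tau> \<Delta> t \<le>
        \<eta> powr (- (real m * k - 1)) * (norm (H t) powr (2 * k) * gw \<tau> \<Delta> t) + \<eta> * (norm (a t) powr (2 * q) * gw \<tau> \<Delta> t)"
      by (simp only: distrib_right mult.assoc)
  qed
  also have "\<dots> = \<eta> powr (- (real m * k - 1)) * (LINT t|lborel. norm (H t) powr (2 * k) * gw \<tau> \<Delta> t) +
    \<eta> * (LINT t|lborel. norm (a t) powr (2 * q) * gw \<tau> \<Delta> t)"
    using int by (subst Bochner_Integration.integral_add) auto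
  finally show ?thesis .
qed

section \<open>Growth exponents of the second moments and the lower bound for a fixed centre\<close>

lemma sum_pr_diff_minus:
  fixes h :: "nat \<Rightarrow> real"
  shows "i \<le> j \<Longrightarrow> (\<Sum>p\<in>pr j - pr i. h p) = (\<Sum>p\<in>pr j. h p) - (\<Sum>p\<in>pr i. h p)"
  by (intro sum_diff finite_pr pr_mono)

lemma prime_pr: "p \<in> pr j \<Longrightarrow> prime p" by (simp add: pr_def)

text \<open>Expanding the square, \<open>v\<close> contributes at most \<open>N / m^2\<close> and
  \<open>u\<close> contributes \<open>\<beta>^2 * N\<close>, while the cross term is bounded. As
  \<open>(1 / m + \<beta>)^2 = k^2\<close>, the exponent falls short of \<open>k^2 * N\<close> by
  \<open>2 * \<beta> * N / m\<close>.\<close>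

lemma exponent_upper:
  fixes u v :: "nat \<Rightarrow> complex" and \<beta> k N M Cu Cv Cx :: real and m :: nat
  assumes u: "\<And>i. \<bar>(\<Sum>p\<in>pr i. (norm (u p))\<^sup>2 / real p) - N * real i * ln 4\<bar> \<le> Cu"
    and v: "\<And>i. \<bar>(\<Sum>p\<in>pr i. (norm (v p))\<^sup>2 / real p) - M * real i * ln 4\<bar> \<le> Cv" and M: "M \<le> N"
    and cross: "\<And>i. (\<Sum>p\<in>pr i. Re (v p * cnj (u p)) / real p) \<le> Cx"
    and m: "m > 0" and \<beta>: "\<beta> \<ge> 0" "k = \<beta> + 1 / real m"
  shows "(\<Sum>p\<in>pr J - pr i1. (norm (v p / of_nat m + of_real \<beta> * u p))\<^sup>2 / real p) \<le>
    (k\<^sup>2 - 2 * \<beta> / real m) * (N * ln 4) * real J + (Cv / (real m)\<^sup>2 + \<beta>\<^sup>2 * Cu + 2 * \<beta> / real m * Cx)"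
proof -
  have sq: "(norm (v p / of_nat m + of_real \<beta> * u p))\<^sup>2 / real p = (1 / (real m)\<^sup>2) * ((norm (v p))\<^sup>2 / real p) +
     \<beta>\<^sup>2 * ((norm (u p))\<^sup>2 / real p) + (2 * \<beta> / real m) * (Re (v p * cnj (u p)) / real p)" for p
  proof -
    define r where "r = 1 / real m"
    have "(norm (of_real r * v p + of_real \<beta> * u p))\<^sup>2 =
        r\<^sup>2 * (norm (v p))\<^sup>2 + \<beta>\<^sup>2 * (norm (u p))\<^sup>2 + (2 * \<beta> * r) * Re (v p * cnj (u p))"
      unfolding cmod_power2 by (simp add: power2_eq_square algebra_simps)
    then have "(norm (v p / of_nat m + of_real \<beta> * u p))\<^sup>2 =
        (1 / (real m)\<^sup>2) * (norm (v p))\<^sup>2 + \<beta>\<^sup>2 * (norm (u p))\<^sup>2 + (2 * \<beta> / real m) * Re (v p * cnj (u p))"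
      by (simp add: r_def power_divide)
    then show ?thesis by (simp only: add_divide_distrib times_divide_eq_right)
  qed
  have v': "(\<Sum>p\<in>pr J. (norm (v p))\<^sup>2 / real p) \<le> (N * ln 4) * real J + Cv"
  proof -
    have "M * (real J * ln 4) \<le> N * (real J * ln 4)" using M by (intro mult_right_mono) auto
    then show ?thesis using v[of J] by (simp add: abs_le_iff algebra_simps)
  qed
  have u': "(\<Sum>p\<in>pr J. (norm (u p))\<^sup>2 / real p) \<le> (N * ln 4) * real J + Cu"
    using u[of J] by (simp add: abs_le_iff algebra_simps)
  have "(\<Sum>p\<in>pr J - pr i1. (norm (v p / of_nat m + of_real \<beta> * u p))\<^sup>2 / real p) \<le>
      (\<Sum>p\<in>pr J. (norm (v p / of_nat m + of_real \<beta> * u p))\<^sup>2 / real p)"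
    by (intro sum_mono2 finite_pr) auto
  also have "\<dots> = (1 / (real m)\<^sup>2) * (\<Sum>p\<in>pr J. (norm (v p))\<^sup>2 / real p) + \<beta>\<^sup>2 * (\<Sum>p\<in>pr J. (norm (u p))\<^sup>2 / real p) +
      (2 * \<beta> / real m) * (\<Sum>p\<in>pr J. Re (v p * cnj (u p)) / real p)"
    unfolding sq sum.distrib sum_distrib_left ..
  also have "\<dots> \<le> (1 / (real m)\<^sup>2) * ((N * ln 4) * real J + Cv) + \<beta>\<^sup>2 * ((N * ln 4) * real J + Cu) + (2 * \<beta> / real m) * Cx"
    using \<beta> by (intro add_mono mult_left_mono u' v' cross) auto
  also have "\<dots> = (k\<^sup>2 - 2 * \<beta> / real m) * (N * ln 4) * real J + (Cv / (real m)\<^sup>2 + \<beta>\<^sup>2 * Cu + 2 * \<beta> / real m * Cx)"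
  proof -
    have k: "k\<^sup>2 - 2 * \<beta> / real m = 1 / (real m)\<^sup>2 + \<beta>\<^sup>2"
      unfolding \<beta>(2) by (simp add: power2_eq_square algebra_simps)
    show ?thesis unfolding k by (simp add: algebra_simps)
  qed
  finally show ?thesis .
qed

text \<open>At primes \<open>g p + x p = k * u p\<close>, so the sum of the
  \<open>\<kappa> p\<close> is \<open>k^2\<close> times a Mertens sum. Its squares have a bounded
  sum, since \<open>\<kappa> p = O(p powr - \<eta>)\<close>, and leaving out the last
  \<open>h\<close> blocks costs a constant factor because \<open>h\<close> is fixed.\<close>

lemma second_moment_lower_exp:
  fixes u g :: "nat \<Rightarrow> complex" and \<beta> k N Cu C \<theta> :: real and m i1 L0 h :: nat
  defines "x \<equiv> \<lambda>p. of_real \<beta> * u p"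
  assumes g: "multiplicative g" "g 1 = 1" "\<And>p. prime p \<Longrightarrow> g p = u p / of_nat m"
    and m: "m > 0" and k: "k = \<beta> + 1 / real m"
    and u: "\<And>i. \<bar>(\<Sum>p\<in>pr i. (norm (u p))\<^sup>2 / real p) - N * real i * ln 4\<bar> \<le> Cu"
    and uC: "\<And>p. prime p \<Longrightarrow> norm (u p) \<le> C * real p powr \<theta>" and \<theta>: "\<theta> < 1 / 2"
    and i1: "i1 \<ge> 1" and L0: "L0 \<ge> 1" and \<kappa>1: "\<And>p. prime p \<Longrightarrow> p \<notin> pr i1 \<Longrightarrow> k\<^sup>2 * ((norm (u p))\<^sup>2 / real p) \<le> 1"
    and L0D: "(1 / 2) ^ L0 * exp (k\<^sup>2 * (N * ln 4 + 2 * Cu)) \<le> 1 / 2" and h: "4 * real L0 / 2 ^ h \<le> 1"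
  obtains c where "c > 0" "\<And>J \<delta>. i1 + h \<le> J \<Longrightarrow> \<delta> \<ge> 0 \<Longrightarrow>
    c * exp (- 2 * \<delta> * (4 * real L0 / 2 ^ h) * 4 ^ J) * exp (k\<^sup>2 * (N * ln 4) * real J) \<le>
    (\<Sum>n=1..cutoff J. (norm (vcoef i1 J L0 g x n))\<^sup>2 * real n powr (- 2 * (1 / 2 + \<delta>)))"
proof -
  define F where "F = (\<lambda>p. (norm (u p))\<^sup>2 / real p)"
  define \<eta> where "\<eta> = 1 - 2 * \<theta>"
  have \<eta>: "\<eta> > 0" using \<theta> by (simp add: \<eta>_def)
  have \<kappa>: "(norm (g p + x p))\<^sup>2 / real p = k\<^sup>2 * F p" if "prime p" for p
  proof -
    have "g p + x p = of_real k * u p" using g(3)[OF that] by (simp add: k x_def algebra_simps)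
    then show ?thesis by (simp add: F_def norm_mult power_mult_distrib)
  qed
  note blF = block_sum_bound[OF u, folded F_def]
  have D: "(\<Sum>p\<in>bl i. (norm (g p + x p))\<^sup>2 / real p) \<le> k\<^sup>2 * (N * ln 4 + 2 * Cu)" for i
  proof -
    have "(\<Sum>p\<in>bl i. (norm (g p + x p))\<^sup>2 / real p) = k\<^sup>2 * (\<Sum>p\<in>bl i. F p)"
      unfolding sum_distrib_left by (intro sum.cong refl \<kappa>) (simp add: in_bl_iff)
    then show ?thesis using mult_left_mono[OF blF[of i], of "k\<^sup>2"] by simp
  qed
  have \<kappa>1': "(norm (g p + x p))\<^sup>2 / real p \<le> 1" if "prime p" "p \<notin> pr i1" for p
    unfolding \<kappa>[OF that(1)] F_def by (rule \<kappa>1[OF that])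
  have F0: "F p \<ge> 0" for p by (simp add: F_def)
  have C0: "C \<ge> 0"
    using order_trans[OF norm_ge_zero uC[OF two_is_prime_nat]] by (simp add: zero_le_mult_iff)
  define c2 where "c2 = k ^ 4 * C\<^sup>2 * (2 * (N * ln 4 + 2 * Cu) / \<eta>)"
  have sq: "(\<Sum>p\<in>pr j - pr i1. ((norm (g p + x p))\<^sup>2 / real p)\<^sup>2) \<le> c2" if "i1 \<le> j" for j
  proof -
    have "(\<Sum>p\<in>pr j - pr i1. ((norm (g p + x p))\<^sup>2 / real p)\<^sup>2) \<le> (\<Sum>p\<in>pr j - pr i1. k ^ 4 * C\<^sup>2 * (F p * real p powr - \<eta>))"
    proof (rule sum_mono)
      fix p assume "p \<in> pr j - pr i1"
      then have p: "prime p" by (auto simp: pr_def)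
      have p0: "real p > 0" using prime_gt_0_nat[OF p] by simp
      have "(norm (u p))\<^sup>2 \<le> (C * real p powr \<theta>)\<^sup>2" using uC[OF p] by (intro power_mono) auto
      then have "F p \<le> (C * real p powr \<theta>)\<^sup>2 / real p" unfolding F_def using p0 by (intro divide_right_mono) auto
      also have "\<dots> = C\<^sup>2 * real p powr - \<eta>"
        using p0 by (simp add: power_mult_distrib \<eta>_def powr_diff powr_realpow[symmetric] powr_powr mult.commute)
      finally have "F p * F p \<le> F p * (C\<^sup>2 * real p powr - \<eta>)" using F0 by (intro mult_left_mono) auto
      then have "k ^ 4 * (F p * F p) \<le> k ^ 4 * (F p * (C\<^sup>2 * real p powr - \<eta>))" by (rule mult_left_mono) auto
      then show "((norm (g p + x p))\<^sup>2 / real p)\<^sup>2 \<le> k ^ 4 * C\<^sup>2 * (F p * real p powr - \<eta>)"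
        unfolding \<kappa>[OF p] by (simp add: power2_eq_square power4_eq_xxxx mult_ac)
    qed
    also have "\<dots> \<le> c2"
      unfolding c2_def sum_distrib_left[symmetric] using sum_powr_decay[OF blF F0 \<eta> that]
      by (intro mult_left_mono) auto
    finally show ?thesis .
  qed
  \<comment> \<open>The loss in the exponent: \<open>h\<close> omitted blocks, the error of the
    Mertens sum, and the primes of \<open>pr i1\<close>.\<close>
  define c1 where "c1 = k\<^sup>2 * (N * ln 4) * real h + k\<^sup>2 * (Cu + (\<Sum>p\<in>pr i1. F p))"
  show ?thesis
  proof (rule that[of "exp (- c1 - c2) / 2"])
    fix J \<delta> assume J: "i1 + h \<le> J" and \<delta>: "(\<delta>::real) \<ge> 0"
    define E where "E = exp (- 2 * \<delta> * (4 * real L0 / 2 ^ h) * 4 ^ J)"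
    have "(\<Sum>p\<in>pr (J - h) - pr i1. (norm (g p + x p))\<^sup>2 / real p) = k\<^sup>2 * (\<Sum>p\<in>pr (J - h) - pr i1. F p)"
      unfolding sum_distrib_left by (intro sum.cong refl \<kappa>) (auto simp: pr_def)
    moreover have "(\<Sum>p\<in>pr (J - h) - pr i1. F p) \<ge> (N * ln 4) * (real J - real h) - Cu - (\<Sum>p\<in>pr i1. F p)"
      using u[of "J - h"] J sum_pr_diff_minus[of i1 "J - h" F]
      by (simp add: F_def abs_le_iff of_nat_diff algebra_simps)
    ultimately have "(\<Sum>p\<in>pr (J - h) - pr i1. (norm (g p + x p))\<^sup>2 / real p) \<ge>
        k\<^sup>2 * ((N * ln 4) * (real J - real h) - Cu - (\<Sum>p\<in>pr i1. F p))" by (simp add: mult_left_mono)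
    also have "k\<^sup>2 * ((N * ln 4) * (real J - real h) - Cu - (\<Sum>p\<in>pr i1. F p)) = k\<^sup>2 * (N * ln 4) * real J - c1"
      by (simp add: c1_def algebra_simps)
    finally have "k\<^sup>2 * (N * ln 4) * real J + (- c1 - c2) \<le>
      (\<Sum>p\<in>pr (J - h) - pr i1. (norm (g p + x p))\<^sup>2 / real p) - (\<Sum>p\<in>pr (J - h) - pr i1. ((norm (g p + x p))\<^sup>2 / real p)\<^sup>2)"
      using sq[of "J - h"] J by linarith
    then have "E / 2 * exp (k\<^sup>2 * (N * ln 4) * real J + (- c1 - c2)) \<le> E / 2 * exp (
      (\<Sum>p\<in>pr (J - h) - pr i1. (norm (g p + x p))\<^sup>2 / real p) - (\<Sum>p\<in>pr (J - h) - pr i1. ((norm (g p + x p))\<^sup>2 / real p)\<^sup>2))"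
      by (intro mult_left_mono) (auto simp: E_def)
    also have "\<dots> \<le> (\<Sum>n=1..cutoff J. (norm (vcoef i1 J L0 g x n))\<^sup>2 * real n powr (- 2 * (1 / 2 + \<delta>)))"
      unfolding E_def by (rule vcoef_second_moment_lower[OF g(1,2) i1 L0 D L0D \<kappa>1' J h \<delta>])
    finally show "exp (- c1 - c2) / 2 * exp (- 2 * \<delta> * (4 * real L0 / 2 ^ h) * 4 ^ J) * exp (k\<^sup>2 * (N * ln 4) * real J) \<le>
        (\<Sum>n=1..cutoff J. (norm (vcoef i1 J L0 g x n))\<^sup>2 * real n powr (- 2 * (1 / 2 + \<delta>)))"
      unfolding E_def[symmetric] exp_add by (simp only: times_divide_eq_left times_divide_eq_right mult_ac)
  qed simp
qed

text \<open>All quantities are values at one point of the right line, \<open>G j\<close> standing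
  for the \<open>m\<close>-th root of the L-series. Both \<open>G j * a\<close> and
  \<open>V j\<close> are at most \<open>2 * K j\<close> in modulus because
  \<open>\<epsilon> <= 1\<close>, so their \<open>m\<close>-th powers differ by at most
  \<open>m * (2 * K j) ^ (m - 1)\<close> times their distance.\<close>

lemma right_line_approx:
  fixes G V :: "'i \<Rightarrow> complex" and b :: "'i \<Rightarrow> complex" and a w :: complex and K :: "'i \<Rightarrow> real"
  assumes w: "norm w \<le> 3" and \<epsilon>: "0 \<le> \<epsilon>" "\<epsilon> \<le> 1"
    and G: "\<And>j. j \<in> I \<Longrightarrow> norm (G j * a) \<le> K j"
    and V: "\<And>j. j \<in> I \<Longrightarrow> norm (G j * a - V j) \<le> \<epsilon> * K j"
  shows "norm (w ^ n * (\<Sum>j\<in>I. b j * G j ^ m) * a ^ m) \<le> 3 ^ n * (\<Sum>j\<in>I. norm (b j) * K j ^ m)"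
    and "norm (w ^ n * (\<Sum>j\<in>I. b j * G j ^ m) * a ^ m - w ^ n * (\<Sum>j\<in>I. b j * V j ^ m)) \<le>
      \<epsilon> * (3 ^ n * (\<Sum>j\<in>I. norm (b j) * (real m * (2 * K j) ^ (m - 1) * K j)))"
proof -
  have eq: "w ^ n * (\<Sum>j\<in>I. b j * G j ^ m) * a ^ m = w ^ n * (\<Sum>j\<in>I. b j * (G j * a) ^ m)"
    by (simp add: sum_distrib_left sum_distrib_right power_mult_distrib mult_ac)
  have wn: "norm w ^ n \<le> 3 ^ n" using w by (intro power_mono) auto
  show "norm (w ^ n * (\<Sum>j\<in>I. b j * G j ^ m) * a ^ m) \<le> 3 ^ n * (\<Sum>j\<in>I. norm (b j) * K j ^ m)"
    unfolding eq norm_mult[of "w ^ n"] norm_power[of w]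
  proof (intro mult_mono wn order_trans[OF norm_sum] sum_mono)
    fix j assume "j \<in> I"
    then show "norm (b j * (G j * a) ^ m) \<le> norm (b j) * K j ^ m"
      using G unfolding norm_mult[of "b j"] norm_power[of "G j * a"] by (intro mult_left_mono power_mono) auto
  qed auto
  have "w ^ n * (\<Sum>j\<in>I. b j * G j ^ m) * a ^ m - w ^ n * (\<Sum>j\<in>I. b j * V j ^ m) =
      w ^ n * (\<Sum>j\<in>I. b j * ((G j * a) ^ m - V j ^ m))"
    unfolding eq by (simp add: sum_subtractf right_diff_distrib)
  moreover have "norm (w ^ n * (\<Sum>j\<in>I. b j * ((G j * a) ^ m - V j ^ m))) \<le>
      3 ^ n * (\<Sum>j\<in>I. norm (b j) * (\<epsilon> * (real m * (2 * K j) ^ (m - 1) * K j)))"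
    unfolding norm_mult[of "w ^ n"] norm_power[of w]
  proof (intro mult_mono wn order_trans[OF norm_sum] sum_mono)
    fix j assume j: "j \<in> I"
    have K0: "K j \<ge> 0" using order_trans[OF norm_ge_zero G[OF j]] .
    then have "\<epsilon> * K j \<le> 1 * K j" using \<epsilon> by (intro mult_right_mono) auto
    then have "norm (G j * a) \<le> 2 * K j" "norm (V j) \<le> 2 * K j"
      using G[OF j] V[OF j] K0 norm_triangle_ineq4[of "G j * a" "G j * a - V j"] by simp_all
    then have "norm ((G j * a) ^ m - V j ^ m) \<le> real m * (2 * K j) ^ (m - 1) * norm (G j * a - V j)"
      by (rule norm_power_diff_le)
    also have "\<dots> \<le> real m * (2 * K j) ^ (m - 1) * (\<epsilon> * K j)" using V[OF j] K0 by (intro mult_left_mono) auto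
    finally show "norm (b j * ((G j * a) ^ m - V j ^ m)) \<le> norm (b j) * (\<epsilon> * (real m * (2 * K j) ^ (m - 1) * K j))"
      unfolding norm_mult[of "b j"] by (intro mult_left_mono) (simp_all add: mult_ac)
  qed auto
  ultimately show "norm (w ^ n * (\<Sum>j\<in>I. b j * G j ^ m) * a ^ m - w ^ n * (\<Sum>j\<in>I. b j * V j ^ m)) \<le>
      \<epsilon> * (3 ^ n * (\<Sum>j\<in>I. norm (b j) * (real m * (2 * K j) ^ (m - 1) * K j)))"
    by (simp add: sum_distrib_left mult_ac)
qed

lemma eventually_dominated:
  fixes X K \<omega> \<mu> c :: real
  assumes "\<omega> > 0" "\<mu> > 0" "c > 0"
  obtains J0 :: nat where "\<And>J. J0 \<le> J \<Longrightarrow> X * exp ((\<mu> - \<omega>) * real J) + K \<le> c * exp (\<mu> * real J)"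
proof -
  have "filterlim (\<lambda>J. real J) at_top sequentially" by (rule filterlim_real_sequentially)
  then have "(\<lambda>J. X * exp (- \<omega> * real J) + K * exp (- \<mu> * real J)) \<longlonglongrightarrow> X * 0 + K * 0"
    using assms by (intro tendsto_intros filterlim_compose[OF exp_at_bot] filterlim_tendsto_neg_mult_at_bot[OF tendsto_const]) auto
  then have "\<forall>\<^sub>F J in sequentially. X * exp (- \<omega> * real J) + K * exp (- \<mu> * real J) < c"
    using assms by (intro order_tendstoD(2)[where a = c]) auto
  then obtain J0 where J0: "\<And>J. J0 \<le> J \<Longrightarrow> X * exp (- \<omega> * real J) + K * exp (- \<mu> * real J) < c"
    by (auto simp: eventually_sequentially)
  show ?thesis
  proof (rule that)
    fix J assume "J0 \<le> J"
    then have "(X * exp (- \<omega> * real J) + K * exp (- \<mu> * real J)) * exp (\<mu> * real J) \<le> c * exp (\<mu> * real J)"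
      using J0 by (intro mult_right_mono less_imp_le) auto
    moreover have "exp (- \<omega> * real J) * exp (\<mu> * real J) = exp ((\<mu> - \<omega>) * real J)" "exp (- \<mu> * real J) * exp (\<mu> * real J) = 1"
      by (simp_all add: algebra_simps flip: exp_add)
    ultimately show "X * exp ((\<mu> - \<omega>) * real J) + K \<le> c * exp (\<mu> * real J)"
      by (simp only: distrib_right mult.assoc mult_1_right)
  qed
qed

text \<open>The whole argument for one Gaussian of given centre. The order of the choices matters:
  \<open>m\<close>, \<open>i1\<close>, \<open>L0\<close> and \<open>\<sigma>2\<close> come first,
  then \<open>h\<close> depending on \<open>L0\<close> and \<open>\<sigma>2\<close>, then the
  multiple \<open>Cc\<close> of \<open>1 / 4 ^ J\<close> by which the abscissa is moved, and
  \<open>J\<close> last. No constant depends on \<open>\<tau>\<close>, which is needed for averaging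
  over the centre.\<close>

lemma local_lower_bound:
  fixes f :: "nat \<Rightarrow> nat \<Rightarrow> complex" and L :: "nat \<Rightarrow> complex \<Rightarrow> complex" and \<theta> k :: real
    and Nj :: "nat \<Rightarrow> real" and b :: "nat \<Rightarrow> complex" and \<Phi>0 :: "complex \<Rightarrow> complex"
  assumes I: "finite I" "j1 \<in> I"
    and mult: "\<And>j. j \<in> I \<Longrightarrow> multiplicative (f j)" and f1: "\<And>j. j \<in> I \<Longrightarrow> f j 1 = 1"
    and \<theta>: "0 < \<theta>" "\<theta> < 1/2"
    and bound: "\<And>j r. j \<in> I \<Longrightarrow> r \<ge> 1 \<Longrightarrow> \<exists>C. \<forall>n\<ge>1. norm (dirichlet_root r (f j) n) \<le> C * real n powr \<theta>"
    and summ: "\<And>j r. j \<in> I \<Longrightarrow> r \<ge> 1 \<Longrightarrow>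
           (\<lambda>(p, m). (norm (dirichlet_root r (f j) (p ^ m)))\<^sup>2 / real p ^ m) summable_on ({p. prime p} \<times> {2..})"
    and Npos: "Nj j1 > 0" and Nmax: "\<And>j. j \<in> I \<Longrightarrow> Nj j \<le> Nj j1"
    and merten: "\<And>j. j \<in> I \<Longrightarrow>
           (\<lambda>x::real. (\<Sum>p | prime p \<and> real p \<le> x. (norm (f j p))\<^sup>2 / real p) - Nj j * ln (ln x)) \<in> O[at_top](\<lambda>_. 1)"
    and cross: "\<And>j i. j \<in> I \<Longrightarrow> j \<noteq> j1 \<Longrightarrow> (\<Sum>p\<in>pr i. Re (f j p * cnj (f j1 p)) / real p) \<le> Cx"
    and Lsum: "\<And>j. j \<in> I \<Longrightarrow> \<exists>\<sigma>. \<forall>s. Re s > \<sigma> \<longrightarrow> ((\<lambda>n. f j n / of_nat n powr s) has_sum L j s) {1..}"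
    and b1: "b j1 \<noteq> 0" and k: "k > 0"
    and ana: "\<Phi>0 analytic_on {s. Re s \<ge> 1 / 2}"
    and \<Phi>0: "\<And>s. Re s \<ge> 1 / 2 \<Longrightarrow> s \<noteq> 1 \<Longrightarrow> \<Phi>0 s = (1 - exp (1 - s)) ^ n * (\<Sum>j\<in>I. b j * L j s)"
    and growth: "\<And>\<sigma>2. \<exists>K. \<forall>s. Re s \<ge> 1 / 2 \<longrightarrow> Re s \<le> \<sigma>2 \<longrightarrow> norm (\<Phi>0 s) \<le> K * (1 + \<bar>Im s\<bar>) ^ M"
  obtains c A J0 where "c > 0" "A \<ge> 1" "\<And>J \<Delta> \<tau>. J0 \<le> J \<Longrightarrow> exp (A * 4 ^ J) \<le> \<Delta> \<Longrightarrow>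
    c * \<Delta> * exp (k\<^sup>2 * (Nj j1 * ln 4) * real J) \<le> (LINT t|lborel. norm (\<Phi>0 (Complex (1 / 2) t)) powr (2 * k) * gw \<tau> \<Delta> t)"
proof -

  \<comment> \<open>Exponents, roots and coefficient bounds\<close>
  obtain m :: nat where m: "max 2 (1 / k) < real m" using reals_Archimedean2 by blast
  then have m2: "m \<ge> 2" and m0: "m > 0" and m1: "m \<ge> 1" and mk: "real m * k > 1" using k by (auto simp: field_simps)
  define \<beta> where "\<beta> = k - 1 / real m"
  have \<beta>: "\<beta> > 0" "\<beta> \<le> k" "k = \<beta> + 1 / real m" using mk m0 by (auto simp: \<beta>_def field_simps)
  \<comment> \<open>\<open>q\<close> is the exponent conjugate to \<open>m * k\<close>; the even
    powers in the moment of \<open>a\<close> require an integer \<open>Q\<close> above it.\<close>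
  define q where "q = k / \<beta>"
  have q: "q * \<beta> = k" "q > 0" using \<beta> k by (auto simp: q_def)
  define Q where "Q = nat \<lceil>q\<rceil>"
  have Q1: "q \<le> real Q" by (simp add: Q_def real_nat_ceiling_ge)
  then have "real Q > 0" using q(2) by linarith
  then have Q: "q \<le> real Q" "Q \<ge> 1" using Q1 by auto
  define p where "p = 2 / real m"
  have p: "0 < p" using m0 by (simp add: p_def)
  define N where "N = Nj j1"
  \<comment> \<open>\<open>exp (k^2 * \<Lambda> * J)\<close> is
    \<open>(log X) powr (N * k^2)\<close> for \<open>log X = 4 ^ J\<close>, and
    \<open>\<omega>\<close> is the saving per block for \<open>j\<close> other than
    \<open>j1\<close>.\<close>
  define \<Lambda> where "\<Lambda> = N * ln 4"
  define \<omega> where "\<omega> = 2 * \<beta> / real m * \<Lambda>"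
  have N: "N > 0" using Npos by (simp add: N_def)
  have \<Lambda>: "\<Lambda> > 0" using N by (simp add: \<Lambda>_def)
  have \<omega>: "\<omega> > 0" using \<Lambda> \<beta> m0 by (simp add: \<omega>_def)
  define u where "u = f j1"
  define x where "x = (\<lambda>p. of_real \<beta> * u p)"
  define g where "g = (\<lambda>j. dirichlet_root m (f j))"
  have g: "multiplicative (g j)" "g j 1 = 1" "\<And>p. prime p \<Longrightarrow> g j p = f j p / of_nat m"
    "\<And>n. n \<ge> 1 \<Longrightarrow> dirichlet_power m (g j) n = f j n" if j: "j \<in> I" for j
  proof -
    note R = is_dirichlet_root_dirichlet_root[of m "f j", OF m1 f1[OF j]]
    show "multiplicative (g j)" unfolding g_def using mult[OF j] f1[OF j] m1 by (rule multiplicative_dirichlet_root)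
    show "g j 1 = 1" "\<And>n. n \<ge> 1 \<Longrightarrow> dirichlet_power m (g j) n = f j n" using R by (auto simp: g_def is_dirichlet_root_def)
    show "\<And>p. prime p \<Longrightarrow> g j p = f j p / of_nat m" unfolding g_def using f1[OF j] m1 by (rule dirichlet_root_prime)
  qed
  obtain Cg where Cg: "\<And>j n. j \<in> I \<Longrightarrow> n \<ge> 1 \<Longrightarrow> norm (g j n) \<le> Cg j * real n powr \<theta>"
    unfolding g_def using bound[OF _ m1] by metis
  have "\<exists>C. \<forall>n\<ge>1. norm (u n) \<le> C * real n powr \<theta>"
    using bound[OF I(2), of 1] dirichlet_root_1[of u, unfolded u_def, OF f1[OF I(2)]] by (simp add: u_def)
  then obtain C where C: "\<And>n. n \<ge> 1 \<Longrightarrow> norm (u n) \<le> C * real n powr \<theta>" by auto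
  have C0: "C \<ge> 0" using order_trans[OF norm_ge_zero C[of 1]] by simp
  have uC: "norm (u p) \<le> C * real p powr \<theta>" if "prime p" for p using prime_ge_1_nat[OF that] by (rule C)
  have "\<exists>Cs. \<forall>i. \<bar>(\<Sum>p\<in>pr i. (norm (f j p))\<^sup>2 / real p) - Nj j * real i * ln 4\<bar> \<le> Cs" if "j \<in> I" for j
    using prime_sum_bound[OF merten[OF that]] by metis
  then obtain Cs where Cs: "\<And>j i. j \<in> I \<Longrightarrow> \<bar>(\<Sum>p\<in>pr i. (norm (f j p))\<^sup>2 / real p) - Nj j * real i * ln 4\<bar> \<le> Cs j" by metis
  note Cu = Cs[OF I(2), folded u_def N_def]
  define Df where "Df = (\<lambda>j. Nj j * ln 4 + 2 * Cs j)"
  have Df: "(\<Sum>p\<in>bl i. (norm (f j p))\<^sup>2 / real p) \<le> Df j" if "j \<in> I" for i j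
    unfolding Df_def by (rule block_sum_bound[OF Cs[OF that]])
  have Dg: "(\<Sum>p\<in>bl i. (norm (g j p))\<^sup>2 / real p) \<le> Df j / (real m)\<^sup>2" if j: "j \<in> I" for i j
  proof -
    have "(\<Sum>p\<in>bl i. (norm (g j p))\<^sup>2 / real p) = (\<Sum>p\<in>bl i. (norm (f j p))\<^sup>2 / real p) / (real m)\<^sup>2"
      unfolding sum_divide_distrib
      by (intro sum.cong refl) (simp add: in_bl_iff g(3)[OF j] norm_divide power_divide)
    then show ?thesis using Df[OF j, of i] by (simp add: divide_right_mono)
  qed
  have Dx: "(\<Sum>p\<in>bl i. (norm (x p))\<^sup>2 / real p) \<le> \<beta>\<^sup>2 * Df j1" for i
  proof -
    have "(\<Sum>p\<in>bl i. (norm (x p))\<^sup>2 / real p) = \<beta>\<^sup>2 * (\<Sum>p\<in>bl i. (norm (f j1 p))\<^sup>2 / real p)"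
      unfolding sum_distrib_left by (intro sum.cong refl) (simp add: x_def u_def norm_mult power_mult_distrib)
    then show ?thesis using Df[OF I(2), of i] by (simp add: mult_left_mono)
  qed
  have xC: "norm (x p) \<le> \<beta> * C * real p powr \<theta>" if "prime p" for p
    using mult_left_mono[OF uC[OF that], of \<beta>] \<beta> by (simp add: x_def norm_mult mult.assoc)
  define T where "T = (\<lambda>j R i1. \<forall>i0 J E. i1 \<le> i0 \<longrightarrow> i0 \<le> J \<longrightarrow>
     (\<Sum>p\<in>pr J - pr i0. \<Sum>e=2..E. 4 ^ e * (norm (majorant (g j) x (p ^ e)))\<^sup>2 / real (p ^ e)) \<le> R)"
  have "\<exists>R i1. T j R i1" if j: "j \<in> I" for j
  proof -
    have summ': "(\<lambda>(p, e). (norm (g j (p ^ e)))\<^sup>2 / real p ^ e) summable_on ({p. prime p} \<times> {2..})"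
      using summ[OF j m1] by (simp add: g_def)
    show ?thesis
    proof (rule prime_power_tail[OF \<theta> xC Cg[OF j] summ' Dx])
      fix R i1 assume A: "\<And>i0 J E. i1 \<le> i0 \<Longrightarrow> i0 \<le> J \<Longrightarrow>
         (\<Sum>p\<in>pr J - pr i0. \<Sum>e=2..E. 4 ^ e * (norm (majorant (g j) x (p ^ e)))\<^sup>2 / real (p ^ e)) \<le> R"
      show ?thesis unfolding T_def by (intro exI[of _ R] exI[of _ i1] allI impI A)
    qed
  qed
  then obtain R i1f where "\<And>j. j \<in> I \<Longrightarrow> T j (R j) (i1f j)" by metis
  then have R: "(\<Sum>p\<in>pr J - pr i0. \<Sum>e=2..E. 4 ^ e * (norm (majorant (g j) x (p ^ e)))\<^sup>2 / real (p ^ e)) \<le> R j"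
    if "j \<in> I" "i1f j \<le> i0" "i0 \<le> J" for j i0 J E using that unfolding T_def by blast

  \<comment> \<open>Choice of the parameters of the blocks and of the right line\<close>
  define \<eta> where "\<eta> = 1 - 2 * \<theta>"
  have \<eta>: "\<eta> > 0" using \<theta> by (simp add: \<eta>_def)
  \<comment> \<open>Makes
    \<open>k^2 * (norm (u p))^2 / p <= k^2 * C^2 * p powr - \<eta> <= 1\<close> for primes outside
    \<open>pr i1\<close>, as required for the lower bound of the product over primes.\<close>
  obtain i2 :: nat where i2: "k\<^sup>2 * C\<^sup>2 / \<eta> < real i2" using reals_Archimedean2 by blast
  define i1 where "i1 = i2 + 1 + (\<Sum>j\<in>I. i1f j)"
  have i1: "i1 \<ge> 1" "i2 \<le> i1" by (auto simp: i1_def)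
  have i1f: "i1f j \<le> i1" if "j \<in> I" for j using member_le_sum[OF that, of i1f] I(1) by (simp add: i1_def)
  have \<kappa>1: "k\<^sup>2 * ((norm (u p))\<^sup>2 / real p) \<le> 1" if pp: "prime p" "p \<notin> pr i1" for p
  proof -
    have p0: "real p > 0" using prime_gt_0_nat[OF pp(1)] by simp
    have "k\<^sup>2 * C\<^sup>2 < \<eta> * real i2" using i2 \<eta> by (simp add: field_simps)
    also have "\<dots> \<le> \<eta> * ln (real p)"
    proof -
      have "real i2 \<le> real i1" "real i1 \<le> 4 ^ i1" "4 ^ i1 < ln (real p)"
        using i1(2) real_le_power_4[of i1] pp by (auto simp: pr_def)
      then show ?thesis using \<eta> by (intro mult_left_mono) linarith+
    qed
    also have "\<dots> \<le> exp (\<eta> * ln (real p))" using exp_ge_add_one_self[of "\<eta> * ln (real p)"] by linarith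
    also have "\<dots> = real p powr \<eta>" using p0 by (simp add: powr_def)
    finally have 1: "k\<^sup>2 * C\<^sup>2 \<le> real p powr \<eta>" by simp
    have "(norm (u p))\<^sup>2 \<le> (C * real p powr \<theta>)\<^sup>2" using uC[OF pp(1)] by (intro power_mono) auto
    also have "\<dots> = C\<^sup>2 * (real p powr \<theta> * real p powr \<theta>)" by (simp add: power2_eq_square)
    finally have "k\<^sup>2 * (norm (u p))\<^sup>2 \<le> k\<^sup>2 * (C\<^sup>2 * (real p powr \<theta> * real p powr \<theta>))" by (intro mult_left_mono) auto
    also have "\<dots> \<le> real p powr \<eta> * (real p powr \<theta> * real p powr \<theta>)"
      unfolding mult.assoc[symmetric] by (intro mult_right_mono 1) auto
    also have "\<dots> = real p" using p0 by (simp add: \<eta>_def flip: powr_add)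
    finally show ?thesis using p0 by simp
  qed
  define D where "D = k\<^sup>2 * Df j1"
  \<comment> \<open>\<open>L1\<close> is for Rankin's trick in the lower second moment,
    \<open>L2\<close> for the pure powers in the moment of \<open>a\<close>.\<close>
  obtain L1 :: nat where L1: "(1 / 2) ^ L1 < 1 / 2 / exp D"
    using real_arch_pow_inv[of "1 / 2 / exp D" "1 / 2 :: real"] by auto
  obtain L2 :: nat where L2: "4 * (4096 * k\<^sup>2 * Df j1 * real Q) < real L2" using reals_Archimedean2 by blast
  define L0 where "L0 = L1 + L2 + 1"
  have L0: "L0 \<ge> 1" by (simp add: L0_def)
  have L0Q: "4 * (4096 * k\<^sup>2 * Df j1 * real Q) \<le> real L0" using L2 by (simp add: L0_def)
  have L0D: "(1 / 2) ^ L0 * exp D \<le> 1 / 2"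
  proof -
    have "(1 / 2 :: real) ^ L0 \<le> (1 / 2) ^ L1" by (intro power_decreasing) (auto simp: L0_def)
    also have "\<dots> \<le> 1 / 2 / exp D" using L1 by simp
    finally show ?thesis by (simp add: field_simps)
  qed
  obtain \<sigma>f where \<sigma>f: "\<And>j s. j \<in> I \<Longrightarrow> Re s > \<sigma>f j \<Longrightarrow> ((\<lambda>n. f j n / of_nat n powr s) has_sum L j s) {1..}"
    using Lsum by metis
  \<comment> \<open>To the right of all half-planes of convergence and beyond the 9/4 that
    \<open>apoly_approx\<close> demands.\<close>
  define \<sigma>2 where "\<sigma>2 = 3 + (\<Sum>j\<in>I. \<bar>\<sigma>f j\<bar>)"
  have \<sigma>2: "\<sigma>2 \<ge> 3" by (simp add: \<sigma>2_def sum_nonneg)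
  have \<sigma>2f: "\<sigma>f j < \<sigma>2" if "j \<in> I" for j
    using member_le_sum[OF that, of "\<lambda>j. \<bar>\<sigma>f j\<bar>"] I(1) by (simp add: \<sigma>2_def)
  \<comment> \<open>At \<open>\<delta> J = Cc / 4 ^ J\<close> the gain from convexity is exactly
    \<open>exp (- 2 * \<rho> * Cc)\<close>. With \<open>2 * \<epsilon> <= \<rho>\<close>, secured by
    the choice of \<open>h\<close>, the main term loses at most
    \<open>exp (- \<rho> * Cc)\<close>.\<close>
  define \<rho> where "\<rho> = p / (8 * \<sigma>2)"
  have \<rho>: "\<rho> > 0" using p \<sigma>2 by (simp add: \<rho>_def)
  have "min 1 (\<rho> / 2) / (4 * real L0) > 0" using \<rho> L0 by simp
  then obtain h where h0: "(1 / 2) ^ h < min 1 (\<rho> / 2) / (4 * real L0)"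
    using real_arch_pow_inv[of "min 1 (\<rho> / 2) / (4 * real L0)" "1 / 2 :: real"] by auto
  define \<epsilon> where "\<epsilon> = 4 * real L0 / 2 ^ h"
  have "4 * real L0 * (1 / 2) ^ h < min 1 (\<rho> / 2)" using h0 L0 by (subst (asm) pos_less_divide_eq) (auto simp: mult_ac)
  then have h: "\<epsilon> \<le> 1" "2 * \<epsilon> \<le> \<rho>" by (simp_all add: \<epsilon>_def power_one_over)
  define s where "s = sqrt (2 * pi)"
  have s: "s > 0" by (simp add: s_def)

  \<comment> \<open>Second moments of the polynomials \<open>V\<close>\<close>
  define e where "e = (\<lambda>j. if j = j1 then k\<^sup>2 * \<Lambda> else k\<^sup>2 * \<Lambda> - \<omega>)"
  have "\<exists>c. \<forall>J. (\<Sum>p\<in>pr J - pr i1. (norm (g j p + x p))\<^sup>2 / real p) \<le> e j * real J + c" if j: "j \<in> I" for j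
  proof (cases "j = j1")
    case True
    have "(\<Sum>p\<in>pr J - pr i1. (norm (g j p + x p))\<^sup>2 / real p) \<le> e j * real J + k\<^sup>2 * Cs j1" for J
    proof -
      have "(\<Sum>p\<in>pr J - pr i1. (norm (g j p + x p))\<^sup>2 / real p) \<le> (\<Sum>p\<in>pr J. (norm (g j p + x p))\<^sup>2 / real p)"
        by (intro sum_mono2 finite_pr) auto
      also have "\<dots> = k\<^sup>2 * (\<Sum>p\<in>pr J. (norm (u p))\<^sup>2 / real p)"
        unfolding sum_distrib_left
      proof (intro sum.cong refl)
        fix p assume "p \<in> pr J"
        then have "g j p + x p = of_real k * u p"
          using g(3)[OF j, of p] True by (simp add: prime_pr \<beta>(3) x_def u_def algebra_simps)
        then show "(norm (g j p + x p))\<^sup>2 / real p = k\<^sup>2 * ((norm (u p))\<^sup>2 / real p)"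
          by (simp add: norm_mult power_mult_distrib)
      qed
      also have "\<dots> \<le> k\<^sup>2 * (\<Lambda> * real J + Cs j1)"
        using Cu[of J] by (intro mult_left_mono) (auto simp: \<Lambda>_def abs_le_iff algebra_simps)
      finally show ?thesis using True by (simp add: e_def algebra_simps)
    qed
    then show ?thesis by blast
  next
    case False
    have "(\<Sum>p\<in>pr J - pr i1. (norm (g j p + x p))\<^sup>2 / real p) \<le> e j * real J +
        (Cs j / (real m)\<^sup>2 + \<beta>\<^sup>2 * Cs j1 + 2 * \<beta> / real m * Cx)" for J
    proof -
      have "(\<Sum>p\<in>pr J - pr i1. (norm (g j p + x p))\<^sup>2 / real p) =
          (\<Sum>p\<in>pr J - pr i1. (norm (f j p / of_nat m + of_real \<beta> * u p))\<^sup>2 / real p)"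
        by (intro sum.cong refl) (auto simp: g(3)[OF j] prime_pr x_def)
      also have "\<dots> \<le> (k\<^sup>2 - 2 * \<beta> / real m) * (N * ln 4) * real J + (Cs j / (real m)\<^sup>2 + \<beta>\<^sup>2 * Cs j1 + 2 * \<beta> / real m * Cx)"
        using exponent_upper[OF Cu Cs[OF j] _ _ m0 _ \<beta>(3), of Cx J i1] Nmax[OF j] cross[OF j False] \<beta>(1)
        by (simp add: N_def u_def)
      also have "(k\<^sup>2 - 2 * \<beta> / real m) * (N * ln 4) * real J = e j * real J"
        using False by (simp add: e_def \<omega>_def \<Lambda>_def algebra_simps)
      finally show ?thesis .
    qed
    then show ?thesis by blast
  qed
  then obtain ce where ce: "\<And>j J. j \<in> I \<Longrightarrow> (\<Sum>p\<in>pr J - pr i1. (norm (g j p + x p))\<^sup>2 / real p) \<le> e j * real J + ce j" by metis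
  define TU where "TU = (\<lambda>j C. C > 0 \<and> (\<forall>J. i1 \<le> J \<longrightarrow> (\<Sum>n=1..cutoff J. (norm (vcoef i1 J L0 (g j) x n))\<^sup>2 / real n) \<le>
    C * exp (\<Sum>p\<in>pr J - pr i1. (norm (g j p + x p))\<^sup>2 / real p)))"
  have "\<exists>C. TU j C" if j: "j \<in> I" for j
  proof (rule vcoef_second_moment_upper[OF g(1,2)[OF j] Cg[OF j] \<theta> i1(1) L0 Dx Dg[OF j] R[OF j i1f[OF j]]])
    fix C :: real assume A: "C > 0" "\<And>J. i1 \<le> J \<Longrightarrow> (\<Sum>n=1..cutoff J. (norm (vcoef i1 J L0 (g j) x n))\<^sup>2 / real n) \<le>
      C * exp (\<Sum>p\<in>pr J - pr i1. (norm (g j p + x p))\<^sup>2 / real p)"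
    show ?thesis unfolding TU_def by (intro exI[of _ C] conjI allI impI A)
  qed
  then obtain CU where TU: "\<And>j. j \<in> I \<Longrightarrow> TU j (CU j)" by metis
  have CU: "CU j > 0" "i1 \<le> J \<Longrightarrow> (\<Sum>n=1..cutoff J. (norm (vcoef i1 J L0 (g j) x n))\<^sup>2 / real n) \<le>
    CU j * exp (\<Sum>p\<in>pr J - pr i1. (norm (g j p + x p))\<^sup>2 / real p)" if "j \<in> I" for j J
    using TU[OF that] unfolding TU_def by blast+
  define KU where "KU = (\<lambda>j. 3 / 2 * s * CU j * exp (ce j))"
  have KU: "KU j > 0" if "j \<in> I" for j using CU(1)[OF that] s by (simp add: KU_def)
  define V where "V = (\<lambda>J j. vpoly i1 J L0 (g j) x)"
  define a where "a = (\<lambda>J. apoly i1 J L0 x)"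
  have U: "(LINT t|lborel. (norm (V J j (Complex y t)))\<^sup>2 * gw \<tau> \<Delta> t) \<le> KU j * \<Delta> * exp (e j * real J)"
    if j: "j \<in> I" and J: "i1 \<le> J" and \<Delta>: "exp (2 * 4 ^ J) \<le> \<Delta>" and y: "y \<ge> 1 / 2" for j J y \<tau> \<Delta>
  proof -
    have \<Delta>0: "\<Delta> > 0" using less_le_trans[OF exp_gt_zero \<Delta>] .
    have "(\<Sum>n=1..cutoff J. (norm (vcoef i1 J L0 (g j) x n))\<^sup>2 * real n powr (- 2 * y)) \<le>
        (\<Sum>n=1..cutoff J. (norm (vcoef i1 J L0 (g j) x n))\<^sup>2 / real n)"
    proof (rule sum_mono)
      fix n assume n: "n \<in> {1..cutoff J}"
      have "real n powr (- 2 * y) \<le> real n powr - 1" using y n by (intro powr_mono) auto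
      then have "(norm (vcoef i1 J L0 (g j) x n))\<^sup>2 * real n powr (- 2 * y) \<le> (norm (vcoef i1 J L0 (g j) x n))\<^sup>2 * real n powr - 1"
        by (intro mult_left_mono) auto
      then show "(norm (vcoef i1 J L0 (g j) x n))\<^sup>2 * real n powr (- 2 * y) \<le> (norm (vcoef i1 J L0 (g j) x n))\<^sup>2 / real n"
        by (simp add: powr_minus_divide)
    qed
    also have "\<dots> \<le> CU j * exp (\<Sum>p\<in>pr J - pr i1. (norm (g j p + x p))\<^sup>2 / real p)" by (rule CU(2)[OF j J])
    also have "\<dots> \<le> CU j * exp (e j * real J + ce j)" using CU(1)[OF j] ce[OF j, of J] by (intro mult_left_mono) auto
    finally have "3 / 2 * (s * \<Delta> * (\<Sum>n=1..cutoff J. (norm (vcoef i1 J L0 (g j) x n))\<^sup>2 * real n powr (- 2 * y))) \<le>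
        3 / 2 * (s * \<Delta> * (CU j * exp (e j * real J + ce j)))"
      using s \<Delta>0 by (intro mult_left_mono) auto
    also have "\<dots> = KU j * \<Delta> * exp (e j * real J)" by (simp add: KU_def exp_add)
    finally show ?thesis
      using vpoly_mean_upper[OF \<Delta>, of i1 L0 "g j" x y \<tau>] unfolding V_def s_def by linarith
  qed
  have L0D': "(1 / 2) ^ L0 * exp (k\<^sup>2 * (N * ln 4 + 2 * Cs j1)) \<le> 1 / 2"
    using L0D by (simp add: D_def Df_def N_def)
  define TL where "TL = (\<lambda>c0. c0 > 0 \<and> (\<forall>J \<delta>. i1 + h \<le> J \<longrightarrow> \<delta> \<ge> 0 \<longrightarrow>
    c0 * exp (- 2 * \<delta> * (4 * real L0 / 2 ^ h) * 4 ^ J) * exp (k\<^sup>2 * (N * ln 4) * real J) \<le>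
    (\<Sum>n=1..cutoff J. (norm (vcoef i1 J L0 (g j1) (\<lambda>p. of_real \<beta> * u p) n))\<^sup>2 * real n powr (- 2 * (1 / 2 + \<delta>)))))"
  have "\<exists>c0. TL c0"
  proof (rule second_moment_lower_exp[OF g(1-3)[OF I(2), folded u_def] m0 \<beta>(3) Cu uC \<theta>(2) i1(1) L0 \<kappa>1 L0D' h(1)[unfolded \<epsilon>_def]])
    fix c0 assume A: "c0 > 0" "\<And>J \<delta>. i1 + h \<le> J \<Longrightarrow> \<delta> \<ge> 0 \<Longrightarrow>
      c0 * exp (- 2 * \<delta> * (4 * real L0 / 2 ^ h) * 4 ^ J) * exp (k\<^sup>2 * (N * ln 4) * real J) \<le>
      (\<Sum>n=1..cutoff J. (norm (vcoef i1 J L0 (g j1) (\<lambda>p. of_real \<beta> * u p) n))\<^sup>2 * real n powr (- 2 * (1 / 2 + \<delta>)))"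
    show ?thesis unfolding TL_def by (intro exI[of _ c0] conjI allI impI A)
  qed
  then obtain c0 where TL: "TL c0" by blast
  have c0: "c0 > 0" "i1 + h \<le> J \<Longrightarrow> \<delta> \<ge> 0 \<Longrightarrow>
    c0 * exp (- 2 * \<delta> * \<epsilon> * 4 ^ J) * exp (k\<^sup>2 * \<Lambda> * real J) \<le>
    (\<Sum>n=1..cutoff J. (norm (vcoef i1 J L0 (g j1) x n))\<^sup>2 * real n powr (- 2 * (1 / 2 + \<delta>)))" for J \<delta>
    using TL unfolding TL_def \<epsilon>_def \<Lambda>_def x_def by blast+

  \<comment> \<open>Distance from the critical line and bounds on the right line\<close>
  define \<alpha> where "\<alpha> = ((1 / 4 :: real) ^ n) powr p"
  define \<gamma> where "\<gamma> = ((3 :: real) ^ n) powr p"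
  have \<alpha>\<gamma>: "\<alpha> > 0" "\<gamma> > 0" by (simp_all add: \<alpha>_def \<gamma>_def)
  define cW where "cW = 1 / 2 * s * c0"
  have cW: "cW > 0" using s c0 by (simp add: cW_def)
  define A1 where "A1 = \<alpha> * norm (b j1) powr p * cW"
  have A1: "A1 > 0" using \<alpha>\<gamma> b1 cW by (simp add: A1_def)
  define X where "X = \<gamma> * (\<Sum>j\<in>I. norm (b j) powr p * KU j)"
  have X: "X \<ge> 0" unfolding X_def using \<alpha>\<gamma> KU by (intro mult_nonneg_nonneg sum_nonneg) (auto intro: less_imp_le)
  \<comment> \<open>Large enough that \<open>X * exp (- 2 * \<rho> * Cc)\<close>, the damped mean
    value at 1/2, is at most half of the main term \<open>A1 * exp (- \<rho> * Cc)\<close>; the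
    remaining half is \<open>2 * c3\<close>.\<close>
  define Cc where "Cc = max 0 (ln ((2 * X + 1) / A1) / \<rho>)"
  define c3 where "c3 = A1 / 4 * exp (- \<rho> * Cc)"
  have c3: "c3 > 0" using A1 by (simp add: c3_def)
  have Cc0: "Cc \<ge> 0" by (simp add: Cc_def)
  have Cc: "A1 * exp (- \<rho> * Cc) - X * exp (- 2 * \<rho> * Cc) \<ge> 2 * c3"
  proof -
    have "ln ((2 * X + 1) / A1) / \<rho> \<le> Cc" by (simp add: Cc_def)
    then have l: "ln ((2 * X + 1) / A1) \<le> \<rho> * Cc" using \<rho> by (simp add: pos_divide_le_eq mult.commute)
    have "(2 * X + 1) / A1 > 0" using X A1 by simp
    then have "(2 * X + 1) / A1 = exp (ln ((2 * X + 1) / A1))" by simp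
    also have "\<dots> \<le> exp (\<rho> * Cc)" using l by simp
    finally have "(2 * X + 1) / A1 \<le> exp (\<rho> * Cc)" .
    then have "2 * X + 1 \<le> exp (\<rho> * Cc) * A1" using A1 by (simp add: field_simps)
    then have "(2 * X) * exp (- 2 * \<rho> * Cc) \<le> (exp (\<rho> * Cc) * A1) * exp (- 2 * \<rho> * Cc)"
      by (intro mult_right_mono) auto
    also have "\<dots> = A1 * (exp (\<rho> * Cc) * exp (- 2 * \<rho> * Cc))" by (simp only: mult_ac)
    also have "exp (\<rho> * Cc) * exp (- 2 * \<rho> * Cc) = exp (- \<rho> * Cc)" by (simp flip: exp_add)
    finally show ?thesis unfolding c3_def by linarith
  qed
  define \<delta> where "\<delta> = (\<lambda>J::nat. Cc / 4 ^ J)"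
  define Kj where "Kj = (\<lambda>j. Cg j * zconst * exp (\<beta> * C * zconst))"
  define K3 where "K3 = 3 ^ n * (\<Sum>j\<in>I. norm (b j) * Kj j ^ m)"
  define K4 where "K4 = 3 ^ n * (\<Sum>j\<in>I. norm (b j) * (real m * (2 * Kj j) ^ (m - 1) * Kj j))"
  have \<theta>': "\<theta> < 1 / 2" by (rule \<theta>(2))
  have Kj0: "Kj j \<ge> 0" if j: "j \<in> I" for j
  proof -
    have "Cg j \<ge> 0" using order_trans[OF norm_ge_zero Cg[OF j, of 1]] by simp
    moreover have "zconst \<ge> 0" unfolding zconst_def by (intro infsum_nonneg) auto
    ultimately show ?thesis by (simp add: Kj_def)
  qed
  have K4: "K4 \<ge> 0" unfolding K4_def using Kj0 by (intro mult_nonneg_nonneg sum_nonneg) auto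
  have right: "norm (\<Phi>0 z * a J z ^ m) \<le> K3"
    "norm (\<Phi>0 z * a J z ^ m - (1 - exp (1 - z)) ^ n * (\<Sum>j\<in>I. b j * V J j z ^ m)) \<le> exp (- (4 ^ J) / 4) * K4"
    if z: "Re z = \<sigma>2" and J: "i1 \<le> J" for z J
  proof -
    have z2: "Re z \<ge> 2" "Re z \<ge> 9 / 4" "Re z \<ge> 1 / 2" "z \<noteq> 1" using z \<sigma>2 by auto
    have Lz: "L j z = dseries (g j) z ^ m" if j: "j \<in> I" for j
    proof -
      have "((\<lambda>n. f j n / of_nat n powr z) has_sum L j z) {1..}" using \<sigma>2f[OF j] z by (intro \<sigma>f[OF j]) simp
      then have "L j z = (\<Sum>\<^sub>\<infinity>n\<in>{1..}. f j n / of_nat n powr z)" by (simp add: infsumI)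
      also have "\<dots> = dseries (dirichlet_power m (g j)) z"
        unfolding dseries_def by (intro infsum_cong) (use g(4)[OF j] in \<open>simp add: powr_minus_divide\<close>)
      also have "\<dots> = dseries (g j) z ^ m"
        by (intro dseries_dirichlet_power dsummable_bound[OF Cg[OF j] \<theta>' z2(1)]) auto
      finally show ?thesis .
    qed
    have eq: "\<Phi>0 z * a J z ^ m = (1 - exp (1 - z)) ^ n * (\<Sum>j\<in>I. b j * dseries (g j) z ^ m) * a J z ^ m"
      using z2 by (simp add: \<Phi>0 Lz)
    have w: "norm (1 - exp (1 - z)) \<le> 3" using z2 by (intro norm_one_minus_exp_le) auto
    have Ga: "norm (dseries (g j) z * a J z) \<le> Kj j" if j: "j \<in> I" for j
      unfolding norm_mult Kj_def a_def
      using norm_dseries_le[OF Cg[OF j] \<theta>' z2(1)] norm_apoly_le[OF xC _ \<theta>' z2(1) i1(1) J] \<beta> C0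
        order_trans[OF norm_ge_zero norm_dseries_le[OF Cg[OF j] \<theta>' z2(1)]]
      by (intro mult_mono) auto
    have Va: "norm (dseries (g j) z * a J z - V J j z) \<le> exp (- (4 ^ J) / 4) * Kj j" if j: "j \<in> I" for j
      unfolding Kj_def a_def V_def using \<beta> C0 by (intro apoly_approx[OF Cg[OF j] xC _ \<theta>' z2(2) i1(1) J]) auto
    show "norm (\<Phi>0 z * a J z ^ m) \<le> K3"
      unfolding eq K3_def by (rule right_line_approx(1)[OF w _ _ Ga Va]) auto
    show "norm (\<Phi>0 z * a J z ^ m - (1 - exp (1 - z)) ^ n * (\<Sum>j\<in>I. b j * V J j z ^ m)) \<le> exp (- (4 ^ J) / 4) * K4"
      unfolding eq K4_def by (rule right_line_approx(2)[OF w _ _ Ga Va]) auto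
  qed
  obtain K0 where K0: "\<And>z. Re z \<ge> 1 / 2 \<Longrightarrow> Re z \<le> \<sigma>2 \<Longrightarrow> norm (\<Phi>0 z) \<le> K0 * (1 + \<bar>Im z\<bar>) ^ M"
    using growth[of \<sigma>2] by auto
  define X1 where "X1 = \<alpha> * (\<Sum>j\<in>I - {j1}. norm (b j) powr p * KU j)"
  define K5 where "K5 = exp (\<sigma>2\<^sup>2 / 2) * (K3 powr p + K4 powr p) * s"
  \<comment> \<open>From here on the terms with \<open>j\<close> different from \<open>j1\<close>,
    smaller by the factor \<open>exp (- \<omega> * J)\<close>, and the contribution of the right
    line together use up at most one of the two \<open>c3\<close>.\<close>
  obtain J1 where J1: "\<And>J. J1 \<le> J \<Longrightarrow> X1 * exp ((k\<^sup>2 * \<Lambda> - \<omega>) * real J) + K5 \<le> c3 * exp (k\<^sup>2 * \<Lambda> * real J)"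
    using eventually_dominated[of \<omega> "k\<^sup>2 * \<Lambda>" c3 X1 K5] \<omega> k \<Lambda> c3 by auto
  \<comment> \<open>Ensures \<open>\<delta> J <= 1 / 4\<close>, where \<open>1 - exp (1 - s)\<close>
    is bounded away from 0.\<close>
  obtain J2 :: nat where J2: "4 * Cc < real J2" using reals_Archimedean2 by blast
  define KA where "KA = 3 / 2 * s * exp (2 * q + 5) * exp (k\<^sup>2 * Cs j1)"
  have KA: "KA > 0" using s by (simp add: KA_def)
  \<comment> \<open>With this weight Young's inequality gives the moment of \<open>a\<close> at most
    \<open>c3 / 4\<close>, half of the lower bound \<open>c3 / 2\<close> for the mixed mean value;
    both in units of \<open>\<Delta> * EJ\<close>.\<close>
  define \<xi> where "\<xi> = c3 / (4 * KA)"
  have \<xi>: "\<xi> > 0" using c3 KA by (simp add: \<xi>_def)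
  define c where "c = c3 / 4 / \<xi> powr (- (real m * k - 1))"
  \<comment> \<open>The first summand serves the moment of \<open>a\<close>, the 2 serves the mean
    squares of \<open>V\<close>.\<close>
  define A where "A = 8 * real Q * real L0 + 2"

  \<comment> \<open>The lower bound for given \<open>J\<close>, width and centre\<close>
  show thesis
  proof (rule that[of c A "J1 + J2 + i1 + h"])
    show "c > 0" using c3 \<xi> by (simp add: c_def)
    show "A \<ge> 1" by (simp add: A_def)
    fix J \<Delta> \<tau> assume J0: "J1 + J2 + i1 + h \<le> J" and \<Delta>: "exp (A * 4 ^ J) \<le> \<Delta>"
    have J: "J1 \<le> J" "J2 \<le> J" "i1 + h \<le> J" "i1 \<le> J" using J0 by auto
    have "8 * real Q * real L0 * 4 ^ J \<le> A * 4 ^ J" "2 * 4 ^ J \<le> A * 4 ^ J" "0 \<le> A * 4 ^ J"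
      by (intro mult_right_mono; simp add: A_def)+ (simp add: A_def)
    then have \<Delta>': "exp (8 * real Q * real L0 * 4 ^ J) \<le> \<Delta>" "exp (2 * 4 ^ J) \<le> \<Delta>" "1 \<le> \<Delta>"
      using order_trans[OF _ \<Delta>] by simp_all
    have \<Delta>0: "\<Delta> > 0" using \<Delta>' by linarith
    define EJ where "EJ = exp (k\<^sup>2 * \<Lambda> * real J)"
    have \<delta>0: "\<delta> J \<ge> 0" using Cc0 by (simp add: \<delta>_def)
    have \<delta>4: "\<delta> J \<le> 1 / 4"
    proof -
      have "4 * Cc \<le> 4 ^ J" using J2 J(2) real_le_power_4[of J] by linarith
      then show ?thesis by (simp add: \<delta>_def field_simps)
    qed
    have \<delta>J: "\<delta> J * 4 ^ J = Cc" by (simp add: \<delta>_def)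
    have int: "integrable lborel (\<lambda>t. (norm (V J j (Complex y t)))\<^sup>2 * gw \<tau> \<Delta> t)" for j y
      unfolding V_def by (rule vpoly_integrable[OF \<Delta>'(2)])
    have W: "cW * exp (- \<rho> * Cc) * \<Delta> * EJ \<le> (LINT t|lborel. (norm (V J j1 (Complex (1 / 2 + \<delta> J) t)))\<^sup>2 * gw \<tau> \<Delta> t)"
    proof -
      have "\<epsilon> * Cc * 2 \<le> \<rho> * Cc" using h(2) Cc0 mult_right_mono[of "2 * \<epsilon>" \<rho> Cc] by (simp add: mult_ac)
      moreover have E: "- 2 * \<delta> J * \<epsilon> * 4 ^ J = - (\<epsilon> * Cc * 2)" unfolding \<delta>J[symmetric] by simp
      ultimately have "exp (- \<rho> * Cc) \<le> exp (- 2 * \<delta> J * \<epsilon> * 4 ^ J)" unfolding E by simp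
      then have "c0 * exp (- \<rho> * Cc) * EJ \<le> c0 * exp (- 2 * \<delta> J * \<epsilon> * 4 ^ J) * EJ"
        using c0(1) by (intro mult_right_mono mult_left_mono) (auto simp: EJ_def)
      also have "\<dots> \<le> (\<Sum>n=1..cutoff J. (norm (vcoef i1 J L0 (g j1) x n))\<^sup>2 * real n powr (- 2 * (1 / 2 + \<delta> J)))"
        unfolding EJ_def by (rule c0(2)[OF J(3) \<delta>0])
      finally have "1 / 2 * (s * \<Delta> * (c0 * exp (- \<rho> * Cc) * EJ)) \<le>
          1 / 2 * (s * \<Delta> * (\<Sum>n=1..cutoff J. (norm (vcoef i1 J L0 (g j1) x n))\<^sup>2 * real n powr (- 2 * (1 / 2 + \<delta> J))))"
        using s \<Delta>0 by (intro mult_left_mono) auto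
      also have "\<dots> \<le> (LINT t|lborel. (norm (V J j1 (Complex (1 / 2 + \<delta> J) t)))\<^sup>2 * gw \<tau> \<Delta> t)"
        unfolding V_def s_def by (rule vpoly_mean_lower[OF \<Delta>'(2)])
      finally have "1 / 2 * (s * \<Delta> * (c0 * exp (- \<rho> * Cc) * EJ)) \<le> (LINT t|lborel. (norm (V J j1 (Complex (1 / 2 + \<delta> J) t)))\<^sup>2 * gw \<tau> \<Delta> t)" .
      moreover have "cW * exp (- \<rho> * Cc) * \<Delta> * EJ = 1 / 2 * (s * \<Delta> * (c0 * exp (- \<rho> * Cc) * EJ))" by (simp add: cW_def)
      ultimately show ?thesis by (simp only:)
    qed
    obtain Ka where Ka: "\<And>z. Re z \<ge> 0 \<Longrightarrow> norm (a J z) \<le> Ka" unfolding a_def using apoly_bounded[OF i1(1)] by blast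
    have "\<exists>K. \<forall>z. Re z \<ge> 0 \<longrightarrow> norm (V J j z) \<le> K" for j unfolding V_def using vpoly_bounded by metis
    then obtain Kv where Kv: "\<And>j z. Re z \<ge> 0 \<Longrightarrow> norm (V J j z) \<le> Kv j" by metis
    have anaa: "a J analytic_on UNIV" and anaV: "\<And>j. V J j analytic_on UNIV"
      unfolding a_def V_def by (intro analytic_apoly i1 analytic_vpoly)+
    define I\<Phi> where "I\<Phi> = (LINT t|lborel. norm (\<Phi>0 (Complex (1 / 2) t) * a J (Complex (1 / 2) t) ^ m) powr p * gw \<tau> \<Delta> t)"
    have \<sigma>1: "\<sigma>2 \<ge> 1" using \<sigma>2 by simp
    define S1 where "S1 = (\<Sum>j\<in>I - {j1}. norm (b j) powr p * (KU j * \<Delta> * exp (e j * real J)))"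
    define S2 where "S2 = (\<Sum>j\<in>I. norm (b j) powr p * (KU j * \<Delta> * exp (e j * real J)))"
    note transfer = transfer_lower_bound[where V = "V J" and a = "a J" and I = I and ?j1.0 = j1 and b = b and ?\<Phi>0.0 = \<Phi>0 and
        U = "\<lambda>j. KU j * \<Delta> * exp (e j * real J)" and n = n and m = m and J = J and M = M and \<tau> = \<tau> and \<Delta> = \<Delta> and
        \<delta> = "\<delta> J" and ?\<sigma>2.0 = \<sigma>2 and ?K0.0 = K0 and Ka = Ka and Kv = Kv and ?K3.0 = K3 and ?K4.0 = K4,
        OF I m2 ana anaa anaV K0 Ka Kv right(1)[OF _ J(4)] right(2)[OF _ J(4)] int U[OF _ J(4) \<Delta>'(2)] W \<Delta>'(3) \<delta>0 \<delta>4 \<sigma>1 K4]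
    have T: "\<alpha> * (norm (b j1) powr p * (cW * exp (- \<rho> * Cc) * \<Delta> * EJ) - S1) \<le>
        2 * I\<Phi> + exp (- (p * 4 ^ J / (4 * \<sigma>2)) * \<delta> J) * (\<gamma> * S2) +
        exp (\<sigma>2\<^sup>2 / 2) * (K3 powr p + K4 powr p) * (s * \<Delta>)"
      unfolding \<alpha>_def \<gamma>_def I\<Phi>_def s_def S1_def S2_def p_def by (rule transfer(1))
    have TI: "integrable lborel (\<lambda>t. norm (\<Phi>0 (Complex (1 / 2) t) * a J (Complex (1 / 2) t) ^ m) powr (2 / real m) * gw \<tau> \<Delta> t)"
      by (rule transfer(2))
    \<comment> \<open>For an upper bound all exponents \<open>e j\<close> may be replaced by the
      largest one, \<open>k^2 * \<Lambda>\<close>.\<close>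
    have S2: "\<gamma> * S2 \<le> X * (\<Delta> * EJ)"
    proof -
      have "S2 \<le> (\<Sum>j\<in>I. norm (b j) powr p * (KU j * \<Delta> * EJ))"
        unfolding S2_def
      proof (intro sum_mono mult_left_mono)
        fix j assume j: "j \<in> I"
        show "exp (e j * real J) \<le> EJ" using \<omega> by (simp add: e_def EJ_def mult_right_mono)
        show "0 \<le> KU j * \<Delta>" using KU[OF j] \<Delta>0 by simp
      qed auto
      then have "\<gamma> * S2 \<le> \<gamma> * (\<Sum>j\<in>I. norm (b j) powr p * (KU j * \<Delta> * EJ))"
        using \<alpha>\<gamma> by (intro mult_left_mono) auto
      also have "\<dots> = X * (\<Delta> * EJ)" by (simp add: X_def sum_distrib_left sum_distrib_right mult_ac)
      finally show ?thesis .
    qed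
    have S20: "0 \<le> \<gamma> * S2"
      unfolding S2_def using \<alpha>\<gamma> KU \<Delta>0 by (intro mult_nonneg_nonneg sum_nonneg) (auto intro: less_imp_le)
    have "p * 4 ^ J / (4 * \<sigma>2) * \<delta> J = 2 * \<rho> * (\<delta> J * 4 ^ J)" using \<sigma>2 by (simp add: \<rho>_def field_simps)
    then have "exp (- (p * 4 ^ J / (4 * \<sigma>2)) * \<delta> J) = exp (- 2 * \<rho> * Cc)" unfolding \<delta>J by simp
    then have t2: "exp (- (p * 4 ^ J / (4 * \<sigma>2)) * \<delta> J) * (\<gamma> * S2) \<le> exp (- 2 * \<rho> * Cc) * (X * (\<Delta> * EJ))"
      using S2 by (simp add: mult_left_mono)
    have t3: "\<alpha> * S1 = X1 * exp ((k\<^sup>2 * \<Lambda> - \<omega>) * real J) * \<Delta>"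
      unfolding S1_def X1_def sum_distrib_left sum_distrib_right by (intro sum.cong refl) (auto simp: e_def)
    have t4: "exp (\<sigma>2\<^sup>2 / 2) * (K3 powr p + K4 powr p) * (s * \<Delta>) = K5 * \<Delta>" by (simp add: K5_def)
    have t5: "X1 * exp ((k\<^sup>2 * \<Lambda> - \<omega>) * real J) * \<Delta> + K5 * \<Delta> \<le> c3 * (\<Delta> * EJ)"
    proof -
      have "(X1 * exp ((k\<^sup>2 * \<Lambda> - \<omega>) * real J) + K5) * \<Delta> \<le> (c3 * EJ) * \<Delta>"
        unfolding EJ_def using \<Delta>0 by (intro mult_right_mono J1[OF J(1)]) auto
      moreover have "(c3 * EJ) * \<Delta> = c3 * (\<Delta> * EJ)" by simp
      ultimately show ?thesis unfolding distrib_right by linarith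
    qed
    have "2 * c3 * (\<Delta> * EJ) \<le> (A1 * exp (- \<rho> * Cc) - X * exp (- 2 * \<rho> * Cc)) * (\<Delta> * EJ)"
      using \<Delta>0 by (intro mult_right_mono Cc) (auto simp: EJ_def)
    moreover have "(A1 * exp (- \<rho> * Cc) - X * exp (- 2 * \<rho> * Cc)) * (\<Delta> * EJ) =
        A1 * exp (- \<rho> * Cc) * (\<Delta> * EJ) - exp (- 2 * \<rho> * Cc) * (X * (\<Delta> * EJ))"
      unfolding left_diff_distrib by simp
    ultimately have t6: "2 * (c3 * (\<Delta> * EJ)) \<le> A1 * exp (- \<rho> * Cc) * (\<Delta> * EJ) - exp (- 2 * \<rho> * Cc) * (X * (\<Delta> * EJ))"
      by (simp only: mult.assoc)
    have t7: "\<alpha> * (norm (b j1) powr p * (cW * exp (- \<rho> * Cc) * \<Delta> * EJ)) = A1 * exp (- \<rho> * Cc) * (\<Delta> * EJ)" by (simp add: A1_def)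
    have I\<Phi>: "c3 * (\<Delta> * EJ) \<le> 2 * I\<Phi>"
      using T t2 t5 t6 unfolding right_diff_distrib t3 t4 t7 by linarith
    define B where "B = (LINT t|lborel. norm (\<Phi>0 (Complex (1 / 2) t)) powr (2 * k) * gw \<tau> \<Delta> t)"
    define AA where "AA = (LINT t|lborel. norm (a J (Complex (1 / 2) t)) powr (2 * q) * gw \<tau> \<Delta> t)"
    have int\<Phi>0: "integrable lborel (\<lambda>t. norm (\<Phi>0 (Complex (1 / 2) t)) powr (2 * k) * gw \<tau> \<Delta> t)"
    proof -
      have sub: "\<Phi>0 analytic_on {z. 1 / 2 \<le> Re z \<and> Re z \<le> \<sigma>2}" by (rule analytic_on_subset[OF ana]) auto
      show ?thesis by (rule strip_gw_integrable[OF sub _ _ _ K0 \<Delta>'(3)]) (use \<sigma>2 k in auto)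
    qed
    have AA: "AA \<le> KA * (\<Delta> * EJ)" and intA: "integrable lborel (\<lambda>t. norm (a J (Complex (1 / 2) t)) powr (2 * q) * gw \<tau> \<Delta> t)"
    proof -
      have mom: "AA \<le> 3 / 2 * sqrt (2 * pi) * exp (2 * q + 5) * \<Delta> * exp (k\<^sup>2 * (\<Sum>p\<in>pr J - pr i1. (norm (u p))\<^sup>2 / real p))"
        "integrable lborel (\<lambda>t. norm (a J (Complex (1 / 2) t)) powr (2 * q) * gw \<tau> \<Delta> t)"
        unfolding AA_def a_def x_def
        by (rule apoly_moment[OF less_imp_le[OF \<beta>(1)] \<beta>(2) q Q Df[OF I(2), folded u_def] i1(1) L0 L0Q J(4) \<Delta>'(1)],
          rule apoly_moment_integrable[OF less_imp_le[OF \<beta>(1)] \<beta>(2) q Q Df[OF I(2), folded u_def] i1(1) L0 L0Q J(4) \<Delta>'(1)])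
      show "integrable lborel (\<lambda>t. norm (a J (Complex (1 / 2) t)) powr (2 * q) * gw \<tau> \<Delta> t)" by (rule mom)
      have "(\<Sum>p\<in>pr J - pr i1. (norm (u p))\<^sup>2 / real p) \<le> (\<Sum>p\<in>pr J. (norm (u p))\<^sup>2 / real p)"
        by (intro sum_mono2 finite_pr) auto
      also have "\<dots> \<le> \<Lambda> * real J + Cs j1" using Cu[of J] by (simp add: \<Lambda>_def abs_le_iff algebra_simps)
      finally have "k\<^sup>2 * (\<Sum>p\<in>pr J - pr i1. (norm (u p))\<^sup>2 / real p) \<le> k\<^sup>2 * (\<Lambda> * real J + Cs j1)" by (intro mult_left_mono) auto
      then have "exp (k\<^sup>2 * (\<Sum>p\<in>pr J - pr i1. (norm (u p))\<^sup>2 / real p)) \<le> EJ * exp (k\<^sup>2 * Cs j1)"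
        by (simp add: EJ_def distrib_left mult.assoc flip: exp_add)
      then have "s * exp (2 * q + 5) * \<Delta> * exp (k\<^sup>2 * (\<Sum>p\<in>pr J - pr i1. (norm (u p))\<^sup>2 / real p)) \<le>
          s * exp (2 * q + 5) * \<Delta> * (EJ * exp (k\<^sup>2 * Cs j1))"
        using s \<Delta>0 by (intro mult_left_mono) auto
      then have "3 / 2 * (s * exp (2 * q + 5) * \<Delta> * exp (k\<^sup>2 * (\<Sum>p\<in>pr J - pr i1. (norm (u p))\<^sup>2 / real p))) \<le>
          3 / 2 * (s * exp (2 * q + 5) * \<Delta> * (EJ * exp (k\<^sup>2 * Cs j1)))" by (rule mult_left_mono) simp
      also have "\<dots> = KA * (\<Delta> * EJ)" by (simp add: KA_def)
      finally show "AA \<le> KA * (\<Delta> * EJ)" using mom(1) unfolding s_def[symmetric] by (simp only: mult.assoc)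
    qed
    \<comment> \<open>The mixed mean value is at least \<open>c3 / 2\<close> in units of
      \<open>\<Delta> * EJ\<close>; half of it is absorbed by the moment of \<open>a\<close>, and
      the rest must come from \<open>\<Phi>0\<close> alone.\<close>
    have "I\<Phi> \<le> \<xi> powr (- (real m * k - 1)) * B + \<xi> * AA"
      unfolding I\<Phi>_def B_def AA_def p_def
      by (rule young_integral[OF m0 mk q(1)[unfolded \<beta>_def] \<xi> TI int\<Phi>0 intA])
    also have "\<xi> * AA \<le> \<xi> * (KA * (\<Delta> * EJ))" using \<xi> AA by (intro mult_left_mono) auto
    also have "\<xi> * (KA * (\<Delta> * EJ)) = c3 / 4 * (\<Delta> * EJ)" using KA by (simp add: \<xi>_def)
    finally have "c3 / 4 * (\<Delta> * EJ) \<le> \<xi> powr (- (real m * k - 1)) * B" using I\<Phi> by simp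
    then have "c * (\<Delta> * EJ) \<le> B" using \<xi> by (simp add: c_def field_simps)
    then show "c * \<Delta> * exp (k\<^sup>2 * (Nj j1 * ln 4) * real J) \<le> (LINT t|lborel. norm (\<Phi>0 (Complex (1 / 2) t)) powr (2 * k) * gw \<tau> \<Delta> t)"
      by (simp add: B_def EJ_def \<Lambda>_def N_def)
  qed
qed

subsection \<open>Removal of the smoothing\<close>

lemma gw_commute: "gw \<tau> \<Delta> t = gw t \<Delta> \<tau>"
  by (simp add: gw_def power2_commute)

text \<open>Outside \<open>[T, 2T]\<close> the distance \<open>y\<close> from the centre is at least
  \<open>T / 4\<close>, so \<open>\<bar>t\<bar> <= 8 * y\<close>. Half of the Gaussian exponent
  gives \<open>exp (- y / 16)\<close> and defeats the polynomial; the other half is the Gaussian of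
  width \<open>sqrt (2 * T)\<close>, still integrable. The 128 is \<open>8 * 16\<close>.\<close>

lemma gw_tail_bound:
  assumes T: "T > 0" and \<tau>: "5 / 4 * T \<le> \<tau>" "\<tau> \<le> 7 / 4 * T" and t: "t \<notin> {T..2 * T}"
  shows "(1 + \<bar>t\<bar>) ^ M * gw \<tau> (sqrt T) t \<le> 128 ^ M * fact M * exp (1 / 128) * gw \<tau> (sqrt (2 * T)) t"
proof -
  define y where "y = \<bar>t - \<tau>\<bar>"
  have y: "T \<le> 4 * y" using T \<tau> t unfolding y_def by auto
  have "\<bar>t\<bar> \<le> y + \<tau>" using \<tau> T unfolding y_def by (auto simp: abs_if)
  then have ty: "\<bar>t\<bar> \<le> 8 * y" using y \<tau> by linarith
  have y0: "y \<ge> 0" by (simp add: y_def)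
  define G where "G = exp (- y\<^sup>2 / (4 * T))"
  have sq: "(t - \<tau>)\<^sup>2 = y\<^sup>2" by (simp add: y_def)
  have g1: "gw \<tau> (sqrt T) t = G * G" using T by (simp add: gw_def sq G_def flip: exp_add)
  have g2: "gw \<tau> (sqrt (2 * T)) t = G" using T by (simp add: gw_def sq G_def)
  have "T * y \<le> (4 * y) * y" using y y0 by (intro mult_right_mono) auto
  then have "y / 16 \<le> y\<^sup>2 / (4 * T)" using T by (simp add: field_simps power2_eq_square)
  then have G: "G \<le> exp (- (y / 16))" unfolding G_def by simp
  define z where "z = (1 + 8 * y) / 128"
  have z: "z \<ge> 0" using y0 by (simp add: z_def)
  have "(1 + \<bar>t\<bar>) ^ M \<le> (128 * z) ^ M" using ty unfolding z_def by (intro power_mono) auto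
  also have "\<dots> = 128 ^ M * z ^ M" by (rule power_mult_distrib)
  also have "\<dots> \<le> 128 ^ M * (fact M * exp z)" by (intro mult_left_mono power_le_fact_exp z) auto
  finally have "(1 + \<bar>t\<bar>) ^ M * G \<le> 128 ^ M * (fact M * exp z) * exp (- (y / 16))"
    using G by (intro mult_mono) (auto simp: G_def)
  also have "\<dots> = 128 ^ M * fact M * (exp z * exp (- (y / 16)))" by simp
  also have "exp z * exp (- (y / 16)) = exp (1 / 128)" by (simp add: z_def field_simps flip: exp_add)
  finally have "(1 + \<bar>t\<bar>) ^ M * G * G \<le> 128 ^ M * fact M * exp (1 / 128) * G"
    by (rule mult_right_mono) (simp add: G_def)
  then show ?thesis unfolding g1 g2 by (simp only: mult.assoc)
qed

lemma real_powr_at_top: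
  fixes E :: real
  assumes "E > 0"
  shows "filterlim (\<lambda>x. x powr E) at_top at_top"
  unfolding filterlim_at_top
proof
  fix Z :: real
  show "\<forall>\<^sub>F x in at_top. Z \<le> x powr E"
    using eventually_ge_at_top[of "max 1 (max 0 Z powr (1 / E))"]
  proof (rule eventually_mono)
    fix x assume x: "max 1 (max 0 Z powr (1 / E)) \<le> x"
    then have "(max 0 Z powr (1 / E)) powr E \<le> x powr E" using assms by (intro powr_mono2) auto
    then show "Z \<le> x powr E" using assms by (simp add: powr_powr split: if_splits)
  qed
qed

text \<open>The width is \<open>sqrt T\<close>, so Gaussians centred in the middle half of
  \<open>[T, 2T]\<close> have negligible mass outside. Averaging over the centre gives back at most
  the mass of the Gaussian at every \<open>t\<close>, and the factor \<open>\<Delta>\<close>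
  cancels. The positivity of \<open>E\<close> makes the main term outgrow the bounded tail
  contribution.\<close>

lemma unsmoothing:
  fixes H :: "real \<Rightarrow> real" and c A E K :: real and M J0 :: nat
  assumes H: "continuous_on UNIV H" "\<And>t. 0 \<le> H t" "\<And>t. H t \<le> K * (1 + \<bar>t\<bar>) ^ M"
    and c: "c > 0" and A: "A \<ge> 1" and E: "E > 0"
    and lower: "\<And>J \<Delta> \<tau>. J0 \<le> J \<Longrightarrow> exp (A * 4 ^ J) \<le> \<Delta> \<Longrightarrow>
      c * \<Delta> * exp (E * ln 4 * real J) \<le> (LINT t|lborel. H t * gw \<tau> \<Delta> t)"
  obtains c' where "c' > 0" "\<forall>\<^sub>F T in at_top. c' * T * ln T powr E \<le> integral {T..2 * T} H"
proof -
  have K: "K \<ge> 0" using order_trans[OF H(2) H(3), of 0] by simp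
  define KT where "KT = K * (128 ^ M * fact M * exp (1 / 128))"
  define s where "s = sqrt (2 * pi)"
  have s: "s > 0" by (simp add: s_def)
  \<comment> \<open>The factor \<open>(1 / (8 * A)) powr E\<close> comes from
    \<open>4 ^ J >= ln T / (8 * A)\<close>, the loss in rounding to a power of 4.\<close>
  define c1 where "c1 = c * (1 / (8 * A)) powr E"
  have c1: "c1 > 0" using c A by (simp add: c1_def)
  define c' where "c' = c1 / (4 * s)"
  have ev: "\<forall>\<^sub>F T::real in at_top. T > 1 \<and> 2 * A * 4 ^ J0 \<le> ln T \<and> KT * (s * sqrt 2) \<le> c1 / 2 * ln T powr E"
  proof (intro eventually_conj)
    have ln: "filterlim (ln :: real \<Rightarrow> real) at_top at_top" by (rule ln_at_top)
    show "\<forall>\<^sub>F T::real in at_top. 2 * A * 4 ^ J0 \<le> ln T" using ln by (auto simp: filterlim_at_top)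
    have "filterlim (\<lambda>T. ln T powr E) at_top at_top"
      using E by (intro filterlim_compose[OF real_powr_at_top ln]) auto
    then have "\<forall>\<^sub>F T in at_top. KT * (s * sqrt 2) / (c1 / 2) \<le> ln T powr E" by (simp add: filterlim_at_top)
    then show "\<forall>\<^sub>F T in at_top. KT * (s * sqrt 2) \<le> c1 / 2 * ln T powr E"
      using c1 by (auto elim!: eventually_mono simp: field_simps)
  qed (rule eventually_gt_at_top)
  show ?thesis
  proof (rule that[of c'])
    show "c' > 0" using c1 s by (simp add: c'_def)
    show "\<forall>\<^sub>F T in at_top. c' * T * ln T powr E \<le> integral {T..2 * T} H"
      using ev
    proof (rule eventually_mono)
      fix T :: real assume T: "T > 1 \<and> 2 * A * 4 ^ J0 \<le> ln T \<and> KT * (s * sqrt 2) \<le> c1 / 2 * ln T powr E"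
      \<comment> \<open>\<open>J\<close> is the largest integer with \<open>4 ^ J <= w\<close>, and
        \<open>A * w = ln (sqrt T)\<close>, so \<open>exp (A * 4 ^ J)\<close> does not exceed the
        width.\<close>
      define w where "w = ln T / (2 * A)"
      have w: "4 ^ J0 \<le> w" using T A by (simp add: w_def field_simps)
      have w1: "1 \<le> w" using w one_le_power[of "4::real" J0] by linarith
      define J where "J = nat \<lfloor>log 4 w\<rfloor>"
      have l0: "log 4 w \<ge> 0" using w1 by simp
      have Jr: "real J \<le> log 4 w" "log 4 w < real J + 1" using l0 by (auto simp: J_def)
      have "4 powr real J \<le> 4 powr log 4 w" "4 powr log 4 w < 4 powr (real J + 1)" using Jr by simp_all
      then have J4: "4 ^ J \<le> w" "w < 4 * 4 ^ J" using w1 by (simp_all add: powr_realpow powr_add)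
      have J0: "J0 \<le> J"
      proof -
        have "(4::real) ^ J0 < 4 ^ Suc J" using w J4 by simp
        then show ?thesis by (simp only: power_strict_increasing_iff)
      qed
      define \<Delta> where "\<Delta> = sqrt T"
      have \<Delta>0: "\<Delta> > 0" using T by (simp add: \<Delta>_def)
      have \<Delta>: "exp (A * 4 ^ J) \<le> \<Delta>"
      proof -
        have "A * 4 ^ J \<le> A * w" using J4 A by (intro mult_left_mono) auto
        also have "\<dots> = ln \<Delta>" using A T by (simp add: w_def \<Delta>_def ln_sqrt)
        finally have "exp (A * 4 ^ J) \<le> exp (ln \<Delta>)" by simp
        then show ?thesis using \<Delta>0 by simp
      qed
      define l where "l = ln T powr E"
      have cl: "c1 * l \<le> c * exp (E * ln 4 * real J)"
      proof -
        have "ln T / (8 * A) \<le> 4 ^ J" using J4(2) A by (simp add: w_def field_simps)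
        then have "(ln T / (8 * A)) powr E \<le> (4 ^ J) powr E" using E A T by (intro powr_mono2) auto
        also have "(4 ^ J) powr E = exp (E * ln 4 * real J)" by (simp add: powr_def ln_realpow mult_ac)
        finally have "(1 / (8 * A)) powr E * l \<le> exp (E * ln 4 * real J)"
          using A T by (simp add: l_def powr_divide)
        then show ?thesis using c by (simp add: c1_def mult.assoc)
      qed
      have contH: "continuous_on S H" for S using H(1) by (rule continuous_on_subset) auto
      \<comment> \<open>The part outside \<open>[T, 2T]\<close> is at most
        \<open>KT * s * sqrt 2\<close> times \<open>\<Delta>\<close>, and for large \<open>T\<close>
        this is half of the lower bound.\<close>
      have local: "c1 / 2 * l * \<Delta> \<le> integral {T..2 * T} (\<lambda>t. H t * gw \<tau> \<Delta> t)" if \<tau>: "\<tau> \<in> {5/4*T..7/4*T}" for \<tau>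
      proof -
        have set_int: "set_integrable lborel {T..2 * T} (\<lambda>t. H t * gw \<tau> \<Delta> t)"
          by (intro borel_integrable_atLeastAtMost' continuous_intros contH)
        have gi: "integrable lborel (gw \<tau> (sqrt (2 * T)))" using T by (intro gw_integrable) simp
        have "(LINT t|lborel. H t * gw \<tau> \<Delta> t) \<le> (LINT t|lborel. indicator {T..2 * T} t *\<^sub>R (H t * gw \<tau> \<Delta> t) + KT * gw \<tau> (sqrt (2 * T)) t)"
        proof (rule integral_mono')
          show "integrable lborel (\<lambda>t. indicator {T..2 * T} t *\<^sub>R (H t * gw \<tau> \<Delta> t) + KT * gw \<tau> (sqrt (2 * T)) t)"
            using set_int gi unfolding set_integrable_def by (intro Bochner_Integration.integrable_add integrable_mult_right)
          fix t
          show "0 \<le> indicator {T..2 * T} t *\<^sub>R (H t * gw \<tau> \<Delta> t) + KT * gw \<tau> (sqrt (2 * T)) t"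
            using H(2)[of t] K gw_pos[of \<tau> \<Delta> t] gw_pos[of \<tau> "sqrt (2 * T)" t] by (auto simp: KT_def indicator_def)
          show "H t * gw \<tau> \<Delta> t \<le> indicator {T..2 * T} t *\<^sub>R (H t * gw \<tau> \<Delta> t) + KT * gw \<tau> (sqrt (2 * T)) t"
          proof (cases "t \<in> {T..2 * T}")
            case True
            then show ?thesis using K gw_pos[of \<tau> "sqrt (2 * T)" t] by (simp add: KT_def)
          next
            case False
            have "H t * gw \<tau> \<Delta> t \<le> (K * (1 + \<bar>t\<bar>) ^ M) * gw \<tau> \<Delta> t"
              using H(3)[of t] gw_pos[of \<tau> \<Delta> t] by (intro mult_right_mono) auto
            also have "\<dots> = K * ((1 + \<bar>t\<bar>) ^ M * gw \<tau> (sqrt T) t)" by (simp add: \<Delta>_def)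
            also have "\<dots> \<le> K * (128 ^ M * fact M * exp (1 / 128) * gw \<tau> (sqrt (2 * T)) t)"
              using False \<tau> T K by (intro mult_left_mono gw_tail_bound) auto
            finally show ?thesis using False by (simp add: KT_def mult_ac)
          qed
        qed
        also have "\<dots> = (LINT t:{T..2 * T}|lborel. H t * gw \<tau> \<Delta> t) + KT * (s * sqrt (2 * T))"
          using set_int gi gw_integral[of "sqrt (2 * T)" \<tau>] T
          unfolding set_integrable_def set_lebesgue_integral_def
          by (subst Bochner_Integration.integral_add) (auto simp: s_def)
        also have "(LINT t:{T..2 * T}|lborel. H t * gw \<tau> \<Delta> t) = integral {T..2 * T} (\<lambda>t. H t * gw \<tau> \<Delta> t)"
          by (rule set_borel_integral_eq_integral(2)[OF set_int])
        finally have 1: "(LINT t|lborel. H t * gw \<tau> \<Delta> t) \<le> integral {T..2 * T} (\<lambda>t. H t * gw \<tau> \<Delta> t) + KT * (s * sqrt (2 * T))" .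
        have "(c1 * l) * \<Delta> \<le> (c * exp (E * ln 4 * real J)) * \<Delta>" using cl \<Delta>0 by (intro mult_right_mono) auto
        also have "\<dots> = c * \<Delta> * exp (E * ln 4 * real J)" by simp
        also have "\<dots> \<le> (LINT t|lborel. H t * gw \<tau> \<Delta> t)" by (rule lower[OF J0 \<Delta>])
        finally have 2: "c1 * l * \<Delta> \<le> (LINT t|lborel. H t * gw \<tau> \<Delta> t)" .
        have "KT * (s * sqrt (2 * T)) = (KT * (s * sqrt 2)) * \<Delta>" by (simp add: \<Delta>_def real_sqrt_mult)
        also have "\<dots> \<le> (c1 / 2 * l) * \<Delta>" using T \<Delta>0 unfolding l_def by (intro mult_right_mono) auto
        finally show ?thesis using 1 2 by (simp add: algebra_simps)
      qed
      let ?f = "\<lambda>\<tau> t. H t * gw \<tau> \<Delta> t"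
      have cont2: "continuous_on (cbox (5/4*T, T) (7/4*T, 2 * T)) (\<lambda>(\<tau>, t). ?f \<tau> t)"
        unfolding case_prod_beta
        by (intro continuous_intros continuous_on_compose2[OF H(1)]) auto
      have swap: "integral {5/4*T..7/4*T} (\<lambda>\<tau>. integral {T..2*T} (?f \<tau>)) = integral {T..2*T} (\<lambda>t. integral {5/4*T..7/4*T} (\<lambda>\<tau>. ?f \<tau> t))"
        using integral_swap_continuous[OF cont2] by (simp only: box_real)
      have intg1: "(\<lambda>\<tau>. integral {T..2*T} (?f \<tau>)) integrable_on {5/4*T..7/4*T}"
        and intg2: "(\<lambda>t. integral {5/4*T..7/4*T} (\<lambda>\<tau>. ?f \<tau> t)) integrable_on {T..2*T}"
      proof -
        have "continuous_on (cbox (5/4*T) (7/4*T)) (\<lambda>\<tau>. integral (cbox T (2*T)) (?f \<tau>))"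
          by (rule integral_continuous_on_param) (use cont2 in \<open>simp add: cbox_Pair_eq\<close>)
        then show "(\<lambda>\<tau>. integral {T..2*T} (?f \<tau>)) integrable_on {5/4*T..7/4*T}"
          by (intro integrable_continuous_real) (simp only: box_real)
        have "continuous_on (cbox T (2*T) \<times> cbox (5/4*T) (7/4*T)) (\<lambda>(t, \<tau>). ?f \<tau> t)"
          unfolding case_prod_beta by (intro continuous_intros continuous_on_compose2[OF H(1)]) auto
        then have "continuous_on (cbox T (2*T)) (\<lambda>t. integral (cbox (5/4*T) (7/4*T)) (\<lambda>\<tau>. ?f \<tau> t))"
          by (rule integral_continuous_on_param)
        then show "(\<lambda>t. integral {5/4*T..7/4*T} (\<lambda>\<tau>. ?f \<tau> t)) integrable_on {T..2*T}"
          by (intro integrable_continuous_real) (simp only: box_real)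
      qed
      \<comment> \<open>The interval of centres has length \<open>T / 2\<close>; together with the
        mass \<open>s * \<Delta>\<close> this explains \<open>c' = c1 / (4 * s)\<close>.\<close>
      have "c1 / 2 * l * \<Delta> * (T / 2) = integral {5/4*T..7/4*T} (\<lambda>\<tau>. c1 / 2 * l * \<Delta>)" using T by simp
      also have "\<dots> \<le> integral {5/4*T..7/4*T} (\<lambda>\<tau>. integral {T..2*T} (?f \<tau>))"
        by (intro integral_le intg1 local) auto
      also note swap
      also have "integral {T..2*T} (\<lambda>t. integral {5/4*T..7/4*T} (\<lambda>\<tau>. ?f \<tau> t)) \<le> integral {T..2*T} (\<lambda>t. H t * (s * \<Delta>))"
      proof (intro integral_le intg2 integrable_continuous_real continuous_intros contH)
        fix t
        have si: "set_integrable lborel {5/4*T..7/4*T} (gw t \<Delta>)"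
          by (intro borel_integrable_atLeastAtMost' continuous_intros)
        have "integral {5/4*T..7/4*T} (gw t \<Delta>) = (LINT \<tau>:{5/4*T..7/4*T}|lborel. gw t \<Delta> \<tau>)"
          by (rule set_borel_integral_eq_integral(2)[OF si, symmetric])
        also have "\<dots> \<le> (LINT \<tau>|lborel. gw t \<Delta> \<tau>)"
          unfolding set_lebesgue_integral_def using gw_integrable[OF \<Delta>0] gw_pos[of t \<Delta>]
          by (intro integral_mono') (auto simp: indicator_def less_imp_le)
        also have "\<dots> = s * \<Delta>" using gw_integral[OF \<Delta>0] by (simp add: s_def)
        finally have "H t * integral {5/4*T..7/4*T} (gw t \<Delta>) \<le> H t * (s * \<Delta>)" using H(2) by (intro mult_left_mono)
        then show "integral {5/4*T..7/4*T} (\<lambda>\<tau>. ?f \<tau> t) \<le> H t * (s * \<Delta>)"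
          by (simp add: gw_commute[of _ \<Delta> t])
      qed
      also have "\<dots> = integral {T..2*T} H * (s * \<Delta>)" by simp
      finally have "(c1 / 4 * l * T) * \<Delta> \<le> (integral {T..2*T} H * s) * \<Delta>" by (simp add: mult_ac)
      then have "c1 / 4 * l * T \<le> integral {T..2*T} H * s" using \<Delta>0 by simp
      then show "c' * T * ln T powr E \<le> integral {T..2 * T} H"
        using s by (simp add: c'_def l_def field_simps)
    qed
  qed
qed

theorem theorem12:
  fixes d :: nat
    and f :: "nat \<Rightarrow> nat \<Rightarrow> complex"
    and L :: "nat \<Rightarrow> complex \<Rightarrow> complex"
    and \<theta> B k :: real
    and Nj :: "nat \<Rightarrow> real"
    and b :: "nat \<Rightarrow> complex"
  assumes "d \<ge> 1"
    and "\<And>j. j \<in> {1..d} \<Longrightarrow> multiplicative (f j)"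
    and "\<And>j. j \<in> {1..d} \<Longrightarrow> \<exists>n\<ge>1. f j n \<noteq> 0"
    and "0 < \<theta>" "\<theta> < 1/2"
    and "\<And>j r. j \<in> {1..d} \<Longrightarrow> r \<ge> 1 \<Longrightarrow>
           \<exists>C. \<forall>n\<ge>1. norm (dirichlet_root r (f j) n) \<le> C * real n powr \<theta>"
    and "\<And>j r. j \<in> {1..d} \<Longrightarrow> r \<ge> 1 \<Longrightarrow>
           (\<lambda>(p, m). (norm (dirichlet_root r (f j) (p ^ m)))\<^sup>2 / real p ^ m)
             summable_on ({p. prime p} \<times> {2..})"
    and "\<And>j. j \<in> {1..d} \<Longrightarrow> Nj j > 0"
    and "\<And>j. j \<in> {1..d} \<Longrightarrow>
           (\<lambda>x::real. (\<Sum>p | prime p \<and> real p \<le> x. (norm (f j p))\<^sup>2 / real p) - Nj j * ln (ln x))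
             \<in> O[at_top](\<lambda>_. 1)"
    and "B > 0"
    and "\<And>i j (t::real) (x::real). i \<in> {1..d} \<Longrightarrow> j \<in> {1..d} \<Longrightarrow> i \<noteq> j \<Longrightarrow> x \<ge> 2 \<Longrightarrow>
           Re (\<Sum>p | prime p \<and> real p \<le> x. f i p * cnj (f j p) / of_nat p powr Complex 1 t)
             \<le> B * ln (2 + \<bar>t\<bar>)"
    and "\<And>j. j \<in> {1..d} \<Longrightarrow> is_L_continuation (f j) (L j)"
    and "\<And>j. j \<in> {1..d} \<Longrightarrow>
           \<exists>A>0. \<exists>C t0. \<forall>s. Re s \<ge> 1/2 \<longrightarrow> \<bar>Im s\<bar> \<ge> t0 \<longrightarrow> norm (L j s) \<le> C * \<bar>Im s\<bar> powr A"
    and "\<And>j. j \<in> {1..d} \<Longrightarrow> b j \<noteq> 0"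
    and "k \<ge> 0"
  shows "\<exists>c>0. \<forall>\<^sub>F T in at_top.
           integral {T..2*T} (\<lambda>t. abs_power (\<Sum>j=1..d. b j * L j (Complex (1/2) t)) (2 * k))
             \<ge> c * T * ln T powr (Max (Nj ` {1..d}) * k\<^sup>2)"
proof (cases "k = 0")
  case True
  \<comment> \<open>For \<open>k = 0\<close> the convention of \<open>abs_power\<close> makes the
    integrand 1 even at zeros of the sum, so the integral is \<open>T\<close>.\<close>
  have "\<forall>\<^sub>F T::real in at_top. 1 * T * ln T powr (Max (Nj ` {1..d}) * k\<^sup>2) \<le>
      integral {T..2*T} (\<lambda>t. abs_power (\<Sum>j=1..d. b j * L j (Complex (1/2) t)) (2 * k))"
    using eventually_gt_at_top[of 0] by (rule eventually_mono) (simp add: True abs_power_def)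
  then show ?thesis by (intro exI[of _ 1]) simp
next
  case False
  then have k: "k > 0" using assms(15) by simp
  define I where "I = {1..d}"
  have I: "finite I" "I \<noteq> {}" using assms(1) by (auto simp: I_def)
  have "Max (Nj ` I) \<in> Nj ` I" using I by (intro Max_in) auto
  then obtain j1 where j1: "j1 \<in> I" "Max (Nj ` I) = Nj j1" by auto
  have Nmax: "Nj j \<le> Nj j1" if "j \<in> I" for j unfolding j1(2)[symmetric] using I that by (intro Max_ge) auto
  note A = assms(2-14)[folded I_def]
  have f1: "f j 1 = 1" if "j \<in> I" for j using A(1,2)[OF that] by (rule multiplicative_1)
  define S where "S = {s::complex. Re s \<ge> 1 / 2}"
  have L: "L j meromorphic_on S" "L j analytic_on S - {1}"
    "\<exists>\<sigma>. \<forall>s. Re s > \<sigma> \<longrightarrow> ((\<lambda>n. f j n / of_nat n powr s) has_sum L j s) {1..}" if "j \<in> I" for j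
    using A(11)[OF that] unfolding is_L_continuation_def S_def by blast+
  \<comment> \<open>The possible pole is removed from the combination as a whole, with a single
    exponent \<open>n\<close>, so that one analytic function carries the argument.\<close>
  define F where "F = (\<lambda>s. \<Sum>j\<in>I. b j * L j s)"
  have mer: "F meromorphic_on S" unfolding F_def by (intro meromorphic_intros L)
  have anaF: "F analytic_on S - {1}" unfolding F_def by (intro analytic_intros L)
  have S1: "1 \<in> S" by (simp add: S_def)
  obtain n \<Phi>0 where \<Phi>0: "\<Phi>0 analytic_on S" "\<And>s. s \<in> S \<Longrightarrow> s \<noteq> 1 \<Longrightarrow> \<Phi>0 s = (1 - exp (1 - s)) ^ n * F s"
    by (rule cancel_pole_at_1[OF mer anaF S1]) (rule that)
  have ana: "\<Phi>0 analytic_on {s. Re s \<ge> 1 / 2}" using \<Phi>0(1) by (simp add: S_def)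
  have \<Phi>0': "\<Phi>0 s = (1 - exp (1 - s)) ^ n * F s" if "Re s \<ge> 1 / 2" "s \<noteq> 1" for s
    using \<Phi>0(2)[of s] that by (simp add: S_def)
  define G where "G = (\<lambda>j a C t0. \<forall>s. Re s \<ge> 1/2 \<longrightarrow> \<bar>Im s\<bar> \<ge> t0 \<longrightarrow> norm (L j s) \<le> C * \<bar>Im s\<bar> powr a)"
  have "\<exists>a C t0. a > 0 \<and> G j a C t0" if "j \<in> I" for j using A(12)[OF that] unfolding G_def by blast
  then obtain a C t0 where G: "\<And>j. j \<in> I \<Longrightarrow> a j > 0 \<and> G j (a j) (C j) (t0 j)" by metis
  define t1 where "t1 = (\<Sum>j\<in>I. \<bar>t0 j\<bar>)"
  \<comment> \<open>One integer exponent above all the individual growth exponents, dominated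
    through their sum.\<close>
  obtain M :: nat where M: "(\<Sum>j\<in>I. a j) < real M" using reals_Archimedean2 by blast
  have growthF: "norm (F s) \<le> (\<Sum>j\<in>I. norm (b j) * \<bar>C j\<bar>) * (1 + \<bar>Im s\<bar>) ^ M"
    if s: "Re s \<ge> 1 / 2" "\<bar>Im s\<bar> \<ge> t1" for s
    unfolding F_def sum_distrib_right
  proof (intro order_trans[OF norm_sum] sum_mono)
    fix j assume j: "j \<in> I"
    have "\<bar>t0 j\<bar> \<le> t1" unfolding t1_def using j I by (intro member_le_sum) auto
    then have t: "t0 j \<le> \<bar>Im s\<bar>" using s by linarith
    have a0: "a j > 0" using G[OF j] by blast
    have "a j \<le> (\<Sum>j\<in>I. a j)" using j I G by (intro member_le_sum) (auto intro: less_imp_le)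
    then have aM: "a j \<le> real M" using M by linarith
    have "norm (L j s) \<le> C j * \<bar>Im s\<bar> powr a j" using G[OF j] s t unfolding G_def by blast
    also have "\<dots> \<le> \<bar>C j\<bar> * \<bar>Im s\<bar> powr a j" by (intro mult_right_mono) auto
    also have "\<dots> \<le> \<bar>C j\<bar> * (1 + \<bar>Im s\<bar>) powr real M"
      using a0 aM by (intro mult_left_mono order_trans[OF powr_mono2[of "a j" "\<bar>Im s\<bar>" "1 + \<bar>Im s\<bar>"] powr_mono]) auto
    also have "(1 + \<bar>Im s\<bar>) powr real M = (1 + \<bar>Im s\<bar>) ^ M" by (intro powr_realpow) auto
    finally show "norm (b j * L j s) \<le> norm (b j) * \<bar>C j\<bar> * (1 + \<bar>Im s\<bar>) ^ M"
      by (simp add: norm_mult mult.assoc mult_left_mono)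
  qed
  have growth: "\<exists>K. \<forall>s. Re s \<ge> 1 / 2 \<longrightarrow> Re s \<le> \<sigma>2 \<longrightarrow> norm (\<Phi>0 s) \<le> K * (1 + \<bar>Im s\<bar>) ^ M" for \<sigma>2
  proof (rule polynomial_growth_on_strip[OF ana \<Phi>0' growthF])
    fix K assume K: "\<And>s. Re s \<ge> 1 / 2 \<Longrightarrow> Re s \<le> \<sigma>2 \<Longrightarrow> norm (\<Phi>0 s) \<le> K * (1 + \<bar>Im s\<bar>) ^ M"
    show ?thesis by (intro exI[of _ K] allI impI K)
  qed
  have cross: "(\<Sum>p\<in>pr i. Re (f j p * cnj (f j1 p)) / real p) \<le> B * ln 2" if j: "j \<in> I" "j \<noteq> j1" for j i
  proof -
    \<comment> \<open>The correlation hypothesis is taken at \<open>t = 0\<close> and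
      \<open>x = exp (4 ^ i) >= 2\<close>, where its bound is the constant
      \<open>B * ln 2\<close>.\<close>
    have "(1::real) \<le> 4 ^ i" by simp
    then have "2 \<le> exp ((4::real) ^ i)" using exp_ge_add_one_self[of "(4::real) ^ i"] by linarith
    from A(10)[OF j(1) j1(1) j(2) this, of 0]
    have "Re (\<Sum>p\<in>pr i. f j p * cnj (f j1 p) / of_nat p powr Complex 1 0) \<le> B * ln 2"
      by (simp add: pr_altdef)
    moreover have "Complex 1 0 = 1" by (simp add: complex_eq_iff)
    ultimately show ?thesis by (simp add: Re_divide_of_nat)
  qed
  define E where "E = Nj j1 * k\<^sup>2"
  have E: "E > 0" using A(7)[OF j1(1)] k by (simp add: E_def)
  have E': "Max (Nj ` {1..d}) * k\<^sup>2 = E" using j1(2) by (simp only: I_def E_def)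
  define H where "H = (\<lambda>t. norm (\<Phi>0 (Complex (1 / 2) t)) powr (2 * k))"
  have "continuous_on UNIV (\<lambda>t. \<Phi>0 (Complex (1 / 2) t))"
    using holomorphic_on_imp_continuous_on[OF analytic_imp_holomorphic[OF ana]]
    by (rule continuous_on_compose2) (auto simp: Complex_eq intro!: continuous_intros)
  then have H: "continuous_on UNIV H" unfolding H_def using k
    by (intro continuous_on_powr' continuous_intros) auto
  obtain K where K: "\<And>s. Re s \<ge> 1 / 2 \<Longrightarrow> Re s \<le> 1 / 2 \<Longrightarrow> norm (\<Phi>0 s) \<le> K * (1 + \<bar>Im s\<bar>) ^ M"
    using growth[of "1 / 2"] by blast
  have K0: "K \<ge> 0" using order_trans[OF norm_ge_zero K[of "Complex (1 / 2) 0"]] by simp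
  obtain M' :: nat where M': "real M * (2 * k) < real M'" using reals_Archimedean2 by blast
  have HM: "H t \<le> K powr (2 * k) * (1 + \<bar>t\<bar>) ^ M'" for t
  proof -
    have "H t \<le> (K * (1 + \<bar>t\<bar>) ^ M) powr (2 * k)"
      unfolding H_def using K[of "Complex (1 / 2) t"] k by (intro powr_mono2) auto
    also have "\<dots> = K powr (2 * k) * ((1 + \<bar>t\<bar>) powr real M) powr (2 * k)"
      using K0 by (simp add: powr_mult powr_realpow)
    also have "((1 + \<bar>t\<bar>) powr real M) powr (2 * k) = (1 + \<bar>t\<bar>) powr (real M * (2 * k))" by (rule powr_powr)
    also have "K powr (2 * k) * \<dots> \<le> K powr (2 * k) * (1 + \<bar>t\<bar>) powr real M'"
      using M' by (intro mult_left_mono powr_mono) auto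
    also have "(1 + \<bar>t\<bar>) powr real M' = (1 + \<bar>t\<bar>) ^ M'" by (intro powr_realpow) auto
    finally show ?thesis .
  qed
  define LB where "LB = (\<lambda>c A J0. c > 0 \<and> A \<ge> 1 \<and> (\<forall>J \<Delta> \<tau>. J0 \<le> J \<longrightarrow> exp (A * 4 ^ J) \<le> \<Delta> \<longrightarrow>
    c * \<Delta> * exp (k\<^sup>2 * (Nj j1 * ln 4) * real J) \<le> (LINT t|lborel. norm (\<Phi>0 (Complex (1 / 2) t)) powr (2 * k) * gw \<tau> \<Delta> t)))"
  have "\<exists>c A J0. LB c A J0"
  proof (rule local_lower_bound[OF I(1) j1(1) A(1) f1 A(3-6) A(7)[OF j1(1)] Nmax A(8) cross L(3) A(13)[OF j1(1)] k ana \<Phi>0'[unfolded F_def] growth])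
    fix c A :: real and J0 :: nat
    assume *: "c > 0" "A \<ge> 1" "\<And>J \<Delta> \<tau>. J0 \<le> J \<Longrightarrow> exp (A * 4 ^ J) \<le> \<Delta> \<Longrightarrow>
      c * \<Delta> * exp (k\<^sup>2 * (Nj j1 * ln 4) * real J) \<le> (LINT t|lborel. norm (\<Phi>0 (Complex (1 / 2) t)) powr (2 * k) * gw \<tau> \<Delta> t)"
    show ?thesis unfolding LB_def by (intro exI[of _ c] exI[of _ A] exI[of _ J0] conjI allI impI *)
  qed
  then obtain c A' J0 where LB: "LB c A' J0" by blast
  have c: "c > 0" "A' \<ge> 1" using LB unfolding LB_def by blast+
  have low: "c * \<Delta> * exp (E * ln 4 * real J) \<le> (LINT t|lborel. H t * gw \<tau> \<Delta> t)"
    if "J0 \<le> J" "exp (A' * 4 ^ J) \<le> \<Delta>" for J \<Delta> \<tau>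
  proof -
    have "E * ln 4 * real J = k\<^sup>2 * (Nj j1 * ln 4) * real J" by (simp add: E_def)
    moreover have "c * \<Delta> * exp (k\<^sup>2 * (Nj j1 * ln 4) * real J) \<le> (LINT t|lborel. H t * gw \<tau> \<Delta> t)"
      using LB that unfolding LB_def H_def by blast
    ultimately show ?thesis by (simp only:)
  qed
  have H0: "0 \<le> H t" for t by (simp add: H_def)
  show ?thesis
  proof (rule unsmoothing[OF H H0 HM c(1,2) E low])
    fix c' assume c': "c' > 0" "\<forall>\<^sub>F T in at_top. c' * T * ln T powr E \<le> integral {T..2 * T} H"
    \<comment> \<open>On the critical line the modulus of \<open>\<Phi>0\<close> is at most
      \<open>3 ^ n\<close> times that of \<open>F\<close>, so the lower bound for
      \<open>\<Phi>0\<close> passes to the original sum at the cost of the constant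
      \<open>R\<close>.\<close>
    define R where "R = ((3::real) ^ n) powr (2 * k)"
    have R: "R > 0" by (simp add: R_def)
    let ?h = "\<lambda>t. abs_power (\<Sum>j=1..d. b j * L j (Complex (1/2) t)) (2 * k)"
    have h: "?h t = norm (F (Complex (1/2) t)) powr (2 * k)" for t
      using k by (simp add: abs_power_def F_def I_def)
    have "continuous_on UNIV (\<lambda>t. F (Complex (1 / 2) t))"
    proof (rule continuous_on_compose2[OF holomorphic_on_imp_continuous_on[OF analytic_imp_holomorphic[OF anaF]]])
      show "continuous_on UNIV (\<lambda>t. Complex (1 / 2) t)" by (auto simp: Complex_eq intro!: continuous_intros)
      show "range (Complex (1 / 2)) \<subseteq> S - {1}" by (auto simp: S_def complex_eq_iff)
    qed
    then have conth: "continuous_on X ?h" for X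
      unfolding h using k by (intro continuous_on_powr' continuous_intros continuous_on_subset[where t = X and s = UNIV, of "\<lambda>t. F (Complex (1 / 2) t)"]) auto
    have "\<forall>\<^sub>F T in at_top. c' / R * T * ln T powr (Max (Nj ` {1..d}) * k\<^sup>2) \<le> integral {T..2*T} ?h"
      using c'(2)
    proof (rule eventually_mono)
      fix T assume T: "c' * T * ln T powr E \<le> integral {T..2 * T} H"
      have "integral {T..2 * T} H \<le> integral {T..2 * T} (\<lambda>t. R * ?h t)"
      proof (intro integral_le integrable_continuous_real continuous_intros conth)
        show "continuous_on {T..2 * T} H" using H by (rule continuous_on_subset) auto
        fix t
        let ?s = "Complex (1/2) t"
        have "\<Phi>0 ?s = (1 - exp (1 - ?s)) ^ n * F ?s" by (intro \<Phi>0') (auto simp: complex_eq_iff)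
        moreover have "norm (1 - exp (1 - ?s)) ^ n \<le> 3 ^ n" by (intro power_mono norm_one_minus_exp_le) auto
        ultimately have "norm (\<Phi>0 ?s) \<le> 3 ^ n * norm (F ?s)" by (simp add: norm_mult norm_power mult_right_mono)
        then have "H t \<le> (3 ^ n * norm (F ?s)) powr (2 * k)" unfolding H_def using k by (intro powr_mono2) auto
        then show "H t \<le> R * ?h t" unfolding h by (simp add: R_def powr_mult)
      qed
      also have "\<dots> = R * integral {T..2 * T} ?h" by simp
      finally have "c' * T * ln T powr E \<le> R * integral {T..2 * T} ?h" using T by linarith
      then show "c' / R * T * ln T powr (Max (Nj ` {1..d}) * k\<^sup>2) \<le> integral {T..2*T} ?h"
        unfolding E' using R by (simp add: field_simps)
    qed
    then show ?thesis using c'(1) R by (intro exI[of _ "c' / R"]) simp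
  qed
qed

end
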